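(* Let $R>0$, $\Omega=B^n_R$ and $\tau\ge0$. Then the optimal fields of Theorem 2 are $\underline v=\tau e_r$ and $\overline v=-\tau e_r$; that is, $\underline\lambda(B^n_R,\tau)=\lambda_1(B^n_R,\tau e_r)$ and $\overline\lambda(B^n_R,\tau)=\lambda_1(B^n_R,-\tau e_r)$, with eigenfunctions $\underline\varphi,\overline\varphi$ satisfying $$-\Delta\underline\varphi+\tau e_r\cdot\nabla\underline\varphi=\underline\lambda(B^n_R,\tau)\underline\varphi,\qquad -\Delta\overline\varphi-\tau e_r\cdot\nabla\overline\varphi=\overline\lambda(B^n_R,\tau)\overline\varphi\quad\text{in }B^n_R.$$ Moreover $\underline\varphi$ and $\overline\varphi$ are radially decreasing in $\overline{B^n_R}$: there exist decreasing functions $\underline\phi,\overline\phi:[0,R]\to[0,\infty)$ with $\underline\varphi(x)=\underline\phi(|x|)$ and $\overline\varphi(x)=\overline\phi(|x|)$ for all $x\in\overline{B^n_R}$.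
   Context: $B^n_R$ is the open ball of radius $R$ centered at $0$, $e_r(x)=x/|x|$. $\lambda_1(\Omega,v)$ is the principal Dirichlet eigenvalue of $-\Delta+v\cdot\nabla$ in $\Omega$, with positive eigenfunction $\varphi_{\Omega,v}$ normalized by $\|\varphi_{\Omega,v}\|_\infty=1$. $\underline\lambda(\Omega,\tau)=\inf_{\|v\|_\infty\le\tau}\lambda_1(\Omega,v)$ and $\overline\lambda(\Omega,\tau)=\sup_{\|v\|_\infty\le\tau}\lambda_1(\Omega,v)$; by Theorem 2 these are attained at unique fields $\underline v$, $\overline v$ (with $\|\cdot\|_\infty\le\tau$), and $\underline\varphi=\varphi_{\Omega,\underline v}$, $\overline\varphi=\varphi_{\Omega,\overline v}$. *)

theory Defs
  imports "HOL-Analysis.Analysis"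
begin

text \<open>Radial unit vector field e_r(x) = x/|x| (value at 0 irrelevant: null set).\<close>
definition e_r :: "'a::euclidean_space \<Rightarrow> 'a" where
  "e_r x = x /\<^sub>R norm x"

definition test_fun :: "'a::euclidean_space set \<Rightarrow> ('a \<Rightarrow> real) \<Rightarrow> ('a \<Rightarrow> 'a) \<Rightarrow> bool" where
  "test_fun \<Omega> \<psi> d\<psi> \<longleftrightarrow>
     continuous_on UNIV d\<psi> \<and>
     (\<forall>x. (\<psi> has_derivative (\<lambda>h. d\<psi> x \<bullet> h)) (at x)) \<and>
     compact (closure {x. \<psi> x \<noteq> 0}) \<and> closure {x. \<psi> x \<noteq> 0} \<subseteq> \<Omega>"

definition H1_weak_grad :: "'a::euclidean_space set \<Rightarrow> ('a \<Rightarrow> real) \<Rightarrow> ('a \<Rightarrow> 'a) \<Rightarrow> bool" where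
  "H1_weak_grad \<Omega> u g \<longleftrightarrow>
     u \<in> borel_measurable lebesgue \<and> g \<in> borel_measurable lebesgue \<and>
     set_integrable lebesgue \<Omega> (\<lambda>x. (u x)\<^sup>2) \<and>
     set_integrable lebesgue \<Omega> (\<lambda>x. (norm (g x))\<^sup>2) \<and>
     (\<forall>\<psi> d\<psi>. test_fun \<Omega> \<psi> d\<psi> \<longrightarrow>
        (\<forall>i\<in>Basis. (LINT x:\<Omega>|lebesgue. u x * (d\<psi> x \<bullet> i))
                     = - (LINT x:\<Omega>|lebesgue. (g x \<bullet> i) * \<psi> x)))"

text \<open>Principal Dirichlet eigenpair of  -Delta + v . grad  in Omega (weak formulation):
  phi continuous on the closure, zero on the boundary, positive inside, sup-norm 1,
  phi in H^1 with weak gradient g, and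
  int g.grad psi + (v.g) psi = lambda int phi psi  for all test functions psi.\<close>
definition principal_eigenpair ::
  "'a::euclidean_space set \<Rightarrow> ('a \<Rightarrow> 'a) \<Rightarrow> real \<Rightarrow> ('a \<Rightarrow> real) \<Rightarrow> bool" where
  "principal_eigenpair \<Omega> v lam \<phi> \<longleftrightarrow>
     continuous_on (closure \<Omega>) \<phi> \<and>
     (\<forall>x\<in>frontier \<Omega>. \<phi> x = 0) \<and>
     (\<forall>x\<in>\<Omega>. \<phi> x > 0) \<and>
     (\<forall>x\<in>closure \<Omega>. \<phi> x \<le> 1) \<and> (\<exists>x\<in>closure \<Omega>. \<phi> x = 1) \<and>
     (\<exists>g. H1_weak_grad \<Omega> \<phi> g \<and>
        (\<forall>\<psi> d\<psi>. test_fun \<Omega> \<psi> d\<psi> \<longrightarrow>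
           set_integrable lebesgue \<Omega> (\<lambda>x. (v x \<bullet> g x) * \<psi> x) \<and>
           (LINT x:\<Omega>|lebesgue. g x \<bullet> d\<psi> x + (v x \<bullet> g x) * \<psi> x)
             = lam * (LINT x:\<Omega>|lebesgue. \<phi> x * \<psi> x)))"

definition lambda1 :: "'a::euclidean_space set \<Rightarrow> ('a \<Rightarrow> 'a) \<Rightarrow> real" where
  "lambda1 \<Omega> v = (THE lam. \<exists>\<phi>. principal_eigenpair \<Omega> v lam \<phi>)"

definition admissible :: "'a::euclidean_space set \<Rightarrow> real \<Rightarrow> ('a \<Rightarrow> 'a) set" where
  "admissible \<Omega> \<tau> = {v. v \<in> borel_measurable lebesgue \<and>
                         (AE x in lebesgue. x \<in> \<Omega> \<longrightarrow> norm (v x) \<le> \<tau>)}"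

definition lambda_under :: "'a::euclidean_space set \<Rightarrow> real \<Rightarrow> real" where
  "lambda_under \<Omega> \<tau> = (INF v\<in>admissible \<Omega> \<tau>. lambda1 \<Omega> v)"

definition lambda_over :: "'a::euclidean_space set \<Rightarrow> real \<Rightarrow> real" where
  "lambda_over \<Omega> \<tau> = (SUP v\<in>admissible \<Omega> \<tau>. lambda1 \<Omega> v)"

definition radially_decreasing :: "real \<Rightarrow> ('a::euclidean_space \<Rightarrow> real) \<Rightarrow> bool" where
  "radially_decreasing R \<phi> \<longleftrightarrow>
     (\<exists>f :: real \<Rightarrow> real.
        (\<forall>s\<in>{0..R}. f s \<ge> 0) \<and>
        (\<forall>s\<in>{0..R}. \<forall>t\<in>{0..R}. s \<le> t \<longrightarrow> f t \<le> f s) \<and>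
        (\<forall>x\<in>cball 0 R. \<phi> x = f (norm x)))"

end

(* Write L_v = -Delta + v . grad + c with c large compared with tau. With zero Dirichlet data on the ball,
   L_v has a compact, strongly positive solution operator, so v has exactly one principal eigenfunction
   up to scaling. For v = tau e_r or v = -tau e_r the problem commutes with reflections, so by uniqueness
   the eigenfunction phi is radial; on each smaller ball phi minus its minimum is a supersolution, so by the
   strong maximum principle the minimum is attained on the sphere and phi is radially decreasing. Hence
   grad phi is a nonpositive multiple of e_r, and (v - tau e_r) . grad phi >= 0 >= (v + tau e_r) . grad phi for
   every admissible v. This makes the eigenfunction of tau e_r a supersolution and that of -tau e_r a
   subsolution of the eigenvalue problem for v, and a comparison principle for such pairs orders the
   eigenvalues. Since v is merely bounded, solvability starts from the Green potential of a bounded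
   function, which is C^1 up to the boundary, and the drift is added by the continuity method. *)

theory Submission
  imports Defs "HOL-Complex_Analysis.Great_Picard"
begin

section \<open>Compactly supported C^1 test functions and the divergence theorem\<close>

section \<open>Test functions and integration by parts\<close>

text \<open>The definition of an eigenpair is weak (continuous up to the sphere, gradient merely
  square integrable, drift merely bounded), whereas comparing two eigenfunctions needs sharp
  behaviour at the sphere: both must be squeezed between multiples of \<open>R - norm x\<close>. The
  lower multiple is Hopf's lemma and survives in the weak setting; the upper one needs a gradient
  bounded up to the sphere. Hence the explicit Green kernel of the ball. One antiderivative of
  \<open>t powr (- n / 2)\<close>, n the dimension, evaluated at squared distances, gives this
  kernel in all dimensions at once, power, logarithm and absolute value alike. A bounded gradient
  also makes the drift term a bounded function, which can be moved to the right-hand side. An energy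
  maximum principle for continuous weak subsolutions then identifies every weak eigenfunction with a
  C^1 one. Test functions are only C^1, so it uses the square of a truncation in place of the
  truncation itself; \<open>c > \<tau> ^ 2 / 8\<close> is the condition for the resulting quadratic
  form to be positive. The eigenvalue is a minimum of Collatz-Wielandt type.\<close>

lemma test_fun_continuous: "test_fun \<Omega> \<psi> d\<psi> \<Longrightarrow> continuous_on UNIV \<psi>"
  unfolding test_fun_def by (meson continuous_at_imp_continuous_on has_derivative_continuous)

lemma test_fun_measurable [measurable_dest]:
  assumes "test_fun \<Omega> \<psi> d\<psi>"
  shows "\<psi> \<in> borel_measurable borel" "d\<psi> \<in> borel_measurable borel"
  using test_fun_continuous[OF assms] assms unfolding test_fun_def
  by (auto intro: borel_measurable_continuous_onI)

lemma test_fun_zero: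
  assumes "test_fun \<Omega> \<psi> d\<psi>" "x \<notin> closure {x. \<psi> x \<noteq> 0}"
  shows "\<psi> x = 0" "d\<psi> x = 0"
proof -
  let ?S = "closure {x. \<psi> x \<noteq> 0}"
  show "\<psi> x = 0" using assms(2) closure_subset[of "{x. \<psi> x \<noteq> 0}"] by auto
  have 0: "\<psi> y = 0" if "y \<in> - ?S" for y using that closure_subset[of "{x. \<psi> x \<noteq> 0}"] by auto
  have d: "(\<psi> has_derivative (\<lambda>h. d\<psi> x \<bullet> h)) (at x)" using assms(1) unfolding test_fun_def by blast
  have "((\<lambda>_. 0) has_derivative (\<lambda>h. d\<psi> x \<bullet> h)) (at x)"
    by (rule has_derivative_transform_within_open[OF d, of "- ?S"], rule open_Compl, rule closed_closure) (use assms(2) in simp, rule 0)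
  then have "(\<lambda>h. d\<psi> x \<bullet> h) = (\<lambda>_. 0)"
    using has_derivative_unique has_derivative_const by blast
  then have "d\<psi> x \<bullet> d\<psi> x = 0" by meson
  then show "d\<psi> x = 0" by simp
qed

lemma test_fun_zero_outside:
  assumes "test_fun \<Omega> \<psi> d\<psi>" "x \<notin> \<Omega>"
  shows "\<psi> x = 0" "d\<psi> x = 0"
  using test_fun_zero[OF assms(1)] assms unfolding test_fun_def by blast+

lemma test_fun_bounded:
  assumes "test_fun \<Omega> \<psi> d\<psi>"
  obtains C where "C > 0" "\<And>x. \<bar>\<psi> x\<bar> \<le> C" "\<And>x. norm (d\<psi> x) \<le> C"
proof -
  let ?S = "closure {x. \<psi> x \<noteq> 0}"
  have S: "compact ?S" using assms unfolding test_fun_def by blast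
  have c: "continuous_on ?S \<psi>" "continuous_on ?S d\<psi>"
    using test_fun_continuous[OF assms] assms unfolding test_fun_def by (meson continuous_on_subset subset_UNIV)+
  obtain A where A: "A > 0" "\<And>x. x \<in> ?S \<Longrightarrow> norm (\<psi> x) \<le> A"
    using compact_imp_bounded[OF compact_continuous_image[OF c(1) S]] unfolding bounded_pos by auto
  obtain B where B: "B > 0" "\<And>x. x \<in> ?S \<Longrightarrow> norm (d\<psi> x) \<le> B"
    using compact_imp_bounded[OF compact_continuous_image[OF c(2) S]] unfolding bounded_pos by auto
  show thesis
  proof (rule that[of "max A B"])
    fix x
    show "\<bar>\<psi> x\<bar> \<le> max A B" using A test_fun_zero(1)[OF assms, of x] by (cases "x \<in> ?S") force+
    show "norm (d\<psi> x) \<le> max A B" using A B test_fun_zero(2)[OF assms, of x] by (cases "x \<in> ?S") force+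
  qed (use A in auto)
qed

lemma test_fun_mono: "test_fun \<Omega> \<psi> d\<psi> \<Longrightarrow> \<Omega> \<subseteq> \<Omega>' \<Longrightarrow> test_fun \<Omega>' \<psi> d\<psi>"
  unfolding test_fun_def by blast

lemma test_fun_integrable:
  fixes F :: "'a::euclidean_space \<Rightarrow> real"
  assumes t: "test_fun \<Omega> \<psi> d\<psi>" and F: "F \<in> borel_measurable borel" and \<Omega>: "\<Omega> \<in> sets borel"
    and i: "integrable lborel (\<lambda>x. indicator \<Omega> x * F x)"
  shows "integrable lborel (\<lambda>x. F x * \<psi> x)"
proof -
  obtain C where C: "C > 0" "\<And>x. \<bar>\<psi> x\<bar> \<le> C" using test_fun_bounded[OF t] by metis
  note [measurable] = F \<Omega> test_fun_measurable[OF t]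
  have "integrable lborel (\<lambda>x. C * (indicator \<Omega> x * F x))" using i by simp
  then show ?thesis
  proof (rule Bochner_Integration.integrable_bound)
    show "AE x in lborel. norm (F x * \<psi> x) \<le> norm (C * (indicator \<Omega> x * F x))"
    proof (rule AE_I2)
      fix x
      show "norm (F x * \<psi> x) \<le> norm (C * (indicator \<Omega> x * F x))"
        using C mult_left_mono[OF C(2)[of x], of "\<bar>F x\<bar>"] test_fun_zero_outside(1)[OF t, of x]
        by (cases "x \<in> \<Omega>") (auto simp: abs_mult mult.commute)
    qed
  qed measurable
qed

lemma test_fun_integrable_grad:
  fixes g :: "'a::euclidean_space \<Rightarrow> 'a"
  assumes t: "test_fun \<Omega> \<psi> d\<psi>" and g: "g \<in> borel_measurable borel" and \<Omega>: "\<Omega> \<in> sets borel"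
    and i: "integrable lborel (\<lambda>x. indicator \<Omega> x * norm (g x))"
  shows "integrable lborel (\<lambda>x. g x \<bullet> d\<psi> x)"
proof -
  obtain C where C: "C > 0" "\<And>x. norm (d\<psi> x) \<le> C" using test_fun_bounded[OF t] by metis
  note [measurable] = g \<Omega> test_fun_measurable[OF t]
  have "integrable lborel (\<lambda>x. C * (indicator \<Omega> x * norm (g x)))" using i by simp
  then show ?thesis
  proof (rule Bochner_Integration.integrable_bound)
    show "AE x in lborel. norm (g x \<bullet> d\<psi> x) \<le> norm (C * (indicator \<Omega> x * norm (g x)))"
    proof (rule AE_I2)
      fix x
      have "\<bar>g x \<bullet> d\<psi> x\<bar> \<le> norm (g x) * C"
        by (meson C(2) Cauchy_Schwarz_ineq2 mult_left_mono norm_ge_zero order_trans)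
      then show "norm (g x \<bullet> d\<psi> x) \<le> norm (C * (indicator \<Omega> x * norm (g x)))"
        using C test_fun_zero_outside(2)[OF t, of x] by (cases "x \<in> \<Omega>") (auto simp: abs_mult mult.commute)
    qed
  qed measurable
qed

lemma test_fun_support_ball:
  assumes "test_fun \<Omega> \<psi> d\<psi>"
  obtains r where "r > 0" "\<And>x. norm x > r \<Longrightarrow> \<psi> x = 0" "\<And>x. norm x > r \<Longrightarrow> d\<psi> x = 0"
proof -
  obtain r where "r > 0" "\<And>x. x \<in> closure {x. \<psi> x \<noteq> 0} \<Longrightarrow> norm x \<le> r"
    using assms compact_imp_bounded bounded_pos unfolding test_fun_def by metis
  then show thesis using that test_fun_zero[OF assms] by (metis linorder_not_le)
qed

text \<open>Non-measurable functions are covered as well: translation preserves measurability in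
  both directions, and a function that is not integrable has integral 0 on both sides.\<close>

lemma lborel_integral_translate:
  fixes f :: "'a::euclidean_space \<Rightarrow> 'b::{banach,second_countable_topology}"
  shows "(\<integral>x. f (x + t) \<partial>lborel) = (\<integral>x. f x \<partial>lborel)"
    "integrable lborel (\<lambda>x. f (x + t)) \<longleftrightarrow> integrable lborel f"
proof -
  have m: "(+) t \<in> borel_measurable borel" by measurable
  have e: "(lborel :: 'a measure) = distr lborel borel ((+) t)"
    using lborel_distr_plus[of t] by simp
  { assume f: "f \<in> borel_measurable borel"
    have "(\<integral>x. f (x + t) \<partial>lborel) = (\<integral>x. f x \<partial>lborel)"
      by (subst (2) e) (use f in \<open>simp add: integral_distr add.commute\<close>) }
  note 1 = this
  { assume f: "f \<in> borel_measurable borel"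
    have "integrable lborel (\<lambda>x. f (x + t)) \<longleftrightarrow> integrable lborel f"
      by (subst (2) e) (use f in \<open>simp add: integrable_distr_eq add.commute\<close>) }
  note 2 = this
  have 3: "f \<in> borel_measurable borel" if "(\<lambda>x. f (x + t)) \<in> borel_measurable borel"
  proof -
    have "(\<lambda>x. (\<lambda>x. f (x + t)) (x - t)) \<in> borel_measurable borel"
      by (rule measurable_compose[OF _ that]) measurable
    then show ?thesis by simp
  qed
  show i: "integrable lborel (\<lambda>x. f (x + t)) \<longleftrightarrow> integrable lborel f"
  proof (cases "f \<in> borel_measurable borel")
    case True then show ?thesis by (rule 2)
  next
    case False
    then have "\<not> integrable lborel f" "\<not> integrable lborel (\<lambda>x. f (x + t))"
      using 3 borel_measurable_integrable[of lborel f] borel_measurable_integrable[of lborel "\<lambda>x. f (x + t)"]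
      unfolding measurable_lborel2 by blast+
    then show ?thesis by blast
  qed
  show "(\<integral>x. f (x + t) \<partial>lborel) = (\<integral>x. f x \<partial>lborel)"
  proof (cases "integrable lborel f")
    case True
    then have "f \<in> borel_measurable borel" using borel_measurable_integrable[OF True] unfolding measurable_lborel2 by simp
    then show ?thesis by (rule 1)
  next
    case False then show ?thesis using i by (simp add: not_integrable_integral_eq)
  qed
qed

lemma integrable_bounded_support:
  fixes f :: "'a::euclidean_space \<Rightarrow> 'b::{banach,second_countable_topology}"
  assumes f: "f \<in> borel_measurable borel" and S: "S \<in> sets borel" "bounded S"
    and b: "\<And>x. norm (f x) \<le> C" and z: "\<And>x. x \<notin> S \<Longrightarrow> f x = 0"
  shows "integrable lborel f"
proof (rule integrableI_bounded_set[where A = S and B = C])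
  show "emeasure lborel S < \<infinity>" by (rule emeasure_bounded_finite[OF S(2)])
qed (use assms in auto)

text \<open>Translation invariance makes every difference quotient of \<psi> integrate to 0, and
  dominated convergence passes to the derivative. All later integrations by parts reduce to this
  identity.\<close>

lemma test_fun_integral_grad_eq_0:
  fixes \<psi> :: "'a::euclidean_space \<Rightarrow> real"
  assumes t: "test_fun \<Omega> \<psi> d\<psi>"
  shows "(\<integral>x. d\<psi> x \<bullet> i \<partial>lborel) = 0"
proof -
  obtain C where C: "C > 0" "\<And>x. \<bar>\<psi> x\<bar> \<le> C" "\<And>x. norm (d\<psi> x) \<le> C"
    using test_fun_bounded[OF t] by metis
  obtain r where r: "r > 0" "\<And>x. norm x > r \<Longrightarrow> \<psi> x = 0" "\<And>x. norm x > r \<Longrightarrow> d\<psi> x = 0"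
    using test_fun_support_ball[OF t] by metis
  note [measurable] = test_fun_measurable[OF t]
  have der: "(\<psi> has_derivative (\<lambda>h. d\<psi> x \<bullet> h)) (at x)" for x
    using t unfolding test_fun_def by blast
  have int\<psi>: "integrable lborel \<psi>"
    by (rule integrable_bounded_support[where S = "cball 0 r" and C = C]) (use C r in auto)
  define e where "e n = inverse (real (Suc n))" for n
  have e: "e n > 0" "e n \<le> 1" for n unfolding e_def by (auto simp: field_simps)
  have lim: "(\<lambda>n. e n) \<longlonglongrightarrow> 0" unfolding e_def by (rule LIMSEQ_inverse_real_of_nat)
  define D where "D n x = (\<psi> (x + e n *\<^sub>R i) - \<psi> x) / e n" for n x
  have int0: "(\<integral>x. D n x \<partial>lborel) = 0" for n
    unfolding D_def using int\<psi> lborel_integral_translate[of \<psi> "e n *\<^sub>R i"] by simp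
  have lip: "\<bar>\<psi> y - \<psi> x\<bar> \<le> C * norm (y - x)" for x y
    using differentiable_bound[of UNIV \<psi> "\<lambda>x h. d\<psi> x \<bullet> h" C y x] der C
    by (auto simp: onorm_inner_right[OF bounded_linear_ident] intro!: onorm_le)
      (metis C(3) Cauchy_Schwarz_ineq2 mult_right_mono norm_ge_zero onorm_le order_trans real_norm_def)
  have "(\<lambda>n. \<integral>x. D n x \<partial>lborel) \<longlonglongrightarrow> (\<integral>x. d\<psi> x \<bullet> i \<partial>lborel)"
  \<comment> \<open>Since \<open>e n \<le> 1\<close>, the shifted supports all stay in the ball
    enlarged by \<open>norm i\<close>.\<close>
  proof (rule integral_dominated_convergence[where w = "\<lambda>x. C * norm i * indicator (cball 0 (r + norm i)) x"])
    show "integrable lborel (\<lambda>x::'a. C * norm i * indicator (cball 0 (r + norm i)) x)"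
      by (intro integrable_mult_right integrable_real_indicator)
         (use emeasure_bounded_finite[OF bounded_cball] in auto)
    show "AE x in lborel. (\<lambda>n. D n x) \<longlonglongrightarrow> d\<psi> x \<bullet> i"
    proof (rule AE_I2)
      fix x
      have "((\<lambda>s. x + s *\<^sub>R i) has_derivative (\<lambda>s. s *\<^sub>R i)) (at 0)"
        by (auto intro!: derivative_eq_intros)
      from has_derivative_compose[OF this, of \<psi> "\<lambda>h. d\<psi> x \<bullet> h"] der[of x]
      have "((\<lambda>s. \<psi> (x + s *\<^sub>R i)) has_real_derivative d\<psi> x \<bullet> i) (at 0)"
        by (simp add: has_field_derivative_def mult_commute_abs)
      then have "((\<lambda>s. (\<psi> (x + s *\<^sub>R i) - \<psi> x) / s) \<longlongrightarrow> d\<psi> x \<bullet> i) (at 0)"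
        by (simp add: DERIV_def)
      moreover have "filterlim e (at 0) sequentially"
        using lim e by (simp add: filterlim_at less_imp_neq[THEN not_sym] always_eventually)
      ultimately show "(\<lambda>n. D n x) \<longlonglongrightarrow> d\<psi> x \<bullet> i"
        unfolding D_def by (rule filterlim_compose)
    qed
    show "AE x in lborel. norm (D n x) \<le> C * norm i * indicator (cball 0 (r + norm i)) x" for n
    proof (rule AE_I2)
      fix x
      show "norm (D n x) \<le> C * norm i * indicator (cball 0 (r + norm i)) x"
      proof (cases "x \<in> cball 0 (r + norm i)")
        case True
        then show ?thesis
          using lip[of "x + e n *\<^sub>R i" x] e[of n] by (simp add: D_def field_simps)
      next
        case False
        then have n: "norm x > r + norm i" by simp
        have "norm x \<le> norm (x + e n *\<^sub>R i) + norm (e n *\<^sub>R i)"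
          by (metis add_diff_cancel_right' norm_triangle_ineq4)
        moreover have "norm (e n *\<^sub>R i) \<le> norm i" using e[of n] by (simp add: mult_left_le_one_le)
        ultimately have "norm (x + e n *\<^sub>R i) > r" using n by linarith
        moreover have "norm x > r" using n norm_ge_zero[of i] by linarith
        ultimately show ?thesis using r False by (simp add: D_def)
      qed
    qed
  qed (auto simp: D_def)
  with int0 show ?thesis by (simp add: LIMSEQ_const_iff)
qed

text \<open>F is controlled on \<Omega> alone. The product is glued from two open sets that cover
  the space: \<Omega>, and the complement of the support of \<psi>, where the product
  vanishes.\<close>

lemma test_fun_mult:
  fixes F :: "'a::euclidean_space \<Rightarrow> real"
  assumes t: "test_fun \<Omega> \<psi> d\<psi>" and \<Omega>: "open \<Omega>"
    and F: "\<And>x. x \<in> \<Omega> \<Longrightarrow> (F has_derivative (\<lambda>h. dF x \<bullet> h)) (at x)" and dF: "continuous_on \<Omega> dF"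
  shows "test_fun \<Omega> (\<lambda>x. F x * \<psi> x) (\<lambda>x. F x *\<^sub>R d\<psi> x + \<psi> x *\<^sub>R dF x)"
proof -
  let ?S = "closure {x. \<psi> x \<noteq> 0}"
  let ?g = "\<lambda>x. F x *\<^sub>R d\<psi> x + \<psi> x *\<^sub>R dF x"
  have S: "compact ?S" "?S \<subseteq> \<Omega>" and d: "continuous_on UNIV d\<psi>"
    and der: "\<And>x. (\<psi> has_derivative (\<lambda>h. d\<psi> x \<bullet> h)) (at x)"
    using t unfolding test_fun_def by auto
  have cl: "closure {x. F x * \<psi> x \<noteq> 0} \<subseteq> ?S" by (rule closure_mono) auto
  have 0: "F x * \<psi> x = 0" "?g x = 0" if "x \<in> - ?S" for x using test_fun_zero[OF t, of x] that by auto
  have oS: "open (- ?S)" by auto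
  have cF: "continuous_on \<Omega> F"
    using F by (meson continuous_at_imp_continuous_on has_derivative_continuous)
  have "continuous_on (\<Omega> \<union> - ?S) ?g"
  proof (rule continuous_on_open_Un[OF \<Omega> oS])
    show "continuous_on \<Omega> ?g"
      using cF dF continuous_on_subset[OF d] continuous_on_subset[OF test_fun_continuous[OF t]]
      by (intro continuous_intros) auto
    show "continuous_on (- ?S) ?g"
      by (rule continuous_on_eq[of _ "\<lambda>_. 0"]) (use 0 in auto)
  qed
  moreover have "\<Omega> \<union> - ?S = UNIV" using S by blast
  ultimately have 1: "continuous_on UNIV ?g" by simp
  have 2: "((\<lambda>x. F x * \<psi> x) has_derivative (\<lambda>h. ?g x \<bullet> h)) (at x)" for x
  proof (cases "x \<in> \<Omega>")
    case True
    show ?thesis by (rule has_derivative_eq_rhs[OF has_derivative_mult[OF F[OF True] der]])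
        (auto simp: inner_add_left)
  next
    case False
    then have x: "x \<in> - ?S" using S by blast
    have "((\<lambda>x. 0::real) has_derivative (\<lambda>h. 0)) (at x)" by simp
    then have "((\<lambda>x. F x * \<psi> x) has_derivative (\<lambda>h. 0)) (at x)"
      by (rule has_derivative_transform_within_open[OF _ oS x]) (use 0 in auto)
    then show ?thesis using 0(2)[OF x] by simp
  qed
  show ?thesis unfolding test_fun_def
    using 1 2 cl S compact_Int_closed[OF S(1) closed_closure, of "{x. F x * \<psi> x \<noteq> 0}"]
    by (auto simp: Int_absorb1)
qed

section \<open>Regularised fundamental solution and Green kernel of the ball\<close>

section \<open>A regularised power and its radial kernel\<close>

text \<open>The tangent line of the convex function \<open>t powr (- m)\<close> at \<open>\<epsilon>\<close> replaces it to the left of \<open>\<epsilon>\<close>.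
  With \<open>m\<close> half the dimension, the vector field \<open>2 z * tpow m \<epsilon> (norm z ^ 2)\<close> has divergence
  \<open>tdiv m \<epsilon> (norm z ^ 2)\<close>, a nonnegative bump supported in the ball of radius \<open>sqrt \<epsilon>\<close>.\<close>

definition tpow :: "real \<Rightarrow> real \<Rightarrow> real \<Rightarrow> real" where
  "tpow m \<epsilon> t = (if t < \<epsilon> then \<epsilon> powr (- m) * (1 + m * (1 - t / \<epsilon>)) else t powr (- m))"

definition tpow' :: "real \<Rightarrow> real \<Rightarrow> real \<Rightarrow> real" where
  "tpow' m \<epsilon> t = (if t < \<epsilon> then - (m / \<epsilon>) * \<epsilon> powr (- m) else - m * t powr (- m - 1))"

definition tdiv :: "real \<Rightarrow> real \<Rightarrow> real \<Rightarrow> real" where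
  "tdiv m \<epsilon> t = 4 * (m * tpow m \<epsilon> t + t * tpow' m \<epsilon> t)"

lemma DERIV_tpow:
  assumes "\<epsilon> > 0"
  shows "(tpow m \<epsilon> has_real_derivative tpow' m \<epsilon> t) (at t)"
proof -
  let ?l = "\<lambda>t. \<epsilon> powr (- m) * (1 + m * (1 - t / \<epsilon>))" and ?p = "\<lambda>t. t powr (- m)"
  have L: "(?l has_real_derivative - (m / \<epsilon>) * \<epsilon> powr (- m)) (at t within S)" for t S
    using assms by (auto intro!: derivative_eq_intros simp: field_simps)
  have P: "(?p has_real_derivative - m * t powr (- m - 1)) (at t within S)" if "t > 0" for t S
    by (rule has_field_derivative_at_within, rule has_real_derivative_powr[OF that, THEN DERIV_cong]) simp
  consider "t < \<epsilon>" | "t > \<epsilon>" | "t = \<epsilon>" by linarith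
  then show ?thesis
  proof cases
    case 1
    have "(tpow m \<epsilon> has_real_derivative - (m / \<epsilon>) * \<epsilon> powr (- m)) (at t)"
      by (rule has_field_derivative_transform_within_open[OF L, of "{..<\<epsilon>}"]) (use 1 in \<open>auto simp: tpow_def\<close>)
    then show ?thesis using 1 by (simp add: tpow'_def)
  next
    case 2
    have "(tpow m \<epsilon> has_real_derivative - m * t powr (- m - 1)) (at t)"
      by (rule has_field_derivative_transform_within_open[OF P, of _ "{\<epsilon><..}"]) (use 2 assms in \<open>auto simp: tpow_def\<close>)
    then show ?thesis using 2 by (simp add: tpow'_def)
  next
    case 3
    \<comment> \<open>The one-sided slopes agree because the linear piece is the tangent at
      \<epsilon>; the two-sided derivative is then the join of two one-sided limits.\<close>
    have eq: "- (m / \<epsilon>) * \<epsilon> powr (- m) = - m * \<epsilon> powr (- m - 1)"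
      using assms by (simp add: powr_diff)
    have "(tpow m \<epsilon> has_real_derivative - (m / \<epsilon>) * \<epsilon> powr (- m)) (at \<epsilon> within {..\<epsilon>})"
      by (rule has_field_derivative_transform_within[OF L, of 1]) (use assms in \<open>auto simp: tpow_def\<close>)
    moreover have "(tpow m \<epsilon> has_real_derivative - m * \<epsilon> powr (- m - 1)) (at \<epsilon> within {\<epsilon>..})"
      by (rule has_field_derivative_transform_within[OF P, of _ 1]) (use assms in \<open>auto simp: tpow_def\<close>)
    ultimately have "((\<lambda>y. (tpow m \<epsilon> y - tpow m \<epsilon> \<epsilon>) / (y - \<epsilon>)) \<longlongrightarrow> - m * \<epsilon> powr (- m - 1))
        (at \<epsilon> within {..\<epsilon>} \<union> {\<epsilon>..})"
      unfolding eq has_field_derivative_iff at_within_union by (rule filterlim_sup)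
    moreover have "{..\<epsilon>} \<union> {\<epsilon>..} = UNIV" by auto
    ultimately show ?thesis using 3 by (simp add: tpow'_def has_field_derivative_iff)
  qed
qed

lemma continuous_tpow: "\<epsilon> > 0 \<Longrightarrow> continuous_on UNIV (tpow m \<epsilon>)"
  by (intro continuous_at_imp_continuous_on ballI DERIV_isCont[OF DERIV_tpow])

lemma continuous_tpow':
  assumes "\<epsilon> > 0"
  shows "continuous_on UNIV (tpow' m \<epsilon>)"
proof -
  have "tpow' m \<epsilon> = (\<lambda>t. - m * max t \<epsilon> powr (- m - 1))"
    using assms by (simp add: tpow'_def powr_diff fun_eq_iff max_def)
  moreover have "continuous_on UNIV (\<lambda>t. - m * max t \<epsilon> powr (- m - 1))"
    by (intro continuous_on_mult continuous_on_powr continuous_on_max continuous_on_const continuous_on_id)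
      (use assms in auto)
  ultimately show ?thesis by simp
qed

lemma tpow_nonneg: "m \<ge> 0 \<Longrightarrow> \<epsilon> > 0 \<Longrightarrow> 0 \<le> tpow m \<epsilon> t"
  unfolding tpow_def by (auto intro!: mult_nonneg_nonneg add_nonneg_nonneg)

text \<open>A convex function lies above its tangent, here through \<open>ln s \<le> s - 1\<close>
  and \<open>1 + s \<le> exp s\<close>. This makes the kernel estimates uniform in
  \<epsilon>.\<close>

lemma tpow_le_powr:
  assumes "m \<ge> 0" "\<epsilon> > 0" "t > 0"
  shows "tpow m \<epsilon> t \<le> t powr (- m)"
proof (cases "t < \<epsilon>")
  case True
  have "1 + m * (1 - t / \<epsilon>) \<le> 1 + m * (- ln (t / \<epsilon>))"
    using ln_le_minus_one[of "t / \<epsilon>"] assms by (intro add_left_mono mult_left_mono) auto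
  also have "\<dots> \<le> exp (m * (- ln (t / \<epsilon>)))" using exp_ge_add_one_self by blast
  also have "\<dots> = (t / \<epsilon>) powr (- m)" using assms by (simp add: powr_def)
  finally have "\<epsilon> powr (- m) * (1 + m * (1 - t / \<epsilon>)) \<le> \<epsilon> powr (- m) * (t / \<epsilon>) powr (- m)"
    by (intro mult_left_mono) auto
  also have "\<dots> = t powr (- m)" using assms by (simp flip: powr_mult)
  finally show ?thesis using True by (simp add: tpow_def)
qed (simp add: tpow_def)

lemma tpow_eq_powr: "\<epsilon> \<le> t \<Longrightarrow> tpow m \<epsilon> t = t powr (- m)"
  by (simp add: tpow_def)

text \<open>For the power with exponent \<open>- m\<close> the expression
  \<open>m * f t + t * f' t\<close> vanishes; with m half the dimension this says that the radial
  field is divergence free away from its pole. Only the linear piece contributes.\<close>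

lemma tdiv_eq:
  assumes "\<epsilon> > 0"
  shows "tdiv m \<epsilon> t = (if t < \<epsilon> then 4 * m * (m + 1) * \<epsilon> powr (- m) * (1 - t / \<epsilon>) else 0)"
  using assms by (auto simp: tdiv_def tpow_def tpow'_def powr_diff field_simps)

lemma tdiv_nonneg: "\<epsilon> > 0 \<Longrightarrow> m \<ge> 0 \<Longrightarrow> 0 \<le> tdiv m \<epsilon> t"
  by (auto simp: tdiv_eq)

lemma continuous_tdiv: "\<epsilon> > 0 \<Longrightarrow> continuous_on UNIV (tdiv m \<epsilon>)"
  unfolding tdiv_def[abs_def] by (intro continuous_intros continuous_tpow continuous_tpow')

section \<open>Integrability of the singular kernel\<close>

abbreviation (input) hdim :: "'a::euclidean_space itself \<Rightarrow> real" where
  "hdim _ \<equiv> real DIM('a) / 2"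

text \<open>The order of growth, at the pole, of the gradient of the fundamental solution;
  \<open>powr\<close> makes the value at the pole itself 0.\<close>

definition sing :: "'a::euclidean_space \<Rightarrow> real" where
  "sing x = norm x powr (1 - real DIM('a))"

lemma sing_nonneg [simp]: "0 \<le> sing x" by (simp add: sing_def)

lemma sing_measurable [measurable]: "sing \<in> borel_measurable borel"
  unfolding sing_def[abs_def] by measurable

definition sing_const :: "'a::euclidean_space itself \<Rightarrow> real" where
  "sing_const _ = 2 ^ DIM('a) * unit_ball_vol (real DIM('a))"

lemma sing_const_pos: "sing_const TYPE('a::euclidean_space) > 0"
  by (simp add: sing_const_def)

text \<open>Dyadic shells in place of polar coordinates. Between the radii
  \<open>\<rho> (Suc k)\<close> and \<open>\<rho> k\<close> the integrand is at most
  \<open>\<rho> (Suc k) powr (1 - n)\<close>, and the enclosing ball has volume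
  \<open>unit_ball_vol n * 2 ^ n * \<rho> (Suc k) ^ n\<close>. The product is
  \<open>sing_const\<close> times \<open>\<rho> (Suc k)\<close>, and these radii sum to r.\<close>

lemma nn_integral_sing_le:
  fixes r :: real
  assumes r: "r > 0"
  shows "(\<integral>\<^sup>+x\<in>ball 0 r. ennreal (sing (x::'a::euclidean_space)) \<partial>lborel) \<le> ennreal (sing_const TYPE('a) * r)"
proof -
  let ?n = "DIM('a)" and ?V = "unit_ball_vol (real DIM('a))"
  define \<rho> where "\<rho> k = r / 2 ^ k" for k :: nat
  have \<rho>: "\<rho> k > 0" "\<rho> (Suc k) = \<rho> k / 2" for k using r by (auto simp: \<rho>_def)
  define F where "F k x = ennreal (\<rho> (Suc k) powr (1 - real ?n)) * indicator (ball 0 (\<rho> k)) x" for k and x :: 'a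
  have pt: "ennreal (sing x) * indicator (ball 0 r) x \<le> (\<Sum>k. F k x)" if "x \<noteq> 0" for x :: 'a
  proof (cases "x \<in> ball 0 r")
    case True
    have "(\<lambda>k. r * (1 / 2) ^ k) \<longlonglongrightarrow> r * 0" by (intro tendsto_intros LIMSEQ_power_zero) simp
    then have "\<forall>\<^sub>F k in sequentially. r * (1 / 2) ^ k < norm x"
      using order_tendstoD(2)[of _ "r * 0" sequentially "norm x"] that by simp
    then obtain k0 where "r * (1 / 2) ^ k0 < norm x" by (metis eventually_sequentially order_refl)
    then have ex: "\<rho> k0 \<le> norm x" by (simp add: \<rho>_def power_divide)
    \<comment> \<open>The first dyadic radius that does not exceed \<open>norm x\<close>; its
      predecessor bounds the shell from outside.\<close>
    define k where "k = (LEAST k. \<rho> k \<le> norm x)"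
    have k: "\<rho> k \<le> norm x" unfolding k_def by (rule LeastI[of _ k0]) (rule ex)
    have "k \<noteq> 0" using k True by (intro notI) (simp add: \<rho>_def)
    then obtain j where j: "k = Suc j" using not0_implies_Suc by blast
    have "\<not> \<rho> j \<le> norm x" using not_less_Least[of j "\<lambda>k. \<rho> k \<le> norm x"] j k_def by simp
    then have x: "x \<in> ball 0 (\<rho> j)" by simp
    have "sing x \<le> \<rho> (Suc j) powr (1 - real ?n)"
      unfolding sing_def using k j \<rho>(1)[of "Suc j"] by (intro powr_mono2') auto
    then have "ennreal (sing x) * indicator (ball 0 r) x \<le> F j x"
      using x True by (simp add: F_def ennreal_leI)
    also have "\<dots> = sum (\<lambda>k. F k x) {j}" by simp
    also have "\<dots> \<le> (\<Sum>k. F k x)" by (rule sum_le_suminf) auto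
    finally show ?thesis .
  qed simp
  have "(\<integral>\<^sup>+x\<in>ball 0 r. ennreal (sing (x::'a)) \<partial>lborel) \<le> (\<integral>\<^sup>+x. (\<Sum>k. F k x) \<partial>lborel)"
  proof (rule nn_integral_mono_AE)
    show "AE x in lborel. ennreal (sing (x::'a)) * indicator (ball 0 r) x \<le> (\<Sum>k. F k x)"
      using AE_lborel_singleton[of 0] by eventually_elim (rule pt)
  qed
  also have "\<dots> = (\<Sum>k. \<integral>\<^sup>+x. F k x \<partial>lborel)"
  proof (rule nn_integral_suminf)
    fix k
    have [measurable]: "ball (0::'a) (\<rho> k) \<in> sets borel" by (intro borel_open open_ball)
    show "F k \<in> borel_measurable lborel" unfolding F_def by measurable
  qed
  also have "\<dots> = (\<Sum>k. ennreal (sing_const TYPE('a) * r * ((1 / 2) ^ Suc k)))"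
  proof (rule suminf_cong)
    fix k
    have "(\<integral>\<^sup>+x. F k x \<partial>lborel) = ennreal (\<rho> (Suc k) powr (1 - real ?n)) * ennreal (?V * \<rho> k ^ ?n)"
      unfolding F_def by (subst nn_integral_cmult_indicator) (use \<rho>(1)[of k] in \<open>auto simp: emeasure_ball\<close>)
    also have "\<dots> = ennreal (\<rho> (Suc k) powr (1 - real ?n) * (?V * \<rho> k ^ ?n))"
      by (rule ennreal_mult[symmetric]) (use \<rho>(1)[of k] in auto)
    also have "\<rho> (Suc k) powr (1 - real ?n) * (?V * \<rho> k ^ ?n) = sing_const TYPE('a) * \<rho> (Suc k)"
    proof -
      have "\<rho> k ^ ?n = 2 ^ ?n * \<rho> (Suc k) powr ?n"
        using \<rho>(1)[of k] by (simp add: \<rho>(2) powr_realpow power_divide)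
      then show ?thesis using \<rho>(1)[of "Suc k"] by (simp add: sing_const_def powr_diff)
    qed
    finally show "(\<integral>\<^sup>+x. F k x \<partial>lborel) = ennreal (sing_const TYPE('a) * r * ((1 / 2) ^ Suc k))"
      by (simp add: \<rho>_def power_divide)
  qed
  also have "\<dots> = ennreal (sing_const TYPE('a) * r * 1)"
    using sing_const_pos[where ?'a = 'a] r
    by (intro suminf_ennreal_eq sums_mult power_half_series) auto
  finally show ?thesis by simp
qed

lemma sing_integrable:
  fixes x :: "'a::euclidean_space"
  assumes r: "r > 0"
  shows "integrable lborel (\<lambda>y. indicator (ball x r) y * sing (x - y))"
    and "(\<integral>y. indicator (ball x r) y * sing (x - y) \<partial>lborel) \<le> sing_const TYPE('a) * r"
proof -
  let ?f = "\<lambda>y. indicator (ball 0 r) y * sing (y::'a)"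
  have nn: "(\<integral>\<^sup>+y. ennreal (?f y) \<partial>lborel) \<le> ennreal (sing_const TYPE('a) * r)"
    using nn_integral_sing_le[OF r, where ?'a = 'a]
    by (simp add: ennreal_mult' ennreal_indicator mult.commute cong: nn_integral_cong_simp)
  have i: "integrable lborel ?f"
  proof (rule integrableI_nonneg)
    show "?f \<in> borel_measurable lborel"
      unfolding measurable_lborel2
      by (intro borel_measurable_times borel_measurable_indicator sing_measurable borel_open open_ball)
  qed (auto intro: le_less_trans[OF nn])
  have e: "(\<lambda>y. indicator (ball x r) (y + x) * sing (x - (y + x))) = ?f"
    by (auto simp: fun_eq_iff indicator_def sing_def dist_norm)
  show "integrable lborel (\<lambda>y. indicator (ball x r) y * sing (x - y))"
    using lborel_integral_translate(2)[of "\<lambda>y. indicator (ball x r) y * sing (x - y)" x] i e by simp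
  have "(\<integral>y. ?f y \<partial>lborel) \<le> sing_const TYPE('a) * r"
    using nn r sing_const_pos[where ?'a = 'a] i
    by (subst (asm) nn_integral_eq_integral) (auto simp: ennreal_le_iff)
  then show "(\<integral>y. indicator (ball x r) y * sing (x - y) \<partial>lborel) \<le> sing_const TYPE('a) * r"
    using lborel_integral_translate(1)[of "\<lambda>y. indicator (ball x r) y * sing (x - y)" x] e by simp
qed

section \<open>The Green kernel of the ball\<close>

text \<open>Only differences of values of \<open>tint\<close> occur, so the choice of the antiderivative is immaterial.\<close>

definition tint :: "real \<Rightarrow> real \<Rightarrow> real \<Rightarrow> real" where
  "tint m \<epsilon> = (SOME F. \<forall>t. (F has_real_derivative tpow m \<epsilon> t) (at t))"

lemma DERIV_tint:
  assumes "\<epsilon> > 0"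
  shows "(tint m \<epsilon> has_real_derivative tpow m \<epsilon> t) (at t)"
proof -
  have "\<exists>F. \<forall>t. - \<infinity> < ereal t \<longrightarrow> ereal t < \<infinity> \<longrightarrow> (F has_vector_derivative tpow m \<epsilon> t) (at t)"
    by (rule einterval_antiderivative) (auto intro: DERIV_isCont DERIV_tpow[OF assms])
  then have "\<exists>F. \<forall>t. (F has_real_derivative tpow m \<epsilon> t) (at t)"
    by (simp add: has_real_derivative_iff_has_vector_derivative)
  then show ?thesis unfolding tint_def by (rule someI2_ex) blast
qed

lemma continuous_tint: "\<epsilon> > 0 \<Longrightarrow> continuous_on UNIV (tint m \<epsilon>)"
  by (intro continuous_at_imp_continuous_on ballI DERIV_isCont[OF DERIV_tint])

lemmas continuous_tpow_o [continuous_intros] = continuous_on_compose2[OF continuous_tpow _ subset_UNIV]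
lemmas continuous_tpow'_o [continuous_intros] = continuous_on_compose2[OF continuous_tpow' _ subset_UNIV]
lemmas continuous_tdiv_o [continuous_intros] = continuous_on_compose2[OF continuous_tdiv _ subset_UNIV]
lemmas continuous_tint_o [continuous_intros] = continuous_on_compose2[OF continuous_tint _ subset_UNIV]

text \<open>\<open>grefl R x y\<close> is the squared distance from \<open>x\<close> to the point reflected from \<open>y\<close> at the sphere,
  scaled by \<open>(norm y / R) ^ 2\<close>; it equals \<open>norm (x - y) ^ 2\<close> if \<open>x\<close> lies on the sphere.\<close>

definition grefl :: "real \<Rightarrow> 'a::euclidean_space \<Rightarrow> 'a \<Rightarrow> real" where
  "grefl R x y = R\<^sup>2 - 2 * (x \<bullet> y) + (norm x)\<^sup>2 * (norm y)\<^sup>2 / R\<^sup>2"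

definition grefl_grad :: "real \<Rightarrow> 'a::euclidean_space \<Rightarrow> 'a \<Rightarrow> 'a" where
  "grefl_grad R x y = 2 *\<^sub>R (((norm y)\<^sup>2 / R\<^sup>2) *\<^sub>R x - y)"

text \<open>A regularised Green function up to a positive factor. As \<epsilon> tends to 0,
  \<open>tint\<close> of the squared distance is, up to an additive constant, a multiple of the
  fundamental solution: a power, the logarithm in dimension 2, the distance in dimension 1. The
  first term belongs to the image point and cancels the second on the sphere.\<close>

definition green :: "real \<Rightarrow> real \<Rightarrow> 'a::euclidean_space \<Rightarrow> 'a \<Rightarrow> real" where
  "green R \<epsilon> x y = tint (real DIM('a) / 2) \<epsilon> (grefl R x y) - tint (real DIM('a) / 2) \<epsilon> ((norm (x - y))\<^sup>2)"

definition green_grad :: "real \<Rightarrow> real \<Rightarrow> 'a::euclidean_space \<Rightarrow> 'a \<Rightarrow> 'a" where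
  "green_grad R \<epsilon> x y = tpow (real DIM('a) / 2) \<epsilon> (grefl R x y) *\<^sub>R grefl_grad R x y
     - tpow (real DIM('a) / 2) \<epsilon> ((norm (x - y))\<^sup>2) *\<^sub>R (2 *\<^sub>R (x - y))"

text \<open>The limit at \<open>\<epsilon> = 0\<close>. Only the gradient is given in closed form;
  the potential itself will be obtained as a limit.\<close>

definition green_grad0 :: "real \<Rightarrow> 'a::euclidean_space \<Rightarrow> 'a \<Rightarrow> 'a" where
  "green_grad0 R x y = (grefl R x y powr - (real DIM('a) / 2)) *\<^sub>R grefl_grad R x y
     - ((norm (x - y))\<^sup>2 powr - (real DIM('a) / 2)) *\<^sub>R (2 *\<^sub>R (x - y))"

text \<open>The extra term is a product of factors that are nonnegative in the ball and vanish on
  the sphere. It yields at once the comparison with the squared distance and the zero boundary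
  values of the kernel.\<close>

lemma grefl_eq:
  assumes "R \<noteq> 0"
  shows "grefl R x y = (norm (x - y))\<^sup>2 + (R\<^sup>2 - (norm x)\<^sup>2) * (R\<^sup>2 - (norm y)\<^sup>2) / R\<^sup>2"
proof -
  have "(R\<^sup>2 - a) * (R\<^sup>2 - b) / R\<^sup>2 = R\<^sup>2 - a - b + a * b / R\<^sup>2" for a b
    using assms by (simp add: field_simps)
  moreover have "(norm (x - y))\<^sup>2 = (norm x)\<^sup>2 - 2 * (x \<bullet> y) + (norm y)\<^sup>2"
    by (simp add: power2_norm_eq_inner inner_diff inner_commute)
  ultimately show ?thesis by (simp add: grefl_def)
qed

lemma grefl_ge:
  assumes "x \<in> cball 0 R" "y \<in> cball 0 R" "R > 0"
  shows "(norm (x - y))\<^sup>2 \<le> grefl R x y"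
proof -
  have "(norm x)\<^sup>2 \<le> R\<^sup>2" "(norm y)\<^sup>2 \<le> R\<^sup>2" using assms by (auto intro!: power_mono)
  then show ?thesis using assms(3) by (simp add: grefl_eq)
qed

text \<open>By Cauchy-Schwarz \<open>grefl R x y\<close> is at least
  \<open>(R - norm x * norm y / R) ^ 2\<close>. Over a compact part of the ball the image term is
  thus untouched by the regularisation once \<epsilon> is small, uniformly in y.\<close>

lemma grefl_ge_interior:
  assumes "x \<in> cball 0 r" "y \<in> cball 0 R" "0 \<le> r" "r \<le> R" "R > 0"
  shows "(R - r)\<^sup>2 \<le> grefl R x y"
proof -
  have "norm x * norm y \<le> r * R" using assms by (intro mult_mono) auto
  then have 1: "norm x * norm y / R \<le> r" using assms by (simp add: field_simps)
  have "(R - r)\<^sup>2 \<le> (R - norm x * norm y / R)\<^sup>2" using 1 assms by (intro power_mono) auto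
  also have "\<dots> = R\<^sup>2 - 2 * (norm x * norm y) + (norm x)\<^sup>2 * (norm y)\<^sup>2 / R\<^sup>2"
    using assms by (simp add: power2_eq_square field_simps)
  also have "\<dots> \<le> grefl R x y" using norm_cauchy_schwarz[of x y] by (simp add: grefl_def)
  finally show ?thesis .
qed

text \<open>This is the relation \<open>norm (grad s) ^ 2 = 4 * a * s\<close> of a squared distance
  scaled by a. It bounds the gradient of the image term by a power of \<open>grefl\<close>
  alone.\<close>

lemma norm_grefl_grad:
  assumes "R > 0"
  shows "(norm (grefl_grad R x y))\<^sup>2 = 4 * ((norm y)\<^sup>2 / R\<^sup>2) * grefl R x y"
proof -
  define a where "a = (norm y)\<^sup>2 / R\<^sup>2"
  have Y: "(norm y)\<^sup>2 = a * R\<^sup>2" using assms by (simp add: a_def)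
  have n: "(norm (a *\<^sub>R x - y))\<^sup>2 = a\<^sup>2 * (norm x)\<^sup>2 - 2 * a * (x \<bullet> y) + (norm y)\<^sup>2"
    unfolding power2_norm_eq_inner by (simp add: inner_diff inner_commute power2_eq_square[of a] algebra_simps)
  have d: "(norm (grefl_grad R x y))\<^sup>2 = 4 * (norm (a *\<^sub>R x - y))\<^sup>2"
    unfolding grefl_grad_def a_def[symmetric] by (simp add: power_mult_distrib)
  have g: "grefl R x y = R\<^sup>2 - 2 * (x \<bullet> y) + (norm x)\<^sup>2 * a"
    by (simp add: grefl_def a_def)
  have "(norm (grefl_grad R x y))\<^sup>2 = 4 * a * grefl R x y"
    unfolding d n g Y by (simp add: power2_eq_square[of a] algebra_simps)
  then show ?thesis by (simp add: a_def)
qed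

lemma grefl_derivative: "((\<lambda>x. grefl R x y) has_derivative (\<lambda>h. grefl_grad R x y \<bullet> h)) (at x)"
proof -
  define a where "a = (norm y)\<^sup>2 / R\<^sup>2"
  have eq: "(\<lambda>x. grefl R x y) = (\<lambda>x. R\<^sup>2 - 2 * (x \<bullet> y) + a * (x \<bullet> x))"
    by (simp add: grefl_def power2_norm_eq_inner fun_eq_iff a_def)
  show ?thesis unfolding eq grefl_grad_def a_def[symmetric]
    by (auto intro!: derivative_eq_intros simp: inner_diff inner_commute algebra_simps)
qed

lemma dist_sq_derivative:
  "((\<lambda>x. (norm (x - y))\<^sup>2) has_derivative (\<lambda>h. (2 *\<^sub>R (x - y)) \<bullet> h)) (at (x::'a::real_inner))"
  unfolding power2_norm_eq_inner
  by (auto intro!: derivative_eq_intros simp: inner_diff inner_commute algebra_simps)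

lemma green_derivative:
  assumes "\<epsilon> > 0"
  shows "((\<lambda>x. green R \<epsilon> x y) has_derivative (\<lambda>h. green_grad R \<epsilon> x y \<bullet> h)) (at (x::'a::euclidean_space))"
proof -
  let ?m = "real DIM('a) / 2"
  have 1: "(tint ?m \<epsilon> has_derivative (\<lambda>h. tpow ?m \<epsilon> t * h)) (at t)" for t
    using DERIV_tint[OF assms] by (simp add: has_field_derivative_def mult_commute_abs)
  show ?thesis unfolding green_def
    by (rule has_derivative_eq_rhs[OF has_derivative_diff[OF
          has_derivative_compose[OF grefl_derivative 1] has_derivative_compose[OF dist_sq_derivative 1]]])
      (simp add: green_grad_def inner_diff_left fun_eq_iff)
qed

lemma continuous_green: "\<epsilon> > 0 \<Longrightarrow> continuous_on UNIV (\<lambda>z. green R \<epsilon> (fst z) (snd z :: 'a::euclidean_space))"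
  unfolding green_def grefl_def by (cases "R = 0") (auto intro!: continuous_intros)

lemma continuous_green_grad:
  "\<epsilon> > 0 \<Longrightarrow> continuous_on UNIV (\<lambda>z. green_grad R \<epsilon> (fst z) (snd z :: 'a::euclidean_space))"
  unfolding green_grad_def grefl_def grefl_grad_def by (cases "R = 0") (auto intro!: continuous_intros)

lemma green_boundary: "norm x = R \<Longrightarrow> R > 0 \<Longrightarrow> green R \<epsilon> x y = 0"
  by (simp add: green_def grefl_eq)

text \<open>Only the size of the coefficients c and d enters, so the regularised gradient and its
  limit are covered together. The image part is at most
  \<open>2 * grefl R x y powr ((1 - n) / 2)\<close>; as the exponent is nonpositive and
  \<open>grefl\<close> dominates the squared distance, it is no more singular than the direct
  part.\<close>

lemma green_grad_aux:
  fixes x y :: "'a::euclidean_space"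
  assumes xy: "x \<in> cball 0 R" "y \<in> cball 0 R" "R > 0" "x \<noteq> y"
    and c: "\<bar>c\<bar> \<le> grefl R x y powr - (real DIM('a) / 2)" "\<bar>d\<bar> \<le> (norm (x - y))\<^sup>2 powr - (real DIM('a) / 2)"
  shows "norm (c *\<^sub>R grefl_grad R x y - d *\<^sub>R (2 *\<^sub>R (x - y))) \<le> 4 * sing (x - y)"
proof -
  let ?n = "real DIM('a)"
  have p: "(norm (x - y))\<^sup>2 > 0" using xy by simp
  have q: "(norm (x - y))\<^sup>2 \<le> grefl R x y" by (rule grefl_ge[OF xy(1-3)])
  have q0: "grefl R x y > 0" using p q by linarith
  have n: "?n \<ge> 1" using DIM_positive[where 'a = 'a] by linarith
  have s: "((norm (x - y))\<^sup>2) powr ((1 - ?n) / 2) = sing (x - y)"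
    using xy by (simp add: sing_def powr_powr diff_divide_distrib flip: powr_numeral)
  have "(norm y)\<^sup>2 / R\<^sup>2 \<le> 1" using xy by (simp add: power_mono)
  then have "(norm (grefl_grad R x y))\<^sup>2 \<le> 4 * 1 * grefl R x y"
    unfolding norm_grefl_grad[OF xy(3)] using q0 by (intro mult_right_mono mult_left_mono) auto
  then have "sqrt ((norm (grefl_grad R x y))\<^sup>2) \<le> sqrt (4 * grefl R x y)" by (intro real_sqrt_le_mono) simp
  then have g: "norm (grefl_grad R x y) \<le> 2 * grefl R x y powr (1 / 2)"
    using q0 by (simp add: real_sqrt_mult powr_half_sqrt)
  have "norm (c *\<^sub>R grefl_grad R x y) \<le> grefl R x y powr - (?n / 2) * (2 * grefl R x y powr (1 / 2))"
    using c g by (simp add: mult_mono)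
  also have "\<dots> = 2 * (grefl R x y) powr ((1 - ?n) / 2)"
    using q0 by (simp add: powr_add[symmetric] field_simps)
  also have "\<dots> \<le> 2 * ((norm (x - y))\<^sup>2) powr ((1 - ?n) / 2)"
    using p q n by (intro mult_left_mono powr_mono2') auto
  finally have 1: "norm (c *\<^sub>R grefl_grad R x y) \<le> 2 * sing (x - y)" unfolding s .
  have "norm (d *\<^sub>R (2 *\<^sub>R (x - y))) \<le> ((norm (x - y))\<^sup>2 powr - (?n / 2)) * (2 * norm (x - y))"
    using mult_right_mono[OF c(2), of "2 * norm (x - y)"] by (simp add: abs_mult)
  also have "\<dots> = 2 * (((norm (x - y))\<^sup>2 powr - (?n / 2)) * ((norm (x - y))\<^sup>2) powr (1 / 2))"
    by (simp add: powr_half_sqrt)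
  also have "\<dots> = 2 * sing (x - y)"
    unfolding s[symmetric] by (subst powr_add[symmetric]) (simp add: field_simps)
  finally have 2: "norm (d *\<^sub>R (2 *\<^sub>R (x - y))) \<le> 2 * sing (x - y)" .
  show ?thesis using 1 2 norm_triangle_ineq4[of "c *\<^sub>R grefl_grad R x y" "d *\<^sub>R (2 *\<^sub>R (x - y))"] by linarith
qed

lemma norm_green_grad_le:
  fixes x y :: "'a::euclidean_space"
  assumes "x \<in> cball 0 R" "y \<in> cball 0 R" "R > 0" "x \<noteq> y"
  shows "norm (green_grad0 R x y) \<le> 4 * sing (x - y)"
    and "\<epsilon> > 0 \<Longrightarrow> norm (green_grad R \<epsilon> x y) \<le> 4 * sing (x - y)"
proof -
  have p: "(norm (x - y))\<^sup>2 > 0" using assms by simp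
  have q: "grefl R x y > 0" using grefl_ge[OF assms(1-3)] p by linarith
  show "norm (green_grad0 R x y) \<le> 4 * sing (x - y)"
    unfolding green_grad0_def by (rule green_grad_aux[OF assms]) auto
  show "norm (green_grad R \<epsilon> x y) \<le> 4 * sing (x - y)" if "\<epsilon> > 0"
    unfolding green_grad_def using tpow_le_powr[OF _ that p] tpow_le_powr[OF _ that q] tpow_nonneg[OF _ that]
    by (intro green_grad_aux[OF assms]) auto
qed

lemma green_grad_eq:
  fixes x y :: "'a::euclidean_space"
  assumes "x \<in> cball 0 R" "y \<in> cball 0 R" "R > 0" "\<epsilon> \<le> (norm (x - y))\<^sup>2"
  shows "green_grad R \<epsilon> x y = green_grad0 R x y"
  using grefl_ge[OF assms(1-3)] assms(4) by (simp add: green_grad_def green_grad0_def tpow_eq_powr)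

text \<open>The two gradients agree as soon as \<epsilon> is at most the squared distance, since
  \<open>grefl\<close> is larger still; on the remaining small ball each of them costs 4 times the
  singular bound.\<close>

lemma green_grad_diff_le:
  fixes x y :: "'a::euclidean_space"
  assumes "x \<in> cball 0 R" "y \<in> cball 0 R" "R > 0" "\<epsilon> > 0" "x \<noteq> y"
  shows "norm (green_grad R \<epsilon> x y - green_grad0 R x y) \<le> 8 * (indicator (ball x (sqrt \<epsilon>)) y * sing (x - y))"
proof (cases "y \<in> ball x (sqrt \<epsilon>)")
  case True
  then show ?thesis
    using norm_green_grad_le[OF assms(1-3,5)] assms(4)
      norm_triangle_ineq4[of "green_grad R \<epsilon> x y" "green_grad0 R x y"] by fastforce
next
  case False
  then have "sqrt \<epsilon> \<le> norm (x - y)" by (simp add: dist_norm)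
  then have "\<epsilon> \<le> (norm (x - y))\<^sup>2" using assms(4) by (metis real_le_rsqrt real_sqrt_le_iff real_sqrt_abs abs_norm_cancel)
  then show ?thesis using green_grad_eq[OF assms(1-3)] False by simp
qed

section \<open>Potentials of bounded densities, continuously differentiable up to the sphere\<close>

section \<open>Integrals of continuously differentiable kernels\<close>

text \<open>Shared by the regularised Green kernel and the mollifier. All smoothness sits in the
  kernel, so that the densities may be merely bounded and Borel with compact support.\<close>

locale smooth_kernel =
  fixes k :: "'a::euclidean_space \<Rightarrow> 'a \<Rightarrow> real" and dk :: "'a \<Rightarrow> 'a \<Rightarrow> 'a"
  assumes der: "\<And>x y. ((\<lambda>x. k x y) has_derivative (\<lambda>h. dk x y \<bullet> h)) (at x)"
    and cont: "continuous_on UNIV (\<lambda>z. k (fst z) (snd z))"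
    and dcont: "continuous_on UNIV (\<lambda>z. dk (fst z) (snd z))"
begin

lemma kernel_continuous: "continuous_on K (k x)" "continuous_on K (dk x)"
proof -
  have P: "continuous_on K (\<lambda>y. (x, y))" by (intro continuous_on_Pair continuous_on_const continuous_on_id)
  show "continuous_on K (k x)" "continuous_on K (dk x)"
    using continuous_on_compose2[OF cont P] continuous_on_compose2[OF dcont P] by auto
qed

lemma kernel_measurable [measurable]:
  "(\<lambda>y. k x y) \<in> borel_measurable borel" "(\<lambda>y. dk x y) \<in> borel_measurable borel"
  by (intro borel_measurable_continuous_onI kernel_continuous)+

lemma kernel_bound:
  assumes "compact K"
  obtains C where "C > 0" "\<And>y. y \<in> K \<Longrightarrow> \<bar>k x y\<bar> \<le> C" "\<And>y. y \<in> K \<Longrightarrow> norm (dk x y) \<le> C"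
proof -
  note c = kernel_continuous[of K x]
  obtain A where A: "A > 0" "\<And>y. y \<in> K \<Longrightarrow> norm (k x y) \<le> A"
    using compact_imp_bounded[OF compact_continuous_image[OF c(1) assms]] unfolding bounded_pos by auto
  obtain B where B: "B > 0" "\<And>y. y \<in> K \<Longrightarrow> norm (dk x y) \<le> B"
    using compact_imp_bounded[OF compact_continuous_image[OF c(2) assms]] unfolding bounded_pos by auto
  show thesis by (rule that[of "max A B"]) (use A B in \<open>force simp: max.coboundedI1 max.coboundedI2\<close>)+
qed

lemma kernel_modulus:
  assumes "compact K" "compact L" "e > 0"
  obtains d where "d > 0"
    "\<And>x x' y. x \<in> K \<Longrightarrow> x' \<in> K \<Longrightarrow> y \<in> L \<Longrightarrow> norm (x - x') < d \<Longrightarrow> norm (dk x y - dk x' y) < e"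
proof -
  have "uniformly_continuous_on (K \<times> L) (\<lambda>z. dk (fst z) (snd z))"
    by (rule compact_uniformly_continuous[OF continuous_on_subset[OF dcont]]) (use assms compact_Times in auto)
  then obtain d where "d > 0" and d: "\<And>z z'. z \<in> K \<times> L \<Longrightarrow> z' \<in> K \<times> L \<Longrightarrow> dist z' z < d \<Longrightarrow>
      dist (dk (fst z') (snd z')) (dk (fst z) (snd z)) < e"
    unfolding uniformly_continuous_on_def using assms(3) by meson
  show thesis
    by (rule that[OF \<open>d > 0\<close>]) (use d[of "(_, _)" "(_, _)"] in \<open>simp add: dist_Pair_Pair dist_norm\<close>)
qed

lemma kernel_integrable:
  fixes f :: "'a \<Rightarrow> real"
  assumes f: "f \<in> borel_measurable borel" "\<And>y. \<bar>f y\<bar> \<le> M" "\<And>y. y \<notin> K \<Longrightarrow> f y = 0" and K: "compact K"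
  shows "integrable lborel (\<lambda>y. f y * k x y)" "integrable lborel (\<lambda>y. f y *\<^sub>R dk x y)"
proof -
  note [measurable] = f(1)
  obtain C where C: "C > 0" "\<And>y. y \<in> K \<Longrightarrow> \<bar>k x y\<bar> \<le> C" "\<And>y. y \<in> K \<Longrightarrow> norm (dk x y) \<le> C"
    using kernel_bound[OF K] by metis
  have K': "K \<in> sets borel" "bounded K" using K by (auto intro: borel_compact compact_imp_bounded)
  have M: "M \<ge> 0" using f(2)[of undefined] by linarith
  show "integrable lborel (\<lambda>y. f y * k x y)"
  proof (rule integrable_bounded_support[OF _ K', of _ "M * C"])
    show "norm (f y * k x y) \<le> M * C" for y
      using f C M by (cases "y \<in> K") (auto simp: abs_mult intro!: mult_mono)
  qed (use f in auto)
  show "integrable lborel (\<lambda>y. f y *\<^sub>R dk x y)"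
  proof (rule integrable_bounded_support[OF _ K', of _ "M * C"])
    show "norm (f y *\<^sub>R dk x y) \<le> M * C" for y
      using f C M by (cases "y \<in> K") (auto simp: abs_mult intro!: mult_mono)
  qed (use f in auto)
qed

text \<open>The remainder of the linearisation is estimated by the mean value inequality on the
  segment from x to x', uniformly in y because \<open>dk\<close> is uniformly continuous on compact
  sets.\<close>

lemma kernel_derivative:
  fixes f :: "'a \<Rightarrow> real"
  assumes f: "f \<in> borel_measurable borel" "\<And>y. \<bar>f y\<bar> \<le> M" "\<And>y. y \<notin> K \<Longrightarrow> f y = 0" and K: "compact K"
  shows "((\<lambda>x. \<integral>y. f y * k x y \<partial>lborel) has_derivative (\<lambda>h. (\<integral>y. f y *\<^sub>R dk x y \<partial>lborel) \<bullet> h)) (at x)"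
proof -
  note [measurable] = f(1)
  note int = kernel_integrable[OF f K]
  have M: "M \<ge> 0" using f(2)[of undefined] by linarith
  \<comment> \<open>The summand 1 keeps V positive when M or the measure of K is 0.\<close>
  define V where "V = M * measure lborel K + 1"
  have V: "V > 0" using M by (simp add: V_def add_nonneg_pos)
  have K': "K \<in> sets borel" "bounded K" using K by (auto intro: borel_compact compact_imp_bounded)
  have iK: "integrable lborel (indicator K :: 'a \<Rightarrow> real)"
    using K' emeasure_bounded_finite by (intro integrable_real_indicator) auto
  show ?thesis unfolding has_derivative_at_alt
  proof (intro conjI allI impI)
    show "bounded_linear (\<lambda>h. (\<integral>y. f y *\<^sub>R dk x y \<partial>lborel) \<bullet> h)" by (rule bounded_linear_inner_right)
    fix e :: real assume e: "e > 0"
    obtain d where d: "d > 0" "\<And>z z' y. z \<in> cball x 1 \<Longrightarrow> z' \<in> cball x 1 \<Longrightarrow> y \<in> K \<Longrightarrow> norm (z - z') < d \<Longrightarrow>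
        norm (dk z y - dk z' y) < e / V"
      using kernel_modulus[OF compact_cball K, of "e / V"] e V by (metis divide_pos_pos)
    have "norm ((\<integral>y. f y * k x' y \<partial>lborel) - (\<integral>y. f y * k x y \<partial>lborel) - (\<integral>y. f y *\<^sub>R dk x y \<partial>lborel) \<bullet> (x' - x))
        \<le> e * norm (x' - x)" if x': "norm (x' - x) < min d 1" for x'
    proof -
      let ?r = "\<lambda>y. k x' y - k x y - dk x y \<bullet> (x' - x)"
      have r: "\<bar>?r y\<bar> \<le> e / V * norm (x' - x)" if "y \<in> K" for y
      proof -
        have s: "z \<in> cball x 1 \<and> norm (z - x) < d" if "z \<in> closed_segment x x'" for z
          using segment_bound[OF that] x' by (auto simp: dist_norm norm_minus_commute)
        have "norm (k x' y - k x y - dk x y \<bullet> (x' - x)) \<le> norm (x' - x) * (e / V)"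
        proof (rule differentiable_bound_linearization[of x x' "closed_segment x x'" "\<lambda>z. k z y" "\<lambda>z h. dk z y \<bullet> h" x])
          fix z assume z: "z \<in> closed_segment x x'"
          show "((\<lambda>z. k z y) has_derivative (\<lambda>h. dk z y \<bullet> h)) (at z within closed_segment x x')"
            using der by (rule has_derivative_at_withinI)
          have "norm (dk z y - dk x y) \<le> e / V"
            using d(2)[of z x y] s[OF z] that by force
          then show "onorm ((\<lambda>h. dk z y \<bullet> h) - (\<lambda>h. dk x y \<bullet> h)) \<le> e / V"
            by (intro onorm_le)
              (simp add: fun_diff_def inner_diff_left[symmetric] order_trans[OF Cauchy_Schwarz_ineq2] mult_right_mono
                del: times_divide_eq_left)
        qed (auto simp: closed_segment_def algebra_simps intro!: exI)
        then show ?thesis by (simp add: mult.commute)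
      qed
      have "(\<integral>y. f y * k x' y \<partial>lborel) - (\<integral>y. f y * k x y \<partial>lborel) - (\<integral>y. f y *\<^sub>R dk x y \<partial>lborel) \<bullet> (x' - x)
          = (\<integral>y. f y * ?r y \<partial>lborel)"
      proof -
        have "(\<integral>y. f y *\<^sub>R dk x y \<partial>lborel) \<bullet> (x' - x) = (\<integral>y. f y * (dk x y \<bullet> (x' - x)) \<partial>lborel)"
          using int(2)[of x] by (simp flip: integral_inner_left)
        moreover have "integrable lborel (\<lambda>y. f y * (dk x y \<bullet> (x' - x)))"
          using integrable_inner_left[OF int(2)[of x], of "x' - x"] by simp
        ultimately show ?thesis
          using int(1)[of x] int(1)[of x'] by (simp add: right_diff_distrib)
      qed
      also have "norm \<dots> \<le> (\<integral>y. M * (e / V * norm (x' - x)) * indicator K y \<partial>lborel)"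
      proof (rule Bochner_Integration.integral_norm_bound_integral)
        show "norm (f y * ?r y) \<le> M * (e / V * norm (x' - x)) * indicator K y" for y
          using mult_mono[OF f(2) r M abs_ge_zero] f(3)[of y] by (cases "y \<in> K") (auto simp: abs_mult)
        show "integrable lborel (\<lambda>y. f y * ?r y)"
          using int(1)[of x] int(1)[of x'] integrable_inner_left[OF int(2)[of x], of "x' - x"]
          by (simp add: right_diff_distrib)
      qed (use iK in auto)
      also have "\<dots> = (e / V * norm (x' - x)) * (M * measure lborel K)" by simp
      also have "\<dots> \<le> (e / V * norm (x' - x)) * V" using e V by (intro mult_left_mono) (auto simp: V_def)
      finally show ?thesis using V by simp
    qed
    then show "\<exists>d>0. \<forall>x'. norm (x' - x) < d \<longrightarrow> norm ((\<integral>y. f y * k x' y \<partial>lborel) - (\<integral>y. f y * k x y \<partial>lborel) -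
        (\<integral>y. f y *\<^sub>R dk x y \<partial>lborel) \<bullet> (x' - x)) \<le> e * norm (x' - x)"
      using d(1) by (intro exI[of _ "min d 1"]) auto
  qed
qed

lemma kernel_grad_diff:
  fixes f :: "'a \<Rightarrow> real"
  assumes f: "f \<in> borel_measurable borel" "\<And>y. \<bar>f y\<bar> \<le> M" "\<And>y. y \<notin> K \<Longrightarrow> f y = 0" and K: "compact K"
    and e: "\<And>y. y \<in> K \<Longrightarrow> norm (dk x y - dk x' y) \<le> e"
  shows "norm ((\<integral>y. f y *\<^sub>R dk x y \<partial>lborel) - (\<integral>y. f y *\<^sub>R dk x' y \<partial>lborel)) \<le> e * (M * measure lborel K)"
proof -
  note int = kernel_integrable(2)[OF f K]
  have M: "M \<ge> 0" using f(2)[of undefined] by linarith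
  have iK: "integrable lborel (indicator K :: 'a \<Rightarrow> real)"
    using K emeasure_bounded_finite by (intro integrable_real_indicator) (auto intro: borel_compact compact_imp_bounded)
  have "(\<integral>y. f y *\<^sub>R dk x y \<partial>lborel) - (\<integral>y. f y *\<^sub>R dk x' y \<partial>lborel) = (\<integral>y. f y *\<^sub>R (dk x y - dk x' y) \<partial>lborel)"
    using int by (simp add: scaleR_diff_right flip: Bochner_Integration.integral_diff)
  also have "norm \<dots> \<le> (\<integral>y. M * e * indicator K y \<partial>lborel)"
  proof (rule Bochner_Integration.integral_norm_bound_integral)
    show "norm (f y *\<^sub>R (dk x y - dk x' y)) \<le> M * e * indicator K y" for y
      using f e[of y] M by (cases "y \<in> K") (auto intro!: mult_mono)
    show "integrable lborel (\<lambda>y. f y *\<^sub>R (dk x y - dk x' y))"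
      using int[of x] int[of x'] by (simp add: scaleR_diff_right)
  qed (use iK in auto)
  finally show ?thesis by (simp add: mult_ac)
qed

end

lemma green_kernel: "\<epsilon> > 0 \<Longrightarrow> smooth_kernel (green R \<epsilon>) (green_grad R \<epsilon>)"
  by unfold_locales (rule green_derivative continuous_green continuous_green_grad; assumption)+

section \<open>The Green potential of a bounded function\<close>

definition bfun :: "real \<Rightarrow> real \<Rightarrow> ('a::euclidean_space \<Rightarrow> real) \<Rightarrow> bool" where
  "bfun R M f \<longleftrightarrow> f \<in> borel_measurable borel \<and> (\<forall>y. \<bar>f y\<bar> \<le> M) \<and> (\<forall>y. y \<notin> cball 0 R \<longrightarrow> f y = 0)"

lemma bfunD:
  assumes "bfun R M f"
  shows "f \<in> borel_measurable borel" "\<bar>f y\<bar> \<le> M" "y \<notin> cball 0 R \<Longrightarrow> f y = 0" "M \<ge> 0"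
  using assms unfolding bfun_def by (auto intro: order_trans[OF abs_ge_zero])

lemma bfun_add: "bfun R M f \<Longrightarrow> bfun R N g \<Longrightarrow> bfun R (M + N) (\<lambda>x. f x + g x)"
  unfolding bfun_def by (auto intro!: order_trans[OF abs_triangle_ineq] add_mono)

lemma bfun_scale: "bfun R M f \<Longrightarrow> bfun R (\<bar>c\<bar> * M) (\<lambda>x. c * f x)"
  unfolding bfun_def by (auto simp: abs_mult intro!: mult_left_mono)

definition gpot_eps :: "real \<Rightarrow> real \<Rightarrow> ('a::euclidean_space \<Rightarrow> real) \<Rightarrow> 'a \<Rightarrow> real" where
  "gpot_eps R \<epsilon> f x = (\<integral>y. f y * green R \<epsilon> x y \<partial>lborel)"

definition ggrad_eps :: "real \<Rightarrow> real \<Rightarrow> ('a::euclidean_space \<Rightarrow> real) \<Rightarrow> 'a \<Rightarrow> 'a" where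
  "ggrad_eps R \<epsilon> f x = (\<integral>y. f y *\<^sub>R green_grad R \<epsilon> x y \<partial>lborel)"

definition ggrad :: "real \<Rightarrow> ('a::euclidean_space \<Rightarrow> real) \<Rightarrow> 'a \<Rightarrow> 'a" where
  "ggrad R f x = (\<integral>y. f y *\<^sub>R green_grad0 R x y \<partial>lborel)"

text \<open>The parameters are squares so that \<open>sqrt \<epsilon>\<close>, the rate at which the
  gradients converge, is the inverse of \<open>Suc n\<close>. The normalising factor
  \<open>tconst\<close> is introduced below.\<close>

definition gpot :: "real \<Rightarrow> ('a::euclidean_space \<Rightarrow> real) \<Rightarrow> 'a \<Rightarrow> real" where
  "gpot R f x = lim (\<lambda>n. gpot_eps R ((inverse (real (Suc n)))\<^sup>2) f x)"

lemma green_grad0_measurable [measurable]: "(\<lambda>y. green_grad0 R x y) \<in> borel_measurable borel"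
  unfolding green_grad0_def grefl_def grefl_grad_def by measurable

lemma ggrad_eps_derivative:
  assumes "bfun R M f" "\<epsilon> > 0"
  shows "(gpot_eps R \<epsilon> f has_derivative (\<lambda>h. ggrad_eps R \<epsilon> f x \<bullet> h)) (at x)"
proof -
  interpret smooth_kernel "green R \<epsilon>" "green_grad R \<epsilon>" by (rule green_kernel[OF assms(2)])
  show ?thesis unfolding gpot_eps_def[abs_def] ggrad_eps_def
    by (rule kernel_derivative[of f M "cball 0 R"]) (use bfunD[OF assms(1)] in auto)
qed

lemma bfun_sing_bound:
  fixes f :: "'a::euclidean_space \<Rightarrow> real" and g :: "'a \<Rightarrow> 'a"
  assumes f: "bfun R M f" and x: "x \<in> cball 0 R" and r: "r > 0" and c: "c \<ge> 0" and [measurable]: "g \<in> borel_measurable borel"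
    and g: "\<And>y. y \<in> cball 0 R \<Longrightarrow> y \<noteq> x \<Longrightarrow> norm (g y) \<le> c * (indicator (ball x r) y * sing (x - y))"
  shows "integrable lborel (\<lambda>y. f y *\<^sub>R g y)"
    "norm (\<integral>y. f y *\<^sub>R g y \<partial>lborel) \<le> M * c * (sing_const TYPE('a) * r)"
proof -
  note [measurable] = bfunD(1)[OF f]
  let ?w = "\<lambda>y. M * c * (indicator (ball x r) y * sing (x - y))"
  have w: "integrable lborel ?w" by (intro integrable_mult_right sing_integrable(1)[OF r])
  have ae: "AE y in lborel. norm (f y *\<^sub>R g y) \<le> ?w y"
    using AE_lborel_singleton[of x]
  proof eventually_elim
    case (elim y)
    show ?case
    proof (cases "y \<in> cball 0 R")
      case True
      have "\<bar>f y\<bar> * norm (g y) \<le> M * (c * (indicator (ball x r) y * sing (x - y)))"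
        by (rule mult_mono) (use bfunD[OF f] g[OF True] elim in auto)
      then show ?thesis by (simp add: mult.assoc)
    next
      case False
      then show ?thesis using bfunD(3,4)[OF f] c by simp
    qed
  qed
  show i: "integrable lborel (\<lambda>y. f y *\<^sub>R g y)"
    by (rule Bochner_Integration.integrable_bound[OF w]) (use ae in \<open>auto elim!: eventually_mono\<close>)
  have "norm (\<integral>y. f y *\<^sub>R g y \<partial>lborel) \<le> (\<integral>y. norm (f y *\<^sub>R g y) \<partial>lborel)"
    by (rule integral_norm_bound)
  also have "\<dots> \<le> (\<integral>y. ?w y \<partial>lborel)"
    by (rule integral_mono_AE[OF integrable_norm[OF i] w ae])
  also have "\<dots> = M * c * (\<integral>y. indicator (ball x r) y * sing (x - y) \<partial>lborel)" by simp
  also have "\<dots> \<le> M * c * (sing_const TYPE('a) * r)"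
    using bfunD(4)[OF f] c by (intro mult_left_mono sing_integrable(2)[OF r]) auto
  finally show "norm (\<integral>y. f y *\<^sub>R g y \<partial>lborel) \<le> M * c * (sing_const TYPE('a) * r)" .
qed

context
  fixes R :: real and f :: "'a::euclidean_space \<Rightarrow> real" and M :: real
  assumes R: "R > 0" and f: "bfun R M f"
begin

lemma ggrad_integrable:
  assumes x: "x \<in> cball 0 R"
  shows "integrable lborel (\<lambda>y. f y *\<^sub>R green_grad0 R x y)"
    and ggrad_bound: "norm (ggrad R f x) \<le> 12 * sing_const TYPE('a) * R * M"
proof -
  \<comment> \<open>The radius \<open>3 * R\<close> exceeds the diameter of the ball; with the
    factor 4 of the kernel bound it produces the constant 12.\<close>
  have b: "norm (green_grad0 R x y) \<le> 4 * (indicator (ball x (3 * R)) y * sing (x - y))"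
    if "y \<in> cball 0 R" "y \<noteq> x" for y
  proof -
    have "norm (x - y) \<le> norm x + norm y" by (rule norm_triangle_ineq4)
    also have "\<dots> < 3 * R" using x that R by auto
    finally have "y \<in> ball x (3 * R)" by (simp add: dist_norm)
    then show ?thesis using norm_green_grad_le(1)[OF x that(1) R] that(2) by simp
  qed
  show "integrable lborel (\<lambda>y. f y *\<^sub>R green_grad0 R x y)"
    by (rule bfun_sing_bound(1)[OF f x, of "3 * R" 4]) (use R b in auto)
  have "norm (ggrad R f x) \<le> M * 4 * (sing_const TYPE('a) * (3 * R))"
    unfolding ggrad_def by (rule bfun_sing_bound(2)[OF f x]) (use R b in auto)
  then show "norm (ggrad R f x) \<le> 12 * sing_const TYPE('a) * R * M" by (simp add: mult_ac)
qed

lemma ggrad_eps_integrable: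
  assumes "\<epsilon> > 0"
  shows "integrable lborel (\<lambda>y. f y *\<^sub>R green_grad R \<epsilon> x y)" "integrable lborel (\<lambda>y. f y * green R \<epsilon> x y)"
  using smooth_kernel.kernel_integrable[OF green_kernel[OF assms], of f M "cball 0 R"] bfunD[OF f] by auto

lemma ggrad_eps_diff:
  assumes x: "x \<in> cball 0 R" and e: "\<epsilon> > 0"
  shows "norm (ggrad_eps R \<epsilon> f x - ggrad R f x) \<le> 8 * sing_const TYPE('a) * M * sqrt \<epsilon>"
proof -
  have [measurable]: "green_grad R \<epsilon> x \<in> borel_measurable borel"
    by (rule smooth_kernel.kernel_measurable(2)[OF green_kernel[OF e]])
  have "ggrad_eps R \<epsilon> f x - ggrad R f x = (\<integral>y. f y *\<^sub>R (green_grad R \<epsilon> x y - green_grad0 R x y) \<partial>lborel)"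
    unfolding ggrad_eps_def ggrad_def
    using ggrad_integrable[OF x] ggrad_eps_integrable(1)[OF e] by (simp add: scaleR_diff_right)
  also have "norm \<dots> \<le> M * 8 * (sing_const TYPE('a) * sqrt \<epsilon>)"
    by (rule bfun_sing_bound(2)[OF f x]) (use e R x green_grad_diff_le[of x R _ \<epsilon>] in auto)
  finally show ?thesis by (simp add: mult_ac)
qed

text \<open>Termwise differentiation: the gradients of the regularised potentials converge uniformly
  on the closed ball, and at one boundary point all values are 0. The derivative exists within the
  closed ball, sphere included; all later boundary regularity comes from here.\<close>

lemma gpot_limit_derivative:
  assumes x: "x \<in> cball 0 R"
  shows gpot_limit: "(\<lambda>n. gpot_eps R ((inverse (real (Suc n)))\<^sup>2) f x) \<longlonglongrightarrow> gpot R f x"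
    and gpot_derivative: "(gpot R f has_derivative (\<lambda>h. ggrad R f x \<bullet> h)) (at x within cball 0 R)"
proof -
  let ?e = "\<lambda>n. (inverse (real (Suc n)))\<^sup>2"
  let ?C = "8 * sing_const TYPE('a) * M"
  obtain i :: 'a where i: "i \<in> Basis" using nonempty_Basis by blast
  have "\<exists>g. \<forall>x\<in>cball 0 R. (\<lambda>n. gpot_eps R (?e n) f x) \<longlonglongrightarrow> g x \<and>
      (g has_derivative (\<lambda>h. ggrad R f x \<bullet> h)) (at x within cball 0 R)"
  proof (rule has_derivative_sequence[where ?x0.0 = "R *\<^sub>R i" and l = 0 and f' = "\<lambda>n x h. ggrad_eps R (?e n) f x \<bullet> h"])
    show "(gpot_eps R (?e n) f has_derivative (\<lambda>h. ggrad_eps R (?e n) f x \<bullet> h)) (at x within cball 0 R)" for n x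
      by (rule has_derivative_at_withinI[OF ggrad_eps_derivative[OF f]]) simp
    show "R *\<^sub>R i \<in> cball 0 R" using i R by auto
    have "gpot_eps R (?e n) f (R *\<^sub>R i) = 0" for n
      unfolding gpot_eps_def by (subst green_boundary) (use i R in auto)
    then show "(\<lambda>n. gpot_eps R (?e n) f (R *\<^sub>R i)) \<longlonglongrightarrow> 0" by simp
    fix e :: real assume e: "e > 0"
    have "(\<lambda>n. ?C * inverse (real (Suc n))) \<longlonglongrightarrow> ?C * 0"
      by (intro tendsto_intros LIMSEQ_inverse_real_of_nat)
    then have "\<forall>\<^sub>F n in sequentially. ?C * inverse (real (Suc n)) < e"
      using e by (intro order_tendstoD(2)[of _ "?C * 0"]) auto
    then show "\<forall>\<^sub>F n in sequentially. \<forall>x\<in>cball 0 R. \<forall>h. norm (ggrad_eps R (?e n) f x \<bullet> h - ggrad R f x \<bullet> h) \<le> e * norm h"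
    proof (eventually_elim, intro ballI allI)
      fix n x h assume n: "?C * inverse (real (Suc n)) < e" and x: "x \<in> cball (0::'a) R"
      have "norm (ggrad_eps R (?e n) f x - ggrad R f x) \<le> ?C * sqrt (?e n)"
        by (rule ggrad_eps_diff[OF x]) simp
      also have "sqrt (?e n) = inverse (real (Suc n))" by (simp only: real_sqrt_abs) simp
      finally have "norm (ggrad_eps R (?e n) f x - ggrad R f x) \<le> e" using n by linarith
      then show "norm (ggrad_eps R (?e n) f x \<bullet> h - ggrad R f x \<bullet> h) \<le> e * norm h"
        by (simp add: inner_diff_left[symmetric] order_trans[OF Cauchy_Schwarz_ineq2] mult_right_mono)
    qed
  qed auto
  then obtain g where g: "\<And>x. x \<in> cball 0 R \<Longrightarrow> (\<lambda>n. gpot_eps R (?e n) f x) \<longlonglongrightarrow> g x"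
    "\<And>x. x \<in> cball 0 R \<Longrightarrow> (g has_derivative (\<lambda>h. ggrad R f x \<bullet> h)) (at x within cball 0 R)" by blast
  have eq: "gpot R f x = g x" if "x \<in> cball 0 R" for x
    unfolding gpot_def using g(1)[OF that] by (rule limI)
  show "(\<lambda>n. gpot_eps R (?e n) f x) \<longlonglongrightarrow> gpot R f x" using g(1)[OF x] eq[OF x] by simp
  show "(gpot R f has_derivative (\<lambda>h. ggrad R f x \<bullet> h)) (at x within cball 0 R)"
    by (rule has_derivative_transform[OF x eq g(2)[OF x]])
qed

lemma gpot_boundary:
  assumes "norm x = R"
  shows "gpot R f x = 0"
proof -
  have "gpot_eps R ((inverse (real (Suc n)))\<^sup>2) f x = 0" for n
    unfolding gpot_eps_def by (subst green_boundary) (use assms R in auto)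
  then show ?thesis using gpot_limit[of x] assms by (simp add: LIMSEQ_const_iff)
qed

lemma gpot_lipschitz:
  assumes "x \<in> cball 0 R" "y \<in> cball 0 R"
  shows "\<bar>gpot R f x - gpot R f y\<bar> \<le> 12 * sing_const TYPE('a) * R * M * norm (x - y)"
proof -
  have "norm (gpot R f x - gpot R f y) \<le> 12 * sing_const TYPE('a) * R * M * norm (x - y)"
  proof (rule differentiable_bound[OF convex_cball gpot_derivative])
    show "onorm (\<lambda>h. ggrad R f z \<bullet> h) \<le> 12 * sing_const TYPE('a) * R * M" if "z \<in> cball 0 R" for z
      by (intro onorm_le) (metis Cauchy_Schwarz_ineq2 ggrad_bound[OF that] mult_right_mono norm_ge_zero order_trans real_norm_def)
  qed (use assms in auto)
  then show ?thesis by simp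
qed

lemma gpot_bound:
  assumes "x \<in> cball 0 R"
  shows "\<bar>gpot R f x\<bar> \<le> 24 * sing_const TYPE('a) * R\<^sup>2 * M"
proof -
  obtain i :: 'a where i: "i \<in> Basis" using nonempty_Basis by blast
  have b: "norm (R *\<^sub>R i) = R" using i R by simp
  have M: "12 * sing_const TYPE('a) * R * M \<ge> 0"
    using R bfunD(4)[OF f] sing_const_pos[where ?'a = 'a] by simp
  have "\<bar>gpot R f x - gpot R f (R *\<^sub>R i)\<bar> \<le> 12 * sing_const TYPE('a) * R * M * norm (x - R *\<^sub>R i)"
    by (rule gpot_lipschitz) (use assms b in auto)
  \<comment> \<open>A boundary point, where the value is 0, is at distance at most
    \<open>2 * R\<close>; this doubles 12 to 24.\<close>
  also have "\<dots> \<le> 12 * sing_const TYPE('a) * R * M * (2 * R)"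
    using norm_triangle_ineq4[of x "R *\<^sub>R i"] b assms by (intro mult_left_mono M) simp
  finally show ?thesis using gpot_boundary[OF b] by (simp add: power2_eq_square mult_ac)
qed

end

text \<open>Equicontinuity in f, the input for Arzela-Ascoli. The regularisation error depends on f
  only through M, and the regularised kernel is uniformly continuous, so d can be fixed before
  f.\<close>

lemma ggrad_modulus:
  assumes R: "R > 0" and e: "e > 0" and M: "M > 0"
  shows "\<exists>d>0. \<forall>(f::'a::euclidean_space \<Rightarrow> real) x x'. bfun R M f \<longrightarrow> x \<in> cball 0 R \<longrightarrow> x' \<in> cball 0 R \<longrightarrow>
    norm (x - x') < d \<longrightarrow> norm (ggrad R f x - ggrad R f x') < e"
proof -
  define C where "C = 8 * sing_const TYPE('a) * M"
  have C: "C > 0" using M sing_const_pos[where ?'a = 'a] by (simp add: C_def)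
  \<comment> \<open>Chosen so that passing to the regularised gradient costs \<open>e / 4\<close> at
    either point; a third \<open>e / 4\<close> comes from the modulus of the regularised
    kernel.\<close>
  define \<epsilon> where "\<epsilon> = (e / (4 * C))\<^sup>2"
  have \<epsilon>: "\<epsilon> > 0" "C * sqrt \<epsilon> = e / 4" using e C by (auto simp: \<epsilon>_def)
  define V where "V = M * measure lborel (cball (0::'a) R) + 1"
  have V: "V > 0" using M by (simp add: V_def add_nonneg_pos)
  interpret smooth_kernel "green R \<epsilon> :: 'a \<Rightarrow> _" "green_grad R \<epsilon>" by (rule green_kernel[OF \<epsilon>(1)])
  obtain d where d: "d > 0" "\<And>x x' y. x \<in> cball 0 R \<Longrightarrow> x' \<in> cball 0 R \<Longrightarrow> y \<in> cball 0 R \<Longrightarrow> norm (x - x') < d \<Longrightarrow>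
      norm (green_grad R \<epsilon> (x::'a) y - green_grad R \<epsilon> x' y) < e / (4 * V)"
    using kernel_modulus[of "cball 0 R" "cball 0 R" "e / (4 * V)"] e V by (metis compact_cball divide_pos_pos mult_pos_pos zero_less_numeral)
  show ?thesis
  proof (intro exI[of _ d] conjI allI impI)
    fix f :: "'a \<Rightarrow> real" and x x' :: 'a
    assume f: "bfun R M f" and x: "x \<in> cball 0 R" "x' \<in> cball 0 R" "norm (x - x') < d"
    have 1: "norm (ggrad_eps R \<epsilon> f x - ggrad R f x) \<le> e / 4" "norm (ggrad_eps R \<epsilon> f x' - ggrad R f x') \<le> e / 4"
      using ggrad_eps_diff[OF R f x(1) \<epsilon>(1)] ggrad_eps_diff[OF R f x(2) \<epsilon>(1)] \<epsilon>(2) by (auto simp: C_def)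
    have "norm (ggrad_eps R \<epsilon> f x - ggrad_eps R \<epsilon> f x') \<le> e / (4 * V) * (M * measure lborel (cball (0::'a) R))"
      unfolding ggrad_eps_def
      by (rule kernel_grad_diff) (use bfunD[OF f] d(2)[OF x(1,2) _ x(3)] in \<open>auto intro: less_imp_le\<close>)
    also have "\<dots> \<le> e / (4 * V) * V" using e V by (intro mult_left_mono) (auto simp: V_def)
    finally have 2: "norm (ggrad_eps R \<epsilon> f x - ggrad_eps R \<epsilon> f x') \<le> e / 4" using V by simp
    have "ggrad R f x - ggrad R f x' = (ggrad_eps R \<epsilon> f x - ggrad_eps R \<epsilon> f x') - (ggrad_eps R \<epsilon> f x - ggrad R f x)
        + (ggrad_eps R \<epsilon> f x' - ggrad R f x')" by simp
    also have "norm \<dots> \<le> e / 4 + e / 4 + e / 4"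
    proof -
      have "norm (a - b + c) \<le> norm a + norm b + norm c" for a b c :: 'a
        using norm_triangle_ineq[of "a - b" c] norm_triangle_ineq4[of a b] by linarith
      then show ?thesis by (rule order_trans) (intro add_mono 1 2)
    qed
    also have "\<dots> < e" using e by simp
    finally show "norm (ggrad R f x - ggrad R f x') < e" .
  qed (rule d(1))
qed

lemma ggrad_continuous:
  assumes R: "R > 0" and f: "bfun R M f"
  shows "continuous_on (cball 0 R) (ggrad R f)"
  unfolding continuous_on_iff
proof (intro ballI allI impI)
  fix x and e :: real assume x: "x \<in> cball (0::'a) R" and e: "e > 0"
  \<comment> \<open>The modulus is available for positive bounds, hence
    \<open>M + 1\<close>.\<close>
  have "bfun R (M + 1) f" using f by (auto simp: bfun_def intro: order_trans[of _ M])
  moreover have "M + 1 > 0" using bfunD(4)[OF f] by simp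
  ultimately obtain d where "d > 0" "\<And>x x'. x \<in> cball 0 R \<Longrightarrow> x' \<in> cball 0 R \<Longrightarrow> norm (x - x') < d \<Longrightarrow>
      norm (ggrad R f x - ggrad R f x') < e"
    using ggrad_modulus[OF R e, of "M + 1", where 'a = 'a] by metis
  then show "\<exists>d>0. \<forall>x'\<in>cball 0 R. dist x' x < d \<longrightarrow> dist (ggrad R f x') (ggrad R f x) < e"
    using x by (auto simp: dist_norm intro!: exI[of _ d])
qed

lemma gpot_continuous:
  assumes R: "R > 0" and f: "bfun R M f"
  shows "continuous_on (cball 0 R) (gpot R f)"
  by (auto simp: continuous_on_eq_continuous_within intro: has_derivative_continuous[OF gpot_derivative[OF assms]])

lemma ggrad_lincomb:
  assumes R: "R > 0" and f: "bfun R M f" and g: "bfun R N g" and x: "x \<in> cball 0 R"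
  shows "ggrad R (\<lambda>y. a * f y + b * g y) x = a *\<^sub>R ggrad R f x + b *\<^sub>R ggrad R g x"
proof -
  have "(\<lambda>y. (a * f y + b * g y) *\<^sub>R green_grad0 R x y)
      = (\<lambda>y. a *\<^sub>R (f y *\<^sub>R green_grad0 R x y) + b *\<^sub>R (g y *\<^sub>R green_grad0 R x y))"
    by (simp add: fun_eq_iff scaleR_add_left)
  then show ?thesis unfolding ggrad_def
    using ggrad_integrable(1)[OF R f x] ggrad_integrable(1)[OF R g x] by (simp del: scaleR_scaleR)
qed

lemma gpot_lincomb:
  assumes R: "R > 0" and f: "bfun R M f" and g: "bfun R N g" and x: "x \<in> cball 0 R"
  shows "gpot R (\<lambda>y. a * f y + b * g y) x = a * gpot R f x + b * gpot R g x"
proof -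
  let ?e = "\<lambda>n. (inverse (real (Suc n)))\<^sup>2"
  have h: "bfun R (\<bar>a\<bar> * M + \<bar>b\<bar> * N) (\<lambda>y. a * f y + b * g y)"
    by (intro bfun_add bfun_scale f g)
  have "gpot_eps R (?e n) (\<lambda>y. a * f y + b * g y) x = a * gpot_eps R (?e n) f x + b * gpot_eps R (?e n) g x" for n
  proof -
    have "(\<lambda>y. (a * f y + b * g y) * green R (?e n) x y)
        = (\<lambda>y. a * (f y * green R (?e n) x y) + b * (g y * green R (?e n) x y))"
      by (simp add: fun_eq_iff algebra_simps)
    then show ?thesis unfolding gpot_eps_def
      using ggrad_eps_integrable(2)[OF R f, of "?e n" x] ggrad_eps_integrable(2)[OF R g, of "?e n" x] by simp
  qed
  then have "(\<lambda>n. gpot_eps R (?e n) (\<lambda>y. a * f y + b * g y) x) \<longlonglongrightarrow> a * gpot R f x + b * gpot R g x"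
    using gpot_limit[OF R f x] gpot_limit[OF R g x] by (simp only:) (intro tendsto_intros)
  then show ?thesis using gpot_limit[OF R h x] LIMSEQ_unique by blast
qed

section \<open>The Poisson equation for the potential, in weak form\<close>

section \<open>The Green potential solves the Poisson equation weakly\<close>

lemma test_fun_integrable_continuous:
  fixes F :: "'a::euclidean_space \<Rightarrow> real"
  assumes t: "test_fun \<Omega> \<psi> d\<psi>" and F: "F \<in> borel_measurable borel" "continuous_on \<Omega> F"
  shows "integrable lborel (\<lambda>x. F x * \<psi> x)" "integrable lborel (\<lambda>x. F x * (d\<psi> x \<bullet> i))"
proof -
  let ?S = "closure {x. \<psi> x \<noteq> 0}"
  have S: "compact ?S" "?S \<subseteq> \<Omega>" using t unfolding test_fun_def by auto
  obtain C where C: "C > 0" "\<And>x. \<bar>\<psi> x\<bar> \<le> C" "\<And>x. norm (d\<psi> x) \<le> C" using test_fun_bounded[OF t] by metis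
  obtain A where A: "A > 0" "\<And>x. x \<in> ?S \<Longrightarrow> norm (F x) \<le> A"
    using compact_imp_bounded[OF compact_continuous_image[OF continuous_on_subset[OF F(2) S(2)] S(1)]]
    unfolding bounded_pos by auto
  note [measurable] = F(1) test_fun_measurable[OF t]
  have S': "?S \<in> sets borel" "bounded ?S" using S by (auto intro: borel_compact compact_imp_bounded)
  show "integrable lborel (\<lambda>x. F x * \<psi> x)"
  proof (rule integrable_bounded_support[OF _ S', of _ "A * C"])
    show "F x * \<psi> x = 0" if "x \<notin> ?S" for x using test_fun_zero(1)[OF t that] by simp
    show "norm (F x * \<psi> x) \<le> A * C" for x
      using A C test_fun_zero(1)[OF t, of x] by (cases "x \<in> ?S") (auto simp: abs_mult intro!: mult_mono)
  qed measurable
  show "integrable lborel (\<lambda>x. F x * (d\<psi> x \<bullet> i))"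
  proof (rule integrable_bounded_support[OF _ S', of _ "A * (C * norm i)"])
    show "F x * (d\<psi> x \<bullet> i) = 0" if "x \<notin> ?S" for x using test_fun_zero(2)[OF t that] by simp
    have "\<bar>d\<psi> x \<bullet> i\<bar> \<le> C * norm i" for x
      by (meson C(3) Cauchy_Schwarz_ineq2 mult_right_mono norm_ge_zero order_trans)
    then show "norm (F x * (d\<psi> x \<bullet> i)) \<le> A * (C * norm i)" for x
      using A C test_fun_zero(2)[OF t, of x] by (cases "x \<in> ?S") (auto simp: abs_mult intro!: mult_mono)
  qed measurable
qed

lemma integration_by_parts:
  fixes F :: "'a::euclidean_space \<Rightarrow> real"
  assumes t: "test_fun \<Omega> \<psi> d\<psi>" and \<Omega>: "open \<Omega>"
    and F: "\<And>x. x \<in> \<Omega> \<Longrightarrow> (F has_derivative (\<lambda>h. dF x \<bullet> h)) (at x)" and dF: "continuous_on \<Omega> dF"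
    and m: "F \<in> borel_measurable borel" "dF \<in> borel_measurable borel"
  shows "(\<integral>x. F x * (d\<psi> x \<bullet> i) \<partial>lborel) = - (\<integral>x. (dF x \<bullet> i) * \<psi> x \<partial>lborel)"
proof -
  have cF: "continuous_on \<Omega> F"
    using F by (meson continuous_at_imp_continuous_on has_derivative_continuous)
  note [measurable] = m
  have 1: "integrable lborel (\<lambda>x. F x * (d\<psi> x \<bullet> i))"
    by (rule test_fun_integrable_continuous(2)[OF t m(1) cF])
  have 2: "integrable lborel (\<lambda>x. (dF x \<bullet> i) * \<psi> x)"
    by (rule test_fun_integrable_continuous(1)[OF t]) (use dF in \<open>auto intro!: continuous_intros\<close>)
  have "0 = (\<integral>x. (F x *\<^sub>R d\<psi> x + \<psi> x *\<^sub>R dF x) \<bullet> i \<partial>lborel)"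
    using test_fun_integral_grad_eq_0[OF test_fun_mult[OF t \<Omega> F dF]] by simp
  also have "\<dots> = (\<integral>x. F x * (d\<psi> x \<bullet> i) + (dF x \<bullet> i) * \<psi> x \<partial>lborel)"
    by (simp add: inner_add_left mult.commute)
  also have "\<dots> = (\<integral>x. F x * (d\<psi> x \<bullet> i) \<partial>lborel) + (\<integral>x. (dF x \<bullet> i) * \<psi> x \<partial>lborel)"
    by (rule Bochner_Integration.integral_add[OF 1 2])
  finally show ?thesis by simp
qed

lemma integral_inner_Basis:
  fixes f g :: "'a::euclidean_space \<Rightarrow> 'a"
  assumes "\<And>i. i \<in> Basis \<Longrightarrow> integrable lborel (\<lambda>x. (f x \<bullet> i) * (g x \<bullet> i))"
  shows "(\<integral>x. f x \<bullet> g x \<partial>lborel) = (\<Sum>i\<in>Basis. \<integral>x. (f x \<bullet> i) * (g x \<bullet> i) \<partial>lborel)"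
proof -
  have "(\<lambda>x. f x \<bullet> g x) = (\<lambda>x. \<Sum>i\<in>Basis. (f x \<bullet> i) * (g x \<bullet> i))" by (intro ext) (rule euclidean_inner)
  then show ?thesis using assms by (simp add: Bochner_Integration.integral_sum)
qed

text \<open>For nonzero a, s is a times the squared distance to \<open>y /\<^sub>R a\<close>. Hence
  \<open>norm (grad s) ^ 2 = 4 * a * s\<close>, and the divergence of
  \<open>tpow m \<epsilon> s\<close> times \<open>grad s\<close> collapses to
  \<open>a * tdiv m \<epsilon> s\<close>. The parameters cover the squared distance
  (\<open>a = 1\<close>) as well as \<open>grefl\<close> (\<open>a = norm y ^ 2 / R ^ 2\<close>,
  \<open>b = R ^ 2\<close>).\<close>

lemma radial_field_ibp:
  fixes y :: "'a::euclidean_space"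
  assumes t: "test_fun \<Omega> \<psi> d\<psi>" and e: "\<epsilon> > 0" and y: "(norm y)\<^sup>2 = a * b"
  defines "m \<equiv> real DIM('a) / 2"
  defines "s \<equiv> \<lambda>x. a * (x \<bullet> x) - 2 * (x \<bullet> y) + b"
  shows "(\<integral>x. (tpow m \<epsilon> (s x) *\<^sub>R (2 *\<^sub>R (a *\<^sub>R x - y))) \<bullet> d\<psi> x \<partial>lborel) = - a * (\<integral>x. tdiv m \<epsilon> (s x) * \<psi> x \<partial>lborel)"
proof -
  have t': "test_fun UNIV \<psi> d\<psi>" using t by (rule test_fun_mono) simp
  let ?g = "\<lambda>x. 2 *\<^sub>R (a *\<^sub>R x - y)"
  define F where "F i x = tpow m \<epsilon> (s x) * (?g x \<bullet> i)" for i x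
  define dF where "dF i x = (tpow' m \<epsilon> (s x) * (?g x \<bullet> i)) *\<^sub>R ?g x + (tpow m \<epsilon> (s x) * (2 * a)) *\<^sub>R i" for i x
  have cs: "continuous_on UNIV s" unfolding s_def by (intro continuous_intros)
  have cF: "continuous_on UNIV (F i)" for i unfolding F_def using e by (intro continuous_intros cs)
  have cdF: "continuous_on UNIV (dF i)" for i unfolding dF_def using e by (intro continuous_intros cs)
  have ds: "(s has_derivative (\<lambda>h. ?g x \<bullet> h)) (at x)" for x
    unfolding s_def by (auto intro!: derivative_eq_intros simp: inner_diff inner_commute algebra_simps)
  have tp: "(tpow m \<epsilon> has_derivative (\<lambda>h. tpow' m \<epsilon> t * h)) (at t)" for t
    using DERIV_tpow[OF e] by (simp add: has_field_derivative_def mult_commute_abs)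
  have dgi: "((\<lambda>x. ?g x \<bullet> i) has_derivative (\<lambda>h. 2 * a * (i \<bullet> h))) (at x)" for x i
    by (auto intro!: derivative_eq_intros simp: inner_commute)
  have dF: "(F i has_derivative (\<lambda>h. dF i x \<bullet> h)) (at x)" for i x
    unfolding F_def
    by (rule has_derivative_eq_rhs[OF has_derivative_mult[OF has_derivative_compose[OF ds tp] dgi]])
      (simp add: dF_def inner_add_left algebra_simps)
  have ibp: "(\<integral>x. F i x * (d\<psi> x \<bullet> i) \<partial>lborel) = - (\<integral>x. (dF i x \<bullet> i) * \<psi> x \<partial>lborel)" for i
    by (rule integration_by_parts[OF t']) (use dF cF cdF in \<open>auto intro: borel_measurable_continuous_onI\<close>)
  have i1: "integrable lborel (\<lambda>x. F i x * (d\<psi> x \<bullet> i))" for i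
    by (rule test_fun_integrable_continuous(2)[OF t']) (use cF in \<open>auto intro: borel_measurable_continuous_onI\<close>)
  have i2: "integrable lborel (\<lambda>x. (dF i x \<bullet> i) * \<psi> x)" for i
    by (rule test_fun_integrable_continuous(1)[OF t'])
      (use cdF in \<open>auto intro!: borel_measurable_continuous_onI continuous_intros\<close>)
  have div: "(\<Sum>i\<in>Basis. dF i x \<bullet> i) = a * tdiv m \<epsilon> (s x)" for x
  proof -
    have "?g x \<bullet> ?g x = 4 * a * s x"
      using y by (simp add: s_def inner_diff inner_commute power2_norm_eq_inner algebra_simps)
    then have "(\<Sum>i\<in>Basis. (?g x \<bullet> i) * (?g x \<bullet> i)) = 4 * a * s x" by (simp only: euclidean_inner[of "?g x" "?g x"])
    moreover have "(\<Sum>i\<in>Basis. dF i x \<bullet> i) = (\<Sum>i\<in>Basis. tpow' m \<epsilon> (s x) * ((?g x \<bullet> i) * (?g x \<bullet> i)) + tpow m \<epsilon> (s x) * (2 * a))"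
      by (rule sum.cong) (auto simp: dF_def inner_add_left)
    ultimately have "(\<Sum>i\<in>Basis. dF i x \<bullet> i) = tpow' m \<epsilon> (s x) * (4 * a * s x) + real DIM('a) * (tpow m \<epsilon> (s x) * (2 * a))"
      by (simp only: sum.distrib sum_distrib_left[symmetric] sum_constant mult_ac)
    then show ?thesis by (simp add: tdiv_def m_def algebra_simps)
  qed
  have Fi: "(tpow m \<epsilon> (s x) *\<^sub>R ?g x) \<bullet> i = F i x" for i x by (simp add: F_def)
  have "(\<integral>x. (tpow m \<epsilon> (s x) *\<^sub>R ?g x) \<bullet> d\<psi> x \<partial>lborel) = (\<Sum>i\<in>Basis. \<integral>x. F i x * (d\<psi> x \<bullet> i) \<partial>lborel)"
    by (subst integral_inner_Basis) (simp_all only: Fi i1)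
  also have "\<dots> = - (\<integral>x. (\<Sum>i\<in>Basis. (dF i x \<bullet> i) * \<psi> x) \<partial>lborel)"
    using i2 by (simp add: ibp sum_negf Bochner_Integration.integral_sum)
  also have "\<dots> = - (\<integral>x. a * (tdiv m \<epsilon> (s x) * \<psi> x) \<partial>lborel)"
    by (simp add: sum_distrib_right[symmetric] div mult.assoc)
  finally show ?thesis by simp
qed

text \<open>The factor between \<open>gpot R f\<close> and the solution of \<open>- \<Delta>u = f\<close>.\<close>

definition tconst :: "'a::euclidean_space itself \<Rightarrow> real" where
  "tconst _ = (\<integral>z. tdiv (real DIM('a) / 2) 1 ((norm (z::'a))\<^sup>2) \<partial>lborel)"

lemma tdiv_measurable [measurable]: "\<epsilon> > 0 \<Longrightarrow> tdiv m \<epsilon> \<in> borel_measurable borel"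
  by (intro borel_measurable_continuous_onI continuous_tdiv)

lemma tdiv_bump_integrable:
  fixes y :: "'a::euclidean_space"
  assumes e: "\<epsilon> > 0" and m: "m \<ge> 0"
  shows "integrable lborel (\<lambda>x. tdiv m \<epsilon> ((norm (x - y))\<^sup>2))"
proof (rule integrable_bounded_support[where S = "cball y (sqrt \<epsilon>)" and C = "4 * m * (m + 1) * \<epsilon> powr (- m)"])
  show "(\<lambda>x. tdiv m \<epsilon> ((norm (x - y))\<^sup>2)) \<in> borel_measurable borel"
    by (intro borel_measurable_continuous_onI continuous_intros e)
  show "norm (tdiv m \<epsilon> ((norm (x - y))\<^sup>2)) \<le> 4 * m * (m + 1) * \<epsilon> powr (- m)" for x
  proof (cases "(norm (x - y))\<^sup>2 < \<epsilon>")
    case True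
    have "4 * m * (m + 1) * \<epsilon> powr (- m) * (1 - (norm (x - y))\<^sup>2 / \<epsilon>) \<le> 4 * m * (m + 1) * \<epsilon> powr (- m)"
      using e m by (intro mult_left_le) auto
    then show ?thesis using True tdiv_nonneg[OF e m, of "(norm (x - y))\<^sup>2"] e by (simp add: tdiv_eq)
  qed (use e m in \<open>simp add: tdiv_eq\<close>)
  show "tdiv m \<epsilon> ((norm (x - y))\<^sup>2) = 0" if "x \<notin> cball y (sqrt \<epsilon>)" for x
  proof -
    have "sqrt \<epsilon> \<le> norm (x - y)" using that by (simp add: dist_norm norm_minus_commute)
    then have "\<epsilon> \<le> (norm (x - y))\<^sup>2" using e real_le_rsqrt real_sqrt_le_iff
      by (metis power_mono real_sqrt_ge_zero real_sqrt_pow2 less_imp_le)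
    then show ?thesis using e by (simp add: tdiv_eq)
  qed
qed auto

text \<open>Dilation by \<open>sqrt \<epsilon>\<close>: its Jacobian cancels the factor
  \<open>\<epsilon> powr (- n / 2)\<close> of the bump. The bumps are therefore
  \<open>tconst\<close> times an approximate identity.\<close>

lemma tdiv_bump_integral:
  fixes y :: "'a::euclidean_space"
  assumes e: "\<epsilon> > 0"
  shows "(\<integral>x. tdiv (real DIM('a) / 2) \<epsilon> ((norm (x - y))\<^sup>2) \<partial>lborel) = tconst TYPE('a)"
proof -
  let ?m = "real DIM('a) / 2"
  let ?g = "\<lambda>x. tdiv ?m \<epsilon> ((norm (x - y))\<^sup>2)"
  have m[measurable]: "?g \<in> borel_measurable borel"
    by (intro borel_measurable_continuous_onI continuous_intros e)
  have s: "sqrt \<epsilon> ^ DIM('a) = \<epsilon> powr ?m"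
    using e by (simp add: powr_half_sqrt[symmetric] powr_powr flip: powr_realpow)
  have "(\<integral>x. ?g x \<partial>lborel) = (\<integral>x. ?g x \<partial>density (distr lborel borel (\<lambda>x. y + sqrt \<epsilon> *\<^sub>R x)) (\<lambda>_. ennreal (\<bar>sqrt \<epsilon>\<bar> ^ DIM('a))))"
    using lborel_affine[of "sqrt \<epsilon>" y] e by (simp add: ennreal_power)
  also have "\<dots> = (\<integral>x. sqrt \<epsilon> ^ DIM('a) * ?g (y + sqrt \<epsilon> *\<^sub>R x) \<partial>lborel)"
    using e by (subst integral_density) (auto simp: integral_distr)
  also have "\<dots> = (\<integral>x. tdiv ?m 1 ((norm (x::'a))\<^sup>2) \<partial>lborel)"
  proof -
    have "sqrt \<epsilon> ^ DIM('a) * ?g (y + sqrt \<epsilon> *\<^sub>R x) = tdiv ?m 1 ((norm x)\<^sup>2)" for x :: 'a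
      unfolding s using e by (auto simp: tdiv_eq power_mult_distrib powr_minus field_simps)
    then show ?thesis by simp
  qed
  finally show ?thesis by (simp add: tconst_def)
qed

lemma tconst_pos: "tconst TYPE('a::euclidean_space) > 0"
proof -
  let ?m = "real DIM('a) / 2" and ?B = "ball (0::'a) (1/2)"
  have n: "?m > 0" by simp
  have "0 < 2 * ?m * (?m + 1) * measure lborel ?B"
    using content_ball_pos[of "1/2" "0::'a"] by simp
  also have "\<dots> = (\<integral>z. 2 * ?m * (?m + 1) * indicator ?B z \<partial>lborel)" by simp
  also have "\<dots> \<le> (\<integral>z. tdiv ?m 1 ((norm (z - (0::'a)))\<^sup>2) \<partial>lborel)"
  proof (rule integral_mono)
    show "integrable lborel (\<lambda>z. 2 * ?m * (?m + 1) * indicator ?B z)"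
      by (intro integrable_mult_right integrable_real_indicator emeasure_bounded_finite[OF bounded_ball]) simp
    show "2 * ?m * (?m + 1) * indicator ?B z \<le> tdiv ?m 1 ((norm (z - 0))\<^sup>2)" for z
    proof (cases "z \<in> ?B")
      case True
      have "(norm z)\<^sup>2 \<le> (1/2)\<^sup>2" using True by (intro power_mono) auto
      then have q: "(norm z)\<^sup>2 \<le> 1/2" by (simp add: power2_eq_square)
      have "2 * ?m * (?m + 1) * 1 \<le> 2 * ?m * (?m + 1) * (2 * (1 - (norm z)\<^sup>2))"
        using q by (intro mult_left_mono) auto
      then show ?thesis using True q by (simp add: tdiv_eq algebra_simps)
    qed (simp add: tdiv_nonneg)
  qed (use tdiv_bump_integrable[of 1 ?m "0::'a"] in auto)
  finally show ?thesis by (simp add: tconst_def)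
qed

lemma test_fun_support_ball_less:
  fixes R :: real and \<psi> :: "'a::euclidean_space \<Rightarrow> real"
  assumes t: "test_fun (ball 0 R) \<psi> d\<psi>" and R: "R > 0"
  obtains r where "0 < r" "r < R" "\<And>x. norm x > r \<Longrightarrow> \<psi> x = 0" "\<And>x. norm x > r \<Longrightarrow> d\<psi> x = 0"
proof -
  let ?S = "closure {x. \<psi> x \<noteq> 0}"
  have S: "compact ?S" "?S \<subseteq> ball 0 R" using t unfolding test_fun_def by auto
  obtain r where r: "0 < r" "r < R" "?S \<subseteq> cball 0 r"
  proof (cases "?S = {}")
    case True then show thesis using that[of "R/2"] R by simp
  next
    case False
    obtain z where z: "z \<in> ?S" "\<And>x. x \<in> ?S \<Longrightarrow> norm x \<le> norm z"
      using continuous_attains_sup[OF S(1) False, of norm] continuous_on_norm_id by blast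
    then show thesis using that[of "max (norm z) (R/2)"] R S by fastforce
  qed
  then have "x \<notin> ?S" if "norm x > r" for x using that by force
  then show thesis using that[OF r(1,2)] test_fun_zero[OF t] by blast
qed

lemma test_fun_lipschitz:
  assumes t: "test_fun \<Omega> \<psi> d\<psi>" and C: "\<And>x. norm (d\<psi> x) \<le> C"
  shows "\<bar>\<psi> y - \<psi> x\<bar> \<le> C * norm (y - x)"
proof -
  have "norm (\<psi> y - \<psi> x) \<le> C * norm (y - x)"
  proof (rule differentiable_bound[of UNIV \<psi> "\<lambda>x h. d\<psi> x \<bullet> h"])
    show "(\<psi> has_derivative (\<lambda>h. d\<psi> x \<bullet> h)) (at x within UNIV)" for x using t unfolding test_fun_def by simp
    show "onorm (\<lambda>h. d\<psi> x \<bullet> h) \<le> C" for x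
      by (intro onorm_le) (metis C Cauchy_Schwarz_ineq2 mult_right_mono norm_ge_zero order_trans real_norm_def)
  qed auto
  then show ?thesis by simp
qed

lemma bump_average:
  fixes y :: "'a::euclidean_space"
  assumes t: "test_fun \<Omega> \<psi> d\<psi>" and C: "\<And>x. norm (d\<psi> x) \<le> C" and e: "\<epsilon> > 0"
  shows "\<bar>(\<integral>x. tdiv (real DIM('a) / 2) \<epsilon> ((norm (x - y))\<^sup>2) * \<psi> x \<partial>lborel) - tconst TYPE('a) * \<psi> y\<bar>
    \<le> tconst TYPE('a) * (C * sqrt \<epsilon>)"
proof -
  let ?k = "\<lambda>x. tdiv (real DIM('a) / 2) \<epsilon> ((norm (x - y))\<^sup>2)"
  have k: "integrable lborel ?k" by (rule tdiv_bump_integrable[OF e]) simp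
  have k\<psi>: "integrable lborel (\<lambda>x. ?k x * \<psi> x)"
    by (rule test_fun_integrable_continuous(1)[OF t])
      (intro borel_measurable_continuous_onI continuous_intros e)+
  have C0: "C \<ge> 0" using order_trans[OF norm_ge_zero C] by blast
  have "(\<integral>x. ?k x * \<psi> x \<partial>lborel) - tconst TYPE('a) * \<psi> y = (\<integral>x. ?k x * (\<psi> x - \<psi> y) \<partial>lborel)"
    using k k\<psi> by (simp add: right_diff_distrib tdiv_bump_integral[OF e])
  also have "norm \<dots> \<le> (\<integral>x. (C * sqrt \<epsilon>) * ?k x \<partial>lborel)"
  proof (rule Bochner_Integration.integral_norm_bound_integral)
    show "integrable lborel (\<lambda>x. ?k x * (\<psi> x - \<psi> y))" using k k\<psi> by (simp add: right_diff_distrib)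
    show "norm (?k x * (\<psi> x - \<psi> y)) \<le> (C * sqrt \<epsilon>) * ?k x" for x
    proof (cases "(norm (x - y))\<^sup>2 < \<epsilon>")
      case True
      then have "norm (x - y) \<le> sqrt \<epsilon>" by (simp add: real_le_rsqrt)
      then have "\<bar>\<psi> x - \<psi> y\<bar> \<le> C * sqrt \<epsilon>"
        using test_fun_lipschitz[OF t C, of x y] C0 by (meson mult_left_mono order_trans)
      then show ?thesis using tdiv_nonneg[OF e, of "real DIM('a) / 2"]
        by (simp add: abs_mult mult.commute mult_right_mono)
    qed (use e in \<open>simp add: tdiv_eq\<close>)
  qed (use k in auto)
  also have "\<dots> = tconst TYPE('a) * (C * sqrt \<epsilon>)" by (simp add: tdiv_bump_integral[OF e])
  finally show ?thesis by simp
qed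

text \<open>For such \<epsilon> the image term is divergence free on the support of \<psi>, so only
  the bump around y remains, even for y on the sphere.\<close>

lemma green_grad_test:
  fixes y :: "'a::euclidean_space"
  assumes t: "test_fun (ball 0 R) \<psi> d\<psi>" and r: "0 < r" "r < R" "\<And>x. norm x > r \<Longrightarrow> \<psi> x = 0"
    and e: "0 < \<epsilon>" "\<epsilon> \<le> (R - r)\<^sup>2" and y: "y \<in> cball 0 R"
  shows "(\<integral>x. green_grad R \<epsilon> x y \<bullet> d\<psi> x \<partial>lborel) = (\<integral>x. tdiv (real DIM('a) / 2) \<epsilon> ((norm (x - y))\<^sup>2) * \<psi> x \<partial>lborel)"
proof -
  let ?m = "real DIM('a) / 2" and ?a = "(norm y)\<^sup>2 / R\<^sup>2"
  have R: "R > 0" using r by simp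
  have q: "grefl R x y = ?a * (x \<bullet> x) - 2 * (x \<bullet> y) + R\<^sup>2" for x
    by (simp add: grefl_def power2_norm_eq_inner)
  have p: "(norm (x - y))\<^sup>2 = 1 * (x \<bullet> x) - 2 * (x \<bullet> y) + (norm y)\<^sup>2" for x
    by (simp add: power2_norm_eq_inner inner_diff inner_commute)
  have 1: "(\<integral>x. (tpow ?m \<epsilon> (grefl R x y) *\<^sub>R grefl_grad R x y) \<bullet> d\<psi> x \<partial>lborel)
      = - ?a * (\<integral>x. tdiv ?m \<epsilon> (grefl R x y) * \<psi> x \<partial>lborel)"
    unfolding q grefl_grad_def by (rule radial_field_ibp[OF t e(1)]) (use R in simp)
  have "tdiv ?m \<epsilon> (grefl R x y) * \<psi> x = 0" for x
  proof (cases "norm x > r")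
    case False
    then have "(R - r)\<^sup>2 \<le> grefl R x y" using y r by (intro grefl_ge_interior) auto
    then show ?thesis using e by (simp add: tdiv_eq)
  qed (use r in simp)
  with 1 have 1: "(\<integral>x. (tpow ?m \<epsilon> (grefl R x y) *\<^sub>R grefl_grad R x y) \<bullet> d\<psi> x \<partial>lborel) = 0" by simp
  have 2: "(\<integral>x. (tpow ?m \<epsilon> ((norm (x - y))\<^sup>2) *\<^sub>R (2 *\<^sub>R (x - y))) \<bullet> d\<psi> x \<partial>lborel)
      = - (\<integral>x. tdiv ?m \<epsilon> ((norm (x - y))\<^sup>2) * \<psi> x \<partial>lborel)"
    unfolding p using radial_field_ibp[OF t e(1), of y 1 "(norm y)\<^sup>2"] by simp
  have i: "integrable lborel (\<lambda>x. (tpow ?m \<epsilon> (s x) *\<^sub>R G x) \<bullet> d\<psi> x)"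
    if "continuous_on UNIV s" "continuous_on UNIV G" for s :: "'a \<Rightarrow> real" and G :: "'a \<Rightarrow> 'a"
  proof -
    have "integrable lborel (\<lambda>x. \<Sum>i\<in>Basis. ((tpow ?m \<epsilon> (s x) *\<^sub>R G x) \<bullet> i) * (d\<psi> x \<bullet> i))"
      using that e
      by (intro Bochner_Integration.integrable_sum test_fun_integrable_continuous(2)[OF test_fun_mono[OF t subset_UNIV]]
          borel_measurable_continuous_onI continuous_intros)
    also have "(\<lambda>x. \<Sum>i\<in>Basis. ((tpow ?m \<epsilon> (s x) *\<^sub>R G x) \<bullet> i) * (d\<psi> x \<bullet> i)) = (\<lambda>x. (tpow ?m \<epsilon> (s x) *\<^sub>R G x) \<bullet> d\<psi> x)"
      by (intro ext) (rule euclidean_inner[symmetric])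
    finally show ?thesis .
  qed
  have "integrable lborel (\<lambda>x. (tpow ?m \<epsilon> (grefl R x y) *\<^sub>R grefl_grad R x y) \<bullet> d\<psi> x)"
    unfolding q grefl_grad_def by (rule i) (intro continuous_intros)+
  moreover have "integrable lborel (\<lambda>x. (tpow ?m \<epsilon> ((norm (x - y))\<^sup>2) *\<^sub>R (2 *\<^sub>R (x - y))) \<bullet> d\<psi> x)"
    by (rule i) (intro continuous_intros)+
  ultimately show ?thesis using 1 2 by (simp add: green_grad_def inner_diff_left)
qed

lemma ggrad_eps_test:
  fixes f :: "'a::euclidean_space \<Rightarrow> real"
  assumes f: "bfun R M f" and t: "test_fun (ball 0 R) \<psi> d\<psi>" and e: "\<epsilon> > 0"
  shows "integrable lborel (\<lambda>x. ggrad_eps R \<epsilon> f x \<bullet> d\<psi> x)"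
    "(\<integral>x. ggrad_eps R \<epsilon> f x \<bullet> d\<psi> x \<partial>lborel) = (\<integral>y. f y * (\<integral>x. green_grad R \<epsilon> x y \<bullet> d\<psi> x \<partial>lborel) \<partial>lborel)"
    "integrable lborel (\<lambda>y. f y * (\<integral>x. green_grad R \<epsilon> x y \<bullet> d\<psi> x \<partial>lborel))"
proof -
  interpret smooth_kernel "green R \<epsilon> :: 'a \<Rightarrow> _" "green_grad R \<epsilon>" by (rule green_kernel[OF e])
  note [measurable] = bfunD(1)[OF f] test_fun_measurable[OF t] borel_measurable_continuous_onI[OF dcont]
  obtain C where C: "C > 0" "\<And>x. norm (d\<psi> x) \<le> C" using test_fun_bounded[OF t] by metis
  let ?K = "cball (0::'a) R"
  have K: "compact (?K \<times> ?K)" by (intro compact_Times compact_cball)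
  obtain A where A: "A > 0" "\<And>z. z \<in> ?K \<times> ?K \<Longrightarrow> norm (green_grad R \<epsilon> (fst z) (snd z)) \<le> A"
    using compact_imp_bounded[OF compact_continuous_image[OF continuous_on_subset[OF dcont] K]]
    unfolding bounded_pos by auto
  let ?F = "\<lambda>z. f (snd z) * (green_grad R \<epsilon> (fst z) (snd z) \<bullet> d\<psi> (fst z))"
  have "integrable (lborel :: ('a \<times> 'a) measure) ?F"
  proof (rule integrable_bounded_support[where S = "?K \<times> ?K" and C = "M * (A * C)"])
    have fs: "fst \<in> borel_measurable (borel :: ('a \<times> 'a) measure)" "snd \<in> borel_measurable (borel :: ('a \<times> 'a) measure)"
      by (intro borel_measurable_continuous_onI continuous_intros)+
    show "?F \<in> borel_measurable borel"
      by (intro borel_measurable_times borel_measurable_inner borel_measurable_continuous_onI[OF dcont]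
          measurable_compose[OF fs(2) bfunD(1)[OF f]] measurable_compose[OF fs(1) test_fun_measurable(2)[OF t]])
    show "?K \<times> ?K \<in> sets borel" using K by (rule borel_compact)
    show "bounded (?K \<times> ?K)" using K by (rule compact_imp_bounded)
    show z: "?F z = 0" if "z \<notin> ?K \<times> ?K" for z
      using that bfunD(3)[OF f, of "snd z"] test_fun_zero_outside(2)[OF t, of "fst z"]
      by (cases z) auto
    show "norm (?F z) \<le> M * (A * C)" for z
    proof (cases "z \<in> ?K \<times> ?K")
      case True
      have "\<bar>green_grad R \<epsilon> (fst z) (snd z) \<bullet> d\<psi> (fst z)\<bar> \<le> A * C"
        using A C True by (intro order_trans[OF Cauchy_Schwarz_ineq2] mult_mono) auto
      then show ?thesis using bfunD[OF f] by (simp add: abs_mult mult_mono)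
    next
      case False
      show ?thesis unfolding z[OF False] using A C bfunD(4)[OF f] by simp
    qed
  qed
  then have F: "integrable (lborel \<Otimes>\<^sub>M lborel) (\<lambda>(x, y). f y * (green_grad R \<epsilon> x y \<bullet> d\<psi> x))"
    by (simp add: lborel_prod case_prod_beta')
  have eq: "(\<integral>y. f y * (green_grad R \<epsilon> x y \<bullet> d\<psi> x) \<partial>lborel) = ggrad_eps R \<epsilon> f x \<bullet> d\<psi> x" for x
  proof -
    have "(\<integral>y. (f y *\<^sub>R green_grad R \<epsilon> x y) \<bullet> d\<psi> x \<partial>lborel) = ggrad_eps R \<epsilon> f x \<bullet> d\<psi> x"
      unfolding ggrad_eps_def
      by (rule integral_inner_left) (rule kernel_integrable(2)[of f M ?K], use bfunD[OF f] in auto)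
    then show ?thesis by simp
  qed
  show "integrable lborel (\<lambda>x. ggrad_eps R \<epsilon> f x \<bullet> d\<psi> x)"
    using lborel_pair.integrable_fst'[OF F] eq by simp
  show "(\<integral>x. ggrad_eps R \<epsilon> f x \<bullet> d\<psi> x \<partial>lborel) = (\<integral>y. f y * (\<integral>x. green_grad R \<epsilon> x y \<bullet> d\<psi> x \<partial>lborel) \<partial>lborel)"
    using lborel_pair.Fubini_integral[OF F] eq by simp
  show "integrable lborel (\<lambda>y. f y * (\<integral>x. green_grad R \<epsilon> x y \<bullet> d\<psi> x \<partial>lborel))"
    using lborel_pair.integrable_snd[OF F] by simp
qed

text \<open>Two errors of order \<open>sqrt \<epsilon>\<close> occur: passing to the regularised
  gradient, and replacing \<open>\<psi> y\<close> by its average over a bump of radius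
  \<open>sqrt \<epsilon>\<close>. In between, Fubini moves the test function onto the
  kernel.\<close>

theorem ggrad_weak:
  fixes f :: "'a::euclidean_space \<Rightarrow> real"
  assumes R: "R > 0" and f: "bfun R M f" and t: "test_fun (ball 0 R) \<psi> d\<psi>"
  shows "(\<integral>x. ggrad R f x \<bullet> d\<psi> x \<partial>lborel) = tconst TYPE('a) * (\<integral>x. f x * \<psi> x \<partial>lborel)"
proof -
  let ?c = "tconst TYPE('a)" and ?K = "cball (0::'a) R"
  note [measurable] = bfunD(1)[OF f] test_fun_measurable[OF t]
  obtain C where C: "C > 0" "\<And>x. \<bar>\<psi> x\<bar> \<le> C" "\<And>x. norm (d\<psi> x) \<le> C" using test_fun_bounded[OF t] by metis
  obtain r where r: "0 < r" "r < R" "\<And>x. norm x > r \<Longrightarrow> \<psi> x = 0" using test_fun_support_ball_less[OF t R] by metis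
  define V where "V = measure lborel ?K"
  have iK: "integrable lborel (indicator ?K :: 'a \<Rightarrow> real)"
    using emeasure_bounded_finite[OF bounded_cball] by (intro integrable_real_indicator) auto
  have f\<psi>: "integrable lborel (\<lambda>x. f x * \<psi> x)"
    by (rule integrable_bounded_support[where S = ?K and C = "M * C"])
      (use C bfunD[OF f] in \<open>auto simp: abs_mult intro!: mult_mono\<close>)
  have "(\<lambda>x. indicator ?K x *\<^sub>R ggrad R f x) \<in> borel_measurable borel"
    by (rule borel_measurable_continuous_on_indicator[OF _ ggrad_continuous[OF R f]]) simp
  then have "(\<lambda>x. (indicator ?K x *\<^sub>R ggrad R f x) \<bullet> d\<psi> x) \<in> borel_measurable borel" by measurable
  also have "(\<lambda>x. (indicator ?K x *\<^sub>R ggrad R f x) \<bullet> d\<psi> x) = (\<lambda>x. ggrad R f x \<bullet> d\<psi> x)"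
    using test_fun_zero_outside(2)[OF t] by (force simp: indicator_def fun_eq_iff)
  finally have m: "(\<lambda>x. ggrad R f x \<bullet> d\<psi> x) \<in> borel_measurable borel" .
  have ig: "integrable lborel (\<lambda>x. ggrad R f x \<bullet> d\<psi> x)"
  proof (rule integrable_bounded_support[OF m, where S = ?K and C = "12 * sing_const TYPE('a) * R * M * C"])
    show z: "ggrad R f x \<bullet> d\<psi> x = 0" if "x \<notin> ?K" for x
      using that test_fun_zero_outside(2)[OF t, of x] by auto
    show "norm (ggrad R f x \<bullet> d\<psi> x) \<le> 12 * sing_const TYPE('a) * R * M * C" for x
    proof (cases "x \<in> ?K")
      case True
      then show ?thesis
        using ggrad_bound[OF R f True] C by (auto intro!: order_trans[OF Cauchy_Schwarz_ineq2] mult_mono intro: order_trans[OF norm_ge_zero])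
    next
      case False
      then show ?thesis using z[OF False] R C bfunD(4)[OF f] sing_const_pos[where ?'a = 'a] by simp
    qed
  qed auto
  define D where "D = \<bar>(\<integral>x. ggrad R f x \<bullet> d\<psi> x \<partial>lborel) - ?c * (\<integral>x. f x * \<psi> x \<partial>lborel)\<bar>"
  define A where "A = 8 * sing_const TYPE('a) * M * C * V + M * (?c * C) * V"
  have key: "D \<le> A * sqrt \<epsilon>" if e: "0 < \<epsilon>" "\<epsilon> \<le> (R - r)\<^sup>2" for \<epsilon>
  proof -
    note E = ggrad_eps_test[OF f t e(1)]
    have "norm ((\<integral>x. ggrad_eps R \<epsilon> f x \<bullet> d\<psi> x \<partial>lborel) - (\<integral>x. ggrad R f x \<bullet> d\<psi> x \<partial>lborel))
        = norm (\<integral>x. (ggrad_eps R \<epsilon> f x - ggrad R f x) \<bullet> d\<psi> x \<partial>lborel)"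
      using E(1) ig by (simp add: inner_diff_left)
    also have "\<dots> \<le> (\<integral>x. (8 * sing_const TYPE('a) * M * sqrt \<epsilon> * C) * indicator ?K x \<partial>lborel)"
    proof (rule Bochner_Integration.integral_norm_bound_integral)
      show "norm ((ggrad_eps R \<epsilon> f x - ggrad R f x) \<bullet> d\<psi> x) \<le> (8 * sing_const TYPE('a) * M * sqrt \<epsilon> * C) * indicator ?K x" for x
      proof (cases "x \<in> ?K")
        case True
        have "\<bar>(ggrad_eps R \<epsilon> f x - ggrad R f x) \<bullet> d\<psi> x\<bar> \<le> (8 * sing_const TYPE('a) * M * sqrt \<epsilon>) * C"
          by (rule order_trans[OF Cauchy_Schwarz_ineq2 mult_mono[OF ggrad_eps_diff[OF R f True e(1)] C(3)]])
            (use order_trans[OF norm_ge_zero ggrad_eps_diff[OF R f True e(1)]] in auto)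
        then show ?thesis using True by simp
      next
        case False then show ?thesis using test_fun_zero_outside(2)[OF t, of x] by auto
      qed
    qed (use E(1) ig iK in \<open>auto simp: inner_diff_left\<close>)
    finally have 1: "\<bar>(\<integral>x. ggrad_eps R \<epsilon> f x \<bullet> d\<psi> x \<partial>lborel) - (\<integral>x. ggrad R f x \<bullet> d\<psi> x \<partial>lborel)\<bar>
        \<le> 8 * sing_const TYPE('a) * M * C * V * sqrt \<epsilon>" by (simp add: V_def mult_ac)
    have "norm ((\<integral>y. f y * (\<integral>x. green_grad R \<epsilon> x y \<bullet> d\<psi> x \<partial>lborel) \<partial>lborel) - (\<integral>x. ?c * (f x * \<psi> x) \<partial>lborel))
       = norm (\<integral>y. f y * (\<integral>x. green_grad R \<epsilon> x y \<bullet> d\<psi> x \<partial>lborel) - ?c * (f y * \<psi> y) \<partial>lborel)"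
      by (subst Bochner_Integration.integral_diff[OF E(3)]) (use f\<psi> in auto)
    also have "\<dots> \<le> (\<integral>y. (M * (?c * (C * sqrt \<epsilon>))) * indicator ?K y \<partial>lborel)"
    proof (rule Bochner_Integration.integral_norm_bound_integral)
      show "norm (f y * (\<integral>x. green_grad R \<epsilon> x y \<bullet> d\<psi> x \<partial>lborel) - ?c * (f y * \<psi> y)) \<le> (M * (?c * (C * sqrt \<epsilon>))) * indicator ?K y" for y
      proof (cases "y \<in> ?K")
        case True
        have "\<bar>f y\<bar> * \<bar>(\<integral>x. green_grad R \<epsilon> x y \<bullet> d\<psi> x \<partial>lborel) - ?c * \<psi> y\<bar> \<le> M * (?c * (C * sqrt \<epsilon>))"
          unfolding green_grad_test[OF t r(1) r(2) r(3) e True, simplified]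
          by (rule mult_mono[OF bfunD(2)[OF f] bump_average[OF t C(3) e(1)] bfunD(4)[OF f]]) simp
        then show ?thesis using True by (simp add: abs_mult[symmetric] algebra_simps)
      qed (use bfunD(3)[OF f] in simp)
    qed (use E(3) f\<psi> iK in auto)
    finally have "\<bar>(\<integral>x. ggrad_eps R \<epsilon> f x \<bullet> d\<psi> x \<partial>lborel) - ?c * (\<integral>x. f x * \<psi> x \<partial>lborel)\<bar> \<le> M * (?c * C) * V * sqrt \<epsilon>"
      unfolding E(2)[symmetric] by (simp add: V_def mult_ac)
    with 1 show ?thesis unfolding D_def A_def distrib_right by linarith
  qed
  \<comment> \<open>Substitute \<open>\<epsilon> = s ^ 2\<close> and let s tend to 0; D does not
    depend on s.\<close>
  have "D \<le> A * s" if "0 < s" "s \<le> R - r" for s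
    using key[of "s\<^sup>2"] that by (simp add: power_mono)
  then have "\<forall>\<^sub>F s in at_right 0. D \<le> A * s"
    using r by (intro eventually_at_rightI[of 0 "R - r"]) auto
  moreover have "((\<lambda>s. A * s) \<longlongrightarrow> A * 0) (at_right 0)" by (intro tendsto_intros)
  ultimately have "D \<le> A * 0" by (intro tendsto_le[OF _ _ tendsto_const]) auto
  then show ?thesis by (simp add: D_def)
qed

section \<open>Mollification and the maximum principle for weak subsolutions\<close>

section \<open>Mollification of square integrable functions\<close>

text \<open>Squaring makes the positive part C^1. The mollifier and the truncated test functions of
  the maximum principle are both built from it.\<close>

lemma DERIV_pos_square: "((\<lambda>s::real. (max 0 s)\<^sup>2) has_real_derivative 2 * max 0 s) (at s)"
proof -
  consider "s < 0" | "s > 0" | "s = 0" by linarith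
  then show ?thesis
  proof cases
    case 1
    have "((\<lambda>s::real. (max 0 s)\<^sup>2) has_real_derivative 0) (at s)"
      by (rule has_field_derivative_transform_within_open[OF DERIV_const[of 0], where S = "{..<0}"]) (use 1 in auto)
    then show ?thesis using 1 by simp
  next
    case 2
    have "((\<lambda>s::real. s\<^sup>2) has_real_derivative 2 * s) (at s)" by (auto intro!: derivative_eq_intros)
    then have "((\<lambda>s::real. (max 0 s)\<^sup>2) has_real_derivative 2 * s) (at s)"
      by (rule has_field_derivative_transform_within_open[where S = "{0<..}"]) (use 2 in auto)
    then show ?thesis using 2 by simp
  next
    case 3
    have "((\<lambda>h. ((max 0 h)\<^sup>2 - 0) / h) \<longlongrightarrow> 0) (at (0::real))"
    proof (rule Lim_null_comparison)
      show "\<forall>\<^sub>F h in at (0::real). norm (((max 0 h)\<^sup>2 - 0) / h) \<le> \<bar>h\<bar>"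
        by (intro always_eventually allI) (auto simp: max_def power2_eq_square)
      show "((\<lambda>h::real. \<bar>h\<bar>) \<longlongrightarrow> 0) (at 0)" by (intro tendsto_rabs_zero tendsto_ident_at)
    qed
    then show ?thesis using 3 by (simp add: DERIV_def)
  qed
qed

lemma pos_square_has_derivative:
  assumes "(f has_derivative f') (at x)"
  shows "((\<lambda>x. (max 0 (f x :: real))\<^sup>2) has_derivative (\<lambda>h. 2 * max 0 (f x) * f' h)) (at x)"
proof -
  have "((\<lambda>s::real. (max 0 s)\<^sup>2) has_derivative (\<lambda>h. 2 * max 0 s * h)) (at s)" for s
    using DERIV_pos_square[of s] by (simp add: has_field_derivative_def)
  from has_derivative_compose[OF assms this] show ?thesis .
qed

text \<open>Test functions are only asked to be C^1, so a piecewise polynomial bump serves as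
  mollifier.\<close>

definition mbump :: "real \<Rightarrow> 'a::euclidean_space \<Rightarrow> real" where
  "mbump \<delta> z = (max 0 (1 - (norm z)\<^sup>2 / \<delta>\<^sup>2))\<^sup>2"

definition mnorm :: "'a::euclidean_space itself \<Rightarrow> real \<Rightarrow> real" where
  "mnorm _ \<delta> = (\<integral>z. mbump \<delta> (z::'a) \<partial>lborel)"

definition moll :: "real \<Rightarrow> 'a::euclidean_space \<Rightarrow> 'a \<Rightarrow> real" where
  "moll \<delta> x y = mbump \<delta> (x - y) / mnorm TYPE('a) \<delta>"

definition dmoll :: "real \<Rightarrow> 'a::euclidean_space \<Rightarrow> 'a \<Rightarrow> 'a" where
  "dmoll \<delta> x y = (- (4 / \<delta>\<^sup>2) * max 0 (1 - (norm (x - y))\<^sup>2 / \<delta>\<^sup>2) / mnorm TYPE('a) \<delta>) *\<^sub>R (x - y)"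

lemma mbump_nonneg: "0 \<le> mbump \<delta> z" by (simp add: mbump_def)

lemma mbump_le_1: "mbump \<delta> z \<le> 1"
  unfolding mbump_def by (rule power_le_one) auto

lemma mbump_outside:
  assumes "\<delta> > 0" "\<delta> \<le> norm z"
  shows "mbump \<delta> z = 0"
proof -
  have "\<delta>\<^sup>2 \<le> (norm z)\<^sup>2" using assms by (intro power_mono) auto
  then show ?thesis using assms(1) by (simp add: mbump_def)
qed

lemma mbump_integrable: "\<delta> > 0 \<Longrightarrow> integrable lborel (mbump \<delta> :: 'a::euclidean_space \<Rightarrow> real)"
proof (rule integrable_bounded_support[where S = "cball 0 \<delta>" and C = 1])
  show "(mbump \<delta> :: 'a \<Rightarrow> real) \<in> borel_measurable borel"
    unfolding mbump_def by measurable
qed (simp_all add: mbump_outside mbump_nonneg mbump_le_1 abs_of_nonneg)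

lemma mnorm_pos:
  assumes d: "\<delta> > 0"
  shows "mnorm TYPE('a::euclidean_space) \<delta> > 0"
proof -
  let ?B = "ball (0::'a) (\<delta>/2)"
  have "0 < (1/2) * measure lborel ?B"
    using content_ball_pos[of "\<delta>/2" "0::'a"] d by simp
  also have "\<dots> = (\<integral>z. (1/2) * indicator ?B z \<partial>lborel)" by simp
  also have "\<dots> \<le> mnorm TYPE('a) \<delta>" unfolding mnorm_def
  proof (rule integral_mono[OF _ mbump_integrable[OF d]])
    show "integrable lborel (\<lambda>z. (1/2) * indicator ?B z :: real)"
      by (intro integrable_mult_right integrable_real_indicator emeasure_bounded_finite[OF bounded_ball]) simp
    show "(1/2) * indicator ?B z \<le> mbump \<delta> z" for z
    proof (cases "z \<in> ?B")
      case True
      have "(norm z)\<^sup>2 \<le> (\<delta>/2)\<^sup>2" using True by (intro power_mono) auto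
      then have "3/4 \<le> 1 - (norm z)\<^sup>2 / \<delta>\<^sup>2" using d by (simp add: power_divide field_simps)
      then have "(3/4)\<^sup>2 \<le> mbump \<delta> z" unfolding mbump_def by (intro power_mono max.coboundedI2) auto
      then show ?thesis using True by (simp add: power2_eq_square)
    qed (simp add: mbump_nonneg)
  qed
  finally show ?thesis .
qed

lemma moll_commute: "moll \<delta> x y = moll \<delta> y x"
  by (simp add: moll_def mbump_def norm_minus_commute)

lemma dmoll_commute: "dmoll \<delta> x y = - dmoll \<delta> y x"
  by (simp add: dmoll_def norm_minus_commute flip: scaleR_minus_right)

lemma moll_nonneg: "\<delta> > 0 \<Longrightarrow> 0 \<le> moll \<delta> x y"
  unfolding moll_def using mnorm_pos[of \<delta>] by (intro divide_nonneg_pos mbump_nonneg)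

lemma moll_outside: "\<delta> > 0 \<Longrightarrow> \<delta> \<le> norm (x - y) \<Longrightarrow> moll \<delta> x y = 0"
  by (simp add: moll_def mbump_outside)

lemma moll_integral:
  fixes x :: "'a::euclidean_space"
  assumes d: "\<delta> > 0"
  shows "integrable lborel (moll \<delta> x)" "(\<integral>y. moll \<delta> x y \<partial>lborel) = 1"
proof -
  have e: "moll \<delta> x (y + x) = mbump \<delta> y / mnorm TYPE('a) \<delta>" for y
    by (simp add: moll_def mbump_def)
  show "integrable lborel (moll \<delta> x)"
    using lborel_integral_translate(2)[of "moll \<delta> x" x] mbump_integrable[OF d, where 'a = 'a] by (simp add: e)
  show "(\<integral>y. moll \<delta> x y \<partial>lborel) = 1"
    using lborel_integral_translate(1)[of "moll \<delta> x" x] mnorm_pos[OF d, where 'a = 'a] by (simp add: e mnorm_def)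
qed

lemma moll_kernel:
  assumes d: "\<delta> > 0"
  shows "smooth_kernel (moll \<delta>) (dmoll \<delta> :: 'a::euclidean_space \<Rightarrow> _)"
proof
  fix x y :: 'a
  let ?N = "mnorm TYPE('a) \<delta>"
  have "((\<lambda>x. 1 - (norm (x - y))\<^sup>2 / \<delta>\<^sup>2) has_derivative (\<lambda>h. - ((2 *\<^sub>R (x - y)) \<bullet> h / \<delta>\<^sup>2))) (at x)"
    using has_derivative_diff[OF has_derivative_const has_derivative_divide'[OF dist_sq_derivative[of x y]]] d
    by (intro has_derivative_eq_rhs[OF has_derivative_diff[OF has_derivative_const
          bounded_linear.has_derivative[OF bounded_linear_divide dist_sq_derivative]]]) simp
  from bounded_linear.has_derivative[OF bounded_linear_divide pos_square_has_derivative[OF this], of ?N]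
  show "((\<lambda>x. moll \<delta> x y) has_derivative (\<lambda>h. dmoll \<delta> x y \<bullet> h)) (at x)"
    unfolding moll_def mbump_def dmoll_def by (rule has_derivative_eq_rhs) (simp add: fun_eq_iff)
next
  show "continuous_on UNIV (\<lambda>z. moll \<delta> (fst z) (snd z :: 'a))"
    unfolding moll_def mbump_def using d mnorm_pos[OF d, where 'a = 'a] by (auto intro!: continuous_intros)
  show "continuous_on UNIV (\<lambda>z. dmoll \<delta> (fst z) (snd z :: 'a))"
    unfolding dmoll_def using d mnorm_pos[OF d, where 'a = 'a] by (auto intro!: continuous_intros)
qed

text \<open>With the mollifier itself as test function, the weak gradient identity says that
  mollification commutes with the gradient. The minus sign comes from differentiating in the second
  variable.\<close>

lemma moll_test_fun:
  assumes d: "\<delta> > 0" and x: "cball x \<delta> \<subseteq> \<Omega>"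
  shows "test_fun \<Omega> (moll \<delta> x) (\<lambda>y. - dmoll \<delta> x y)"
proof -
  interpret smooth_kernel "moll \<delta>" "dmoll \<delta> :: 'a \<Rightarrow> _" by (rule moll_kernel[OF d])
  have eq: "moll \<delta> x = (\<lambda>y. moll \<delta> y x)" "(\<lambda>y. - dmoll \<delta> x y) = (\<lambda>y. dmoll \<delta> y x)"
    using moll_commute[of \<delta> x] dmoll_commute[of \<delta> x] by auto
  have "{y. moll \<delta> x y \<noteq> 0} \<subseteq> cball x \<delta>"
    using moll_outside[OF d, of x] by (auto simp: dist_norm intro: ccontr)
  then have cl: "closure {y. moll \<delta> x y \<noteq> 0} \<subseteq> cball x \<delta>" by (intro closure_minimal) auto
  show ?thesis unfolding test_fun_def
  proof (intro conjI allI)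
    show "continuous_on UNIV (\<lambda>y. - dmoll \<delta> x y)" by (intro continuous_intros kernel_continuous)
    show "(moll \<delta> x has_derivative (\<lambda>h. - dmoll \<delta> x y \<bullet> h)) (at y)" for y
      using der[of x y] eq(2) unfolding eq(1) by (metis (no_types, lifting))
    show "compact (closure {y. moll \<delta> x y \<noteq> 0})"
      using compact_Int_closed[OF compact_cball closed_closure] cl by (metis inf.absorb_iff2)
    show "closure {y. moll \<delta> x y \<noteq> 0} \<subseteq> \<Omega>" using cl x by blast
  qed
qed

lemma norm_sum_square_le: "(norm (a + b))\<^sup>2 \<le> 2 * (norm a)\<^sup>2 + 2 * (norm (b::'b::real_inner))\<^sup>2"
proof -
  have "(norm (a + b))\<^sup>2 + (norm (a - b))\<^sup>2 = 2 * (norm a)\<^sup>2 + 2 * (norm b)\<^sup>2" 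
    by (simp add: power2_norm_eq_inner inner_add inner_diff)
  then show ?thesis using zero_le_power2[of "norm (a - b)"] by linarith
qed

text \<open>Truncate G at a high level, take continuous functions converging almost everywhere to
  the truncation, and project their values onto the ball of that radius, so that dominated
  convergence applies.\<close>

lemma square_integrable_approx_continuous:
  fixes G :: "'a::euclidean_space \<Rightarrow> 'b::euclidean_space"
  assumes G[measurable]: "G \<in> borel_measurable borel" and i: "integrable lborel (\<lambda>x. (norm (G x))\<^sup>2)"
    and S[measurable]: "S \<in> sets borel" and bS: "bounded S" and z: "\<And>x. x \<notin> S \<Longrightarrow> G x = 0" and e: "e > 0"
  obtains h :: "'a \<Rightarrow> 'b" where "continuous_on UNIV h" "integrable lborel (\<lambda>x. indicator S x * (norm (G x - h x))\<^sup>2)"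
    "(\<integral>x. indicator S x * (norm (G x - h x))\<^sup>2 \<partial>lborel) < e"
proof -
  define Gn where "Gn n x = (if norm (G x) \<le> real n then G x else 0)" for n x
  have Gn[measurable]: "Gn n \<in> borel_measurable borel" for n unfolding Gn_def by measurable
  have "(\<lambda>n. \<integral>x. (norm (G x - Gn n x))\<^sup>2 \<partial>lborel) \<longlonglongrightarrow> (\<integral>x. 0 \<partial>(lborel :: 'a measure))"
  proof (rule integral_dominated_convergence[OF _ _ i])
    show "AE x in lborel. (\<lambda>n. (norm (G x - Gn n x))\<^sup>2) \<longlonglongrightarrow> 0"
    proof (rule AE_I2)
      fix x
      obtain N where "norm (G x) \<le> real N" using real_arch_simple by blast
      then have "(norm (G x - Gn n x))\<^sup>2 = 0" if "n \<ge> N" for n using that by (simp add: Gn_def)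
      then show "(\<lambda>n. (norm (G x - Gn n x))\<^sup>2) \<longlonglongrightarrow> 0"
        by (intro tendsto_eventually) (auto simp: eventually_sequentially)
    qed
  qed (auto simp: Gn_def)
  then have "\<forall>\<^sub>F n in sequentially. (\<integral>x. (norm (G x - Gn n x))\<^sup>2 \<partial>lborel) < e / 4"
    using e by (intro order_tendstoD(2)) auto
  then obtain n where n: "(\<integral>x. (norm (G x - Gn n x))\<^sup>2 \<partial>lborel) < e / 4"
    using eventually_happens'[OF sequentially_bot] by blast
  have i1: "integrable lborel (\<lambda>x. (norm (G x - Gn n x))\<^sup>2)"
    by (rule Bochner_Integration.integrable_bound[OF i]) (auto simp: Gn_def)
  have "G \<in> borel_measurable lebesgue" by (intro measurable_completion) simp
  then have "Gn n \<in> borel_measurable lebesgue" by (intro measurable_completion) simp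
  then have "Gn n measurable_on UNIV" by (intro lebesgue_measurable_imp_measurable_on) auto
  then obtain N g where N: "negligible N" "\<And>k. continuous_on UNIV (g k)" "\<And>x. x \<notin> N \<Longrightarrow> (\<lambda>k. g k x) \<longlonglongrightarrow> Gn n x"
    unfolding measurable_on_def by auto
  define p where "p = closest_point (cball (0::'b) (real n))"
  have pc: "continuous_on UNIV p" unfolding p_def by (intro continuous_on_closest_point) auto
  have pb: "norm (p x) \<le> real n" for x
    using closest_point_in_set[of "cball (0::'b) (real n)" x] unfolding p_def by auto
  have pG: "p (Gn n x) = Gn n x" for x unfolding p_def by (rule closest_point_self) (simp add: Gn_def)
  have c: "continuous_on UNIV (\<lambda>x. p (g k x))" for k
    by (rule continuous_on_compose2[OF pc N(2)]) simp
  then have [measurable]: "(\<lambda>x. p (g k x)) \<in> borel_measurable borel" for k by (rule borel_measurable_continuous_onI)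
  have AEN: "AE x in lborel. x \<notin> N"
  proof -
    have "AE x in lebesgue. x \<notin> N" using N(1) by (intro AE_not_in) (simp add: negligible_iff_null_sets)
    then show ?thesis by (simp add: AE_completion_iff)
  qed
  have iS: "integrable lborel (indicator S :: 'a \<Rightarrow> real)"
    by (intro integrable_real_indicator emeasure_bounded_finite[OF bS]) simp
  have bd: "indicator S x * (norm (Gn n x - p (g k x)))\<^sup>2 \<le> (2 * real n)\<^sup>2 * indicator S x" for x k
  proof -
    have "norm (Gn n x - p (g k x)) \<le> real n + real n"
      by (intro order_trans[OF norm_triangle_ineq4] add_mono pb) (simp add: Gn_def)
    then have "(norm (Gn n x - p (g k x)))\<^sup>2 \<le> (2 * real n)\<^sup>2" by (intro power_mono) auto
    then show ?thesis by (simp add: indicator_def)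
  qed
  have "(\<lambda>k. \<integral>x. indicator S x * (norm (Gn n x - p (g k x)))\<^sup>2 \<partial>lborel) \<longlonglongrightarrow> (\<integral>x. 0 \<partial>(lborel :: 'a measure))"
  proof (rule integral_dominated_convergence[where w = "\<lambda>x. (2 * real n)\<^sup>2 * indicator S x"])
    show "AE x in lborel. (\<lambda>k. indicator S x * (norm (Gn n x - p (g k x)))\<^sup>2) \<longlonglongrightarrow> 0"
      using AEN
    proof eventually_elim
      case (elim x)
      have "(\<lambda>k. p (g k x)) \<longlonglongrightarrow> p (Gn n x)"
        using continuous_on_tendsto_compose[OF pc N(3)[OF elim]] by simp
      then have "(\<lambda>k. indicator S x * (norm (Gn n x - p (g k x)))\<^sup>2) \<longlonglongrightarrow> indicator S x * (norm (Gn n x - Gn n x))\<^sup>2"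
        unfolding pG by (intro tendsto_intros)
      then show ?case by simp
    qed
  qed (use iS bd in auto)
  then have "\<forall>\<^sub>F k in sequentially. (\<integral>x. indicator S x * (norm (Gn n x - p (g k x)))\<^sup>2 \<partial>lborel) < e / 4"
    using e by (intro order_tendstoD(2)) auto
  then obtain k where k: "(\<integral>x. indicator S x * (norm (Gn n x - p (g k x)))\<^sup>2 \<partial>lborel) < e / 4"
    using eventually_happens'[OF sequentially_bot] by blast
  have i2: "integrable lborel (\<lambda>x. indicator S x * (norm (Gn n x - p (g k x)))\<^sup>2)"
    by (rule Bochner_Integration.integrable_bound[OF integrable_mult_right[OF iS, of "(2 * real n)\<^sup>2"]])
      (use bd[of _ k] in \<open>auto intro: order_trans\<close>)
  let ?w = "\<lambda>x. 2 * (norm (G x - Gn n x))\<^sup>2 + 2 * (indicator S x * (norm (Gn n x - p (g k x)))\<^sup>2)"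
  have w: "indicator S x * (norm (G x - p (g k x)))\<^sup>2 \<le> ?w x" for x
    using norm_sum_square_le[of "G x - Gn n x" "Gn n x - p (g k x)"] by (simp add: indicator_def)
  have iw: "integrable lborel ?w" using i1 i2 by auto
  have i3: "integrable lborel (\<lambda>x. indicator S x * (norm (G x - p (g k x)))\<^sup>2)"
    by (rule Bochner_Integration.integrable_bound[OF iw]) (use w in \<open>auto intro: order_trans\<close>)
  have "(\<integral>x. indicator S x * (norm (G x - p (g k x)))\<^sup>2 \<partial>lborel) \<le> (\<integral>x. ?w x \<partial>lborel)"
    by (rule integral_mono[OF i3 iw w])
  also have "\<dots> = 2 * (\<integral>x. (norm (G x - Gn n x))\<^sup>2 \<partial>lborel) + 2 * (\<integral>x. indicator S x * (norm (Gn n x - p (g k x)))\<^sup>2 \<partial>lborel)"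
    using i1 i2 by simp
  also have "\<dots> < e" using n k by simp
  finally show thesis using that[OF c i3] by blast
qed

text \<open>This is the nonnegativity of the variance of F under the probability weight w.\<close>

lemma integral_Jensen_square:
  fixes F :: "'a \<Rightarrow> 'b::euclidean_space" and w :: "'a \<Rightarrow> real"
  assumes w: "\<And>y. 0 \<le> w y" "integrable M w" "(\<integral>y. w y \<partial>M) = 1"
    and F: "integrable M (\<lambda>y. w y *\<^sub>R F y)" "integrable M (\<lambda>y. w y * (norm (F y))\<^sup>2)"
  shows "(norm (\<integral>y. w y *\<^sub>R F y \<partial>M))\<^sup>2 \<le> (\<integral>y. w y * (norm (F y))\<^sup>2 \<partial>M)"
proof -
  define m where "m = (\<integral>y. w y *\<^sub>R F y \<partial>M)"
  have eq: "w y * (norm (F y - m))\<^sup>2 = w y * (norm (F y))\<^sup>2 - 2 * ((w y *\<^sub>R F y) \<bullet> m) + (norm m)\<^sup>2 * w y" for y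
    by (simp add: power2_norm_eq_inner inner_diff inner_commute algebra_simps)
  have "0 \<le> (\<integral>y. w y * (norm (F y - m))\<^sup>2 \<partial>M)" by (intro integral_nonneg_AE AE_I2) (simp add: w)
  also have "\<dots> = (\<integral>y. w y * (norm (F y))\<^sup>2 \<partial>M) - 2 * (m \<bullet> m) + (norm m)\<^sup>2"
  proof -
    have "(\<integral>y. (w y *\<^sub>R F y) \<bullet> m \<partial>M) = m \<bullet> m" unfolding m_def by (rule integral_inner_left) (rule F(1))
    moreover have "integrable M (\<lambda>y. (w y *\<^sub>R F y) \<bullet> m)" by (rule integrable_inner_left) (rule F(1))
    ultimately show ?thesis unfolding eq using F w by (simp del: inner_scaleR_left)
  qed
  finally show ?thesis by (simp add: m_def[symmetric] power2_norm_eq_inner)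
qed

lemma moll_fubini:
  fixes D :: "'a::euclidean_space \<Rightarrow> real"
  assumes d: "\<delta> > 0" and D: "integrable lborel D" "\<And>y. D y \<ge> 0" "D \<in> borel_measurable borel"
  shows "integrable lborel (\<lambda>x. \<integral>y. moll \<delta> x y * D y \<partial>lborel)"
    "(\<integral>x. (\<integral>y. moll \<delta> x y * D y \<partial>lborel) \<partial>lborel) = (\<integral>y. D y \<partial>lborel)"
proof -
  interpret smooth_kernel "moll \<delta>" "dmoll \<delta> :: 'a \<Rightarrow> _" by (rule moll_kernel[OF d])
  have eq: "(\<lambda>x. moll \<delta> x y) = moll \<delta> y" for y :: 'a using moll_commute[of \<delta> _ y] by auto
  have I1: "integrable lborel (\<lambda>x. moll \<delta> x y)" "(\<integral>x. moll \<delta> x y \<partial>lborel) = 1" for y :: 'a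
    unfolding eq by (rule moll_integral[OF d])+
  have fs: "fst \<in> borel_measurable (borel :: ('a \<times> 'a) measure)"
    by (intro borel_measurable_continuous_onI continuous_intros)
  have c: "continuous_on UNIV (\<lambda>z::'a\<times>'a. moll \<delta> (snd z) (fst z))"
  proof -
    have "continuous_on UNIV (\<lambda>z::'a\<times>'a. (snd z, fst z))"
      by (intro continuous_on_Pair continuous_on_fst continuous_on_snd continuous_on_id)
    from continuous_on_compose2[OF cont this] show ?thesis by simp
  qed
  have "integrable (lborel \<Otimes>\<^sub>M lborel) (\<lambda>z::'a\<times>'a. moll \<delta> (snd z) (fst z) * D (fst z))"
  proof (rule lborel_pair.Fubini_integrable)
    show "(\<lambda>z::'a\<times>'a. moll \<delta> (snd z) (fst z) * D (fst z)) \<in> borel_measurable (lborel \<Otimes>\<^sub>M lborel)"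
      unfolding lborel_prod measurable_lborel2
      by (intro borel_measurable_times borel_measurable_continuous_onI[OF c] measurable_compose[OF fs D(3)])
    have "norm (moll \<delta> x y * D y) = moll \<delta> x y * D y" for x y
      using moll_nonneg[OF d, of x y] D(2)[of y] by simp
    then have "(\<integral>x. norm (moll \<delta> x y * D y) \<partial>lborel) = D y" for y
      using I1[of y] by simp
    then show "integrable lborel (\<lambda>y. \<integral>x. norm (moll \<delta> (snd (y, x)) (fst (y, x)) * D (fst (y, x))) \<partial>lborel)"
      using D(1) by simp
    show "AE y in lborel. integrable lborel (\<lambda>x. moll \<delta> (snd (y, x)) (fst (y, x)) * D (fst (y, x)))"
      using I1 by simp
  qed
  then have I: "integrable (lborel \<Otimes>\<^sub>M lborel) (\<lambda>(y, x). moll \<delta> x y * D y)"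
    by (simp add: case_prod_beta')
  show "integrable lborel (\<lambda>x. \<integral>y. moll \<delta> x y * D y \<partial>lborel)"
    using lborel_pair.integrable_snd[OF I] by simp
  show "(\<integral>x. (\<integral>y. moll \<delta> x y * D y \<partial>lborel) \<partial>lborel) = (\<integral>y. D y \<partial>lborel)"
    using lborel_pair.Fubini_integral[OF I] I1 by simp
qed

text \<open>Split G into a continuous part and a remainder that is small in L^2. Jensen and Fubini
  keep the mollified remainder small, and the continuous part moves little because it is uniformly
  continuous on a compact ball.\<close>

lemma mollify_L2:
  fixes G :: "'a::euclidean_space \<Rightarrow> 'b::euclidean_space"
  assumes G[measurable]: "G \<in> borel_measurable borel" and i: "integrable lborel (\<lambda>x. (norm (G x))\<^sup>2)"
    and r: "\<And>x. x \<notin> cball 0 r \<Longrightarrow> G x = 0" and e: "e > 0"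
  obtains d where "d > 0"
    "\<And>\<delta>. 0 < \<delta> \<Longrightarrow> \<delta> < d \<Longrightarrow> integrable lborel (\<lambda>x. indicator (cball 0 r) x * (norm ((\<integral>y. moll \<delta> x y *\<^sub>R G y \<partial>lborel) - G x))\<^sup>2)"
    "\<And>\<delta>. 0 < \<delta> \<Longrightarrow> \<delta> < d \<Longrightarrow> (\<integral>x. indicator (cball 0 r) x * (norm ((\<integral>y. moll \<delta> x y *\<^sub>R G y \<partial>lborel) - G x))\<^sup>2 \<partial>lborel) < e"
proof -
  \<comment> \<open>Mollification at a point of the ball of radius r looks less than 1 beyond it,
    hence the larger ball for h.\<close>
  let ?K = "cball (0::'a) r" and ?S = "cball (0::'a) (r + 1)"
  define V where "V = measure lborel ?K + 1"
  have V: "V > 0" by (simp add: V_def add_nonneg_pos)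
  have zS: "G x = 0" if "x \<notin> ?S" for x using r[of x] that by auto
  \<comment> \<open>Squaring a sum of three terms costs a factor 3, and three contributions share e:
    hence \<open>e / 9\<close>.\<close>
  obtain h where h: "continuous_on UNIV h" "integrable lborel (\<lambda>x. indicator ?S x * (norm (G x - h x))\<^sup>2)"
    "(\<integral>x. indicator ?S x * (norm (G x - h x))\<^sup>2 \<partial>lborel) < e / 9"
    by (rule square_integrable_approx_continuous[OF G i, of ?S "e / 9"]) (use zS e in auto)
  define D where "D x = indicator ?S x * (norm (G x - h x))\<^sup>2" for x
  have [measurable]: "h \<in> borel_measurable borel" using h(1) by (rule borel_measurable_continuous_onI)
  have [measurable]: "?S \<in> sets borel" "?K \<in> sets borel" by auto
  have Dm[measurable]: "D \<in> borel_measurable borel" unfolding D_def by measurable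
  have D: "integrable lborel D" "\<And>y. D y \<ge> 0" "(\<integral>x. D x \<partial>lborel) < e / 9"
    using h unfolding D_def by auto
  define s where "s = sqrt (e / (9 * V))"
  have s: "s > 0" "s\<^sup>2 * V = e / 9" using e V by (auto simp: s_def)
  have "uniformly_continuous_on ?S h"
    by (rule compact_uniformly_continuous[OF continuous_on_subset[OF h(1)]]) auto
  then obtain d where d: "d > 0" "\<And>x y. x \<in> ?S \<Longrightarrow> y \<in> ?S \<Longrightarrow> dist y x < d \<Longrightarrow> dist (h y) (h x) < s"
    unfolding uniformly_continuous_on_def using s(1) by meson
  show thesis
  proof (rule that[of "min d 1"])
    show "min d 1 > 0" using d by simp
    fix \<delta> assume \<delta>: "0 < \<delta>" "\<delta> < min d 1"
    interpret smooth_kernel "moll \<delta>" "dmoll \<delta> :: 'a \<Rightarrow> _" by (rule moll_kernel[OF \<delta>(1)])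
    let ?T = "\<lambda>x. \<integral>y. moll \<delta> x y *\<^sub>R G y \<partial>lborel"
    let ?B = "\<lambda>x. \<integral>y. moll \<delta> x y * D y \<partial>lborel"
    note B = moll_fubini[OF \<delta>(1) D(1,2) Dm]
    have mb: "moll \<delta> x y \<le> 1 / mnorm TYPE('a) \<delta>" for x y :: 'a
      unfolding moll_def using mnorm_pos[OF \<delta>(1), where 'a = 'a] mbump_le_1 by (intro divide_right_mono) auto
    have bnd: "integrable lborel (\<lambda>y. moll \<delta> x y *\<^sub>R F y)" if F: "integrable lborel F" for F :: "'a \<Rightarrow> 'c::euclidean_space" and x
    proof (rule Bochner_Integration.integrable_bound[OF integrable_mult_right[OF integrable_norm[OF F], of "1 / mnorm TYPE('a) \<delta>"]])
      show "(\<lambda>y. moll \<delta> x y *\<^sub>R F y) \<in> borel_measurable lborel" using borel_measurable_integrable[OF F] by measurable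
      show "AE y in lborel. norm (moll \<delta> x y *\<^sub>R F y) \<le> norm (1 / mnorm TYPE('a) \<delta> * norm (F y))"
        using mult_right_mono[OF mb norm_ge_zero] moll_nonneg[OF \<delta>(1), of x] mnorm_pos[OF \<delta>(1), where 'a = 'a]
        by (intro AE_I2) (simp add: abs_mult)
    qed
    have iS: "integrable lborel (indicator ?S :: 'a \<Rightarrow> real)"
      by (intro integrable_real_indicator emeasure_bounded_finite[OF bounded_cball]) simp
    have L1: "integrable lborel F" if "F \<in> borel_measurable borel" "integrable lborel (\<lambda>x. (norm (F x))\<^sup>2)" "\<And>x. x \<notin> ?S \<Longrightarrow> F x = 0"
      for F :: "'a \<Rightarrow> 'b"
    proof (rule Bochner_Integration.integrable_bound[OF Bochner_Integration.integrable_add[OF iS that(2)]])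
      have "norm (F x) \<le> 1 + (norm (F x))\<^sup>2" for x
        using sum_squares_bound[of "norm (F x)" 1, simplified] norm_ge_zero[of "F x"] by linarith
      then show "AE x in lborel. norm (F x) \<le> norm (indicator ?S x + (norm (F x))\<^sup>2)"
        using that(3) by (intro AE_I2) (auto simp: indicator_def)
    qed (use that(1) in simp)
    have iG: "integrable lborel G" by (rule L1[OF G i zS])
    define Q where "Q x = indicator ?S x *\<^sub>R (G x - h x)" for x
    have Qm[measurable]: "Q \<in> borel_measurable borel" unfolding Q_def by measurable
    have Q2: "(norm (Q x))\<^sup>2 = D x" for x by (simp add: Q_def D_def power_mult_distrib indicator_def)
    have iQ: "integrable lborel Q" by (rule L1) (use Q2 D(1) in \<open>auto simp: Q_def\<close>)
    define H where "H x = indicator ?S x *\<^sub>R h x" for x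
    have H: "H x = G x - Q x" for x using zS[of x] by (simp add: H_def Q_def indicator_def)
    have iH: "integrable lborel H" unfolding H[abs_def] using iG iQ by auto
    have pt: "(norm (?T x - G x))\<^sup>2 \<le> 3 * ?B x + 3 * s\<^sup>2 + 3 * D x" if x: "x \<in> ?K" for x
    proof -
      have xS: "x \<in> ?S" using x by auto
      have T: "?T x - G x = (\<integral>y. moll \<delta> x y *\<^sub>R Q y \<partial>lborel) + (\<integral>y. moll \<delta> x y *\<^sub>R (H y - h x) \<partial>lborel) - Q x"
      proof -
        have "(\<integral>y. moll \<delta> x y *\<^sub>R (H y - h x) \<partial>lborel) = (\<integral>y. moll \<delta> x y *\<^sub>R H y \<partial>lborel) - h x"
          using bnd[OF iH, of x] moll_integral[OF \<delta>(1), of x] by (simp add: scaleR_diff_right)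
        moreover have "?T x = (\<integral>y. moll \<delta> x y *\<^sub>R Q y \<partial>lborel) + (\<integral>y. moll \<delta> x y *\<^sub>R H y \<partial>lborel)"
          using bnd[OF iH, of x] bnd[OF iQ, of x] by (simp add: H scaleR_diff_right flip: Bochner_Integration.integral_add)
        moreover have "Q x = G x - h x" using xS by (simp add: Q_def)
        ultimately show ?thesis by simp
      qed
      have 1: "(norm (\<integral>y. moll \<delta> x y *\<^sub>R Q y \<partial>lborel))\<^sup>2 \<le> ?B x"
        using integral_Jensen_square[OF moll_nonneg[OF \<delta>(1)] moll_integral[OF \<delta>(1), of x] bnd[OF iQ, of x]] bnd[OF D(1), of x]
        by (simp add: Q2)
      have "norm (\<integral>y. moll \<delta> x y *\<^sub>R (H y - h x) \<partial>lborel) \<le> (\<integral>y. moll \<delta> x y * s \<partial>lborel)"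
      proof (rule Bochner_Integration.integral_norm_bound_integral)
        show "integrable lborel (\<lambda>y. moll \<delta> x y *\<^sub>R (H y - h x))"
          using bnd[OF iH, of x] moll_integral[OF \<delta>(1), of x] by (simp add: scaleR_diff_right)
        show "norm (moll \<delta> x y *\<^sub>R (H y - h x)) \<le> moll \<delta> x y * s" for y
        proof (cases "norm (x - y) < \<delta>")
          case True
          have "norm y \<le> norm x + norm (x - y)" by (metis add.commute norm_triangle_sub norm_minus_commute)
          then have "y \<in> ?S" using x True \<delta> by auto
          then have "norm (H y - h x) < s"
            using d(2)[OF xS, of y] True \<delta> by (simp add: H_def dist_norm norm_minus_commute)
          then show ?thesis using moll_nonneg[OF \<delta>(1), of x y] by (simp add: mult_left_mono)
        qed (simp add: moll_outside[OF \<delta>(1)])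
      qed (use moll_integral[OF \<delta>(1), of x] in auto)
      then have "norm (\<integral>y. moll \<delta> x y *\<^sub>R (H y - h x) \<partial>lborel) \<le> s" using moll_integral(2)[OF \<delta>(1), of x] by simp
      then have 2: "(norm (\<integral>y. moll \<delta> x y *\<^sub>R (H y - h x) \<partial>lborel))\<^sup>2 \<le> s\<^sup>2" by (intro power_mono) auto
      have tri: "(norm (a + b - c))\<^sup>2 \<le> 3 * (norm a)\<^sup>2 + 3 * (norm b)\<^sup>2 + 3 * (norm c)\<^sup>2" for a b c :: 'b
      proof -
        have "3 * (norm a)\<^sup>2 + 3 * (norm b)\<^sup>2 + 3 * (norm c)\<^sup>2 - (norm (a + b - c))\<^sup>2
            = (norm (a - b))\<^sup>2 + (norm (a + c))\<^sup>2 + (norm (b + c))\<^sup>2"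
          by (simp add: power2_norm_eq_inner inner_diff inner_add inner_commute)
        then show ?thesis
          using zero_le_power2[of "norm (a - b)"] zero_le_power2[of "norm (a + c)"] zero_le_power2[of "norm (b + c)"]
          by linarith
      qed
      show ?thesis unfolding T using tri[of "\<integral>y. moll \<delta> x y *\<^sub>R Q y \<partial>lborel" "\<integral>y. moll \<delta> x y *\<^sub>R (H y - h x) \<partial>lborel" "Q x"] 1 2
        by (simp add: Q2)
    qed
    have iK: "integrable lborel (indicator ?K :: 'a \<Rightarrow> real)"
      by (intro integrable_real_indicator emeasure_bounded_finite[OF bounded_cball]) simp
    let ?w = "\<lambda>x. 3 * ?B x + 3 * s\<^sup>2 * indicator ?K x + 3 * D x"
    have B0: "?B x \<ge> 0" for x by (intro integral_nonneg_AE AE_I2) (simp add: moll_nonneg[OF \<delta>(1)] D(2))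
    have iw: "integrable lborel ?w" using B(1) iK D(1) by auto
    have w: "indicator ?K x * (norm (?T x - G x))\<^sup>2 \<le> ?w x" for x
      using pt[of x] B0[of x] D(2)[of x] by (cases "x \<in> ?K") auto
    have Tm: "?T \<in> borel_measurable borel"
    proof -
      have fs: "snd \<in> borel_measurable (borel :: ('a \<times> 'a) measure)"
        by (intro borel_measurable_continuous_onI continuous_intros)
      have "(\<lambda>z::'a\<times>'a. moll \<delta> (fst z) (snd z) *\<^sub>R G (snd z)) \<in> borel_measurable borel"
        by (intro borel_measurable_scaleR borel_measurable_continuous_onI[OF cont] measurable_compose[OF fs G])
      moreover have "sets (borel \<Otimes>\<^sub>M lborel :: ('a \<times> 'a) measure) = sets borel"
        unfolding borel_prod[symmetric] by (rule sets_pair_measure_cong) simp_all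
      ultimately have "(\<lambda>(x, y). moll \<delta> x y *\<^sub>R G y) \<in> borel_measurable (borel \<Otimes>\<^sub>M lborel)"
        unfolding case_prod_beta' by (subst measurable_cong_sets[OF _ refl])
      then show ?thesis by (rule lborel.borel_measurable_lebesgue_integral)
    qed
    show iT: "integrable lborel (\<lambda>x. indicator ?K x * (norm (?T x - G x))\<^sup>2)"
    proof (rule Bochner_Integration.integrable_bound[OF iw])
      show "(\<lambda>x. indicator ?K x * (norm (?T x - G x))\<^sup>2) \<in> borel_measurable lborel" using Tm by measurable
      show "AE x in lborel. norm (indicator ?K x * (norm (?T x - G x))\<^sup>2) \<le> norm (?w x)"
        by (intro AE_I2) (simp add: order_trans[OF w abs_ge_self])
    qed
    have "(\<integral>x. indicator ?K x * (norm (?T x - G x))\<^sup>2 \<partial>lborel) \<le> (\<integral>x. ?w x \<partial>lborel)"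
      by (rule integral_mono[OF iT iw w])
    also have "\<dots> = 3 * (\<integral>x. D x \<partial>lborel) + 3 * s\<^sup>2 * measure lborel ?K + 3 * (\<integral>x. D x \<partial>lborel)"
      using B iK D(1) by simp
    also have "\<dots> < e"
    proof -
      have "s\<^sup>2 * measure lborel ?K \<le> s\<^sup>2 * V" by (intro mult_left_mono) (auto simp: V_def)
      then show ?thesis using D(3) s(2) by linarith
    qed
    finally show "(\<integral>x. indicator ?K x * (norm (?T x - G x))\<^sup>2 \<partial>lborel) < e" .
  qed
qed

section \<open>The energy maximum principle\<close>

lemma (in smooth_kernel) kernel_grad_continuous:
  fixes f :: "'a \<Rightarrow> real"
  assumes f: "f \<in> borel_measurable borel" "\<And>y. \<bar>f y\<bar> \<le> M" "\<And>y. y \<notin> K \<Longrightarrow> f y = 0" and K: "compact K"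
  shows "continuous_on UNIV (\<lambda>x. \<integral>y. f y *\<^sub>R dk x y \<partial>lborel)"
  unfolding continuous_on_iff
proof (intro ballI allI impI)
  fix x :: 'a and e :: real assume e: "e > 0"
  define V where "V = M * measure lborel K + 1"
  have M: "M \<ge> 0" using f(2)[of undefined] by linarith
  have V: "V > 0" using M by (simp add: V_def add_nonneg_pos)
  obtain d where d: "d > 0" "\<And>z z' y. z \<in> cball x 1 \<Longrightarrow> z' \<in> cball x 1 \<Longrightarrow> y \<in> K \<Longrightarrow> norm (z - z') < d \<Longrightarrow>
      norm (dk z y - dk z' y) < e / V"
    using kernel_modulus[OF compact_cball K, of "e / V"] e V by (metis divide_pos_pos)
  show "\<exists>d>0. \<forall>x'\<in>UNIV. dist x' x < d \<longrightarrow> dist (\<integral>y. f y *\<^sub>R dk x' y \<partial>lborel) (\<integral>y. f y *\<^sub>R dk x y \<partial>lborel) < e"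
  proof (intro exI[of _ "min d 1"] conjI ballI impI)
    fix x' assume x': "dist x' x < min d 1"
    have "norm ((\<integral>y. f y *\<^sub>R dk x' y \<partial>lborel) - (\<integral>y. f y *\<^sub>R dk x y \<partial>lborel)) \<le> e / V * (M * measure lborel K)"
      by (rule kernel_grad_diff[OF f K]) (use d(2)[of x' x] x' in \<open>auto simp: dist_norm norm_minus_commute intro: less_imp_le\<close>)
    also have "\<dots> < e / V * V" using e V by (intro mult_strict_left_mono) (auto simp: V_def)
    finally show "dist (\<integral>y. f y *\<^sub>R dk x' y \<partial>lborel) (\<integral>y. f y *\<^sub>R dk x y \<partial>lborel) < e"
      using V by (simp add: dist_norm)
  qed (use d in simp)
qed

text \<open>The Borel counterpart of \<open>H1_weak_grad\<close>. The integrals against test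
  functions run over the whole space, since test functions vanish outside \<Omega>.\<close>

definition weak_grad :: "'a::euclidean_space set \<Rightarrow> ('a \<Rightarrow> real) \<Rightarrow> ('a \<Rightarrow> 'a) \<Rightarrow> bool" where
  "weak_grad \<Omega> u g \<longleftrightarrow> u \<in> borel_measurable borel \<and> g \<in> borel_measurable borel \<and>
     integrable lborel (\<lambda>x. indicator \<Omega> x * (u x)\<^sup>2) \<and> integrable lborel (\<lambda>x. indicator \<Omega> x * (norm (g x))\<^sup>2) \<and>
     (\<forall>\<psi> d\<psi>. test_fun \<Omega> \<psi> d\<psi> \<longrightarrow> (\<forall>i\<in>Basis. (\<integral>x. u x * (d\<psi> x \<bullet> i) \<partial>lborel) = - (\<integral>x. (g x \<bullet> i) * \<psi> x \<partial>lborel)))"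

definition wform :: "('a::euclidean_space \<Rightarrow> 'a) \<Rightarrow> real \<Rightarrow> ('a \<Rightarrow> real) \<Rightarrow> ('a \<Rightarrow> 'a) \<Rightarrow> ('a \<Rightarrow> real) \<Rightarrow> ('a \<Rightarrow> 'a) \<Rightarrow> real" where
  "wform v c u g \<psi> d\<psi> = (\<integral>x. g x \<bullet> d\<psi> x + (v x \<bullet> g x) * \<psi> x + c * u x * \<psi> x \<partial>lborel)"

text \<open>Testing with \<open>w\<^sup>2\<close>, where \<open>w\<close> approximates the positive part of \<open>z - k\<close> for a level \<open>k > 0\<close>,
  gives in the limit at least the integral of
  \<open>2 w |g|\<^sup>2 + (v \<bullet> g) w\<^sup>2 + c w\<^sup>3\<close>, which is positive for \<open>w > 0\<close> as soon as \<open>c > \<tau>\<^sup>2 / 8\<close>.\<close>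

lemma energy_max_principle:
  fixes z :: "'a::euclidean_space \<Rightarrow> real" and g v :: "'a \<Rightarrow> 'a"
  assumes \<Omega>: "open \<Omega>" "bounded \<Omega>"
    and v: "v \<in> borel_measurable borel" "\<And>x. norm (v x) \<le> \<tau>" and c: "c > \<tau>\<^sup>2 / 8"
    and zg: "weak_grad \<Omega> z g" and cont: "continuous_on (closure \<Omega>) z"
    and bd: "\<And>x. x \<in> frontier \<Omega> \<Longrightarrow> z x \<le> 0"
    and sub: "\<And>\<psi> d\<psi>. test_fun \<Omega> \<psi> d\<psi> \<Longrightarrow> (\<And>x. 0 \<le> \<psi> x) \<Longrightarrow> wform v c z g \<psi> d\<psi> \<le> 0"
    and x: "x \<in> closure \<Omega>"
  shows "z x \<le> 0"
proof (rule ccontr)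
  assume neg: "\<not> z x \<le> 0"
  have x\<Omega>: "x \<in> \<Omega>" using x bd[of x] neg \<Omega>(1) by (auto simp: frontier_def interior_open)
  note [measurable] = v(1)
  have zm[measurable]: "z \<in> borel_measurable borel" and gm[measurable]: "g \<in> borel_measurable borel"
    and g2: "integrable lborel (\<lambda>x. indicator \<Omega> x * (norm (g x))\<^sup>2)"
    and wg: "\<And>\<psi> d\<psi> i. test_fun \<Omega> \<psi> d\<psi> \<Longrightarrow> i \<in> Basis \<Longrightarrow> (\<integral>x. z x * (d\<psi> x \<bullet> i) \<partial>lborel) = - (\<integral>x. (g x \<bullet> i) * \<psi> x \<partial>lborel)"
    using zg unfolding weak_grad_def by auto
  have \<Omega>m[measurable]: "\<Omega> \<in> sets borel" using \<Omega> by simp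
  have \<tau>: "\<tau> \<ge> 0" using order_trans[OF norm_ge_zero v(2)] .
  have c0: "c > 0" using c zero_le_power2[of \<tau>] by linarith
  \<comment> \<open>As z is at most 0 on the boundary, the set where z reaches a positive level is
    compact in \<Omega>.\<close>
  define k where "k = z x / 2"
  have k: "k > 0" "z x = 2 * k" using neg by (auto simp: k_def)
  have ccl: "compact (closure \<Omega>)" using \<Omega>(2) by simp
  obtain W where W: "W > 0" "\<And>x. x \<in> closure \<Omega> \<Longrightarrow> \<bar>z x\<bar> \<le> W"
    using compact_imp_bounded[OF compact_continuous_image[OF cont ccl]] unfolding bounded_pos by auto
  \<comment> \<open>The level \<open>k / 2\<close>, below the truncation level k, leaves room for
    mollification: farther than \<delta> from K the averaged function is at most
    \<open>k / 2\<close>.\<close>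
  define K where "K = {x \<in> closure \<Omega>. k / 2 \<le> z x}"
  have "closed K" unfolding K_def
    using continuous_closed_preimage[OF cont closed_closure, of "{k/2..}"] by (simp add: vimage_def Int_def)
  moreover have "bounded K" by (rule bounded_subset[OF bounded_closure[OF \<Omega>(2)]]) (auto simp: K_def)
  ultimately have cK: "compact K" by (simp add: compact_eq_bounded_closed)
  have K\<Omega>: "K \<subseteq> \<Omega>"
  proof
    fix y assume "y \<in> K"
    then have "y \<in> closure \<Omega>" "\<not> z y \<le> 0" using k by (auto simp: K_def)
    then show "y \<in> \<Omega>" using bd[of y] \<Omega>(1) by (auto simp: frontier_def interior_open)
  qed
  obtain e0 where e0: "e0 > 0" "(\<Union>x\<in>K. cball x e0) \<subseteq> \<Omega>"
    using compact_subset_open_imp_cball_epsilon_subset[OF cK \<Omega>(1) K\<Omega>] by metis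
  define \<delta>0 where "\<delta>0 = e0 / 2"
  have \<delta>0: "\<delta>0 > 0" using e0 by (simp add: \<delta>0_def)
  \<comment> \<open>The closed \<delta>-neighbourhood of K, written as a sum of compact sets to have
    its compactness at once.\<close>
  define S where "S \<delta> = {a + b |a b. a \<in> K \<and> b \<in> cball (0::'a) \<delta>}" for \<delta>
  have S: "y \<in> S \<delta> \<longleftrightarrow> (\<exists>a\<in>K. dist a y \<le> \<delta>)" for y \<delta>
  proof
    assume "\<exists>a\<in>K. dist a y \<le> \<delta>"
    then obtain a where "a \<in> K" "dist a y \<le> \<delta>" by blast
    then show "y \<in> S \<delta>" unfolding S_def by (intro CollectI exI[of _ a] exI[of _ "y - a"]) (auto simp: dist_norm norm_minus_commute)
  next
    assume "y \<in> S \<delta>"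
    then obtain a b where "y = a + b" "a \<in> K" "norm b \<le> \<delta>" by (auto simp: S_def)
    then show "\<exists>a\<in>K. dist a y \<le> \<delta>" by (intro bexI[of _ a]) (simp_all add: dist_norm)
  qed
  have cS: "compact (S \<delta>)" for \<delta> unfolding S_def by (intro compact_sums cK compact_cball)
  have S\<Omega>: "cball y \<delta> \<subseteq> \<Omega>" if y: "y \<in> S \<delta>0" "\<delta> \<le> \<delta>0" for y \<delta>
  proof
    fix w assume w: "w \<in> cball y \<delta>"
    obtain a where a: "a \<in> K" "dist a y \<le> \<delta>0" using y(1) unfolding S by blast
    have "dist a w \<le> dist a y + dist y w" by (rule dist_triangle)
    then have "w \<in> cball a e0" using a w y by (simp add: \<delta>0_def)
    then show "w \<in> \<Omega>" using subsetD[OF e0(2)] a(1) by (meson UN_I)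
  qed
  have S0\<Omega>: "S \<delta>0 \<subseteq> \<Omega>" 
  proof
    fix y assume "y \<in> S \<delta>0"
    from S\<Omega>[OF this order_refl] show "y \<in> \<Omega>" using \<delta>0 by auto
  qed
  have Sm[measurable]: "S \<delta>0 \<in> sets borel" using cS by (rule borel_compact)
  obtain r where r: "\<Omega> \<subseteq> cball 0 r" using \<Omega>(2) unfolding bounded_iff by (auto simp: subset_iff)
  define Z where "Z y = indicator \<Omega> y * z y" for y
  define G where "G y = indicator \<Omega> y *\<^sub>R g y" for y
  have Zm[measurable]: "Z \<in> borel_measurable borel" and Gm[measurable]: "G \<in> borel_measurable borel"
    unfolding Z_def G_def by measurable
  have Zb: "\<bar>Z y\<bar> \<le> W" for y using W closure_subset[of \<Omega>] by (auto simp: Z_def indicator_def)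
  have Z0: "Z y = 0" if "y \<notin> closure \<Omega>" for y using that closure_subset[of \<Omega>] by (auto simp: Z_def indicator_def)
  have G2: "(norm (G y))\<^sup>2 = indicator \<Omega> y * (norm (g y))\<^sup>2" for y by (simp add: G_def indicator_def)
  have iG: "integrable lborel (\<lambda>y. (norm (G y))\<^sup>2)" unfolding G2 by (rule g2)
  have G0: "G y = 0" if "y \<notin> cball 0 r" for y using that r by (auto simp: G_def indicator_def)
  have iB: "integrable lborel (indicator (cball 0 r) :: 'a \<Rightarrow> real)"
    by (intro integrable_real_indicator emeasure_bounded_finite[OF bounded_cball]) simp
  define w where "w y = max 0 (z y - k)" for y
  \<comment> \<open>The limit of the integrand of the weak form tested with \<open>w ^ 2\<close>,
    whose gradient is formally \<open>2 * w * g\<close>.\<close>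
  define I where "I y = indicator (S \<delta>0) y * (2 * w y * (norm (g y))\<^sup>2 + (v y \<bullet> g y) * (w y)\<^sup>2 + c * z y * (w y)\<^sup>2)" for y
  have Im[measurable]: "I \<in> borel_measurable borel" unfolding I_def w_def by measurable
  have wb: "0 \<le> w y" "w y \<le> W" if "y \<in> \<Omega>" for y
    using W(2)[of y] W(1) k(1) closure_subset[of \<Omega>] that by (auto simp: w_def)
  have vg: "\<bar>v y \<bullet> g y\<bar> \<le> \<tau> * (1 + (norm (g y))\<^sup>2)" for y
  proof -
    have "\<bar>v y \<bullet> g y\<bar> \<le> \<tau> * norm (g y)"
      by (rule order_trans[OF Cauchy_Schwarz_ineq2]) (intro mult_right_mono v(2) norm_ge_zero)
    also have "norm (g y) \<le> 1 + (norm (g y))\<^sup>2"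
      using sum_squares_bound[of "norm (g y)" 1, simplified] norm_ge_zero[of "g y"] by linarith
    finally show ?thesis using \<tau> by (simp add: mult_left_mono)
  qed
  have iI: "integrable lborel I"
  proof (rule Bochner_Integration.integrable_bound)
    let ?E = "\<lambda>y. (2 * W + \<tau> * W\<^sup>2) * (norm (G y))\<^sup>2 + (\<tau> * W\<^sup>2 + c * W * W\<^sup>2) * indicator (cball 0 r) y"
    show "integrable lborel ?E" using iG iB by auto
    show "AE y in lborel. norm (I y) \<le> norm (?E y)"
    proof (rule AE_I2)
      fix y
      have E0: "0 \<le> ?E y" using W \<tau> c0 by simp
      show "norm (I y) \<le> norm (?E y)"
      proof (cases "y \<in> S \<delta>0")
        case True
        then have y: "y \<in> \<Omega>" "y \<in> cball 0 r" using S0\<Omega> r by auto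
        have w2: "(w y)\<^sup>2 \<le> W\<^sup>2" using wb[OF y(1)] by (intro power_mono) auto
        have 1: "\<bar>2 * w y * (norm (g y))\<^sup>2\<bar> \<le> 2 * W * (norm (g y))\<^sup>2"
          using wb[OF y(1)] by (simp add: abs_mult mult_right_mono)
        have 2: "\<bar>(v y \<bullet> g y) * (w y)\<^sup>2\<bar> \<le> \<tau> * (1 + (norm (g y))\<^sup>2) * W\<^sup>2"
          unfolding abs_mult using vg[of y] w2 \<tau> by (intro mult_mono) auto
        have 3: "\<bar>c * z y * (w y)\<^sup>2\<bar> \<le> c * W * W\<^sup>2"
          unfolding abs_mult using W(2)[of y] closure_subset[of \<Omega>] y w2 c0 W(1) by (intro mult_mono) auto
        have "\<bar>I y\<bar> \<le> \<bar>2 * w y * (norm (g y))\<^sup>2\<bar> + \<bar>(v y \<bullet> g y) * (w y)\<^sup>2\<bar> + \<bar>c * z y * (w y)\<^sup>2\<bar>"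
          using True by (simp add: I_def)
        also have "\<dots> \<le> ?E y" using 1 2 3 y by (simp add: G2 algebra_simps)
        finally show ?thesis using E0 by simp
      qed (simp add: I_def)
    qed
  qed measurable
  \<comment> \<open>Collects the bounds for the error \<open>E\<close> below; what matters is its
    independence of s.\<close>
  define A where "A = (3 * W + 2 + 2 * \<tau> * W) * (\<integral>y. (norm (G y))\<^sup>2 \<partial>lborel)
    + (2 * \<tau> * W + 2 * c * W * W) * measure lborel (cball (0::'a) r) + W"
  have key: "(\<integral>y. I y \<partial>lborel) \<le> s * A" if s: "0 < s" "s < 1" for s
  proof -
    \<comment> \<open>The squared error is taken below \<open>s ^ 2\<close> because Young's
      inequality with weight s will divide it by s.\<close>
    obtain d1 where d1: "d1 > 0"
      "\<And>\<delta>. 0 < \<delta> \<Longrightarrow> \<delta> < d1 \<Longrightarrow> integrable lborel (\<lambda>x. indicator (cball 0 r) x * (norm ((\<integral>y. moll \<delta> x y *\<^sub>R G y \<partial>lborel) - G x))\<^sup>2)"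
      "\<And>\<delta>. 0 < \<delta> \<Longrightarrow> \<delta> < d1 \<Longrightarrow> (\<integral>x. indicator (cball 0 r) x * (norm ((\<integral>y. moll \<delta> x y *\<^sub>R G y \<partial>lborel) - G x))\<^sup>2 \<partial>lborel) < s\<^sup>2"
      by (rule mollify_L2[OF Gm iG G0, where e = "s\<^sup>2"]) (use s in auto)
    have "uniformly_continuous_on (closure \<Omega>) z" by (rule compact_uniformly_continuous[OF cont ccl])
    then obtain d2 where d2: "d2 > 0" "\<And>x y. x \<in> closure \<Omega> \<Longrightarrow> y \<in> closure \<Omega> \<Longrightarrow> dist y x < d2 \<Longrightarrow> dist (z y) (z x) < s"
      unfolding uniformly_continuous_on_def using s(1) by meson
    define \<delta> where "\<delta> = min (min d1 d2) \<delta>0 / 2"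
    have \<delta>: "0 < \<delta>" "\<delta> < d1" "\<delta> < d2" "\<delta> \<le> \<delta>0" using d1(1) d2(1) \<delta>0 by (auto simp: \<delta>_def)
    interpret smooth_kernel "moll \<delta>" "dmoll \<delta> :: 'a \<Rightarrow> _" by (rule moll_kernel[OF \<delta>(1)])
    define T where "T y = (\<integral>w. moll \<delta> y w *\<^sub>R G w \<partial>lborel)" for y
    define zd where "zd y = (\<integral>w. Z w * moll \<delta> y w \<partial>lborel)" for y
    define gd where "gd y = (\<integral>w. Z w *\<^sub>R dmoll \<delta> y w \<partial>lborel)" for y
    have ider: "(zd has_derivative (\<lambda>h. gd y \<bullet> h)) (at y)" for y
      unfolding zd_def[abs_def] gd_def by (rule kernel_derivative[OF Zm Zb Z0 ccl])
    have icont: "continuous_on UNIV gd" unfolding gd_def[abs_def] by (rule kernel_grad_continuous[OF Zm Zb Z0 ccl])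
    have zdcont: "continuous_on UNIV zd"
      using ider by (meson continuous_at_imp_continuous_on has_derivative_continuous)
    have imoll: "integrable lborel (\<lambda>w. Z w * moll \<delta> y w)" for y by (rule kernel_integrable(1)[OF Zm Zb Z0 ccl])
    have m1: "integrable lborel (moll \<delta> y)" "(\<integral>w. moll \<delta> y w \<partial>lborel) = 1" for y :: 'a
      by (rule moll_integral[OF \<delta>(1)])+
    \<comment> \<open>Centred at a point of \<open>S \<delta>0\<close>, the mollifier is a test
      function in \<Omega>, so here the gradient of the mollified function is the mollified weak
      gradient.\<close>
    have gd: "gd y = T y" if y: "y \<in> S \<delta>0" for y
    proof (rule euclidean_eqI)
      fix i :: 'a assume i: "i \<in> Basis"
      have t: "test_fun \<Omega> (moll \<delta> y) (\<lambda>w. - dmoll \<delta> y w)"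
        by (rule moll_test_fun[OF \<delta>(1) S\<Omega>[OF y \<delta>(4)]])
      have "gd y \<bullet> i = (\<integral>w. (Z w *\<^sub>R dmoll \<delta> y w) \<bullet> i \<partial>lborel)"
        unfolding gd_def by (rule integral_inner_left[symmetric]) (rule kernel_integrable(2)[OF Zm Zb Z0 ccl])
      also have "\<dots> = (\<integral>w. - (z w * (- dmoll \<delta> y w \<bullet> i)) \<partial>lborel)"
        using test_fun_zero_outside(2)[OF t] by (intro Bochner_Integration.integral_cong) (auto simp: Z_def indicator_def)
      also have "\<dots> = (\<integral>w. (g w \<bullet> i) * moll \<delta> y w \<partial>lborel)" using wg[OF t i] by simp
      also have "\<dots> = (\<integral>w. (moll \<delta> y w *\<^sub>R G w) \<bullet> i \<partial>lborel)"
        using test_fun_zero_outside(1)[OF t] by (intro Bochner_Integration.integral_cong) (auto simp: G_def indicator_def)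
      also have "\<dots> = T y \<bullet> i" unfolding T_def
      proof (rule integral_inner_left)
        have mb: "moll \<delta> y w \<le> 1 / mnorm TYPE('a) \<delta>" for w
          unfolding moll_def using mnorm_pos[OF \<delta>(1), where 'a = 'a] mbump_le_1 by (intro divide_right_mono) auto
        have N: "1 / mnorm TYPE('a) \<delta> > 0" using mnorm_pos[OF \<delta>(1), where 'a = 'a] by simp
        show "integrable lborel (\<lambda>w. moll \<delta> y w *\<^sub>R G w)"
        proof (rule Bochner_Integration.integrable_bound)
          show "integrable lborel (\<lambda>w. (1 / mnorm TYPE('a) \<delta>) * (indicator (cball 0 r) w + (norm (G w))\<^sup>2))"
            using iB iG by auto
          show "AE w in lborel. norm (moll \<delta> y w *\<^sub>R G w) \<le> norm ((1 / mnorm TYPE('a) \<delta>) * (indicator (cball 0 r) w + (norm (G w))\<^sup>2))"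
          proof (rule AE_I2)
            fix w
            have "norm (G w) \<le> 1 + (norm (G w))\<^sup>2"
              using sum_squares_bound[of "norm (G w)" 1, simplified] norm_ge_zero[of "G w"] by linarith
            then have "norm (G w) \<le> indicator (cball 0 r) w + (norm (G w))\<^sup>2"
              using G0[of w] by (cases "w \<in> cball 0 r") auto
            then have "moll \<delta> y w * norm (G w) \<le> (1 / mnorm TYPE('a) \<delta>) * (indicator (cball 0 r) w + (norm (G w))\<^sup>2)"
              using mb[of w] N by (intro mult_mono) auto
            then show "norm (moll \<delta> y w *\<^sub>R G w) \<le> norm ((1 / mnorm TYPE('a) \<delta>) * (indicator (cball 0 r) w + (norm (G w))\<^sup>2))"
              using moll_nonneg[OF \<delta>(1), of y w] mnorm_pos[OF \<delta>(1), where 'a = 'a] by simp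
          qed
        qed measurable
      qed
      finally show "gd y \<bullet> i = T y \<bullet> i" .
    qed
    have near: "\<bar>zd y - z y\<bar> \<le> s" if y: "y \<in> S \<delta>0" for y
    proof -
      have b: "cball y \<delta> \<subseteq> \<Omega>" by (rule S\<Omega>[OF y \<delta>(4)])
      have "zd y - z y = (\<integral>w. moll \<delta> y w * (Z w - z y) \<partial>lborel)"
        unfolding zd_def using imoll[of y] m1[of y] by (simp add: right_diff_distrib mult.commute)
      also have "norm \<dots> \<le> (\<integral>w. moll \<delta> y w * s \<partial>lborel)"
      proof (rule Bochner_Integration.integral_norm_bound_integral)
        show "integrable lborel (\<lambda>w. moll \<delta> y w * (Z w - z y))"
          using imoll[of y] m1[of y] by (simp add: right_diff_distrib mult.commute)
        show "norm (moll \<delta> y w * (Z w - z y)) \<le> moll \<delta> y w * s" for w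
        proof (cases "norm (y - w) < \<delta>")
          case True
          then have w: "w \<in> \<Omega>" "y \<in> \<Omega>" using b \<delta>(1) by (auto simp: dist_norm subset_iff)
          then have "dist (z w) (z y) < s"
            using d2(2)[of y w] closure_subset[of \<Omega>] True \<delta> by (auto simp: dist_norm norm_minus_commute)
          then show ?thesis using moll_nonneg[OF \<delta>(1), of y w] w by (simp add: Z_def abs_mult dist_real_def mult_left_mono)
        qed (simp add: moll_outside[OF \<delta>(1)])
      qed (use m1 in auto)
      finally show ?thesis using m1[of y] by simp
    qed
    have far: "zd y \<le> k / 2" if y: "y \<notin> S \<delta>" for y
    proof -
      have "zd y \<le> (\<integral>w. (k / 2) * moll \<delta> y w \<partial>lborel)" unfolding zd_def
      proof (rule integral_mono[OF imoll])
        show "Z w * moll \<delta> y w \<le> (k / 2) * moll \<delta> y w" for w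
        proof (cases "norm (y - w) < \<delta>")
          case True
          then have "w \<notin> K" using y S by (auto simp: dist_norm norm_minus_commute)
          then have "Z w \<le> k / 2" using k(1) closure_subset[of \<Omega>] by (auto simp: Z_def K_def indicator_def)
          then show ?thesis using moll_nonneg[OF \<delta>(1)] by (intro mult_right_mono)
        qed (simp add: moll_outside[OF \<delta>(1)])
      qed (use m1 in auto)
      then show ?thesis using m1[of y] by simp
    qed
    define wd where "wd y = max 0 (zd y - k)" for y
    have wd0: "wd y = 0" if "y \<notin> S \<delta>" for y using far[OF that] k(1) by (simp add: wd_def)
    have SS: "S \<delta> \<subseteq> S \<delta>0" using S \<delta>(4) by fastforce
    have wd00: "wd y = 0" if "y \<notin> S \<delta>0" for y using wd0 SS that by blast
    have zdW: "\<bar>zd y\<bar> \<le> W" for y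
    proof -
      have "norm (zd y) \<le> (\<integral>w. W * moll \<delta> y w \<partial>lborel)" unfolding zd_def
        by (rule Bochner_Integration.integral_norm_bound_integral[OF imoll])
          (use m1 Zb moll_nonneg[OF \<delta>(1), of y] in \<open>auto simp: abs_mult intro: mult_right_mono\<close>)
      then show ?thesis using m1[of y] by simp
    qed
    have wdb: "0 \<le> wd y" "wd y \<le> W" for y using zdW[of y] W(1) k(1) by (auto simp: wd_def)
    have wnear: "\<bar>wd y - w y\<bar> \<le> s" if "y \<in> S \<delta>0" for y using near[OF that] by (auto simp: wd_def w_def max_def)
    \<comment> \<open>The square makes the truncation of the mollified function C^1; truncating at
      k, above \<open>k / 2\<close>, keeps its support in \<open>S \<delta>\<close>.\<close>
    define \<psi> where "\<psi> y = (wd y)\<^sup>2" for y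
    define d\<psi> where "d\<psi> y = (2 * wd y) *\<^sub>R gd y" for y
    have t: "test_fun \<Omega> \<psi> d\<psi>" unfolding test_fun_def
    proof (intro conjI allI)
      show "continuous_on UNIV d\<psi>" unfolding d\<psi>_def wd_def
        by (intro continuous_intros zdcont icont)
      show "(\<psi> has_derivative (\<lambda>h. d\<psi> y \<bullet> h)) (at y)" for y
      proof -
        have "((\<lambda>y. zd y - k) has_derivative (\<lambda>h. gd y \<bullet> h)) (at y)"
          using has_derivative_diff[OF ider has_derivative_const[of k]] by simp
        from pos_square_has_derivative[OF this] show ?thesis
          unfolding \<psi>_def wd_def d\<psi>_def by simp
      qed
      have "{y. \<psi> y \<noteq> 0} \<subseteq> S \<delta>" using wd0 by (auto simp: \<psi>_def)
      then have cl: "closure {y. \<psi> y \<noteq> 0} \<subseteq> S \<delta>" by (intro closure_minimal compact_imp_closed cS)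
      then show "closure {y. \<psi> y \<noteq> 0} \<subseteq> \<Omega>" using SS S0\<Omega> by blast
      show "compact (closure {y. \<psi> y \<noteq> 0})"
        using compact_Int_closed[OF cS closed_closure] cl by (metis inf.absorb_iff2)
    qed
    define J where "J y = g y \<bullet> d\<psi> y + (v y \<bullet> g y) * \<psi> y + c * z y * \<psi> y" for y
    have J0: "(\<integral>y. J y \<partial>lborel) \<le> 0"
      using sub[OF t] unfolding wform_def J_def by (simp add: \<psi>_def)
    define E where "E y = W * (s * (norm (G y))\<^sup>2 + indicator (cball 0 r) y * (norm (T y - G y))\<^sup>2 / s) + 2 * s * (norm (G y))\<^sup>2
        + 2 * \<tau> * W * s * (indicator (cball 0 r) y + (norm (G y))\<^sup>2) + 2 * c * W * W * s * indicator (cball 0 r) y" for y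
    have diff: "\<bar>J y - I y\<bar> \<le> E y" for y
    proof (cases "y \<in> S \<delta>0")
      case False
      have "E y \<ge> 0" unfolding E_def using W \<tau> s c0 by (intro add_nonneg_nonneg mult_nonneg_nonneg divide_nonneg_nonneg) auto
      then show ?thesis using wd00[OF False] False by (simp add: J_def I_def \<psi>_def d\<psi>_def)
    next
      case True
      then have y: "y \<in> \<Omega>" "y \<in> cball 0 r" using S0\<Omega> r by auto
      have Gy: "G y = g y" using y by (simp add: G_def)
      have sq: "\<bar>(wd y)\<^sup>2 - (w y)\<^sup>2\<bar> \<le> 2 * W * s"
      proof -
        have "\<bar>(wd y)\<^sup>2 - (w y)\<^sup>2\<bar> = \<bar>wd y - w y\<bar> * \<bar>wd y + w y\<bar>"
          by (simp add: power2_eq_square abs_mult[symmetric] algebra_simps)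
        also have "\<dots> \<le> s * (2 * W)" using wnear[OF True] wdb[of y] wb[OF y(1)] s by (intro mult_mono) auto
        finally show ?thesis by (simp add: mult_ac)
      qed
      have J: "J y - I y = 2 * wd y * (g y \<bullet> (T y - g y)) + 2 * (wd y - w y) * (norm (g y))\<^sup>2
          + (v y \<bullet> g y) * ((wd y)\<^sup>2 - (w y)\<^sup>2) + c * z y * ((wd y)\<^sup>2 - (w y)\<^sup>2)"
        using True by (simp add: J_def I_def \<psi>_def d\<psi>_def gd inner_diff_right power2_norm_eq_inner algebra_simps)
      have 1: "\<bar>2 * wd y * (g y \<bullet> (T y - g y))\<bar> \<le> W * (s * (norm (g y))\<^sup>2 + (norm (T y - g y))\<^sup>2 / s)"
      proof -
        have "2 * \<bar>g y \<bullet> (T y - g y)\<bar> \<le> 2 * (norm (g y) * norm (T y - g y))" using Cauchy_Schwarz_ineq2[of "g y" "T y - g y"] by simp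
        also have "\<dots> = 2 * (sqrt s * norm (g y)) * (norm (T y - g y) / sqrt s)" using s by simp
        also have "\<dots> \<le> (sqrt s * norm (g y))\<^sup>2 + (norm (T y - g y) / sqrt s)\<^sup>2" by (rule sum_squares_bound)
        also have "\<dots> = s * (norm (g y))\<^sup>2 + (norm (T y - g y))\<^sup>2 / s" using s by (simp add: power_mult_distrib power_divide)
        finally have "wd y * (2 * \<bar>g y \<bullet> (T y - g y)\<bar>) \<le> W * (s * (norm (g y))\<^sup>2 + (norm (T y - g y))\<^sup>2 / s)"
          using wdb[of y] W by (intro mult_mono) auto
        then show ?thesis using wdb[of y] by (simp add: abs_mult mult_ac)
      qed
      have 2: "\<bar>2 * (wd y - w y) * (norm (g y))\<^sup>2\<bar> \<le> 2 * s * (norm (g y))\<^sup>2"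
        using wnear[OF True] by (simp add: abs_mult mult_right_mono)
      have 3: "\<bar>(v y \<bullet> g y) * ((wd y)\<^sup>2 - (w y)\<^sup>2)\<bar> \<le> \<tau> * (1 + (norm (g y))\<^sup>2) * (2 * W * s)"
        unfolding abs_mult using vg[of y] sq \<tau> by (intro mult_mono) auto
      have 4: "\<bar>c * z y * ((wd y)\<^sup>2 - (w y)\<^sup>2)\<bar> \<le> c * W * (2 * W * s)"
        unfolding abs_mult using W(2)[of y] closure_subset[of \<Omega>] y sq c0 W(1) by (intro mult_mono) auto
      have "\<bar>J y - I y\<bar> \<le> W * (s * (norm (g y))\<^sup>2 + (norm (T y - g y))\<^sup>2 / s) + 2 * s * (norm (g y))\<^sup>2
          + \<tau> * (1 + (norm (g y))\<^sup>2) * (2 * W * s) + c * W * (2 * W * s)"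
        unfolding J using 1 2 3 4 by linarith
      also have "\<dots> = E y" unfolding E_def Gy using y(2) by (simp add: algebra_simps)
      finally show ?thesis .
    qed
    have iT: "integrable lborel (\<lambda>y. indicator (cball 0 r) y * (norm (T y - G y))\<^sup>2)"
      "(\<integral>y. indicator (cball 0 r) y * (norm (T y - G y))\<^sup>2 \<partial>lborel) < s\<^sup>2"
      unfolding T_def using d1(2,3)[OF \<delta>(1,2)] by auto
    have iE: "integrable lborel E" unfolding E_def[abs_def] using iG iB iT(1) by auto
    have intE: "(\<integral>y. E y \<partial>lborel) \<le> s * A"
    proof -
      define N2 where "N2 = (\<integral>y. (norm (G y))\<^sup>2 \<partial>lborel)"
      define D2 where "D2 = (\<integral>y. indicator (cball 0 r) y * (norm (T y - G y))\<^sup>2 \<partial>lborel)"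
      have "N2 \<ge> 0" unfolding N2_def by (intro integral_nonneg_AE AE_I2) simp
      have "(\<integral>y. E y \<partial>lborel) = W * (s * N2 + D2 / s) + 2 * s * N2
          + 2 * \<tau> * W * s * (measure lborel (cball (0::'a) r) + N2) + 2 * c * W * W * s * measure lborel (cball (0::'a) r)"
        unfolding E_def[abs_def] N2_def D2_def using iG iB iT(1) by simp
      also have "W * (s * N2 + D2 / s) \<le> W * (s * N2 + s)"
        using iT(2) s W(1) by (intro mult_left_mono add_left_mono) (auto simp: D2_def field_simps power2_eq_square)
      finally have "(\<integral>y. E y \<partial>lborel) \<le> W * (s * N2 + s) + 2 * s * N2
          + 2 * \<tau> * W * s * (measure lborel (cball (0::'a) r) + N2) + 2 * c * W * W * s * measure lborel (cball (0::'a) r)" by simp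
      also have "\<dots> = s * (A - 2 * W * N2)" unfolding A_def N2_def by (simp add: algebra_simps)
      also have "\<dots> \<le> s * A" using s W \<open>N2 \<ge> 0\<close> by (intro mult_left_mono) auto
      finally show ?thesis .
    qed
    have iJ: "integrable lborel J"
    proof (rule Bochner_Integration.integrable_bound[OF Bochner_Integration.integrable_add[OF integrable_abs[OF iI] iE]])
      note [measurable] = test_fun_measurable[OF t]
      show "J \<in> borel_measurable lborel" unfolding J_def by measurable
      have "\<bar>J y\<bar> \<le> \<bar>I y\<bar> + E y" for y using diff[of y] by linarith
      then show "AE y in lborel. norm (J y) \<le> norm (\<bar>I y\<bar> + E y)" by (intro AE_I2) (simp add: order_trans[OF _ abs_ge_self])
    qed
    have "(\<integral>y. I y \<partial>lborel) \<le> (\<integral>y. J y + E y \<partial>lborel)"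
    proof (rule integral_mono[OF iI])
      show "I y \<le> J y + E y" for y using diff[of y] by linarith
    qed (use iJ iE in auto)
    also have "\<dots> = (\<integral>y. J y \<partial>lborel) + (\<integral>y. E y \<partial>lborel)" using iJ iE by simp
    finally show ?thesis using J0 intE by linarith
  qed
  have I0: "(\<integral>y. I y \<partial>lborel) \<le> 0"
  proof -
    have "\<forall>\<^sub>F s in at_right 0. (\<integral>y. I y \<partial>lborel) \<le> s * A"
      using key by (intro eventually_at_rightI[of 0 1]) auto
    moreover have "((\<lambda>s. s * A) \<longlongrightarrow> 0 * A) (at_right 0)" by (intro tendsto_intros)
    ultimately have "(\<integral>y. I y \<partial>lborel) \<le> 0 * A" by (intro tendsto_le[OF _ _ tendsto_const]) auto
    then show ?thesis by simp
  qed
  define \<kappa> where "\<kappa> = c - \<tau>\<^sup>2 / 8"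
  have \<kappa>: "\<kappa> > 0" using c by (simp add: \<kappa>_def)
  \<comment> \<open>Completing the square in \<open>norm (g y)\<close>: the cross term
    \<open>\<tau> * norm (g y) * w ^ 2\<close> is absorbed into
    \<open>2 * w * (norm (g y) - \<tau> * w / 4) ^ 2\<close> at the cost of
    \<open>\<tau> ^ 2 / 8 * w ^ 3\<close>. This is the origin of the bound on c.\<close>
  have low: "I y \<ge> \<kappa> * (w y) ^ 3" if "y \<in> S \<delta>0" for y
  proof -
    have y: "y \<in> \<Omega>" using S0\<Omega> that by auto
    let ?a = "norm (g y)" and ?w = "w y"
    have w0: "?w \<ge> 0" using wb[OF y] by simp
    have "- (v y \<bullet> g y) \<le> \<tau> * ?a"
      using order_trans[OF Cauchy_Schwarz_ineq2[of "v y" "g y"] mult_right_mono[OF v(2) norm_ge_zero]] by linarith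
    then have "- (\<tau> * ?a) * ?w\<^sup>2 \<le> (v y \<bullet> g y) * ?w\<^sup>2" by (intro mult_right_mono) auto
    moreover have "c * ?w * ?w\<^sup>2 \<le> c * z y * ?w\<^sup>2"
    proof (cases "?w = 0")
      case False
      then have "?w \<le> z y" using k(1) by (auto simp: w_def max_def split: if_splits)
      then show ?thesis using c0 by (intro mult_right_mono mult_left_mono) auto
    qed simp
    moreover have "I y = 2 * ?w * ?a\<^sup>2 + (v y \<bullet> g y) * ?w\<^sup>2 + c * z y * ?w\<^sup>2" using that by (simp add: I_def)
    ultimately have "I y \<ge> 2 * ?w * ?a\<^sup>2 - (\<tau> * ?a) * ?w\<^sup>2 + c * ?w * ?w\<^sup>2" by simp
    also have "2 * ?w * ?a\<^sup>2 - (\<tau> * ?a) * ?w\<^sup>2 + c * ?w * ?w\<^sup>2 = 2 * ?w * (?a - \<tau> * ?w / 4)\<^sup>2 + \<kappa> * ?w ^ 3"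
      by (simp add: \<kappa>_def power2_eq_square power3_eq_cube algebra_simps)
    finally show ?thesis using mult_nonneg_nonneg[OF w0 zero_le_power2[of "?a - \<tau> * ?w / 4"]] by linarith
  qed
  have xK: "x \<in> K" using k closure_subset[of \<Omega>] x\<Omega> by (auto simp: K_def)
  have "isCont z x"
    using cont closure_subset[of \<Omega>] x\<Omega> \<Omega>(1) by (metis continuous_on_eq_continuous_at continuous_on_subset)
  then obtain \<rho> where \<rho>: "\<rho> > 0" "\<And>y. dist y x < \<rho> \<Longrightarrow> dist (z y) (z x) < k / 2"
    using k(1) unfolding continuous_at_eps_delta by (metis half_gt_zero)
  define B where "B = ball x (min \<rho> \<delta>0)"
  have BS: "B \<subseteq> S \<delta>0" using xK S by (auto simp: B_def intro!: bexI[of _ x])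
  have wB: "w y \<ge> k / 2" if "y \<in> B" for y
  proof -
    have "\<bar>z y - z x\<bar> < k / 2" using \<rho>(2)[of y] that by (simp add: B_def dist_commute[of y x] dist_real_def)
    then have "k / 2 \<le> z y - k" using k(2) by linarith
    then show ?thesis unfolding w_def by (rule max.coboundedI2)
  qed
  have "0 < \<kappa> * (k / 2) ^ 3 * measure lborel B"
    using \<kappa> k \<rho>(1) \<delta>0 content_ball_pos[of "min \<rho> \<delta>0" x] by (simp add: B_def)
  also have "\<dots> = (\<integral>y. \<kappa> * (k / 2) ^ 3 * indicator B y \<partial>lborel)" by simp
  also have "\<dots> \<le> (\<integral>y. I y \<partial>lborel)"
  proof (rule integral_mono[OF _ iI])
    show "integrable lborel (\<lambda>y. \<kappa> * (k / 2) ^ 3 * indicator B y)" unfolding B_def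
      by (intro integrable_mult_right integrable_real_indicator emeasure_bounded_finite[OF bounded_ball]) simp
    show "\<kappa> * (k / 2) ^ 3 * indicator B y \<le> I y" for y
    proof (cases "y \<in> S \<delta>0")
      case True
      have "\<kappa> * (k / 2) ^ 3 * indicator B y \<le> \<kappa> * w y ^ 3"
        using wB[of y] wb[of y] True S0\<Omega> \<kappa> k(1) by (cases "y \<in> B") (auto intro!: mult_left_mono power_mono)
      then show ?thesis using low[OF True] by linarith
    next
      case False
      then show ?thesis using BS by (auto simp: I_def indicator_def)
    qed
  qed
  finally show False using I0 by linarith
qed

section \<open>Algebra of weak formulations\<close>

lemma square_integrable_imp_integrable:
  fixes g :: "'a::euclidean_space \<Rightarrow> 'b::{banach,second_countable_topology}"
  assumes \<Omega>: "\<Omega> \<in> sets borel" "bounded \<Omega>" and g[measurable]: "g \<in> borel_measurable borel"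
    and i: "integrable lborel (\<lambda>x. indicator \<Omega> x * (norm (g x))\<^sup>2)"
  shows "integrable lborel (\<lambda>x. indicator \<Omega> x * norm (g x))"
proof (rule Bochner_Integration.integrable_bound)
  note [measurable] = \<Omega>(1)
  have "integrable lborel (indicator \<Omega> :: 'a \<Rightarrow> real)"
    by (intro integrable_real_indicator emeasure_bounded_finite[OF \<Omega>(2)]) (use \<Omega> in simp)
  then show "integrable lborel (\<lambda>x. indicator \<Omega> x + indicator \<Omega> x * (norm (g x))\<^sup>2)" using i by auto
  have "norm (g x) \<le> 1 + (norm (g x))\<^sup>2" for x
    using sum_squares_bound[of "norm (g x)" 1, simplified] norm_ge_zero[of "g x"] by linarith
  then show "AE x in lborel. norm (indicator \<Omega> x * norm (g x)) \<le> norm (indicator \<Omega> x + indicator \<Omega> x * (norm (g x))\<^sup>2)"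
    by (intro AE_I2) (simp add: indicator_def)
  show "(\<lambda>x. indicator \<Omega> x * norm (g x)) \<in> borel_measurable lborel" by measurable
qed

lemma weak_gradD:
  assumes "weak_grad \<Omega> u g"
  shows "u \<in> borel_measurable borel" "g \<in> borel_measurable borel"
    "integrable lborel (\<lambda>x. indicator \<Omega> x * (u x)\<^sup>2)" "integrable lborel (\<lambda>x. indicator \<Omega> x * (norm (g x))\<^sup>2)"
    "\<And>\<psi> d\<psi> i. test_fun \<Omega> \<psi> d\<psi> \<Longrightarrow> i \<in> Basis \<Longrightarrow> (\<integral>x. u x * (d\<psi> x \<bullet> i) \<partial>lborel) = - (\<integral>x. (g x \<bullet> i) * \<psi> x \<partial>lborel)"
  using assms unfolding weak_grad_def by auto

context
  fixes \<Omega> :: "'a::euclidean_space set" and v :: "'a \<Rightarrow> 'a" and \<tau> :: real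
  assumes \<Omega>: "\<Omega> \<in> sets borel" "bounded \<Omega>" and v: "v \<in> borel_measurable borel" "\<And>x. norm (v x) \<le> \<tau>"
begin

lemma weak_grad_integrable:
  assumes w: "weak_grad \<Omega> u g" and t: "test_fun \<Omega> \<psi> d\<psi>"
  shows "integrable lborel (\<lambda>x. g x \<bullet> d\<psi> x)" "integrable lborel (\<lambda>x. (v x \<bullet> g x) * \<psi> x)"
    "integrable lborel (\<lambda>x. u x * \<psi> x)" "integrable lborel (\<lambda>x. u x * (d\<psi> x \<bullet> i))" "integrable lborel (\<lambda>x. (g x \<bullet> i) * \<psi> x)"
proof -
  note [measurable] = weak_gradD(1,2)[OF w] v(1) \<Omega>(1)
  have ig: "integrable lborel (\<lambda>x. indicator \<Omega> x * norm (g x))"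
    by (rule square_integrable_imp_integrable[OF \<Omega> weak_gradD(2,4)[OF w]])
  have iu: "integrable lborel (\<lambda>x. indicator \<Omega> x * norm (u x))"
    by (rule square_integrable_imp_integrable[OF \<Omega> weak_gradD(1)[OF w]]) (use weak_gradD(3)[OF w] in simp)
  show "integrable lborel (\<lambda>x. g x \<bullet> d\<psi> x)"
    by (rule test_fun_integrable_grad[OF t weak_gradD(2)[OF w] \<Omega>(1) ig])
  show "integrable lborel (\<lambda>x. u x * \<psi> x)"
    by (rule test_fun_integrable[OF t weak_gradD(1)[OF w] \<Omega>(1)])
      (rule Bochner_Integration.integrable_bound[OF iu], auto simp: abs_mult)
  show "integrable lborel (\<lambda>x. (v x \<bullet> g x) * \<psi> x)"
  proof (rule test_fun_integrable[OF t _ \<Omega>(1)])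
    show "integrable lborel (\<lambda>x. indicator \<Omega> x * (v x \<bullet> g x))"
    proof (rule Bochner_Integration.integrable_bound[OF integrable_mult_right[OF ig, of \<tau>]])
      have "\<bar>v x \<bullet> g x\<bar> \<le> \<tau> * norm (g x)" for x
        by (rule order_trans[OF Cauchy_Schwarz_ineq2]) (intro mult_right_mono v(2) norm_ge_zero)
      moreover have "\<tau> \<ge> 0" using order_trans[OF norm_ge_zero v(2)] .
      ultimately show "AE x in lborel. norm (indicator \<Omega> x * (v x \<bullet> g x)) \<le> norm (\<tau> * (indicator \<Omega> x * norm (g x)))"
        by (intro AE_I2) (simp add: indicator_def)
    qed measurable
  qed measurable
  obtain C where C: "C > 0" "\<And>x. norm (d\<psi> x) \<le> C" using test_fun_bounded[OF t] by metis
  note [measurable] = test_fun_measurable[OF t]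
  show "integrable lborel (\<lambda>x. u x * (d\<psi> x \<bullet> i))"
  proof (rule Bochner_Integration.integrable_bound[OF integrable_mult_right[OF iu, of "C * norm i"]])
    have "\<bar>d\<psi> x \<bullet> i\<bar> \<le> C * norm i" for x
      by (rule order_trans[OF Cauchy_Schwarz_ineq2]) (intro mult_right_mono C(2) norm_ge_zero)
    then have "\<bar>u x\<bar> * \<bar>d\<psi> x \<bullet> i\<bar> \<le> \<bar>u x\<bar> * (C * norm i)" for x by (rule mult_left_mono) simp
    then show "AE x in lborel. norm (u x * (d\<psi> x \<bullet> i)) \<le> norm (C * norm i * (indicator \<Omega> x * norm (u x)))"
      using test_fun_zero_outside(2)[OF t] C(1) by (intro AE_I2) (auto simp: indicator_def abs_mult mult_ac)
  qed measurable
  show "integrable lborel (\<lambda>x. (g x \<bullet> i) * \<psi> x)"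
  proof (rule test_fun_integrable[OF t _ \<Omega>(1)])
    show "integrable lborel (\<lambda>x. indicator \<Omega> x * (g x \<bullet> i))"
    proof (rule Bochner_Integration.integrable_bound[OF integrable_mult_right[OF ig, of "norm i"]])
      have "\<bar>g x \<bullet> i\<bar> \<le> norm i * norm (g x)" for x using Cauchy_Schwarz_ineq2[of "g x" i] by (simp add: mult.commute)
      then show "AE x in lborel. norm (indicator \<Omega> x * (g x \<bullet> i)) \<le> norm (norm i * (indicator \<Omega> x * norm (g x)))"
        by (intro AE_I2) (simp add: indicator_def)
    qed measurable
  qed measurable
qed

lemma weak_grad_lincomb:
  assumes w: "weak_grad \<Omega> u1 g1" "weak_grad \<Omega> u2 g2"
  shows "weak_grad \<Omega> (\<lambda>x. a * u1 x + b * u2 x) (\<lambda>x. a *\<^sub>R g1 x + b *\<^sub>R g2 x)"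
  unfolding weak_grad_def
proof (intro conjI allI impI ballI)
  note [measurable] = weak_gradD(1,2)[OF w(1)] weak_gradD(1,2)[OF w(2)] \<Omega>(1)
  show "(\<lambda>x. a * u1 x + b * u2 x) \<in> borel_measurable borel" "(\<lambda>x. a *\<^sub>R g1 x + b *\<^sub>R g2 x) \<in> borel_measurable borel"
    by measurable
  have "(a * u1 x + b * u2 x)\<^sup>2 \<le> 2 * a\<^sup>2 * (u1 x)\<^sup>2 + 2 * b\<^sup>2 * (u2 x)\<^sup>2" for x
    using norm_sum_square_le[of "a * u1 x" "b * u2 x"] by (simp add: power_mult_distrib)
  then have "indicator \<Omega> x * (a * u1 x + b * u2 x)\<^sup>2 \<le> 2 * a\<^sup>2 * (indicator \<Omega> x * (u1 x)\<^sup>2) + 2 * b\<^sup>2 * (indicator \<Omega> x * (u2 x)\<^sup>2)" for x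
    by (simp add: indicator_def)
  note 1 = this order_trans[OF this abs_ge_self]
  show "integrable lborel (\<lambda>x. indicator \<Omega> x * (a * u1 x + b * u2 x)\<^sup>2)"
    by (rule Bochner_Integration.integrable_bound[OF Bochner_Integration.integrable_add[OF
            integrable_mult_right[OF weak_gradD(3)[OF w(1)], of "2 * a\<^sup>2"] integrable_mult_right[OF weak_gradD(3)[OF w(2)], of "2 * b\<^sup>2"]]])
      (measurable, intro AE_I2, simp add: 1)
  have "(norm (a *\<^sub>R g1 x + b *\<^sub>R g2 x))\<^sup>2 \<le> 2 * a\<^sup>2 * (norm (g1 x))\<^sup>2 + 2 * b\<^sup>2 * (norm (g2 x))\<^sup>2" for x
    using norm_sum_square_le[of "a *\<^sub>R g1 x" "b *\<^sub>R g2 x"] by (simp add: power_mult_distrib)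
  then have "indicator \<Omega> x * (norm (a *\<^sub>R g1 x + b *\<^sub>R g2 x))\<^sup>2 \<le> 2 * a\<^sup>2 * (indicator \<Omega> x * (norm (g1 x))\<^sup>2) + 2 * b\<^sup>2 * (indicator \<Omega> x * (norm (g2 x))\<^sup>2)" for x
    by (simp add: indicator_def)
  note 2 = this order_trans[OF this abs_ge_self]
  show "integrable lborel (\<lambda>x. indicator \<Omega> x * (norm (a *\<^sub>R g1 x + b *\<^sub>R g2 x))\<^sup>2)"
    by (rule Bochner_Integration.integrable_bound[OF Bochner_Integration.integrable_add[OF
            integrable_mult_right[OF weak_gradD(4)[OF w(1)], of "2 * a\<^sup>2"] integrable_mult_right[OF weak_gradD(4)[OF w(2)], of "2 * b\<^sup>2"]]])
      (measurable, intro AE_I2, simp add: 2)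
next
  fix \<psi> d\<psi> and i :: 'a
  assume t: "test_fun \<Omega> \<psi> d\<psi>" and i: "i \<in> Basis"
  note I = weak_grad_integrable[OF w(1) t] weak_grad_integrable[OF w(2) t]
  have "(\<integral>x. (a * u1 x + b * u2 x) * (d\<psi> x \<bullet> i) \<partial>lborel)
      = (\<integral>x. a * (u1 x * (d\<psi> x \<bullet> i)) + b * (u2 x * (d\<psi> x \<bullet> i)) \<partial>lborel)"
    by (simp add: distrib_right mult.assoc)
  also have "\<dots> = a * (\<integral>x. u1 x * (d\<psi> x \<bullet> i) \<partial>lborel) + b * (\<integral>x. u2 x * (d\<psi> x \<bullet> i) \<partial>lborel)"
    using I by simp
  also have "\<dots> = - (a * (\<integral>x. (g1 x \<bullet> i) * \<psi> x \<partial>lborel) + b * (\<integral>x. (g2 x \<bullet> i) * \<psi> x \<partial>lborel))"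
    using weak_gradD(5)[OF w(1) t i] weak_gradD(5)[OF w(2) t i] by simp
  also have "\<dots> = - (\<integral>x. a * ((g1 x \<bullet> i) * \<psi> x) + b * ((g2 x \<bullet> i) * \<psi> x) \<partial>lborel)"
    using I by simp
  finally show "(\<integral>x. (a * u1 x + b * u2 x) * (d\<psi> x \<bullet> i) \<partial>lborel) = - (\<integral>x. (a *\<^sub>R g1 x + b *\<^sub>R g2 x) \<bullet> i * \<psi> x \<partial>lborel)"
    by (simp add: inner_add_left distrib_right mult.assoc)
qed

lemma wform_lincomb:
  assumes w: "weak_grad \<Omega> u1 g1" "weak_grad \<Omega> u2 g2" and t: "test_fun \<Omega> \<psi> d\<psi>"
  shows "wform v c (\<lambda>x. a * u1 x + b * u2 x) (\<lambda>x. a *\<^sub>R g1 x + b *\<^sub>R g2 x) \<psi> d\<psi> = a * wform v c u1 g1 \<psi> d\<psi> + b * wform v c u2 g2 \<psi> d\<psi>"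
proof -
  note I = weak_grad_integrable[OF w(1) t] weak_grad_integrable[OF w(2) t]
  let ?F = "\<lambda>u g x. g x \<bullet> d\<psi> x + (v x \<bullet> g x) * \<psi> x + c * u x * \<psi> x"
  have i: "integrable lborel (?F u1 g1)" "integrable lborel (?F u2 g2)"
    using I by (auto simp: mult.assoc)
  have "wform v c (\<lambda>x. a * u1 x + b * u2 x) (\<lambda>x. a *\<^sub>R g1 x + b *\<^sub>R g2 x) \<psi> d\<psi> = (\<integral>x. a * ?F u1 g1 x + b * ?F u2 g2 x \<partial>lborel)"
    unfolding wform_def by (intro Bochner_Integration.integral_cong) (auto simp: inner_add_left inner_add_right algebra_simps)
  also have "\<dots> = a * (\<integral>x. ?F u1 g1 x \<partial>lborel) + b * (\<integral>x. ?F u2 g2 x \<partial>lborel)"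
    by (subst Bochner_Integration.integral_add) (use i in simp_all)
  finally show ?thesis unfolding wform_def .
qed

lemma wform_split:
  assumes w: "weak_grad \<Omega> u g" and t: "test_fun \<Omega> \<psi> d\<psi>"
  shows "wform v c u g \<psi> d\<psi> = (\<integral>x. g x \<bullet> d\<psi> x \<partial>lborel) + (\<integral>x. (v x \<bullet> g x) * \<psi> x \<partial>lborel) + c * (\<integral>x. u x * \<psi> x \<partial>lborel)"
  unfolding wform_def using weak_grad_integrable[OF w t] by (simp add: mult.assoc)

end

lemma weak_grad_mono:
  assumes w: "weak_grad \<Omega> u g" and s: "\<Omega>' \<subseteq> \<Omega>" "\<Omega>' \<in> sets borel"
  shows "weak_grad \<Omega>' u g"
proof -
  note [measurable] = weak_gradD(1,2)[OF w] s(2)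
  have "integrable lborel (\<lambda>x. indicator \<Omega>' x * (u x)\<^sup>2)"
    by (rule Bochner_Integration.integrable_bound[OF weak_gradD(3)[OF w]])
      (measurable, use s in \<open>auto simp: indicator_def\<close>)
  moreover have "integrable lborel (\<lambda>x. indicator \<Omega>' x * (norm (g x))\<^sup>2)"
    by (rule Bochner_Integration.integrable_bound[OF weak_gradD(4)[OF w]])
      (measurable, use s in \<open>auto simp: indicator_def\<close>)
  ultimately show ?thesis using w test_fun_mono[OF _ s(1)] unfolding weak_grad_def by blast
qed

lemma weak_grad_classical:
  fixes u :: "'a::euclidean_space \<Rightarrow> real"
  assumes \<Omega>: "open \<Omega>" "bounded \<Omega>"
    and d: "\<And>x. x \<in> \<Omega> \<Longrightarrow> (u has_derivative (\<lambda>h. g x \<bullet> h)) (at x)" and c: "continuous_on \<Omega> g"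
    and m: "u \<in> borel_measurable borel" "g \<in> borel_measurable borel"
    and b: "\<And>x. x \<in> \<Omega> \<Longrightarrow> \<bar>u x\<bar> \<le> C" "\<And>x. x \<in> \<Omega> \<Longrightarrow> norm (g x) \<le> C"
  shows "weak_grad \<Omega> u g"
proof -
  note [measurable] = m
  have [measurable]: "\<Omega> \<in> sets borel" using \<Omega> by simp
  have "integrable lborel (\<lambda>x. indicator \<Omega> x * (u x)\<^sup>2)"
  proof (rule integrable_bounded_support[where S = \<Omega> and C = "C\<^sup>2"])
    have "\<bar>u x\<bar>\<^sup>2 \<le> C\<^sup>2" if "x \<in> \<Omega>" for x using b(1)[OF that] by (intro power_mono) auto
    then show "norm (indicator \<Omega> x * (u x)\<^sup>2) \<le> C\<^sup>2" for x by (simp add: indicator_def)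
  qed (use \<Omega> in auto)
  moreover have "integrable lborel (\<lambda>x. indicator \<Omega> x * (norm (g x))\<^sup>2)"
  proof (rule integrable_bounded_support[where S = \<Omega> and C = "C\<^sup>2"])
    have "(norm (g x))\<^sup>2 \<le> C\<^sup>2" if "x \<in> \<Omega>" for x using b(2)[OF that] by (intro power_mono) auto
    then show "norm (indicator \<Omega> x * (norm (g x))\<^sup>2) \<le> C\<^sup>2" for x by (simp add: indicator_def)
  qed (use \<Omega> in auto)
  ultimately show ?thesis
    unfolding weak_grad_def using m integration_by_parts[OF _ \<Omega>(1) d c m] by blast
qed

lemma weak_grad_const:
  assumes "open \<Omega>" "bounded \<Omega>"
  shows "weak_grad \<Omega> (\<lambda>_. k) (\<lambda>_. 0)"
  by (rule weak_grad_classical[OF assms, where C = "\<bar>k\<bar>"]) auto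

section \<open>The Dirichlet problem, by continuation in the lower-order terms\<close>

section \<open>The continuity method for compact perturbations of the identity\<close>

text \<open>The lower bound \<kappa> holds along the whole family
  \<open>w + s *\<^sub>R A w\<close>: otherwise normalised almost-kernel vectors would, by
  compactness, subconverge to a unit kernel vector for some s. Surjectivity then travels from
  \<open>s = 0\<close> to \<open>s = 1\<close> in equal steps, each solved by a contraction; the
  step length depends only on \<kappa> and a bound for A.\<close>

lemma compact_perturbation_invertible:
  fixes A :: "'w::{real_normed_vector, complete_space} \<Rightarrow> 'w"
  assumes A: "bounded_linear A"
    and cpt: "\<And>X::nat \<Rightarrow> 'w. bounded (range X) \<Longrightarrow> \<exists>l r. strict_mono r \<and> (\<lambda>n. A (X (r n))) \<longlonglongrightarrow> l"
    and inj: "\<And>s w. 0 \<le> s \<Longrightarrow> s \<le> 1 \<Longrightarrow> w + s *\<^sub>R A w = 0 \<Longrightarrow> w = 0"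
  obtains \<kappa> where "\<kappa> > 0" "\<And>w. \<kappa> * norm w \<le> norm (w + A w)" "\<And>y. \<exists>w. w + A w = y"
proof -
  interpret A: bounded_linear A by (rule A)
  have "\<exists>\<kappa>>0. \<forall>s w. 0 \<le> s \<longrightarrow> s \<le> 1 \<longrightarrow> \<kappa> * norm w \<le> norm (w + s *\<^sub>R A w)"
  proof (rule ccontr)
    assume "\<not> ?thesis"
    then have "\<forall>n. \<exists>s w. 0 \<le> s \<and> s \<le> 1 \<and> norm (w + s *\<^sub>R A w) < inverse (real (Suc n)) * norm w"
      by (metis inverse_positive_iff_positive not_le of_nat_0_less_iff zero_less_Suc)
    then obtain s w where sw: "\<And>n. 0 \<le> s n" "\<And>n. s n \<le> (1::real)"
      "\<And>n. norm (w n + s n *\<^sub>R A (w n)) < inverse (real (Suc n)) * norm (w n)" by metis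
    have w0: "w n \<noteq> 0" for n using sw(3)[of n] by auto
    define x where "x n = w n /\<^sub>R norm (w n)" for n
    have x1: "norm (x n) = 1" for n using w0 by (simp add: x_def)
    have xs: "norm (x n + s n *\<^sub>R A (x n)) \<le> inverse (real (Suc n))" for n
    proof -
      have "x n + s n *\<^sub>R A (x n) = (w n + s n *\<^sub>R A (w n)) /\<^sub>R norm (w n)"
        by (simp add: x_def A.scaleR scaleR_add_right)
      then show ?thesis using sw(3)[of n] w0[of n] by (simp add: divide_simps mult.commute)
    qed
    have "bounded (range x)" unfolding bounded_iff using x1 by auto
    then obtain l r where r: "strict_mono r" "(\<lambda>n. A (x (r n))) \<longlonglongrightarrow> l" using cpt by blast
    have "seq_compact {0..1::real}" by (simp add: compact_imp_seq_compact)
    then obtain t q where q: "t \<in> {0..1}" "strict_mono q" "((\<lambda>n. s (r n)) \<circ> q) \<longlonglongrightarrow> t"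
      by (rule seq_compactE[where f = "\<lambda>n. s (r n)"]) (use sw in auto)
    define p where "p n = r (q n)" for n
    have p: "strict_mono p" using strict_mono_o[OF r(1) q(2)] by (simp add: p_def[abs_def] o_def)
    have Ap: "(\<lambda>n. A (x (p n))) \<longlonglongrightarrow> l" using LIMSEQ_subseq_LIMSEQ[OF r(2) q(2)] by (simp add: p_def o_def)
    have sp: "(\<lambda>n. s (p n)) \<longlonglongrightarrow> t" using q(3) by (simp add: p_def o_def)
    have "(\<lambda>n. x n + s n *\<^sub>R A (x n)) \<longlonglongrightarrow> 0"
      by (rule Lim_null_comparison[OF _ LIMSEQ_inverse_real_of_nat]) (use xs in auto)
    from LIMSEQ_subseq_LIMSEQ[OF this p] have z: "(\<lambda>n. x (p n) + s (p n) *\<^sub>R A (x (p n))) \<longlonglongrightarrow> 0" by (simp add: o_def)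
    have "(\<lambda>n. (x (p n) + s (p n) *\<^sub>R A (x (p n))) - s (p n) *\<^sub>R A (x (p n))) \<longlonglongrightarrow> 0 - t *\<^sub>R l"
      by (intro tendsto_intros z sp Ap)
    then have xl: "(\<lambda>n. x (p n)) \<longlonglongrightarrow> - (t *\<^sub>R l)" by simp
    have "norm (- (t *\<^sub>R l)) = 1" using tendsto_norm[OF xl] x1 by (simp add: LIMSEQ_const_iff)
    moreover have "A (- (t *\<^sub>R l)) = l" using LIMSEQ_unique[OF A.tendsto[OF xl] Ap] .
    then have "- (t *\<^sub>R l) = 0" using inj[of t "- (t *\<^sub>R l)"] q(1) by auto
    ultimately show False by simp
  qed
  then obtain \<kappa> where \<kappa>: "\<kappa> > 0" "\<And>s w. 0 \<le> s \<Longrightarrow> s \<le> 1 \<Longrightarrow> \<kappa> * norm w \<le> norm (w + s *\<^sub>R A w)" by blast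
  obtain M where M: "M > 0" "\<And>w. norm (A w) \<le> norm w * M" using A.pos_bounded by blast
  \<comment> \<open>A step length \<open>1 / N\<close> below \<open>\<kappa> / M\<close> makes the
    fixed point map a contraction.\<close>
  obtain N where N: "M / \<kappa> < real N" using reals_Archimedean2 by blast
  have N0: "N > 0" using N M \<kappa> by (metis divide_pos_pos gr0I less_trans of_nat_0 order_less_irrefl)
  have surj: "\<exists>w. w + (real k / real N) *\<^sub>R A w = y" if "k \<le> N" for k y
    using that
  proof (induction k arbitrary: y)
    case (Suc k)
    define s where "s = real k / real N"
    have s: "0 \<le> s" "s \<le> 1" using Suc.prems N0 by (auto simp: s_def)
    have "\<forall>y. \<exists>w. w + s *\<^sub>R A w = y" using Suc by (simp add: s_def)
    then obtain B where B: "\<And>y. B y + s *\<^sub>R A (B y) = y" by metis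
    have Bd: "\<kappa> * norm (B y - B y') \<le> norm (y - y')" for y y'
    proof -
      have "(B y - B y') + s *\<^sub>R A (B y - B y') = (B y + s *\<^sub>R A (B y)) - (B y' + s *\<^sub>R A (B y'))"
        by (simp add: A.diff scaleR_diff_right)
      then show ?thesis using \<kappa>(2)[OF s, of "B y - B y'"] by (simp add: B)
    qed
    define F where "F w = B (y - (1 / real N) *\<^sub>R A w)" for w
    have "\<exists>!w. F w = w"
    proof (rule banach_fix_type[of "M / (\<kappa> * real N)"])
      show "0 \<le> M / (\<kappa> * real N)" "M / (\<kappa> * real N) < 1" using M \<kappa> N N0 by (auto simp: field_simps)
      show "\<forall>x y. dist (F x) (F y) \<le> M / (\<kappa> * real N) * dist x y"
      proof (intro allI)
        fix a b
        have "\<kappa> * norm (F a - F b) \<le> norm ((1 / real N) *\<^sub>R A (b - a))"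
          using Bd[of "y - (1 / real N) *\<^sub>R A a" "y - (1 / real N) *\<^sub>R A b"] by (simp add: F_def A.diff scaleR_diff_right)
        also have "\<dots> \<le> (1 / real N) * (norm (a - b) * M)"
          using M(2)[of "b - a"] by (simp add: norm_minus_commute divide_right_mono)
        finally show "dist (F a) (F b) \<le> M / (\<kappa> * real N) * dist a b"
          using \<kappa>(1) N0 by (simp add: dist_norm field_simps)
      qed
    qed
    then obtain w where "F w = w" by blast
    then have "w + s *\<^sub>R A w = y - (1 / real N) *\<^sub>R A w" using B[of "y - (1 / real N) *\<^sub>R A w"] by (simp add: F_def)
    then have "w + (s + 1 / real N) *\<^sub>R A w = y" by (simp add: scaleR_add_left algebra_simps)
    moreover have "s + 1 / real N = real (Suc k) / real N" by (simp add: s_def add_divide_distrib)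
    ultimately show ?case by metis
  qed simp
  show thesis
    by (rule that[OF \<kappa>(1)]) (use \<kappa>(2)[of 1] surj[of N] N0 in auto)
qed

section \<open>Solvability of the Dirichlet problem with drift\<close>

text \<open>\<open>csol R v c u p h\<close>: \<open>u\<close> is a solution of \<open>- \<Delta>u + v \<bullet> \<nabla>u + c u = h\<close> in the ball that vanishes on
  the sphere and is continuously differentiable up to the boundary, with gradient \<open>p\<close>.\<close>

definition csol :: "real \<Rightarrow> ('a::euclidean_space \<Rightarrow> 'a) \<Rightarrow> real \<Rightarrow> ('a \<Rightarrow> real) \<Rightarrow> ('a \<Rightarrow> 'a) \<Rightarrow> ('a \<Rightarrow> real) \<Rightarrow> bool" where
  "csol R v c u p h \<longleftrightarrow> continuous_on (cball 0 R) p \<and>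
     (\<forall>x\<in>cball 0 R. (u has_derivative (\<lambda>k. p x \<bullet> k)) (at x within cball 0 R)) \<and>
     (\<forall>x. R \<le> norm x \<longrightarrow> u x = 0) \<and> (\<forall>x. R < norm x \<longrightarrow> p x = 0) \<and>
     (\<forall>\<psi> d\<psi>. test_fun (ball 0 R) \<psi> d\<psi> \<longrightarrow> wform v c u p \<psi> d\<psi> = (\<integral>x. h x * \<psi> x \<partial>lborel))"

lemma csolD:
  assumes "csol R v c u p h"
  shows "continuous_on (cball 0 R) p" "x \<in> cball 0 R \<Longrightarrow> (u has_derivative (\<lambda>k. p x \<bullet> k)) (at x within cball 0 R)"
    "R \<le> norm x \<Longrightarrow> u x = 0" "R < norm x \<Longrightarrow> p x = 0"
    "test_fun (ball 0 R) \<psi> d\<psi> \<Longrightarrow> wform v c u p \<psi> d\<psi> = (\<integral>x. h x * \<psi> x \<partial>lborel)"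
  using assms unfolding csol_def by auto

lemma csol_continuous: "csol R v c u p h \<Longrightarrow> continuous_on (cball 0 R) u"
  unfolding continuous_on_eq_continuous_within by (meson csolD(2) has_derivative_continuous)

lemma csol_derivative:
  assumes s: "csol R v c u p h" and x: "x \<in> ball 0 R"
  shows "(u has_derivative (\<lambda>k. p x \<bullet> k)) (at x)"
proof -
  have "(u has_derivative (\<lambda>k. p x \<bullet> k)) (at x within ball 0 R)"
    by (rule has_derivative_subset[OF csolD(2)[OF s]]) (use x in auto)
  then show ?thesis using x by (metis at_within_open open_ball)
qed

lemma borel_measurable_zero_outside:
  fixes f :: "'a::euclidean_space \<Rightarrow> 'b::real_normed_vector"
  assumes "continuous_on S f" "closed S" "\<And>x. x \<notin> S \<Longrightarrow> f x = 0"
  shows "f \<in> borel_measurable borel"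
proof -
  have "(\<lambda>x. indicator S x *\<^sub>R f x) \<in> borel_measurable borel"
    by (rule borel_measurable_continuous_on_indicator[OF _ assms(1)]) (use assms(2) in simp)
  also have "(\<lambda>x. indicator S x *\<^sub>R f x) = f" using assms(3) by (auto simp: indicator_def fun_eq_iff)
  finally show ?thesis .
qed

lemma csol_measurable:
  assumes "csol R v c u p h"
  shows "u \<in> borel_measurable borel" "p \<in> borel_measurable borel"
  using csolD(3,4)[OF assms]
  by (auto intro!: borel_measurable_zero_outside[OF csol_continuous[OF assms]] borel_measurable_zero_outside[OF csolD(1)[OF assms]])

lemma compact_continuous_bounded:
  fixes f :: "'a::topological_space \<Rightarrow> 'b::real_normed_vector"
  assumes "continuous_on K f" "compact K"
  obtains C where "C > 0" "\<And>x. x \<in> K \<Longrightarrow> norm (f x) \<le> C"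
  using compact_imp_bounded[OF compact_continuous_image[OF assms]] unfolding bounded_pos by auto

lemma csol_weak_grad:
  assumes s: "csol R v c u p h"
  shows "weak_grad (ball 0 R) u p"
proof -
  obtain A where A: "\<And>x. x \<in> cball 0 R \<Longrightarrow> norm (u x) \<le> A"
    using compact_continuous_bounded[OF csol_continuous[OF s] compact_cball] by metis
  obtain B where B: "\<And>x. x \<in> cball 0 R \<Longrightarrow> norm (p x) \<le> B"
    using compact_continuous_bounded[OF csolD(1)[OF s] compact_cball] by metis
  show ?thesis
  proof (rule weak_grad_classical[where C = "max A B"])
    show "continuous_on (ball 0 R) p" by (rule continuous_on_subset[OF csolD(1)[OF s] ball_subset_cball])
    show "\<bar>u x\<bar> \<le> max A B" if "x \<in> ball 0 R" for x using A[of x] that by auto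
    show "norm (p x) \<le> max A B" if "x \<in> ball 0 R" for x using B[of x] that by auto
  qed (use csol_derivative[OF s] csol_measurable[OF s] in auto)
qed

definition prj :: "real \<Rightarrow> 'a::euclidean_space \<Rightarrow> 'a" where
  "prj R = closest_point (cball 0 R)"

lemma prj:
  assumes "R > 0"
  shows "continuous_on UNIV (prj R)" "prj R x \<in> cball 0 R" "x \<in> cball 0 R \<Longrightarrow> prj R x = x"
proof -
  show "continuous_on UNIV (prj R)" unfolding prj_def using assms by (intro continuous_on_closest_point) auto
  show "prj R x \<in> cball 0 R" unfolding prj_def using assms by (intro closest_point_in_set) auto
  show "x \<in> cball 0 R \<Longrightarrow> prj R x = x" unfolding prj_def by (rule closest_point_self)
qed

text \<open>Composition with the projection onto the ball makes the normalised potential and its gradient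
  one bounded continuous function on the whole space, an element of a Banach space.\<close>

definition gsol :: "real \<Rightarrow> ('a::euclidean_space \<Rightarrow> real) \<Rightarrow> 'a \<Rightarrow>\<^sub>C (real \<times> 'a)" where
  "gsol R f = Bcontfun (\<lambda>x. (gpot R f (prj R x) / tconst TYPE('a), ggrad R f (prj R x) /\<^sub>R tconst TYPE('a)))"

definition gsol_const :: "'a::euclidean_space itself \<Rightarrow> real \<Rightarrow> real" where
  "gsol_const _ R = (24 * sing_const TYPE('a) * R\<^sup>2 + 12 * sing_const TYPE('a) * R) / tconst TYPE('a)"

lemma gsol_const_pos: "R > 0 \<Longrightarrow> gsol_const TYPE('a::euclidean_space) R > 0"
  unfolding gsol_const_def using tconst_pos[where 'a = 'a] sing_const_pos[where ?'a = 'a]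
  by (intro divide_pos_pos add_pos_pos mult_pos_pos) auto

context
  fixes R :: real
  assumes R: "R > 0"
begin

lemma gsol_bound_aux:
  fixes f :: "'a::euclidean_space \<Rightarrow> real"
  assumes f: "bfun R M f" and x: "x \<in> cball 0 R"
  shows "norm (gpot R f x / tconst TYPE('a), ggrad R f x /\<^sub>R tconst TYPE('a)) \<le> gsol_const TYPE('a) R * M"
proof -
  let ?k = "tconst TYPE('a)"
  have k: "?k > 0" by (rule tconst_pos)
  have n: "norm (ggrad R f x /\<^sub>R ?k) = norm (ggrad R f x) / ?k" "norm (gpot R f x / ?k) = \<bar>gpot R f x\<bar> / ?k"
    using k by (auto simp: divide_inverse mult.commute abs_mult)
  have "norm (gpot R f x / ?k, ggrad R f x /\<^sub>R ?k) \<le> \<bar>gpot R f x\<bar> / ?k + norm (ggrad R f x) / ?k"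
    unfolding n[symmetric] by (rule norm_Pair_le)
  also have "\<dots> \<le> (24 * sing_const TYPE('a) * R\<^sup>2 * M) / ?k + (12 * sing_const TYPE('a) * R * M) / ?k"
    using gpot_bound[OF R f x] ggrad_bound[OF R f x] k by (intro add_mono divide_right_mono) auto
  also have "\<dots> = gsol_const TYPE('a) R * M" unfolding gsol_const_def by (simp add: add_divide_distrib distrib_right)
  finally show ?thesis .
qed

lemma gsol_apply:
  fixes f :: "'a::euclidean_space \<Rightarrow> real"
  assumes f: "bfun R M f"
  shows "apply_bcontfun (gsol R f) x = (gpot R f (prj R x) / tconst TYPE('a), ggrad R f (prj R x) /\<^sub>R tconst TYPE('a))"
proof -
  have "(\<lambda>x. (gpot R f (prj R x) / tconst TYPE('a), ggrad R f (prj R x) /\<^sub>R tconst TYPE('a))) \<in> bcontfun"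
  proof (rule bcontfun_normI)
    show "continuous_on UNIV (\<lambda>x. (gpot R f (prj R x) / tconst TYPE('a), ggrad R f (prj R x) /\<^sub>R tconst TYPE('a)))"
      using tconst_pos[where 'a = 'a] prj[OF R]
      by (intro continuous_intros continuous_on_compose2[OF gpot_continuous[OF R f] prj(1)[OF R]]
          continuous_on_compose2[OF ggrad_continuous[OF R f] prj(1)[OF R]]) auto
    show "norm (gpot R f (prj R x) / tconst TYPE('a), ggrad R f (prj R x) /\<^sub>R tconst TYPE('a)) \<le> gsol_const TYPE('a) R * M" for x
      by (rule gsol_bound_aux[OF f prj(2)[OF R]])
  qed
  then show ?thesis unfolding gsol_def by (simp add: Bcontfun_inverse)
qed

lemma gsol_norm:
  fixes f :: "'a::euclidean_space \<Rightarrow> real"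
  assumes f: "bfun R M f"
  shows "norm (gsol R f) \<le> gsol_const TYPE('a) R * M"
  by (rule norm_bound) (simp only: gsol_apply[OF f] gsol_bound_aux[OF f prj(2)[OF R]])

lemma gsol_lincomb:
  fixes f g :: "'a::euclidean_space \<Rightarrow> real"
  assumes f: "bfun R M f" and g: "bfun R N g"
  shows "gsol R (\<lambda>y. a * f y + b * g y) = a *\<^sub>R gsol R f + b *\<^sub>R gsol R g"
proof (rule bcontfun_eqI)
  fix x
  have h: "bfun R (\<bar>a\<bar> * M + \<bar>b\<bar> * N) (\<lambda>y. a * f y + b * g y)" by (intro bfun_add bfun_scale f g)
  show "apply_bcontfun (gsol R (\<lambda>y. a * f y + b * g y)) x = apply_bcontfun (a *\<^sub>R gsol R f + b *\<^sub>R gsol R g) x"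
    using gpot_lincomb[OF R f g prj(2)[OF R]] ggrad_lincomb[OF R f g prj(2)[OF R]]
    by (simp add: gsol_apply[OF f] gsol_apply[OF g] gsol_apply[OF h] add_divide_distrib scaleR_add_right mult.commute)
qed

text \<open>Arzela-Ascoli for values and gradients together: the potentials are uniformly Lipschitz,
  the gradients equicontinuous by \<open>ggrad_modulus\<close>. Compactness thus holds for C^1
  convergence, which makes the drift term a compact perturbation.\<close>

lemma gsol_compact:
  fixes f :: "nat \<Rightarrow> 'a::euclidean_space \<Rightarrow> real"
  assumes f: "\<And>n. bfun R M (f n)"
  shows "\<exists>l r. strict_mono r \<and> (\<lambda>n. gsol R (f (r n))) \<longlonglongrightarrow> l"
proof -
  let ?k = "tconst TYPE('a)"
  have k: "?k > 0" by (rule tconst_pos)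
  define F where "F n x = (gpot R (f n) x / ?k, ggrad R (f n) x /\<^sub>R ?k)" for n x
  define L where "L = 12 * sing_const TYPE('a) * R * M / ?k"
  have M0: "M \<ge> 0" by (rule bfunD(4)[OF f])
  have L0: "L \<ge> 0" using R M0 k sing_const_pos[where ?'a = 'a] by (simp add: L_def)
  have f': "bfun R (M + 1) (f n)" for n using f[of n] by (auto simp: bfun_def intro: order_trans[of _ M])
  obtain g r where g: "continuous_on (cball 0 R) g" "strict_mono (r :: nat \<Rightarrow> nat)"
    "\<And>e. 0 < e \<Longrightarrow> \<exists>N. \<forall>n x. n \<ge> N \<and> x \<in> cball 0 R \<longrightarrow> norm (F (r n) x - g x) < e"
  proof (rule Arzela_Ascoli[of "cball (0::'a) R" F "gsol_const TYPE('a) R * M"])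
    show "norm (F n x) \<le> gsol_const TYPE('a) R * M" if "x \<in> cball 0 R" for n x
      unfolding F_def by (rule gsol_bound_aux[OF f that])
    show "\<exists>d>0. \<forall>n y. y \<in> cball 0 R \<and> norm (x - y) < d \<longrightarrow> norm (F n x - F n y) < e"
      if x: "x \<in> cball 0 R" and e: "0 < e" for x e
    proof -
      obtain d where d: "d > 0" "\<And>f x x'. bfun R (M + 1) f \<Longrightarrow> (x::'a) \<in> cball 0 R \<Longrightarrow> x' \<in> cball 0 R \<Longrightarrow>
          norm (x - x') < d \<Longrightarrow> norm (ggrad R f x - ggrad R f x') < e * ?k / 2"
        using ggrad_modulus[OF R, of "e * ?k / 2" "M + 1", where 'a = 'a] e k M0 by (metis add_nonneg_pos half_gt_zero mult_pos_pos zero_less_one)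
      show ?thesis
      proof (intro exI[of _ "min d (e / (2 * (L + 1)))"] conjI allI impI)
        show "0 < min d (e / (2 * (L + 1)))" using d(1) e L0 by simp
        fix n y assume y: "y \<in> cball 0 R \<and> norm (x - y) < min d (e / (2 * (L + 1)))"
        have "\<bar>gpot R (f n) x - gpot R (f n) y\<bar> / ?k \<le> L * norm (x - y)"
          using gpot_lipschitz[OF R f[of n] x, of y] y k by (simp add: L_def divide_right_mono)
        also have "\<dots> \<le> L * (e / (2 * (L + 1)))" using y L0 by (intro mult_left_mono) auto
        also have "\<dots> \<le> e / 2" using L0 e by (simp add: field_simps)
        finally have 1: "\<bar>(gpot R (f n) x - gpot R (f n) y) / ?k\<bar> \<le> e / 2" using k by simp
        have "norm (ggrad R (f n) x - ggrad R (f n) y) < e * ?k / 2" using d(2)[OF f' x, of y n] y by simp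
        moreover have "norm ((ggrad R (f n) x - ggrad R (f n) y) /\<^sub>R ?k) = norm (ggrad R (f n) x - ggrad R (f n) y) / ?k"
          using k by (simp only: norm_scaleR) (simp add: divide_inverse mult.commute)
        ultimately have 2: "norm ((ggrad R (f n) x - ggrad R (f n) y) /\<^sub>R ?k) < e / 2" using k by (simp add: pos_divide_less_eq)
        have "F n x - F n y = ((gpot R (f n) x - gpot R (f n) y) / ?k, (ggrad R (f n) x - ggrad R (f n) y) /\<^sub>R ?k)"
          by (simp add: F_def diff_divide_distrib scaleR_diff_right)
        then show "norm (F n x - F n y) < e"
          using norm_Pair_le[of "(gpot R (f n) x - gpot R (f n) y) / ?k" "(ggrad R (f n) x - ggrad R (f n) y) /\<^sub>R ?k"] 1 2
          by (simp only: real_norm_def)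
      qed
    qed
  qed (use compact_cball in blast)+
  obtain C where C: "\<And>x. x \<in> cball 0 R \<Longrightarrow> norm (g x) \<le> C"
    using compact_continuous_bounded[OF g(1) compact_cball] by metis
  define l where "l = Bcontfun (\<lambda>x. g (prj R x))"
  have "(\<lambda>x. g (prj R x)) \<in> bcontfun"
    by (rule bcontfun_normI[of _ C])
      (use C prj[OF R] in \<open>auto intro!: continuous_on_compose2[OF g(1) prj(1)[OF R]]\<close>)
  then have l: "apply_bcontfun l x = g (prj R x)" for x by (simp add: l_def Bcontfun_inverse)
  have "(\<lambda>n. gsol R (f (r n))) \<longlonglongrightarrow> l"
  proof (rule LIMSEQ_I)
    fix e :: real assume e: "e > 0"
    then obtain N where N: "\<And>n x. n \<ge> N \<Longrightarrow> x \<in> cball 0 R \<Longrightarrow> norm (F (r n) x - g x) < e / 2"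
      using g(3)[of "e / 2"] by (metis half_gt_zero)
    have "norm (gsol R (f (r n)) - l) \<le> e / 2" if "n \<ge> N" for n
    proof (rule norm_bound)
      show "norm (apply_bcontfun (gsol R (f (r n)) - l) x) \<le> e / 2" for x
        using N[OF that prj(2)[OF R], of x] by (simp add: l gsol_apply[OF f] F_def)
    qed
    then show "\<exists>N. \<forall>n\<ge>N. norm (gsol R (f (r n)) - l) < e" using e by (intro exI[of _ N]) fastforce
  qed
  then show ?thesis using g(2) by blast
qed

lemma gsol_csol:
  fixes f :: "'a::euclidean_space \<Rightarrow> real"
  assumes f: "bfun R M f"
  defines "u \<equiv> \<lambda>x. if x \<in> cball 0 R then fst (apply_bcontfun (gsol R f) x) else 0"
    and "p \<equiv> \<lambda>x. if x \<in> cball 0 R then snd (apply_bcontfun (gsol R f) x) else 0"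
  shows "csol R (\<lambda>_. 0) 0 u p f"
proof -
  let ?k = "tconst TYPE('a)"
  have k: "?k > 0" by (rule tconst_pos)
  have u: "u x = gpot R f x / ?k" and p: "p x = ggrad R f x /\<^sub>R ?k" if "x \<in> cball 0 R" for x
    using that by (simp_all add: u_def p_def gsol_apply[OF f] prj(3)[OF R])
  show ?thesis unfolding csol_def
  proof (intro conjI ballI allI impI)
    show "continuous_on (cball 0 R) p"
      by (rule continuous_on_eq[of _ "\<lambda>x. ggrad R f x /\<^sub>R ?k"])
        (use p ggrad_continuous[OF R f] in \<open>auto intro!: continuous_intros\<close>)
    fix x assume x: "x \<in> cball (0::'a) R"
    have "((\<lambda>x. gpot R f x / ?k) has_derivative (\<lambda>h. (ggrad R f x \<bullet> h) / ?k)) (at x within cball 0 R)"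
      by (rule bounded_linear.has_derivative[OF bounded_linear_divide gpot_derivative[OF R f x]])
    then show "(u has_derivative (\<lambda>h. p x \<bullet> h)) (at x within cball 0 R)"
      unfolding p[OF x] by (intro has_derivative_transform[OF x u, of "\<lambda>x. x"]) (simp_all add: divide_inverse mult.commute)
  next
    fix x :: 'a assume "R \<le> norm x"
    then show "u x = 0" using u[of x] gpot_boundary[OF R f, of x] by (cases "norm x = R") (auto simp: u_def)
  next
    fix x :: 'a assume "R < norm x" then show "p x = 0" by (simp add: p_def)
  next
    fix \<psi> d\<psi> assume t: "test_fun (ball (0::'a) R) \<psi> d\<psi>"
    have "p x \<bullet> d\<psi> x = (ggrad R f x \<bullet> d\<psi> x) / ?k" for x
      using p[of x] test_fun_zero_outside(2)[OF t, of x] by (cases "x \<in> ball 0 R") (auto simp: divide_inverse)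
    then have "(\<integral>x. p x \<bullet> d\<psi> x \<partial>lborel) = (\<integral>x. f x * \<psi> x \<partial>lborel)"
      using ggrad_weak[OF R f t] k by simp
    then show "wform (\<lambda>_. 0) 0 u p \<psi> d\<psi> = (\<integral>x. f x * \<psi> x \<partial>lborel)" by (simp add: wform_def)
  qed
qed

lemma csol_max_principle:
  fixes v :: "'a::euclidean_space \<Rightarrow> 'a"
  assumes v: "v \<in> borel_measurable borel" "\<And>x. norm (v x) \<le> \<tau>" and c: "c > \<tau>\<^sup>2 / 8"
    and s: "csol R v c u p h" and h: "\<And>\<psi>. (\<And>x. 0 \<le> \<psi> x) \<Longrightarrow> (\<integral>x. h x * \<psi> x \<partial>lborel) \<le> 0"
  shows "u x \<le> 0"
proof (cases "x \<in> cball 0 R")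
  case True
  show ?thesis
  proof (rule energy_max_principle[OF open_ball bounded_ball v c csol_weak_grad[OF s]])
    show "continuous_on (closure (ball 0 R)) u" using csol_continuous[OF s] R by simp
    show "u y \<le> 0" if "y \<in> frontier (ball 0 R)" for y using that csolD(3)[OF s, of y] R by simp
    show "wform v c u p \<psi> d\<psi> \<le> 0" if "test_fun (ball 0 R) \<psi> d\<psi>" "\<And>x. 0 \<le> \<psi> x" for \<psi> d\<psi>
      using csolD(5)[OF s that(1)] h[OF that(2)] by simp
    show "x \<in> closure (ball 0 R)" using True R by simp
  qed
qed (use csolD(3)[OF s, of x] in simp)

lemma csol_lincomb:
  fixes v :: "'a::euclidean_space \<Rightarrow> 'a"
  assumes v: "v \<in> borel_measurable borel" "\<And>x. norm (v x) \<le> \<tau>"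
    and s: "csol R v c u1 p1 h1" "csol R v c u2 p2 h2" and h: "bfun R M h1" "bfun R N h2"
  shows "csol R v c (\<lambda>x. a * u1 x + b * u2 x) (\<lambda>x. a *\<^sub>R p1 x + b *\<^sub>R p2 x) (\<lambda>x. a * h1 x + b * h2 x)"
  unfolding csol_def
proof (intro conjI ballI allI impI)
  show "continuous_on (cball 0 R) (\<lambda>x. a *\<^sub>R p1 x + b *\<^sub>R p2 x)"
    by (intro continuous_intros csolD(1)[OF s(1)] csolD(1)[OF s(2)])
  fix x assume x: "x \<in> cball (0::'a) R"
  show "((\<lambda>x. a * u1 x + b * u2 x) has_derivative (\<lambda>k. (a *\<^sub>R p1 x + b *\<^sub>R p2 x) \<bullet> k)) (at x within cball 0 R)"
    by (rule has_derivative_eq_rhs[OF has_derivative_add[OF has_derivative_mult_right[OF csolD(2)[OF s(1) x]]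
            has_derivative_mult_right[OF csolD(2)[OF s(2) x]]]]) (simp add: inner_add_left fun_eq_iff)
next
  fix \<psi> d\<psi> assume t: "test_fun (ball (0::'a) R) \<psi> d\<psi>"
  have i: "integrable lborel (\<lambda>x. h1 x * \<psi> x)" "integrable lborel (\<lambda>x. h2 x * \<psi> x)"
  proof -
    have iB: "integrable lborel (\<lambda>x. indicator (ball 0 R) x * f x)" if "bfun R M f" for f :: "'a \<Rightarrow> real" and M
      by (rule integrable_bounded_support[where S = "cball 0 R" and C = M])
        (use bfunD[OF that] in \<open>auto simp: indicator_def\<close>)
    show "integrable lborel (\<lambda>x. h1 x * \<psi> x)" "integrable lborel (\<lambda>x. h2 x * \<psi> x)"
      by (rule test_fun_integrable[OF t bfunD(1)[OF h(1)] _ iB[OF h(1)]], simp)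
        (rule test_fun_integrable[OF t bfunD(1)[OF h(2)] _ iB[OF h(2)]], simp)
  qed
  have "wform v c (\<lambda>x. a * u1 x + b * u2 x) (\<lambda>x. a *\<^sub>R p1 x + b *\<^sub>R p2 x) \<psi> d\<psi>
      = a * (\<integral>x. h1 x * \<psi> x \<partial>lborel) + b * (\<integral>x. h2 x * \<psi> x \<partial>lborel)"
    by (subst wform_lincomb[OF _ bounded_ball v csol_weak_grad[OF s(1)] csol_weak_grad[OF s(2)] t])
      (use csolD(5)[OF s(1) t] csolD(5)[OF s(2) t] in auto)
  also have "\<dots> = (\<integral>x. a * (h1 x * \<psi> x) + b * (h2 x * \<psi> x) \<partial>lborel)" using i by simp
  finally show "wform v c (\<lambda>x. a * u1 x + b * u2 x) (\<lambda>x. a *\<^sub>R p1 x + b *\<^sub>R p2 x) \<psi> d\<psi> = (\<integral>x. (a * h1 x + b * h2 x) * \<psi> x \<partial>lborel)"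
    by (simp add: distrib_right mult.assoc)
qed (use csolD(3,4)[OF s(1)] csolD(3,4)[OF s(2)] in auto)

lemma csol_gradient_zero:
  assumes s: "csol R v c u p h" and u: "\<And>x. u x = 0"
  shows "p x = 0"
proof (cases "x \<in> cball 0 R")
  case True
  have "p y = 0" if "y \<in> ball 0 R" for y
  proof -
    have "u = (\<lambda>_. 0)" using u by auto
    then have "((\<lambda>_. 0) has_derivative (\<lambda>k. p y \<bullet> k)) (at y)" using csol_derivative[OF s that] by simp
    then have "(\<lambda>k. p y \<bullet> k) = (\<lambda>_. 0)" using has_derivative_unique has_derivative_const by blast
    then have "p y \<bullet> p y = 0" by meson
    then show ?thesis by simp
  qed
  then show ?thesis
    using continuous_constant_on_closure[of "ball 0 R" p 0 x] csolD(1)[OF s] True R by simp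
qed (use csolD(4)[OF s, of x] in simp)

text \<open>The unknown is the pair w of solution and gradient. Moving the lower-order terms to the
  right-hand side turns the problem into \<open>w + A w = gsol R h\<close> with A compact;
  injectivity along the homotopy is the maximum principle for the drift \<open>s *\<^sub>R v\<close>
  and the zero-order term \<open>s * c\<close>.\<close>

theorem dirichlet_problem_solvable:
  fixes v :: "'a::euclidean_space \<Rightarrow> 'a"
  assumes v: "v \<in> borel_measurable borel" "\<And>x. norm (v x) \<le> \<tau>" and c: "c > \<tau>\<^sup>2 / 8"
  obtains C where "C > 0"
    "\<And>h M. bfun R M h \<Longrightarrow> \<exists>u p. csol R v c u p h \<and> (\<forall>x. \<bar>u x\<bar> \<le> C * M) \<and> (\<forall>x. norm (p x) \<le> C * M)"
proof -
  note [measurable] = v(1)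
  have \<tau>: "\<tau> \<ge> 0" using order_trans[OF norm_ge_zero v(2)] .
  have c0: "c > 0" using c zero_le_power2[of \<tau>] by linarith
  define q :: "('a \<Rightarrow>\<^sub>C (real \<times> 'a)) \<Rightarrow> 'a \<Rightarrow> real" where
    "q w y = (if y \<in> cball 0 R then v y \<bullet> snd (apply_bcontfun w y) + c * fst (apply_bcontfun w y) else 0)" for w y
  have q: "bfun R ((\<tau> + c) * norm w) (q w)" for w
    unfolding bfun_def
  proof (intro conjI allI impI)
    have [measurable]: "apply_bcontfun w \<in> borel_measurable borel"
      by (rule borel_measurable_continuous_onI[OF continuous_on_apply_bcontfun])
    have fs: "(\<lambda>y. snd (apply_bcontfun w y)) \<in> borel_measurable borel" "(\<lambda>y. fst (apply_bcontfun w y)) \<in> borel_measurable borel"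
      by (intro borel_measurable_continuous_onI continuous_intros continuous_on_apply_bcontfun)+
    note [measurable] = fs
    have cb: "cball (0::'a) R \<in> sets borel" by simp
    note [measurable] = cb
    show "q w \<in> borel_measurable borel" unfolding q_def by measurable
    show "q w y = 0" if "y \<notin> cball 0 R" for y using that by (simp add: q_def)
    show "\<bar>q w y\<bar> \<le> (\<tau> + c) * norm w" for y
    proof (cases "y \<in> cball 0 R")
      case True
      have 1: "norm (snd (apply_bcontfun w y)) \<le> norm w" "\<bar>fst (apply_bcontfun w y)\<bar> \<le> norm w"
        using norm_bounded[of w y] norm_snd_le[of "snd (apply_bcontfun w y)" "fst (apply_bcontfun w y)"]
          norm_fst_le[of "fst (apply_bcontfun w y)" "snd (apply_bcontfun w y)"] by auto
      have "\<bar>v y \<bullet> snd (apply_bcontfun w y)\<bar> \<le> \<tau> * norm w"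
        by (rule order_trans[OF Cauchy_Schwarz_ineq2]) (intro mult_mono v(2) 1 \<tau> norm_ge_zero)
      moreover have "\<bar>c * fst (apply_bcontfun w y)\<bar> \<le> c * norm w" using 1 c0 by (simp add: abs_mult)
      ultimately show ?thesis using True by (simp add: q_def distrib_right)
    qed (use \<tau> c0 in \<open>simp add: q_def\<close>)
  qed
  define A where "A w = gsol R (q w)" for w
  have qlin: "q (a *\<^sub>R w + b *\<^sub>R w') = (\<lambda>y. a * q w y + b * q w' y)" for a b w w'
    by (auto simp: q_def fun_eq_iff inner_add_right algebra_simps)
  have Alin: "A (a *\<^sub>R w + b *\<^sub>R w') = a *\<^sub>R A w + b *\<^sub>R A w'" for a b w w'
    unfolding A_def qlin by (rule gsol_lincomb[OF q q])
  have bl: "bounded_linear A"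
  proof
    show "A (w + w') = A w + A w'" for w w' using Alin[of 1 w 1 w'] by simp
    show "A (a *\<^sub>R w) = a *\<^sub>R A w" for a w using Alin[of a w 0 w] by simp
    show "\<exists>K. \<forall>w. norm (A w) \<le> norm w * K"
      using gsol_norm[OF q] by (intro exI[of _ "gsol_const TYPE('a) R * (\<tau> + c)"]) (auto simp: A_def mult_ac)
  qed
  have cpt: "\<exists>l r. strict_mono r \<and> (\<lambda>n. A (X (r n))) \<longlonglongrightarrow> l" if "bounded (range X)" for X :: "nat \<Rightarrow> 'a \<Rightarrow>\<^sub>C (real \<times> 'a)"
  proof -
    obtain K where K: "\<And>n. norm (X n) \<le> K" using \<open>bounded (range X)\<close> unfolding bounded_iff by auto
    have "bfun R ((\<tau> + c) * K) (q (X n))" for n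
    proof -
      have "(\<tau> + c) * norm (X n) \<le> (\<tau> + c) * K" using K \<tau> c0 by (intro mult_left_mono) auto
      then show ?thesis using q[of "X n"] unfolding bfun_def by (meson order_trans)
    qed
    from gsol_compact[OF this] show ?thesis unfolding A_def .
  qed
  define U where "U w x = (if x \<in> cball 0 R then fst (apply_bcontfun w x) else 0)" for w :: "'a \<Rightarrow>\<^sub>C (real \<times> 'a)" and x
  define P where "P w x = (if x \<in> cball 0 R then snd (apply_bcontfun w x) else 0)" for w :: "'a \<Rightarrow>\<^sub>C (real \<times> 'a)" and x
  have solves: "csol R (\<lambda>x. s *\<^sub>R v x) (s * c) (U w) (P w) h" if w: "w + s *\<^sub>R A w = gsol R h" and h: "bfun R M h" for s w h M
  proof -
    \<comment> \<open>The equation says that w is itself the potential of h minus the lower-order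
      terms of w, so the drift-free theory applies to it.\<close>
    define f where "f y = 1 * h y + (- s) * q w y" for y
    have f: "bfun R (\<bar>1\<bar> * M + \<bar>- s\<bar> * ((\<tau> + c) * norm w)) f" unfolding f_def by (intro bfun_add bfun_scale h q)
    have "w = gsol R h - s *\<^sub>R A w" using w by (simp add: algebra_simps)
    also have "\<dots> = gsol R f" unfolding f_def A_def using gsol_lincomb[OF h q, of 1 "- s" w] by simp
    finally have wf: "w = gsol R f" .
    have s0: "csol R (\<lambda>_. 0) 0 (U w) (P w) f" unfolding U_def[abs_def] P_def[abs_def] wf by (rule gsol_csol[OF f])
    have z: "(\<lambda>_. 0::'a) \<in> borel_measurable borel" "\<And>x. norm ((\<lambda>_. 0::'a) x) \<le> \<tau>" using \<tau> by auto
    show ?thesis unfolding csol_def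
    proof (intro conjI ballI allI impI)
      fix \<psi> d\<psi> assume t: "test_fun (ball (0::'a) R) \<psi> d\<psi>"
      note I = weak_grad_integrable[OF _ bounded_ball v csol_weak_grad[OF s0] t]
      have iB: "integrable lborel (\<lambda>x. g x * \<psi> x)" if g: "bfun R N g" for g N
      proof (rule test_fun_integrable[OF t bfunD(1)[OF g]])
        show "integrable lborel (\<lambda>x. indicator (ball 0 R) x * g x)"
          by (rule integrable_bounded_support[where S = "cball 0 R" and C = N])
            (use bfunD[OF g] in \<open>auto simp: indicator_def\<close>)
      qed simp
      have e: "s * (q w x * \<psi> x) = (s *\<^sub>R v x \<bullet> P w x) * \<psi> x + s * c * U w x * \<psi> x" for x
        by (simp add: q_def U_def P_def algebra_simps)
      have "wform (\<lambda>x. s *\<^sub>R v x) (s * c) (U w) (P w) \<psi> d\<psi> = (\<integral>x. P w x \<bullet> d\<psi> x + s * (q w x * \<psi> x) \<partial>lborel)"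
        unfolding wform_def e by (simp add: add.assoc)
      also have "\<dots> = (\<integral>x. P w x \<bullet> d\<psi> x \<partial>lborel) + (\<integral>x. s * (q w x * \<psi> x) \<partial>lborel)"
        by (rule Bochner_Integration.integral_add) (use I(1) iB[OF q[of w]] in auto)
      also have "(\<integral>x. P w x \<bullet> d\<psi> x \<partial>lborel) = (\<integral>x. f x * \<psi> x \<partial>lborel)"
        using csolD(5)[OF s0 t] by (simp add: wform_def)
      also have "(\<integral>x. f x * \<psi> x \<partial>lborel) + (\<integral>x. s * (q w x * \<psi> x) \<partial>lborel) = (\<integral>x. h x * \<psi> x \<partial>lborel)"
        using iB[OF q[of w]] iB[OF h] iB[OF f] by (simp add: f_def left_diff_distrib mult.assoc)
      finally show "wform (\<lambda>x. s *\<^sub>R v x) (s * c) (U w) (P w) \<psi> d\<psi> = (\<integral>x. h x * \<psi> x \<partial>lborel)" .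
    qed (use csolD[OF s0] in auto)
  qed
  have inj: "w = 0" if s: "0 \<le> s" "s \<le> 1" and w: "w + s *\<^sub>R A w = 0" for s w
  proof (cases "s = 0")
    case False
    have z0: "bfun R 0 (\<lambda>_::'a. 0)" by (simp add: bfun_def)
    have g0: "gsol R (\<lambda>_::'a. 0) = 0" using gsol_lincomb[OF z0 z0, of 0 0] by simp
    have cs: "csol R (\<lambda>x. s *\<^sub>R v x) (s * c) (U w) (P w) (\<lambda>_. 0)" by (rule solves[OF _ z0]) (use w g0 in simp)
    have v': "(\<lambda>x. s *\<^sub>R v x) \<in> borel_measurable borel" "\<And>x. norm (s *\<^sub>R v x) \<le> s * \<tau>"
      using v(2) s by (auto intro: mult_left_mono)
    \<comment> \<open>From \<open>s ^ 2 \<le> s\<close>: the condition on c survives when the drift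
      and the zero-order term are scaled by the same s.\<close>
    have c': "s * c > (s * \<tau>)\<^sup>2 / 8"
    proof -
      have "s * s * \<tau>\<^sup>2 \<le> s * 1 * \<tau>\<^sup>2" using s by (intro mult_right_mono mult_left_mono) auto
      moreover have "s * (\<tau>\<^sup>2 / 8) < s * c" using s False c by (intro mult_strict_left_mono) auto
      moreover have "(s * \<tau>)\<^sup>2 = s * s * \<tau>\<^sup>2" by (simp add: power2_eq_square)
      ultimately show ?thesis by simp
    qed
    have "U w x \<le> 0" for x by (rule csol_max_principle[OF v' c' cs]) simp
    moreover have "- U w x \<le> 0" for x
    proof -
      have "csol R (\<lambda>x. s *\<^sub>R v x) (s * c) (\<lambda>x. (- 1) * U w x + 0 * U w x) (\<lambda>x. (- 1) *\<^sub>R P w x + 0 *\<^sub>R P w x) (\<lambda>x. (- 1) * 0 + 0 * 0)"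
        by (rule csol_lincomb[OF v' cs cs z0 z0])
      from csol_max_principle[OF v' c' this, of x] show ?thesis by simp
    qed
    ultimately have U0: "U w x = 0" for x by (simp add: order_antisym)
    have P0: "P w x = 0" for x by (rule csol_gradient_zero[OF cs U0])
    \<comment> \<open>w is a function on the whole space, but A reads it only on the ball; then
      \<open>A w = 0\<close>, and the equation makes w vanish everywhere.\<close>
    have z: "apply_bcontfun w x = 0" if "x \<in> cball 0 R" for x
      using U0[of x] P0[of x] that by (simp add: U_def P_def prod_eq_iff)
    have "q w = (\<lambda>_. 0)" using z by (auto simp: q_def fun_eq_iff)
    then have "A w = 0" using g0 by (simp add: A_def)
    then show ?thesis using w by simp
  qed (use w in simp)
  obtain \<kappa> where \<kappa>: "\<kappa> > 0" "\<And>w. \<kappa> * norm w \<le> norm (w + A w)" "\<And>y. \<exists>w. w + A w = y"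
  proof (rule compact_perturbation_invertible[of A])
    show "bounded_linear A" by (rule bl)
    show "\<exists>l r. strict_mono r \<and> (\<lambda>n. A (X (r n))) \<longlonglongrightarrow> l" if "bounded (range X)"
      for X :: "nat \<Rightarrow> 'a \<Rightarrow>\<^sub>C (real \<times> 'a)" by (rule cpt[OF that])
    show "w = 0" if "0 \<le> s" "s \<le> 1" "w + s *\<^sub>R A w = 0" for s w by (rule inj[OF that])
  qed blast
  show thesis
  proof (rule that[of "gsol_const TYPE('a) R / \<kappa>"])
    show "gsol_const TYPE('a) R / \<kappa> > 0" using gsol_const_pos[OF R, where 'a = 'a] \<kappa>(1) by simp
    fix h :: "'a \<Rightarrow> real" and M assume h: "bfun R M h"
    obtain w where w: "w + A w = gsol R h" using \<kappa>(3) by blast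
    have "csol R (\<lambda>x. 1 *\<^sub>R v x) (1 * c) (U w) (P w) h" by (rule solves[OF _ h]) (use w in simp)
    moreover have "norm w \<le> gsol_const TYPE('a) R / \<kappa> * M"
      using \<kappa>(2)[of w] w gsol_norm[OF h] \<kappa>(1) by (simp add: field_simps)
    moreover have "\<bar>U w x\<bar> \<le> norm w" "norm (P w x) \<le> norm w" for x
      using norm_bounded[of w x] norm_snd_le[of "snd (apply_bcontfun w x)" "fst (apply_bcontfun w x)"]
        norm_fst_le[of "fst (apply_bcontfun w x)" "snd (apply_bcontfun w x)"] by (auto simp: U_def P_def)
    ultimately show "\<exists>u p. csol R v c u p h \<and> (\<forall>x. \<bar>u x\<bar> \<le> gsol_const TYPE('a) R / \<kappa> * M) \<and> (\<forall>x. norm (p x) \<le> gsol_const TYPE('a) R / \<kappa> * M)"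
      by (intro exI[of _ "U w"] exI[of _ "P w"]) (auto intro: order_trans)
  qed
qed

end

section \<open>Propagation of positivity and linear growth at the sphere\<close>

section \<open>Strong maximum principle and Hopf lemma\<close>

text \<open>Hopf's barrier. Its Laplacian contains
  \<open>4 * \<alpha> ^ 2 * norm (x - x0) ^ 2\<close> times the Gaussian, which on the annulus, away
  from the centre, beats the other terms once \<alpha> is large.\<close>

lemma barrier_subsolution:
  fixes v :: "'a::euclidean_space \<Rightarrow> 'a" and x0 :: 'a
  assumes v: "v \<in> borel_measurable borel" "\<And>x. norm (v x) \<le> \<tau>" and c: "c \<ge> 0"
    and \<rho>: "0 < \<rho>" "\<rho> < D"
  defines "\<Omega> \<equiv> ball x0 D - cball x0 \<rho>"
  obtains \<alpha> where "\<alpha> > 0"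
    "weak_grad \<Omega> (\<lambda>x. exp (- \<alpha> * (norm (x - x0))\<^sup>2) - exp (- \<alpha> * D\<^sup>2)) (\<lambda>x. (- 2 * \<alpha> * exp (- \<alpha> * (norm (x - x0))\<^sup>2)) *\<^sub>R (x - x0))"
    "\<And>\<psi> d\<psi>. test_fun \<Omega> \<psi> d\<psi> \<Longrightarrow> (\<And>x. 0 \<le> \<psi> x) \<Longrightarrow>
      wform v c (\<lambda>x. exp (- \<alpha> * (norm (x - x0))\<^sup>2) - exp (- \<alpha> * D\<^sup>2)) (\<lambda>x. (- 2 * \<alpha> * exp (- \<alpha> * (norm (x - x0))\<^sup>2)) *\<^sub>R (x - x0)) \<psi> d\<psi> \<le> 0"
proof -
  note [measurable] = v(1)
  let ?n = "real DIM('a)"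
  have \<tau>: "\<tau> \<ge> 0" using order_trans[OF norm_ge_zero v(2)] .
  have D: "D > 0" using \<rho> by simp
  have \<Omega>: "open \<Omega>" "bounded \<Omega>" unfolding \<Omega>_def by (auto intro: bounded_subset[OF bounded_ball])
  \<comment> \<open>The terms to be beaten, divided by \<alpha>: \<open>2 * n\<close> from the
    Laplacian, \<open>2 * \<tau> * D\<close> from the drift, and c, where
    \<open>\<alpha> \<ge> 1\<close> replaces c by \<open>c * \<alpha>\<close>.\<close>
  define B where "B = 2 * ?n + 2 * \<tau> * D + c"
  define \<alpha> where "\<alpha> = max 1 (B / (4 * \<rho>\<^sup>2))"
  have \<alpha>: "\<alpha> \<ge> 1" "B \<le> \<alpha> * (4 * \<rho>\<^sup>2)"
  proof -
    show "\<alpha> \<ge> 1" by (simp add: \<alpha>_def)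
    have "B / (4 * \<rho>\<^sup>2) \<le> \<alpha>" by (simp add: \<alpha>_def)
    then show "B \<le> \<alpha> * (4 * \<rho>\<^sup>2)" using \<rho> by (simp add: pos_divide_le_eq)
  qed
  have \<alpha>': "2 * ?n * \<alpha> + 2 * \<alpha> * \<tau> * D + c \<le> 4 * \<alpha>\<^sup>2 * \<rho>\<^sup>2"
  proof -
    have "2 * ?n * \<alpha> + 2 * \<alpha> * \<tau> * D + c * 1 \<le> 2 * ?n * \<alpha> + 2 * \<alpha> * \<tau> * D + c * \<alpha>"
      using \<alpha>(1) c by (intro add_left_mono mult_left_mono)
    also have "\<dots> = \<alpha> * B" by (simp add: B_def algebra_simps)
    also have "\<dots> \<le> \<alpha> * (\<alpha> * (4 * \<rho>\<^sup>2))" using \<alpha> by (intro mult_left_mono) auto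
    finally show ?thesis by (simp add: power2_eq_square mult_ac)
  qed
  define E where "E x = exp (- \<alpha> * (norm (x - x0))\<^sup>2)" for x
  define b where "b x = E x - exp (- \<alpha> * D\<^sup>2)" for x
  define gb where "gb x = (- 2 * \<alpha> * E x) *\<^sub>R (x - x0)" for x
  have dE: "(E has_derivative (\<lambda>h. gb x \<bullet> h)) (at x)" for x
    unfolding E_def gb_def
    by (rule has_derivative_eq_rhs[OF has_derivative_exp[OF has_derivative_mult_right[OF dist_sq_derivative]]])
      (simp add: fun_eq_iff)
  have db: "(b has_derivative (\<lambda>h. gb x \<bullet> h)) (at x)" for x
    unfolding b_def by (rule has_derivative_eq_rhs[OF has_derivative_diff[OF dE has_derivative_const]]) simp
  have cE: "continuous_on S E" for S unfolding E_def by (intro continuous_intros)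
  have cgb: "continuous_on S gb" for S unfolding gb_def by (intro continuous_intros cE)
  have cb: "continuous_on S b" for S unfolding b_def by (intro continuous_intros cE)
  have [measurable]: "E \<in> borel_measurable borel" "b \<in> borel_measurable borel" "gb \<in> borel_measurable borel"
    by (intro borel_measurable_continuous_onI cE cb cgb)+
  have E1: "0 < E x" "E x \<le> 1" for x using \<alpha>(1) by (auto simp: E_def)
  have w: "weak_grad \<Omega> b gb"
  proof (rule weak_grad_classical[OF \<Omega> db cgb, where C = "max 1 (2 * \<alpha> * D)"])
    fix x assume x: "x \<in> \<Omega>"
    then have xD: "norm (x - x0) \<le> D" by (simp add: \<Omega>_def dist_norm norm_minus_commute)
    have "0 < exp (- \<alpha> * D\<^sup>2)" "exp (- \<alpha> * D\<^sup>2) \<le> 1" using \<alpha>(1) by auto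
    then have "\<bar>b x\<bar> \<le> 1" unfolding b_def using E1[of x] by linarith
    then show "\<bar>b x\<bar> \<le> max 1 (2 * \<alpha> * D)" by simp
    have "norm (gb x) = 2 * \<alpha> * E x * norm (x - x0)" using \<alpha>(1) E1(1)[of x] by (simp add: gb_def abs_mult)
    also have "\<dots> \<le> 2 * \<alpha> * 1 * D" using \<alpha>(1) E1[of x] xD by (intro mult_mono) auto
    finally show "norm (gb x) \<le> max 1 (2 * \<alpha> * D)" by simp
  qed auto
  have sub: "wform v c b gb \<psi> d\<psi> \<le> 0" if t: "test_fun \<Omega> \<psi> d\<psi>" and pos: "\<And>x. 0 \<le> \<psi> x" for \<psi> d\<psi>
  proof -
    have t': "test_fun UNIV \<psi> d\<psi>" using t by (rule test_fun_mono) simp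
    \<comment> \<open>L is the Laplacian of E, and \<open>H i\<close> is the gradient of the
      component of \<open>gb\<close> along i.\<close>
    define L where "L x = E x * (4 * \<alpha>\<^sup>2 * (norm (x - x0))\<^sup>2 - 2 * ?n * \<alpha>)" for x
    define H where "H i x = (- 2 * \<alpha> * E x) *\<^sub>R i + (- 2 * \<alpha> * ((x - x0) \<bullet> i)) *\<^sub>R gb x" for i x
    have cH: "continuous_on UNIV (H i)" for i unfolding H_def by (intro continuous_intros cE cgb)
    have cgi: "continuous_on UNIV (\<lambda>x. gb x \<bullet> i)" for i by (intro continuous_intros cgb)
    have dg: "((\<lambda>x. gb x \<bullet> i) has_derivative (\<lambda>h. H i x \<bullet> h)) (at x)" for i x
    proof -
      have "((\<lambda>x. (x - x0) \<bullet> i) has_derivative (\<lambda>h. h \<bullet> i)) (at x)" by (auto intro!: derivative_eq_intros)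
      from has_derivative_mult[OF has_derivative_mult_right[OF dE, of "- 2 * \<alpha>"] this]
      have "((\<lambda>x. (- 2 * \<alpha> * E x) * ((x - x0) \<bullet> i)) has_derivative (\<lambda>h. (- 2 * \<alpha> * E x) * (h \<bullet> i) + (- 2 * \<alpha> * (gb x \<bullet> h)) * ((x - x0) \<bullet> i))) (at x)" .
      moreover have "(\<lambda>x. (- 2 * \<alpha> * E x) * ((x - x0) \<bullet> i)) = (\<lambda>x. gb x \<bullet> i)" by (simp add: gb_def)
      moreover have "(\<lambda>h. (- 2 * \<alpha> * E x) * (h \<bullet> i) + (- 2 * \<alpha> * (gb x \<bullet> h)) * ((x - x0) \<bullet> i)) = (\<lambda>h. H i x \<bullet> h)"
        by (simp add: H_def fun_eq_iff inner_add_left inner_add_right inner_diff_right inner_diff_left inner_commute)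
      ultimately show ?thesis by simp
    qed
    have ibp: "(\<integral>x. (gb x \<bullet> i) * (d\<psi> x \<bullet> i) \<partial>lborel) = - (\<integral>x. (H i x \<bullet> i) * \<psi> x \<partial>lborel)" for i
      by (rule integration_by_parts[OF t' open_UNIV dg cH]) (intro borel_measurable_continuous_onI cgi cH)+
    have i1: "integrable lborel (\<lambda>x. (gb x \<bullet> i) * (d\<psi> x \<bullet> i))" for i
      by (rule test_fun_integrable_continuous(2)[OF t' borel_measurable_continuous_onI[OF cgi] cgi])
    have cHi: "continuous_on UNIV (\<lambda>x. H i x \<bullet> i)" for i by (intro continuous_intros cH)
    have i2: "integrable lborel (\<lambda>x. (H i x \<bullet> i) * \<psi> x)" for i
      by (rule test_fun_integrable_continuous(1)[OF t' borel_measurable_continuous_onI[OF cHi] cHi])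
    have HL: "(\<Sum>i\<in>Basis. H i x \<bullet> i) = L x" for x
    proof -
      have "(\<Sum>i\<in>Basis. H i x \<bullet> i) = (\<Sum>i\<in>Basis. - 2 * \<alpha> * E x + 4 * \<alpha>\<^sup>2 * E x * (((x - x0) \<bullet> i) * ((x - x0) \<bullet> i)))"
        by (intro sum.cong refl) (simp add: H_def gb_def inner_add_left power2_eq_square algebra_simps)
      also have "\<dots> = ?n * (- 2 * \<alpha> * E x) + 4 * \<alpha>\<^sup>2 * E x * ((x - x0) \<bullet> (x - x0))"
        unfolding euclidean_inner[of "x - x0" "x - x0"] sum.distrib sum_distrib_left[symmetric] by simp
      finally show ?thesis by (simp add: L_def power2_norm_eq_inner algebra_simps)
    qed
    have "(\<integral>x. gb x \<bullet> d\<psi> x \<partial>lborel) = (\<Sum>i\<in>Basis. \<integral>x. (gb x \<bullet> i) * (d\<psi> x \<bullet> i) \<partial>lborel)"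
      by (rule integral_inner_Basis) (rule i1)
    also have "\<dots> = - (\<integral>x. (\<Sum>i\<in>Basis. (H i x \<bullet> i) * \<psi> x) \<partial>lborel)"
      using i2 by (simp add: ibp sum_negf Bochner_Integration.integral_sum)
    also have "\<dots> = - (\<integral>x. L x * \<psi> x \<partial>lborel)" by (simp add: sum_distrib_right[symmetric] HL)
    finally have 1: "(\<integral>x. gb x \<bullet> d\<psi> x \<partial>lborel) = - (\<integral>x. L x * \<psi> x \<partial>lborel)" .
    have cL: "continuous_on UNIV L" unfolding L_def by (intro continuous_intros cE)
    have iL: "integrable lborel (\<lambda>x. L x * \<psi> x)"
      by (rule test_fun_integrable_continuous(1)[OF t' borel_measurable_continuous_onI[OF cL] cL])
    note I = weak_grad_integrable[OF _ \<Omega>(2) v w t]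
    have I2: "integrable lborel (\<lambda>x. (v x \<bullet> gb x) * \<psi> x)" "integrable lborel (\<lambda>x. b x * \<psi> x)" using I(2,3) \<Omega>(1) by auto
    have "wform v c b gb \<psi> d\<psi> = - (\<integral>x. L x * \<psi> x \<partial>lborel) + (\<integral>x. (v x \<bullet> gb x) * \<psi> x \<partial>lborel) + c * (\<integral>x. b x * \<psi> x \<partial>lborel)"
      by (subst wform_split[OF _ \<Omega>(2) v w t]) (use \<Omega>(1) 1 in auto)
    also have "\<dots> = (\<integral>x. - (L x * \<psi> x) + (v x \<bullet> gb x) * \<psi> x + c * (b x * \<psi> x) \<partial>lborel)"
      using iL I2 by simp
    also have "\<dots> \<le> (\<integral>x. 0 \<partial>(lborel :: 'a measure))"
    proof (rule integral_mono)
      show "integrable lborel (\<lambda>x. - (L x * \<psi> x) + (v x \<bullet> gb x) * \<psi> x + c * (b x * \<psi> x))" using iL I2 by auto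
      show "- (L x * \<psi> x) + (v x \<bullet> gb x) * \<psi> x + c * (b x * \<psi> x) \<le> 0" for x
      proof (cases "x \<in> \<Omega>")
        case True
        then have r: "\<rho> \<le> norm (x - x0)" "norm (x - x0) \<le> D" by (auto simp: \<Omega>_def dist_norm norm_minus_commute)
        have "v x \<bullet> gb x \<le> \<tau> * (2 * \<alpha> * E x * D)"
        proof -
          have "v x \<bullet> gb x \<le> norm (v x) * norm (gb x)" by (rule norm_cauchy_schwarz)
          also have "\<dots> \<le> \<tau> * (2 * \<alpha> * E x * D)"
            using v(2)[of x] \<tau> r \<alpha>(1) E1[of x] by (intro mult_mono) (auto simp: gb_def abs_mult intro!: mult_left_mono)
          finally show ?thesis .
        qed
        moreover have "b x \<le> E x" by (simp add: b_def)
        then have "c * b x \<le> c * E x" using c by (rule mult_left_mono)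
        moreover have "E x * (4 * \<alpha>\<^sup>2 * \<rho>\<^sup>2 - 2 * ?n * \<alpha>) \<le> L x"
          unfolding L_def using r \<rho> E1[of x] by (intro mult_left_mono diff_right_mono power_mono) auto
        ultimately have "- L x + v x \<bullet> gb x + c * b x \<le> - (E x * (4 * \<alpha>\<^sup>2 * \<rho>\<^sup>2 - 2 * ?n * \<alpha>)) + \<tau> * (2 * \<alpha> * E x * D) + c * E x"
          by linarith
        also have "\<dots> = E x * (2 * ?n * \<alpha> + 2 * \<alpha> * \<tau> * D + c - 4 * \<alpha>\<^sup>2 * \<rho>\<^sup>2)" by (simp add: algebra_simps)
        also have "\<dots> \<le> 0" using E1[of x] \<alpha>' by (simp add: mult_nonneg_nonpos)
        finally have "(- L x + v x \<bullet> gb x + c * b x) * \<psi> x \<le> 0" using pos by (simp add: mult_nonpos_nonneg)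
        then show ?thesis by (simp add: algebra_simps)
      qed (simp add: test_fun_zero_outside(1)[OF t])
    qed simp
    finally show ?thesis by simp
  qed
  show thesis
    using that[of \<alpha>] \<alpha>(1) w sub unfolding b_def[abs_def] gb_def[abs_def] E_def by auto
qed

definition weak_super :: "'a::euclidean_space set \<Rightarrow> ('a \<Rightarrow> 'a) \<Rightarrow> real \<Rightarrow> ('a \<Rightarrow> real) \<Rightarrow> ('a \<Rightarrow> 'a) \<Rightarrow> bool" where
  "weak_super \<Omega> v c z g \<longleftrightarrow> weak_grad \<Omega> z g \<and>
     (\<forall>\<psi> d\<psi>. test_fun \<Omega> \<psi> d\<psi> \<longrightarrow> (\<forall>x. 0 \<le> \<psi> x) \<longrightarrow> 0 \<le> wform v c z g \<psi> d\<psi>)"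

lemma weak_super_mono:
  "weak_super \<Omega> v c z g \<Longrightarrow> \<Omega>' \<subseteq> \<Omega> \<Longrightarrow> \<Omega>' \<in> sets borel \<Longrightarrow> weak_super \<Omega>' v c z g"
  unfolding weak_super_def using weak_grad_mono test_fun_mono by blast

context
  fixes v :: "'a::euclidean_space \<Rightarrow> 'a" and \<tau> c :: real
  assumes v: "v \<in> borel_measurable borel" "\<And>x. norm (v x) \<le> \<tau>" and c: "c > \<tau>\<^sup>2 / 8"
begin

text \<open>Comparison with m times the barrier, which is at most 1 on the inner sphere and 0 on the
  outer one. By \<open>1 + t \<le> exp t\<close> the barrier dominates a multiple of
  \<open>D - norm (x - x0)\<close>.\<close>

lemma annulus_growth:
  assumes \<rho>: "0 < \<rho>" "\<rho> < D" and cz: "continuous_on (cball x0 D) z" and z0: "\<And>x. x \<in> cball x0 D \<Longrightarrow> 0 \<le> z x"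
    and m: "m > 0" "\<And>x. norm (x - x0) = \<rho> \<Longrightarrow> m \<le> z x"
    and s: "weak_super (ball x0 D - cball x0 \<rho>) v c z g"
  obtains k where "k > 0" "\<And>x. \<rho> \<le> norm (x - x0) \<Longrightarrow> norm (x - x0) \<le> D \<Longrightarrow> k * (D - norm (x - x0)) \<le> z x"
proof -
  let ?\<Omega> = "ball x0 D - cball x0 \<rho>"
  have c0: "c \<ge> 0" using c zero_le_power2[of \<tau>] by linarith
  have \<Omega>: "open ?\<Omega>" "bounded ?\<Omega>" "?\<Omega> \<in> sets borel" by (auto intro: bounded_subset[OF bounded_ball])
  have D: "D > 0" using \<rho> by simp
  let ?b = "\<lambda>\<alpha> x. exp (- \<alpha> * (norm (x - x0))\<^sup>2) - exp (- \<alpha> * D\<^sup>2)"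
  let ?g = "\<lambda>\<alpha> x. (- 2 * \<alpha> * exp (- \<alpha> * (norm (x - x0))\<^sup>2)) *\<^sub>R (x - x0)"
  obtain \<alpha> where \<alpha>: "\<alpha> > 0" "weak_grad ?\<Omega> (?b \<alpha>) (?g \<alpha>)"
    "\<And>\<psi> d\<psi>. test_fun ?\<Omega> \<psi> d\<psi> \<Longrightarrow> (\<And>x. 0 \<le> \<psi> x) \<Longrightarrow> wform v c (?b \<alpha>) (?g \<alpha>) \<psi> d\<psi> \<le> 0"
    by (rule barrier_subsolution[OF v c0 \<rho>, where ?x0.0 = x0]) blast
  have wz: "weak_grad ?\<Omega> z g" and sz: "\<And>\<psi> d\<psi>. test_fun ?\<Omega> \<psi> d\<psi> \<Longrightarrow> (\<And>x. 0 \<le> \<psi> x) \<Longrightarrow> 0 \<le> wform v c z g \<psi> d\<psi>"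
    using s unfolding weak_super_def by auto
  let ?z = "\<lambda>x. m * ?b \<alpha> x + (- 1) * z x"
  have cl: "closure ?\<Omega> \<subseteq> {x. \<rho> \<le> norm (x - x0) \<and> norm (x - x0) \<le> D}" (is "_ \<subseteq> ?A")
  proof (rule closure_minimal)
    show "?\<Omega> \<subseteq> ?A" by (auto simp: dist_norm norm_minus_commute)
    show "closed ?A" by (intro closed_Collect_conj closed_Collect_le continuous_intros)
  qed
  have b1: "?b \<alpha> w \<le> 1" for w
  proof -
    have "exp (- \<alpha> * (norm (w - x0))\<^sup>2) \<le> 1" using \<alpha>(1) by simp
    moreover have "0 < exp (- \<alpha> * D\<^sup>2)" by simp
    ultimately show ?thesis by linarith
  qed
  have clD: "closure ?\<Omega> \<subseteq> cball x0 D" using cl by (auto simp: dist_norm norm_minus_commute)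
  have le: "?z x \<le> 0" if x: "x \<in> closure ?\<Omega>" for x
  proof (rule energy_max_principle[OF \<Omega>(1,2) v c _ _ _ _ x])
    show "weak_grad ?\<Omega> ?z (\<lambda>x. m *\<^sub>R ?g \<alpha> x + (- 1) *\<^sub>R g x)"
      by (rule weak_grad_lincomb[OF \<Omega>(3,2) v \<alpha>(2) wz])
    show "continuous_on (closure ?\<Omega>) ?z"
      by (intro continuous_intros continuous_on_subset[OF cz clD])
    show "?z y \<le> 0" if y: "y \<in> frontier ?\<Omega>" for y
    proof -
      have "y \<in> closure ?\<Omega>" "y \<notin> ?\<Omega>" using y \<Omega>(1) by (auto simp: frontier_def interior_open)
      then consider "norm (y - x0) = \<rho>" | "norm (y - x0) = D" using cl by (force simp: dist_norm norm_minus_commute)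
      then show ?thesis
      proof cases
        case 1
        have "m * ?b \<alpha> y \<le> m * 1" using m(1) b1 by (intro mult_left_mono) auto
        then show ?thesis using m(2)[OF 1] by simp
      next
        case 2 then show ?thesis using z0[of y] by (simp add: dist_norm norm_minus_commute)
      qed
    qed
    show "wform v c ?z (\<lambda>x. m *\<^sub>R ?g \<alpha> x + (- 1) *\<^sub>R g x) \<psi> d\<psi> \<le> 0" if t: "test_fun ?\<Omega> \<psi> d\<psi>" "\<And>x. 0 \<le> \<psi> x" for \<psi> d\<psi>
    proof -
      have "m * wform v c (?b \<alpha>) (?g \<alpha>) \<psi> d\<psi> \<le> 0" using \<alpha>(3)[OF t] m(1) by (simp add: mult_nonneg_nonpos)
      then show ?thesis unfolding wform_lincomb[OF \<Omega>(3,2) v \<alpha>(2) wz t(1)] using sz[OF t] by linarith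
    qed
  qed
  define k where "k = m * (exp (- \<alpha> * D\<^sup>2) * \<alpha> * D)"
  have "k * (D - norm (x - x0)) \<le> z x" if x: "\<rho> \<le> norm (x - x0)" "norm (x - x0) \<le> D" for x
  proof -
    have bl: "exp (- \<alpha> * D\<^sup>2) * \<alpha> * D * (D - norm (x - x0)) \<le> ?b \<alpha> x"
    proof -
      let ?r = "norm (x - x0)"
      have "D * (D - ?r) \<le> (D + ?r) * (D - ?r)" using x(2) by (intro mult_right_mono) auto
      then have "\<alpha> * (D * (D - ?r)) \<le> \<alpha> * (D\<^sup>2 - ?r\<^sup>2)" using \<alpha>(1) by (intro mult_left_mono) (auto simp: power2_eq_square algebra_simps)
      also have "\<dots> \<le> exp (\<alpha> * (D\<^sup>2 - ?r\<^sup>2)) - 1" using exp_ge_add_one_self[of "\<alpha> * (D\<^sup>2 - ?r\<^sup>2)"] by linarith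
      finally have "exp (- \<alpha> * D\<^sup>2) * (\<alpha> * (D * (D - ?r))) \<le> exp (- \<alpha> * D\<^sup>2) * (exp (\<alpha> * (D\<^sup>2 - ?r\<^sup>2)) - 1)" by (intro mult_left_mono) auto
      also have "\<dots> = ?b \<alpha> x" by (simp add: right_diff_distrib exp_add[symmetric])
      finally show ?thesis by (simp add: mult.assoc)
    qed
    show ?thesis
    proof (cases "x \<in> closure ?\<Omega>")
      case True
      have "m * (exp (- \<alpha> * D\<^sup>2) * \<alpha> * D * (D - norm (x - x0))) \<le> m * ?b \<alpha> x" using bl m(1) by (intro mult_left_mono) auto
      then show ?thesis using le[OF True] by (simp add: k_def mult_ac)
    next
      case False
      then have "x \<notin> ?\<Omega>" using subsetD[OF closure_subset] by metis
      then have "norm (x - x0) = \<rho> \<or> norm (x - x0) = D" using x by (auto simp: dist_norm norm_minus_commute)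
      then consider "norm (x - x0) = \<rho>" | "norm (x - x0) = D" by blast
      then show ?thesis
      proof cases
        case 1
        have "exp (- \<alpha> * D\<^sup>2) * \<alpha> * D * (D - norm (x - x0)) \<le> 1" using bl b1 by (rule order_trans)
        then have "m * (exp (- \<alpha> * D\<^sup>2) * \<alpha> * D * (D - norm (x - x0))) \<le> m * 1" using m(1) by (intro mult_left_mono) auto
        then show ?thesis using m(2)[OF 1] by (simp add: k_def mult_ac)
      next
        case 2 then show ?thesis using z0[of x] by (simp add: dist_norm norm_minus_commute)
      qed
    qed
  qed
  moreover have "k > 0" using m(1) \<alpha>(1) D by (simp add: k_def)
  ultimately show thesis using that by blast
qed

text \<open>The annulus bound spreads positivity from a point to the largest ball around it inside
  the domain, so the sets where z is positive and where z is 0 are both open in a connected ball. A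
  last annulus around the origin gives the linear growth at the sphere.\<close>

theorem strong_positivity:
  assumes R: "R > 0" and cz: "continuous_on (cball 0 R) z" and z0: "\<And>x. x \<in> cball 0 R \<Longrightarrow> 0 \<le> z x"
    and s: "weak_super (ball 0 R) v c z g" and ne: "\<exists>x\<in>ball 0 R. z x \<noteq> 0"
  obtains k where "k > 0" "\<And>x. x \<in> cball 0 R \<Longrightarrow> k * (R - norm x) \<le> z x"
proof -
  have spread: "z y > 0" if x1: "x1 \<in> ball 0 R" "z x1 > 0" and y: "norm (y - x1) < R - norm x1" for x1 y
  proof -
    define D where "D = R - norm x1"
    have D: "D > 0" using x1 by (simp add: D_def)
    have sub: "cball x1 D \<subseteq> cball 0 R"
    proof
      fix w assume "w \<in> cball x1 D"
      then have "norm (w - x1) \<le> D" by (simp add: dist_norm norm_minus_commute)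
      then show "w \<in> cball 0 R" using norm_triangle_sub[of w x1] by (simp add: D_def)
    qed
    have subo: "ball x1 D \<subseteq> ball 0 R"
    proof
      fix w assume "w \<in> ball x1 D"
      then have "norm (w - x1) < D" by (simp add: dist_norm norm_minus_commute)
      then show "w \<in> ball 0 R" using norm_triangle_sub[of w x1] by (simp add: D_def)
    qed
    have "continuous_on (ball 0 R) z" by (rule continuous_on_subset[OF cz ball_subset_cball])
    then have "isCont z x1" using x1 by (metis continuous_on_eq_continuous_at open_ball)
    then obtain d where d: "d > 0" "\<And>w. dist w x1 < d \<Longrightarrow> dist (z w) (z x1) < z x1 / 2"
      using x1(2) unfolding continuous_at_eps_delta by (metis half_gt_zero)
    define \<rho> where "\<rho> = min d D / 2"
    have \<rho>: "0 < \<rho>" "\<rho> < D" "\<rho> < d" using d D by (auto simp: \<rho>_def)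
    have near: "z w \<ge> z x1 / 2" if "norm (w - x1) \<le> \<rho>" for w
    proof -
      have "\<bar>z w - z x1\<bar> < z x1 / 2" using d(2)[of w] that \<rho> by (simp add: dist_norm)
      then show ?thesis by linarith
    qed
    have s': "weak_super (ball x1 D - cball x1 \<rho>) v c z g" by (rule weak_super_mono[OF s]) (use subo in auto)
    obtain k where k: "k > 0" "\<And>x. \<rho> \<le> norm (x - x1) \<Longrightarrow> norm (x - x1) \<le> D \<Longrightarrow> k * (D - norm (x - x1)) \<le> z x"
      by (rule annulus_growth[OF \<rho>(1,2) continuous_on_subset[OF cz sub], of "z x1 / 2"])
        (use z0 sub near s' x1(2) in auto)
    show "z y > 0"
    proof (cases "norm (y - x1) \<le> \<rho>")
      case True then show ?thesis using near[of y] x1(2) by linarith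
    next
      case False
      then have "k * (D - norm (y - x1)) \<le> z y" using k(2)[of y] y by (simp add: D_def)
      moreover have "k * (D - norm (y - x1)) > 0" using k(1) y by (simp add: D_def)
      ultimately show ?thesis by linarith
    qed
  qed
  define P where "P = {x \<in> ball 0 R. z x > 0}"
  define N where "N = {x \<in> ball 0 R. \<not> z x > 0}"
  \<comment> \<open>Within a third of the distance to the sphere, each of the two points lies in the
    ball to which positivity spreads from the other.\<close>
  have nb: "y \<in> ball 0 R \<and> x \<in> ball 0 R \<and> norm (x - y) < R - norm y \<and> norm (y - x) < R - norm x"
    if x: "x \<in> ball 0 R" and y: "dist x y < (R - norm x) / 3" for x y :: 'a
    using x y norm_triangle_sub[of y x] by (auto simp: dist_norm norm_minus_commute)
  have "open P" unfolding open_dist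
  proof
    fix x assume x: "x \<in> P"
    show "\<exists>e>0. \<forall>y. dist y x < e \<longrightarrow> y \<in> P"
      using x nb[of x] spread[of x] by (intro exI[of _ "(R - norm x) / 3"]) (auto simp: P_def dist_commute)
  qed
  moreover have "open N" unfolding open_dist
  proof
    fix x assume x: "x \<in> N"
    show "\<exists>e>0. \<forall>y. dist y x < e \<longrightarrow> y \<in> N"
    proof (intro exI[of _ "(R - norm x) / 3"] conjI allI impI)
      show "(R - norm x) / 3 > 0" using x by (simp add: N_def)
      fix y assume y: "dist y x < (R - norm x) / 3"
      have "\<not> z y > 0" using spread[of y x] nb[of x y] x y by (auto simp: N_def dist_commute)
      then show "y \<in> N" using nb[of x y] x y by (auto simp: N_def dist_commute)
    qed
  qed
  moreover have "P \<inter> ball 0 R \<noteq> {}"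
    using ne z0 ball_subset_cball[of "0::'a" R] by (fastforce simp: P_def order_less_le)
  moreover have "connected (ball (0::'a) R)" by simp
  ultimately have "N \<inter> ball 0 R = {}"
  proof -
    assume *: "open P" "open N" "P \<inter> ball 0 R \<noteq> {}" "connected (ball (0::'a) R)"
    have "P \<inter> N \<inter> ball 0 R = {}" "ball 0 R \<subseteq> P \<union> N" by (auto simp: P_def N_def)
    then show ?thesis using connectedD[OF *(4) *(1,2)] *(3) by blast
  qed
  then have pos: "z x > 0" if "x \<in> ball 0 R" for x using that by (auto simp: N_def)
  have R2: "0 < R / 2" "R / 2 < R" using R by auto
  obtain x2 where x2: "x2 \<in> cball 0 (R / 2)" "\<And>x. x \<in> cball 0 (R / 2) \<Longrightarrow> z x2 \<le> z x"
  proof -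
    have "continuous_on (cball 0 (R / 2)) z" by (rule continuous_on_subset[OF cz]) (use R2 in auto)
    moreover have "cball (0::'a) (R / 2) \<noteq> {}" using R2 by simp
    ultimately have "\<exists>x\<in>cball (0::'a) (R / 2). \<forall>y\<in>cball 0 (R / 2). z x \<le> z y"
      by (intro continuous_attains_inf) auto
    then show ?thesis using that by metis
  qed
  have m: "z x2 > 0" using pos[of x2] x2(1) R2 by auto
  have s': "weak_super (ball 0 R - cball 0 (R / 2)) v c z g" by (rule weak_super_mono[OF s]) auto
  obtain k where k: "k > 0" "\<And>x. R / 2 \<le> norm (x - 0) \<Longrightarrow> norm (x - 0) \<le> R \<Longrightarrow> k * (R - norm (x - 0)) \<le> z x"
    by (rule annulus_growth[OF R2 cz z0 m _ s']) (use x2 in auto)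
  show thesis
  proof (rule that[of "min k (z x2 / R)"])
    show "min k (z x2 / R) > 0" using k(1) m R by simp
    fix x assume x: "x \<in> cball (0::'a) R"
    show "min k (z x2 / R) * (R - norm x) \<le> z x"
    proof (cases "norm x \<le> R / 2")
      case True
      have "min k (z x2 / R) * (R - norm x) \<le> z x2 / R * R" using R m k(1) x by (intro mult_mono) auto
      also have "\<dots> = z x2" using R by simp
      also have "\<dots> \<le> z x" using True x2(2)[of x] by simp
      finally show ?thesis .
    next
      case False
      have "min k (z x2 / R) * (R - norm x) \<le> k * (R - norm x)" using x by (intro mult_right_mono) auto
      also have "\<dots> \<le> z x" using k(2)[of x] False x by simp
      finally show ?thesis .
    qed
  qed
qed

end

section \<open>Comparison of sub- and supersolutions; existence of the principal eigenvalue\<close>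

section \<open>The principal eigenvalue\<close>

locale drift =
  fixes R \<tau> c :: real and v :: "'a::euclidean_space \<Rightarrow> 'a"
  assumes R: "R > 0" and v: "v \<in> borel_measurable borel" "\<And>x. norm (v x) \<le> \<tau>" and c: "c > \<tau>\<^sup>2 / 8"
begin

lemma c0: "c > 0" using c zero_le_power2[of \<tau>] by linarith

lemma bfun_integrable:
  assumes h: "bfun R M h" and t: "test_fun (ball (0::'a) R) \<psi> d\<psi>"
  shows "integrable lborel (\<lambda>x. h x * \<psi> x)"
proof (rule test_fun_integrable[OF t bfunD(1)[OF h]])
  show "integrable lborel (\<lambda>x. indicator (ball 0 R) x * h x)"
    by (rule integrable_bounded_support[where S = "cball 0 R" and C = M])
      (use bfunD[OF h] in \<open>auto simp: indicator_def\<close>)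
qed simp

lemma csol_nonpos:
  assumes s: "csol R v c u p h" and h: "\<And>x. h x \<le> 0"
  shows "u x \<le> 0"
proof (rule csol_max_principle[OF R v c s])
  fix \<psi> :: "'a \<Rightarrow> real" assume "\<And>x. 0 \<le> \<psi> x"
  then have "0 \<le> (\<integral>x. - (h x * \<psi> x) \<partial>lborel)"
    using h by (intro integral_nonneg_AE AE_I2) (simp add: mult_nonpos_nonneg)
  then show "(\<integral>x. h x * \<psi> x \<partial>lborel) \<le> 0" by simp
qed

lemma csol_scale:
  assumes "csol R v c u p h" "bfun R M h"
  shows "csol R v c (\<lambda>x. a * u x) (\<lambda>x. a *\<^sub>R p x) (\<lambda>x. a * h x)"
  using csol_lincomb[OF R v assms(1) assms(1) assms(2) assms(2), of a 0] by simp

lemma csol_nonneg: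
  assumes s: "csol R v c u p h" and b: "bfun R M h" and h: "\<And>x. 0 \<le> h x"
  shows "0 \<le> u x"
  using csol_nonpos[OF csol_scale[OF s b, of "- 1"], of x] h by simp

lemma csol_unique:
  assumes s: "csol R v c u1 p1 h" "csol R v c u2 p2 h" and b: "bfun R M h"
  shows "u1 = u2"
proof
  fix x
  have 1: "csol R v c (\<lambda>x. a * u1 x + - a * u2 x) (\<lambda>x. a *\<^sub>R p1 x + - a *\<^sub>R p2 x) (\<lambda>x. a * h x + - a * h x)" for a
    by (rule csol_lincomb[OF R v s b b])
  show "u1 x = u2 x"
    using csol_nonpos[OF 1[of 1], of x] csol_nonpos[OF 1[of "- 1"], of x] by simp
qed

lemma csol_super:
  assumes s: "csol R v c u p h" and h: "\<And>x. 0 \<le> h x"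
  shows "weak_super (ball 0 R) v c u p"
  unfolding weak_super_def using csol_weak_grad[OF s] csolD(5)[OF s] h by (auto intro!: integral_nonneg_AE)

lemma csol_hopf:
  assumes s: "csol R v c u p h" and b: "bfun R M h" and h: "\<And>x. 0 \<le> h x" and ne: "\<exists>x. u x \<noteq> 0"
  obtains k where "k > 0" "\<And>x. x \<in> cball 0 R \<Longrightarrow> k * (R - norm x) \<le> u x"
proof -
  have "\<exists>x\<in>ball 0 R. u x \<noteq> 0" using ne csolD(3)[OF s] by (metis mem_ball_0 not_le)
  then show thesis
    using strong_positivity[OF v c R csol_continuous[OF s] csol_nonneg[OF s b h] csol_super[OF s h]] that by blast
qed

text \<open>The gradient bound along the radius through x. Together with Hopf's lemma it makes two
  positive solutions comparable up to the sphere.\<close>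

lemma csol_boundary_growth:
  assumes s: "csol R v c u p h"
  obtains C where "C > 0" "\<And>x. x \<in> cball 0 R \<Longrightarrow> \<bar>u x\<bar> \<le> C * (R - norm x)"
proof -
  obtain C where C: "C > 0" "\<And>x. x \<in> cball 0 R \<Longrightarrow> norm (p x) \<le> C"
    using compact_continuous_bounded[OF csolD(1)[OF s] compact_cball] by metis
  have "\<bar>u x\<bar> \<le> C * (R - norm x)" if x: "x \<in> cball 0 R" for x
  proof -
    obtain i :: 'a where i: "i \<in> Basis" using nonempty_Basis by blast
    define e where "e = (if x = 0 then i else x /\<^sub>R norm x)"
    have e: "norm e = 1" "x = norm x *\<^sub>R e" using i by (auto simp: e_def)
    have "R *\<^sub>R e - x = (R - norm x) *\<^sub>R e" using e(2) by (simp add: scaleR_diff_left)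
    then have d: "norm (x - R *\<^sub>R e) = R - norm x" using e(1) x by (subst norm_minus_commute) simp
    have "norm (u x - u (R *\<^sub>R e)) \<le> C * norm (x - R *\<^sub>R e)"
    proof (rule differentiable_bound[OF convex_cball csolD(2)[OF s]])
      show "onorm (\<lambda>k. p y \<bullet> k) \<le> C" if "y \<in> cball 0 R" for y
        by (intro onorm_le) (metis C(2)[OF that] Cauchy_Schwarz_ineq2 mult_right_mono norm_ge_zero order_trans real_norm_def)
    qed (use x e R in auto)
    moreover have "u (R *\<^sub>R e) = 0" using csolD(3)[OF s, of "R *\<^sub>R e"] e R by simp
    ultimately show ?thesis using d by simp
  qed
  then show thesis using that C(1) by blast
qed

text \<open>The constant \<open>K / c\<close> is a supersolution with right-hand side K, nonnegative
  on the sphere.\<close>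

lemma csol_upper_bound:
  assumes s: "csol R v c u p h" and b: "bfun R M h" and K: "K \<ge> 0" and h: "\<And>x. h x \<le> K"
  shows "u x \<le> K / c"
proof (cases "x \<in> cball 0 R")
  case True
  have \<Omega>: "ball (0::'a) R \<in> sets borel" by simp
  have wk: "weak_grad (ball (0::'a) R) (\<lambda>_. K / c) (\<lambda>_. 0)" by (rule weak_grad_const) auto
  have "1 * u x + (- 1) * (K / c) \<le> 0"
  proof (rule energy_max_principle[OF open_ball bounded_ball v c weak_grad_lincomb[OF \<Omega> bounded_ball v csol_weak_grad[OF s] wk]])
    show "continuous_on (closure (ball 0 R)) (\<lambda>x. 1 * u x + (- 1) * (K / c))"
      using csol_continuous[OF s] R by (auto intro!: continuous_intros)
    show "1 * u y + (- 1) * (K / c) \<le> 0" if "y \<in> frontier (ball 0 R)" for y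
      using that csolD(3)[OF s, of y] R K c0 by simp
    fix \<psi> :: "'a \<Rightarrow> real" and d\<psi> assume t: "test_fun (ball 0 R) \<psi> d\<psi>" and pos: "\<And>x. 0 \<le> \<psi> x"
    have i\<psi>: "integrable lborel \<psi>" using weak_grad_integrable(3)[OF \<Omega> bounded_ball v weak_grad_const[OF open_ball bounded_ball] t, of 1] by simp
    have "wform v c (\<lambda>x. 1 * u x + (- 1) * (K / c)) (\<lambda>x. 1 *\<^sub>R p x + (- 1) *\<^sub>R 0) \<psi> d\<psi>
        = (\<integral>x. h x * \<psi> x \<partial>lborel) - wform v c (\<lambda>_. K / c) (\<lambda>_. 0) \<psi> d\<psi>"
      by (subst wform_lincomb[OF \<Omega> bounded_ball v csol_weak_grad[OF s] wk t]) (simp add: csolD(5)[OF s t])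
    also have "wform v c (\<lambda>_. K / c) (\<lambda>_. 0) \<psi> d\<psi> = (\<integral>x. K * \<psi> x \<partial>lborel)" using c0 by (simp add: wform_def)
    also have "(\<integral>x. h x * \<psi> x \<partial>lborel) - (\<integral>x. K * \<psi> x \<partial>lborel) \<le> 0"
      using bfun_integrable[OF b t] i\<psi> h pos by (simp only: diff_le_0_iff_le) (intro integral_mono mult_right_mono, auto)
    finally show "wform v c (\<lambda>x. 1 * u x + (- 1) * (K / c)) (\<lambda>x. 1 *\<^sub>R p x + (- 1) *\<^sub>R 0) \<psi> d\<psi> \<le> 0" .
  next
    show "x \<in> closure (ball 0 R)" using True R by simp
  qed
  then show ?thesis by simp
qed (use csolD(3)[OF s, of x] K c0 in simp)

text \<open>Test with a mollifier placed where h is at least m. The lemma excludes that a comparison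
  collapses to equality of the solutions while the right-hand sides differ strictly on a
  ball.\<close>

lemma csol_zero_rhs:
  assumes s: "csol R v c u p h" and u: "\<And>x. u x = 0" and b: "bfun R M h" and h: "\<And>x. 0 \<le> h x"
    and r: "r > 0" "ball x0 r \<subseteq> ball 0 R" and m: "m > 0" "\<And>x. x \<in> ball x0 r \<Longrightarrow> m \<le> h x"
  shows False
proof -
  have d: "r / 2 > 0" using r by simp
  have "cball x0 (r / 2) \<subseteq> ball 0 R" using r by (intro order_trans[OF _ r(2)]) auto
  then have t: "test_fun (ball 0 R) (moll (r / 2) x0) (\<lambda>y. - dmoll (r / 2) x0 y)" by (rule moll_test_fun[OF d])
  have "m = (\<integral>x. m * moll (r / 2) x0 x \<partial>lborel)" using moll_integral[OF d, of x0] by simp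
  also have "\<dots> \<le> (\<integral>x. h x * moll (r / 2) x0 x \<partial>lborel)"
  proof (rule integral_mono[OF _ bfun_integrable[OF b t]])
    show "integrable lborel (\<lambda>x. m * moll (r / 2) x0 x)" using moll_integral[OF d, of x0] by simp
    show "m * moll (r / 2) x0 x \<le> h x * moll (r / 2) x0 x" for x
    proof (cases "r / 2 \<le> norm (x0 - x)")
      case False
      then have "x \<in> ball x0 r" using r by (simp add: dist_norm)
      then show ?thesis using m(2) moll_nonneg[OF d] by (intro mult_right_mono) auto
    qed (simp add: moll_outside[OF d])
  qed
  also have "\<dots> = wform v c u p (moll (r / 2) x0) (\<lambda>y. - dmoll (r / 2) x0 y)" by (rule csolD(5)[OF s t, symmetric])
  also have "\<dots> = 0" using u csol_gradient_zero[OF R s u] by (simp add: wform_def)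
  finally show False using m(1) by simp
qed

lemma continuous_positive_ball:
  assumes "continuous_on (ball (0::'a) R) (h :: 'a \<Rightarrow> real)" "x0 \<in> ball 0 R" "h x0 > 0"
  obtains r where "r > 0" "ball x0 r \<subseteq> ball 0 R" "\<And>x. x \<in> ball x0 r \<Longrightarrow> h x0 / 2 \<le> h x"
proof -
  have "isCont h x0" using assms by (metis continuous_on_eq_continuous_at open_ball)
  then obtain d where d: "d > 0" "\<And>w. dist w x0 < d \<Longrightarrow> dist (h w) (h x0) < h x0 / 2"
    using assms(3) unfolding continuous_at_eps_delta by (metis half_gt_zero)
  obtain e where e: "e > 0" "ball x0 e \<subseteq> ball 0 R" using assms(2) openE[OF open_ball] by metis
  show thesis
  proof (rule that[of "min d e"])
    show "ball x0 (min d e) \<subseteq> ball 0 R" using e(2) by auto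
    show "h x0 / 2 \<le> h x" if "x \<in> ball x0 (min d e)" for x
    proof -
      have "\<bar>h x - h x0\<bar> < h x0 / 2" using d(2)[of x] that by (simp add: dist_commute[of x x0] dist_real_def)
      then show ?thesis by linarith
    qed
  qed (use d e in simp)
qed

text \<open>uA is a supersolution with parameter a, uB a subsolution with parameter b. Take the
  largest t with \<open>t * uB \<le> uA\<close>: if the difference did not vanish, Hopf's lemma
  would allow a larger t. So uA is a multiple of uB, and then \<open>(a - b) * uA\<close> must
  vanish as well. Both the uniqueness of the eigenpair and the ordering of the eigenvalues follow
  from this.\<close>

lemma csol_compare:
  assumes A: "csol R v c uA pA hA" "bfun R MA hA" "\<And>x. a * uA x \<le> hA x" "\<And>x. 0 \<le> uA x" "\<exists>x. uA x \<noteq> 0"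
    and B: "csol R v c uB pB hB" "bfun R MB hB" "\<And>x. hB x \<le> b * uB x" "\<And>x. 0 \<le> uB x" "\<exists>x. uB x \<noteq> 0"
    and ab: "0 \<le> b" "b \<le> a"
  shows "a = b" and "\<exists>t>0. \<forall>x. uA x = t * uB x"
proof -
  have hA: "0 \<le> hA x" for x using A(3)[of x] mult_nonneg_nonneg[OF order_trans[OF ab] A(4)[of x]] by linarith
  obtain k where k: "k > 0" "\<And>x. x \<in> cball 0 R \<Longrightarrow> k * (R - norm x) \<le> uA x"
    by (rule csol_hopf[OF A(1,2) hA A(5)]) blast
  obtain C where C: "C > 0" "\<And>x. x \<in> cball 0 R \<Longrightarrow> \<bar>uB x\<bar> \<le> C * (R - norm x)"
    by (rule csol_boundary_growth[OF B(1)]) blast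
  obtain x1 where "uB x1 \<noteq> 0" using B(5) by blast
  then have x1: "uB x1 > 0" "x1 \<in> cball 0 R" using B(4)[of x1] csolD(3)[OF B(1), of x1] by (force simp: order_less_le)+
  define T where "T = {t. 0 \<le> t \<and> (\<forall>x\<in>cball 0 R. t * uB x \<le> uA x)}"
  \<comment> \<open>Hopf's lower bound for uA against the upper bound for uB: the set of multiples
    contains a positive number.\<close>
  have T0: "k / C \<in> T" unfolding T_def
  proof (intro CollectI conjI ballI)
    fix x assume x: "x \<in> cball (0::'a) R"
    have "k / C * uB x \<le> k / C * (C * (R - norm x))" using C(2)[OF x] k(1) C(1) by (intro mult_left_mono) auto
    also have "\<dots> \<le> uA x" using k(2)[OF x] C(1) by simp
    finally show "k / C * uB x \<le> uA x" .
  qed (use k C in simp)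
  have bdd: "bdd_above T"
  proof (rule bdd_aboveI)
    fix t assume "t \<in> T" then show "t \<le> uA x1 / uB x1" using x1 by (auto simp: T_def pos_le_divide_eq)
  qed
  define t where "t = Sup T"
  have t0: "t > 0" using cSup_upper[OF T0 bdd] k C by (simp add: t_def) (meson divide_pos_pos less_le_trans)
  have tle: "t * uB x \<le> uA x" if x: "x \<in> cball 0 R" for x
  proof (cases "uB x = 0")
    case False
    then have p: "uB x > 0" using B(4)[of x] by simp
    have "t \<le> uA x / uB x" unfolding t_def
      by (rule cSup_least) (use T0 x p in \<open>auto simp: T_def pos_le_divide_eq\<close>)
    then show ?thesis using p by (simp add: pos_le_divide_eq)
  qed (use A(4) in simp)
  define z where "z x = 1 * uA x + (- t) * uB x" for x
  define hz where "hz x = 1 * hA x + (- t) * hB x" for x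
  have z: "csol R v c z (\<lambda>x. 1 *\<^sub>R pA x + (- t) *\<^sub>R pB x) hz" unfolding z_def[abs_def] hz_def[abs_def]
    by (rule csol_lincomb[OF R v A(1) B(1) A(2) B(2)])
  have hzb: "bfun R (\<bar>1\<bar> * MA + \<bar>- t\<bar> * MB) hz" unfolding hz_def[abs_def] by (intro bfun_add bfun_scale A B)
  have z0: "0 \<le> z x" for x
    using tle[of x] csolD(3)[OF A(1), of x] csolD(3)[OF B(1), of x] by (cases "x \<in> cball 0 R") (auto simp: z_def)
  \<comment> \<open>The strict part \<open>(a - b) * uA\<close> is kept; it excludes
    \<open>a > b\<close> once z is known to vanish.\<close>
  have hz: "b * z x + (a - b) * uA x \<le> hz x" for x
  proof -
    have "t * hB x \<le> t * (b * uB x)" using B(3)[of x] t0 by (intro mult_left_mono) auto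
    then show ?thesis using A(3)[of x] by (simp add: z_def hz_def algebra_simps)
  qed
  have hz0: "0 \<le> hz x" for x
    using hz[of x] mult_nonneg_nonneg[OF ab(1) z0[of x]] mult_nonneg_nonneg[of "a - b" "uA x"] A(4)[of x] ab by linarith
  have zz: "z x = 0" for x
  proof (rule ccontr)
    assume "z x \<noteq> 0"
    then have ne: "\<exists>x. z x \<noteq> 0" by blast
    obtain k' where k': "k' > 0" "\<And>x. x \<in> cball 0 R \<Longrightarrow> k' * (R - norm x) \<le> z x"
      by (rule csol_hopf[OF z hzb hz0 ne]) blast
    have "t + k' / C \<in> T" unfolding T_def
    proof (intro CollectI conjI ballI)
      fix x assume x: "x \<in> cball (0::'a) R"
      have "k' / C * uB x \<le> k' / C * (C * (R - norm x))" using C(2)[OF x] k'(1) C(1) by (intro mult_left_mono) auto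
      also have "\<dots> \<le> z x" using k'(2)[OF x] C(1) by simp
      finally show "(t + k' / C) * uB x \<le> uA x" by (simp add: z_def algebra_simps)
    qed (use t0 k' C in simp)
    then have "t + k' / C \<le> t" unfolding t_def using bdd by (intro cSup_upper) auto
    then show False using k' C by (simp add: field_simps)
  qed
  show "\<exists>t>0. \<forall>x. uA x = t * uB x" using t0 zz by (intro exI[of _ t]) (simp add: z_def)
  show "a = b"
  proof (rule ccontr)
    assume "a \<noteq> b"
    then have ab': "a - b > 0" using ab by simp
    obtain x0 where "uA x0 \<noteq> 0" using A(5) by blast
    then have x0: "uA x0 > 0" "x0 \<in> ball 0 R" using A(4)[of x0] csolD(3)[OF A(1), of x0] by (force simp: order_less_le)+
    have cA: "continuous_on (ball 0 R) uA" by (rule continuous_on_subset[OF csol_continuous[OF A(1)] ball_subset_cball])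
    obtain r where r: "r > 0" "ball x0 r \<subseteq> ball 0 R" "\<And>x. x \<in> ball x0 r \<Longrightarrow> uA x0 / 2 \<le> uA x"
      using continuous_positive_ball[OF cA x0(2,1)] by metis
    show False
    proof (rule csol_zero_rhs[OF z zz hzb hz0 r(1,2), of "(a - b) * (uA x0 / 2)"])
      show "(a - b) * (uA x0 / 2) > 0" using ab' x0 by simp
      show "(a - b) * (uA x0 / 2) \<le> hz x" if "x \<in> ball x0 r" for x
      proof -
        have "(a - b) * (uA x0 / 2) \<le> (a - b) * uA x" using r(3)[OF that] ab' by (intro mult_left_mono) auto
        also have "\<dots> \<le> hz x" using hz[of x] zz[of x] by simp
        finally show ?thesis .
      qed
    qed
  qed
qed

text \<open>The gradient g is only square integrable; the energy maximum principle, applied to both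
  signs of the difference, identifies \<phi> with the C^1 solution, and the boundary estimates
  become available for it.\<close>

lemma weak_solution_eq_csol:
  assumes s: "csol R v c u p h" and w: "weak_grad (ball 0 R) \<phi> g" and cont: "continuous_on (cball 0 R) \<phi>"
    and bd: "\<And>x. norm x = R \<Longrightarrow> \<phi> x = 0"
    and eq: "\<And>\<psi> d\<psi>. test_fun (ball 0 R) \<psi> d\<psi> \<Longrightarrow> wform v c \<phi> g \<psi> d\<psi> = (\<integral>x. h x * \<psi> x \<partial>lborel)"
    and x: "x \<in> cball 0 R"
  shows "\<phi> x = u x"
proof -
  have \<Omega>: "ball (0::'a) R \<in> sets borel" by simp
  have "a * \<phi> x + (- a) * u x \<le> 0" for a
  proof (rule energy_max_principle[OF open_ball bounded_ball v c weak_grad_lincomb[OF \<Omega> bounded_ball v w csol_weak_grad[OF s]]])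
    show "continuous_on (closure (ball 0 R)) (\<lambda>x. a * \<phi> x + (- a) * u x)"
      using csol_continuous[OF s] cont R by (auto intro!: continuous_intros)
    show "a * \<phi> y + (- a) * u y \<le> 0" if "y \<in> frontier (ball 0 R)" for y
      using that csolD(3)[OF s, of y] bd[of y] R by simp
    show "wform v c (\<lambda>x. a * \<phi> x + (- a) * u x) (\<lambda>x. a *\<^sub>R g x + (- a) *\<^sub>R p x) \<psi> d\<psi> \<le> 0"
      if t: "test_fun (ball 0 R) \<psi> d\<psi>" "\<And>x. 0 \<le> \<psi> x" for \<psi> d\<psi>
      by (subst wform_lincomb[OF \<Omega> bounded_ball v w csol_weak_grad[OF s] t(1)]) (simp add: csolD(5)[OF s t(1)] eq[OF t(1)])
  qed (use x R in auto)
  from this[of 1] this[of "- 1"] show ?thesis by simp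
qed

text \<open>The choice is determined: \<open>csol_unique\<close> leaves one solution for each
  bounded right-hand side.\<close>

definition Sol :: "('a \<Rightarrow> real) \<Rightarrow> 'a \<Rightarrow> real" where
  "Sol h = (SOME u. \<exists>p. csol R v c u p h)"

lemma Sol_csol:
  obtains C where "C > 0" "\<And>h M. bfun R M h \<Longrightarrow> \<exists>p. csol R v c (Sol h) p h \<and> (\<forall>x. norm (p x) \<le> C * M)"
proof -
  obtain C where C: "C > 0"
    "\<And>h M. bfun R M h \<Longrightarrow> \<exists>u p. csol R v c u p h \<and> (\<forall>x. \<bar>u x\<bar> \<le> C * M) \<and> (\<forall>x. norm (p x) \<le> C * M)"
    using dirichlet_problem_solvable[OF R v c] by blast
  have "\<exists>p. csol R v c (Sol h) p h \<and> (\<forall>x. norm (p x) \<le> C * M)" if h: "bfun R M h" for h M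
  proof -
    obtain u p where u: "csol R v c u p h" "\<forall>x. norm (p x) \<le> C * M" using C(2)[OF h] by blast
    have "\<exists>p. csol R v c (Sol h) p h" unfolding Sol_def by (rule someI[of _ u]) (use u in blast)
    then have "Sol h = u" using csol_unique[OF _ u(1) h] by blast
    then show ?thesis using u by auto
  qed
  then show thesis using that C(1) by blast
qed

lemma Sol_eqI: "csol R v c u p h \<Longrightarrow> bfun R M h \<Longrightarrow> Sol h = u"
  using Sol_csol csol_unique by metis

lemma Sol_lincomb:
  assumes f: "bfun R M f" and g: "bfun R N g"
  shows "Sol (\<lambda>x. a * f x + b * g x) = (\<lambda>x. a * Sol f x + b * Sol g x)"
proof -
  obtain p q where p: "csol R v c (Sol f) p f" "csol R v c (Sol g) q g" using Sol_csol f g by metis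
  show ?thesis by (rule Sol_eqI[OF csol_lincomb[OF R v p f g] bfun_add[OF bfun_scale[OF f] bfun_scale[OF g]]])
qed

lemma Sol_upper:
  assumes f: "bfun R M f" and K: "K \<ge> 0" "\<And>x. f x \<le> K"
  shows "Sol f x \<le> K / c"
  using Sol_csol csol_upper_bound[OF _ f K] f by metis

lemma Sol_bound:
  assumes f: "bfun R M f"
  shows "\<bar>Sol f x\<bar> \<le> M / c"
proof -
  have "Sol (\<lambda>x. - 1 * f x + 0 * f x) x \<le> M / c"
    using bfunD(2)[OF f] bfunD(4)[OF f] by (intro Sol_upper[OF bfun_add[OF bfun_scale[OF f] bfun_scale[OF f]]]) (auto simp: abs_le_iff)
  then have "- Sol f x \<le> M / c" using Sol_lincomb[OF f f, of "- 1" 0] by simp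
  moreover have "Sol f x \<le> M / c" using bfunD(2)[OF f] bfunD(4)[OF f] by (intro Sol_upper[OF f]) (auto simp: abs_le_iff)
  ultimately show ?thesis by linarith
qed

lemma Sol_bfun:
  assumes f: "bfun R M f"
  shows "bfun R (M / c) (Sol f)"
proof -
  obtain p where p: "csol R v c (Sol f) p f" using Sol_csol f by metis
  show ?thesis unfolding bfun_def using csol_measurable(1)[OF p] Sol_bound[OF f] csolD(3)[OF p] by auto
qed

lemma Sol_nonneg: "bfun R M f \<Longrightarrow> (\<And>x. 0 \<le> f x) \<Longrightarrow> 0 \<le> Sol f x"
  using Sol_csol csol_nonneg by metis

lemma Sol_pos:
  assumes f: "bfun R M f" "\<And>x. 0 \<le> f x" and x0: "x0 \<in> ball 0 R" "f x0 > 0" and cf: "continuous_on (ball 0 R) f"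
  obtains k where "k > 0" "\<And>x. x \<in> cball 0 R \<Longrightarrow> k * (R - norm x) \<le> Sol f x"
proof -
  obtain p where p: "csol R v c (Sol f) p f" using Sol_csol f by metis
  obtain r where r: "r > 0" "ball x0 r \<subseteq> ball 0 R" "\<And>x. x \<in> ball x0 r \<Longrightarrow> f x0 / 2 \<le> f x"
    using continuous_positive_ball[OF cf x0] by metis
  have "\<exists>x. Sol f x \<noteq> 0"
    using csol_zero_rhs[OF p _ f r(1,2) _ r(3)] x0 by (metis half_gt_zero)
  then show thesis using csol_hopf[OF p f] that by blast
qed

lemma Sol_boundary_growth:
  assumes f: "bfun R M f"
  obtains C where "C > 0" "\<And>x. x \<in> cball 0 R \<Longrightarrow> \<bar>Sol f x\<bar> \<le> C * (R - norm x)"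
  using Sol_csol f csol_boundary_growth by metis

lemma Sol_continuous:
  assumes "bfun R M f"
  shows "continuous_on (cball 0 R) (Sol f)"
  using Sol_csol assms csol_continuous by metis

end

context drift
begin

text \<open>Collatz-Wielandt numbers of the positive operator \<open>Sol\<close>; their infimum is
  the reciprocal of its spectral radius. The maximum 1 of x is attained, which prevents a minimising
  sequence from fading to 0.\<close>

definition Eig :: "real set" where
  "Eig = {\<rho>. 0 \<le> \<rho> \<and> (\<exists>x. bfun R 1 x \<and> (\<forall>y. 0 \<le> x y) \<and> (\<exists>y. x y = 1) \<and> (\<forall>y. x y \<le> \<rho> * Sol x y))}"

lemma EigI:
  assumes w: "bfun R M w" "\<And>x. 0 \<le> w x" "continuous_on (cball 0 R) w" "\<exists>x. w x \<noteq> 0"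
    and \<rho>: "0 \<le> \<rho>" "\<And>x. w x \<le> \<rho> * Sol w x"
  shows "\<rho> \<in> Eig"
proof -
  have "cball (0::'a) R \<noteq> {}" using R by simp
  then obtain y where y: "y \<in> cball 0 R" "\<And>x. x \<in> cball 0 R \<Longrightarrow> w x \<le> w y"
    using continuous_attains_sup[OF compact_cball _ w(3)] by blast
  have le: "w x \<le> w y" for x using y(2)[of x] bfunD(3)[OF w(1), of x] w(2)[of y] by (cases "x \<in> cball 0 R") auto
  have W: "w y > 0" using w(4) w(2) le by (metis order_antisym not_le)
  define x where "x z = (1 / w y) * w z + 0 * w z" for z
  have Sx: "Sol x = (\<lambda>z. (1 / w y) * Sol w z + 0 * Sol w z)" unfolding x_def[abs_def] by (rule Sol_lincomb[OF w(1) w(1)])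
  have "bfun R 1 x" unfolding bfun_def x_def
    using bfunD(1,3)[OF w(1)] le w(2) W by (auto simp: divide_le_eq abs_of_nonneg)
  moreover have "x z \<le> \<rho> * Sol x z" for z
    using \<rho>(2)[of z] W by (simp add: x_def Sx divide_right_mono)
  moreover have "0 \<le> x z" for z using w(2) W by (simp add: x_def)
  moreover have "x y = 1" using W by (simp add: x_def)
  ultimately show ?thesis unfolding Eig_def using \<rho>(1) by blast
qed

text \<open>\<open>Sol f\<close> lies below and \<open>Sol (Sol f)\<close> above a positive multiple
  of \<open>R - norm x\<close>, by the gradient bound and by Hopf's lemma; the quotient of the two
  constants is an element.\<close>

lemma Eig_nonempty: "Eig \<noteq> {}"
proof -
  define f :: "'a \<Rightarrow> real" where "f = indicator (cball 0 R)"
  have f: "bfun R 1 f" by (auto simp: f_def bfun_def indicator_def intro!: borel_measurable_indicator)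
  have f0: "0 \<le> f x" for x by (simp add: f_def)
  have "continuous_on (ball 0 R) f" by (rule continuous_on_eq[of _ "\<lambda>_. 1"]) (auto simp: f_def)
  then obtain k where k: "k > 0" "\<And>x. x \<in> cball 0 R \<Longrightarrow> k * (R - norm x) \<le> Sol f x"
    using Sol_pos[OF f f0, of 0] R by (auto simp: f_def)
  note w = Sol_bfun[OF f]
  have w0: "0 \<le> Sol f x" for x by (rule Sol_nonneg[OF f f0])
  have cw: "continuous_on (cball 0 R) (Sol f)" by (rule Sol_continuous[OF f])
  have p0: "Sol f 0 > 0" using less_le_trans[OF mult_pos_pos[OF k(1) R], of "Sol f 0"] k(2)[of 0] R by simp
  have "0 \<in> ball (0::'a) R" using R by simp
  then obtain k2 where k2: "k2 > 0" "\<And>x. x \<in> cball 0 R \<Longrightarrow> k2 * (R - norm x) \<le> Sol (Sol f) x"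
    using Sol_pos[OF w w0 _ p0 continuous_on_subset[OF cw ball_subset_cball]] by metis
  obtain C where C: "C > 0" "\<And>x. x \<in> cball 0 R \<Longrightarrow> \<bar>Sol f x\<bar> \<le> C * (R - norm x)"
    by (rule Sol_boundary_growth[OF f]) blast
  have "C / k2 \<in> Eig"
  proof (rule EigI[OF w w0 cw])
    show "\<exists>x. Sol f x \<noteq> 0" using p0 by (intro exI[of _ 0]) simp
    show "Sol f x \<le> C / k2 * Sol (Sol f) x" for x
    proof (cases "x \<in> cball 0 R")
      case True
      have "Sol f x \<le> C / k2 * (k2 * (R - norm x))" using C(2)[OF True] k2(1) by simp
      also have "\<dots> \<le> C / k2 * Sol (Sol f) x" using k2(2)[OF True] k2(1) C(1) by (intro mult_left_mono) auto
      finally show ?thesis .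
    next
      case False
      then show ?thesis using bfunD(3)[OF w False] Sol_nonneg[OF w w0, of x] k2(1) C(1) by simp
    qed
  qed (use k2 C in simp)
  then show ?thesis by blast
qed

text \<open>The eigenvalue is the least \<open>\<rho>\<close> with \<open>x \<le> \<rho> * Sol x\<close> for some nonnegative \<open>x \<noteq> 0\<close>: at the minimum,
  a strict inequality anywhere would by strong positivity allow a smaller \<open>\<rho>\<close>.\<close>

theorem principal_eigenfunction:
  obtains \<rho> \<phi> p where "\<rho> \<ge> c" "csol R v c \<phi> p (\<lambda>x. \<rho> * \<phi> x)" "\<And>x. 0 \<le> \<phi> x" "\<And>x. \<phi> x \<le> 1" "\<exists>x. \<phi> x = 1"
    "\<And>x. x \<in> ball 0 R \<Longrightarrow> 0 < \<phi> x"
proof -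
  define \<rho>0 where "\<rho>0 = Inf Eig"
  have bdd: "bdd_below Eig" by (rule bdd_belowI[of _ 0]) (auto simp: Eig_def)
  \<comment> \<open>Nonnegativity of the eigenvalue \<open>\<rho> - c\<close>, on which the
    monotonicity of the eigenfunction will rest.\<close>
  have low: "c \<le> \<rho>" if \<rho>E: "\<rho> \<in> Eig" for \<rho>
  proof -
    obtain x y where x: "bfun R 1 x" "x y = 1" "x y \<le> \<rho> * Sol x y" "0 \<le> \<rho>" using \<rho>E unfolding Eig_def by blast
    have "Sol x y \<le> 1 / c" using Sol_bound[OF x(1), of y] by simp
    then have "\<rho> * Sol x y \<le> \<rho> * (1 / c)" using x(4) by (intro mult_left_mono)
    then have "1 \<le> \<rho> / c" using x(2,3) by simp
    then show ?thesis using c0 by (simp add: pos_le_divide_eq)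
  qed
  have \<rho>0c: "c \<le> \<rho>0" unfolding \<rho>0_def using low by (intro cInf_greatest Eig_nonempty)
  have \<rho>0: "\<rho>0 > 0" using \<rho>0c c0 by linarith
  have "\<exists>\<rho>\<in>Eig. \<rho> < \<rho>0 + inverse (real (Suc n))" for n
    using cInf_lessD[OF Eig_nonempty, of "\<rho>0 + inverse (real (Suc n))"] by (simp add: \<rho>0_def)
  then obtain \<rho> where \<rho>: "\<And>n. \<rho> n \<in> Eig" "\<And>n. \<rho> n < \<rho>0 + inverse (real (Suc n))" by metis
  have \<rho>ge: "\<rho>0 \<le> \<rho> n" for n unfolding \<rho>0_def by (rule cInf_lower[OF \<rho>(1) bdd])
  have \<rho>1: "\<rho> n \<le> \<rho>0 + 1" for n
  proof -
    have "inverse (real (Suc n)) \<le> 1" by (simp add: field_simps)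
    then show ?thesis using \<rho>(2)[of n] by linarith
  qed
  have \<rho>lim: "\<rho> \<longlonglongrightarrow> \<rho>0"
  proof (rule real_tendsto_sandwich[of "\<lambda>_. \<rho>0" _ _ "\<lambda>n. \<rho>0 + inverse (real (Suc n))"])
    show "(\<lambda>n. \<rho>0 + inverse (real (Suc n))) \<longlonglongrightarrow> \<rho>0" by (rule LIMSEQ_inverse_real_of_nat_add)
  qed (use \<rho>(2) \<rho>ge in \<open>auto intro!: always_eventually less_imp_le\<close>)
  have "\<forall>n. \<exists>x. bfun R 1 x \<and> (\<forall>y. 0 \<le> x y) \<and> (\<exists>y. x y = 1) \<and> (\<forall>y. x y \<le> \<rho> n * Sol x y)"
    using \<rho>(1) unfolding Eig_def by blast
  then obtain x where x: "\<And>n. bfun R 1 (x n)" "\<And>n y. 0 \<le> x n y" "\<And>n. \<exists>y. x n y = 1" "\<And>n y. x n y \<le> \<rho> n * Sol (x n) y" by metis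
  \<comment> \<open>The minimising functions themselves have no compactness, but their images under
    \<open>Sol\<close> are uniformly Lipschitz. Applying the monotone \<open>Sol\<close> to the
    defining inequality shows that the images satisfy it too.\<close>
  define s where "s n = Sol (x n)" for n
  obtain C where C: "C > 0" "\<And>h M. bfun R M h \<Longrightarrow> \<exists>p. csol R v c (Sol h) p h \<and> (\<forall>x. norm (p x) \<le> C * M)"
    using Sol_csol by metis
  have lip: "\<bar>s n y - s n y'\<bar> \<le> C * norm (y - y')" if "y \<in> cball 0 R" "y' \<in> cball 0 R" for n y y'
  proof -
    obtain p where p: "csol R v c (s n) p (x n)" "\<And>x. norm (p x) \<le> C * 1" using C(2)[OF x(1)[of n]] by (auto simp: s_def)
    have "norm (s n y - s n y') \<le> C * norm (y - y')"
    proof (rule differentiable_bound[OF convex_cball csolD(2)[OF p(1)]])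
      show "onorm (\<lambda>k. p z \<bullet> k) \<le> C" for z
        by (intro onorm_le) (metis p(2) Cauchy_Schwarz_ineq2 mult.right_neutral mult_right_mono norm_ge_zero order_trans real_norm_def)
    qed (use that in auto)
    then show ?thesis by simp
  qed
  have sb: "bfun R (1 / c) (s n)" for n unfolding s_def by (rule Sol_bfun[OF x(1)])
  have s0: "0 \<le> s n y" for n y unfolding s_def by (rule Sol_nonneg[OF x(1,2)])
  obtain g r where g: "continuous_on (cball 0 R) g" "strict_mono (r :: nat \<Rightarrow> nat)"
    "\<And>e. 0 < e \<Longrightarrow> \<exists>N. \<forall>n x. n \<ge> N \<and> x \<in> cball 0 R \<longrightarrow> norm (s (r n) x - g x) < e"
  proof (rule Arzela_Ascoli[of "cball (0::'a) R" s "1 / c"])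
    show "norm (s n x) \<le> 1 / c" for n x using bfunD(2)[OF sb] by simp
    show "\<exists>d>0. \<forall>n y. y \<in> cball 0 R \<and> norm (x - y) < d \<longrightarrow> norm (s n x - s n y) < e"
      if "x \<in> cball 0 R" "0 < e" for x e
    proof (intro exI[of _ "e / C"] conjI allI impI)
      fix n y assume y: "y \<in> cball 0 R \<and> norm (x - y) < e / C"
      have "norm (s n x - s n y) \<le> C * norm (x - y)" using lip[OF that(1), of y n] y by simp
      also have "\<dots> < e" using y C(1) by (simp add: field_simps)
      finally show "norm (s n x - s n y) < e" .
    qed (use that C in simp)
  qed (use compact_cball in blast)+
  define u where "u y = (if y \<in> cball 0 R then g y else 0)" for y
  have cu: "continuous_on (cball 0 R) u" by (rule continuous_on_eq[OF g(1)]) (simp add: u_def)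
  have unif: "\<exists>N. \<forall>n y. n \<ge> N \<longrightarrow> \<bar>s (r n) y - u y\<bar> < e" if "e > 0" for e
    using g(3)[OF that] bfunD(3)[OF sb] that by (auto simp: u_def) (metis abs_0 diff_self mem_cball_0)
  have su: "(\<lambda>n. s (r n) y) \<longlonglongrightarrow> u y" for y
    by (rule LIMSEQ_I) (use unif in \<open>auto, metis\<close>)
  have u0: "0 \<le> u y" for y by (rule LIMSEQ_le_const[OF su]) (use s0 in auto)
  have ub: "bfun R (1 / c) u" unfolding bfun_def
  proof (intro conjI allI impI)
    show "u \<in> borel_measurable borel" by (rule borel_measurable_zero_outside[OF cu]) (auto simp: u_def)
    show "\<bar>u y\<bar> \<le> 1 / c" for y
      using LIMSEQ_le_const2[OF su[of y], of "1 / c"] bfunD(2)[OF sb, of _ y] u0[of y] by (simp add: abs_le_iff)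
    show "u y = 0" if "y \<notin> cball 0 R" for y using that by (simp add: u_def)
  qed
  have rlim: "(\<lambda>n. \<rho> (r n)) \<longlonglongrightarrow> \<rho>0" using LIMSEQ_subseq_LIMSEQ[OF \<rho>lim g(2)] by (simp add: o_def)
  have SS: "(\<lambda>n. Sol (s (r n)) y) \<longlonglongrightarrow> Sol u y" for y
  proof (rule LIMSEQ_I)
    fix e :: real assume e: "e > 0"
    then have "e * c / 2 > 0" using c0 by simp
    then obtain N where N: "\<And>n y. n \<ge> N \<Longrightarrow> \<bar>s (r n) y - u y\<bar> < e * c / 2" using unif by metis
    have "norm (Sol (s (r n)) y - Sol u y) < e" if "n \<ge> N" for n
    proof -
      define d where "d y = 1 * s (r n) y + (- 1) * u y" for y
      have "bfun R (e * c / 2) d" unfolding bfun_def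
      proof (intro conjI allI impI)
        note [measurable] = bfunD(1)[OF sb] bfunD(1)[OF ub]
        show "d \<in> borel_measurable borel" unfolding d_def by measurable
        show "\<bar>d y\<bar> \<le> e * c / 2" for y using N[OF that, of y] by (simp add: d_def)
        show "d y = 0" if "y \<notin> cball 0 R" for y using bfunD(3)[OF sb that] bfunD(3)[OF ub that] by (simp add: d_def)
      qed
      from Sol_bound[OF this, of y] have "\<bar>Sol d y\<bar> \<le> e / 2" using c0 by simp
      moreover have "Sol d y = Sol (s (r n)) y - Sol u y"
        unfolding d_def[abs_def] by (subst Sol_lincomb[OF sb ub]) simp
      ultimately show ?thesis using e by simp
    qed
    then show "\<exists>N. \<forall>n\<ge>N. norm (Sol (s (r n)) y - Sol u y) < e" by blast
  qed
  have sSs: "s n y \<le> \<rho> n * Sol (s n) y" for n y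
  proof -
    have "0 \<le> Sol (\<lambda>y. \<rho> n * s n y + (- 1) * x n y) y"
    proof (rule Sol_nonneg[OF bfun_add[OF bfun_scale[OF sb] bfun_scale[OF x(1)]]])
      show "0 \<le> \<rho> n * s n y + (- 1) * x n y" for y using x(4)[of n y] by (simp add: s_def)
    qed
    then show ?thesis by (subst (asm) Sol_lincomb[OF sb x(1)]) (simp add: s_def)
  qed
  have uSu: "u y \<le> \<rho>0 * Sol u y" for y
    by (rule LIMSEQ_le[OF su tendsto_mult[OF rlim SS]]) (use sSs in auto)
  have une: "\<exists>y. u y > 0"
  proof -
    \<comment> \<open>Half of \<open>1 / (\<rho>0 + 1)\<close>, which is a lower bound for
      \<open>s n\<close> at a point where \<open>x n\<close> equals 1; uniform convergence then
      keeps the limit from vanishing.\<close>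
    define q where "q = 1 / (2 * (\<rho>0 + 1))"
    have e: "q > 0" using \<rho>0 by (simp add: q_def)
    obtain N where N: "\<And>n y. n \<ge> N \<Longrightarrow> \<bar>s (r n) y - u y\<bar> < q" using unif[OF e] by metis
    obtain y where y: "x (r N) y = 1" using x(3) by blast
    have "1 \<le> \<rho> (r N) * s (r N) y" using x(4)[of "r N" y] y by (simp add: s_def)
    also have "\<dots> \<le> (\<rho>0 + 1) * s (r N) y" using \<rho>1 s0 by (intro mult_right_mono)
    finally have "s (r N) y \<ge> 1 / (\<rho>0 + 1)" using \<rho>0 by (simp add: pos_divide_le_eq mult.commute)
    moreover have "1 / (\<rho>0 + 1) = 2 * q" using \<rho>0 by (simp add: q_def field_simps)
    ultimately have "u y > 0" using N[OF order_refl, of y] e by linarith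
    then show ?thesis by blast
  qed
  \<comment> \<open>\<open>Sol\<close> is applied once more: a defect z of the inequality for u
    becomes, through Hopf's lemma, a gain \<open>k * (R - norm x)\<close> in the inequality for
    w.\<close>
  define w where "w = Sol u"
  have wb: "bfun R (1 / c / c) w" unfolding w_def by (rule Sol_bfun[OF ub])
  have w0: "0 \<le> w y" for y unfolding w_def by (rule Sol_nonneg[OF ub u0])
  have cw: "continuous_on (cball 0 R) w" unfolding w_def by (rule Sol_continuous[OF ub])
  define z where "z y = \<rho>0 * w y + (- 1) * u y" for y
  have zb: "bfun R (\<bar>\<rho>0\<bar> * (1 / c / c) + \<bar>- 1\<bar> * (1 / c)) z" unfolding z_def[abs_def] by (intro bfun_add bfun_scale wb ub)
  have z0: "0 \<le> z y" for y using uSu[of y] by (simp add: z_def w_def)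
  have cz: "continuous_on (cball 0 R) z" unfolding z_def by (intro continuous_intros cw cu)
  obtain pu where pu: "csol R v c w pu u" using Sol_csol ub unfolding w_def by metis
  have zz: "z y = 0" for y
  proof (rule ccontr)
    assume ne: "z y \<noteq> 0"
    have "y \<in> ball 0 R"
    proof (rule ccontr)
      assume "y \<notin> ball 0 R"
      then have "w y = 0" using csolD(3)[OF pu, of y] by simp
      then show False using z0[of y] u0[of y] ne by (simp add: z_def)
    qed
    moreover have "z y > 0" using ne z0[of y] by simp
    ultimately obtain k where k: "k > 0" "\<And>x. x \<in> cball 0 R \<Longrightarrow> k * (R - norm x) \<le> Sol z x"
      using Sol_pos[OF zb z0 _ _ continuous_on_subset[OF cz ball_subset_cball]] by metis
    have Sz: "Sol z = (\<lambda>y. \<rho>0 * Sol w y + (- 1) * w y)"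
      unfolding z_def[abs_def] by (subst Sol_lincomb[OF wb ub]) (simp add: w_def)
    obtain C' where C': "C' > 0" "\<And>x. x \<in> cball 0 R \<Longrightarrow> \<bar>w x\<bar> \<le> C' * (R - norm x)"
      by (rule csol_boundary_growth[OF pu]) blast
    have q: "1 + k / C' > 0" using k C' by (simp add: add_pos_pos)
    \<comment> \<open>As w is at most \<open>C' * (R - norm x)\<close>, the gain is at least
      \<open>k / C' * w\<close>, which puts a number below the infimum into
      \<open>Eig\<close>.\<close>
    have "\<rho>0 / (1 + k / C') \<in> Eig"
    proof (rule EigI[OF wb w0 cw])
      obtain y1 where "u y1 > 0" using une by blast
      then have "0 < \<rho>0 * w y1" using uSu[of y1] by (simp add: w_def)
      then show "\<exists>x. w x \<noteq> 0" by (intro exI[of _ y1]) auto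
      show "w x \<le> \<rho>0 / (1 + k / C') * Sol w x" for x
      proof -
        have "(1 + k / C') * w x \<le> \<rho>0 * Sol w x"
        proof (cases "x \<in> cball 0 R")
          case True
          have "k / C' * w x \<le> k / C' * (C' * (R - norm x))" using C'(2)[OF True] k C' by (intro mult_left_mono) auto
          also have "\<dots> \<le> Sol z x" using k(2)[OF True] C'(1) by simp
          finally show ?thesis by (simp add: Sz distrib_right)
        next
          case False
          then show ?thesis using bfunD(3)[OF wb False] Sol_nonneg[OF wb w0, of x] \<rho>0 by simp
        qed
        then show ?thesis using q by (simp add: pos_le_divide_eq mult.commute)
      qed
    qed (use \<rho>0 q in simp)
    then have "\<rho>0 \<le> \<rho>0 / (1 + k / C')" unfolding \<rho>0_def using bdd by (intro cInf_lower)
    then have "\<rho>0 * (1 + k / C') \<le> \<rho>0" using q by (simp add: pos_le_divide_eq)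
    then have "\<rho>0 * (k / C') \<le> 0" by (simp add: distrib_left)
    moreover have "\<rho>0 * (k / C') > 0" using \<rho>0 k C' by simp
    ultimately show False by linarith
  qed
  have uw: "u y = \<rho>0 * w y" for y using zz[of y] by (simp add: z_def)
  have "cball (0::'a) R \<noteq> {}" using R by simp
  then obtain ym where ym: "ym \<in> cball 0 R" "\<And>x. x \<in> cball 0 R \<Longrightarrow> u x \<le> u ym"
    using continuous_attains_sup[OF compact_cball _ cu] by blast
  have um: "u x \<le> u ym" for x using ym(2)[of x] u0[of ym] by (cases "x \<in> cball 0 R") (auto simp: u_def)
  have U: "u ym > 0" using une um by (meson less_le_trans)
  define \<phi> where "\<phi> y = (1 / u ym) * u y" for y
  have \<phi>w: "\<phi> = (\<lambda>y. (\<rho>0 / u ym) * w y)" by (simp add: \<phi>_def uw fun_eq_iff)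
  have eq: "(\<lambda>x. \<rho>0 / u ym * u x) = (\<lambda>x. \<rho>0 * \<phi> x)" by (simp add: \<phi>_def)
  have csw: "csol R v c (\<lambda>y. (\<rho>0 / u ym) * w y) (\<lambda>y. (\<rho>0 / u ym) *\<^sub>R pu y) (\<lambda>x. \<rho>0 / u ym * u x)" by (rule csol_scale[OF pu ub])
  have cs: "csol R v c \<phi> (\<lambda>y. (\<rho>0 / u ym) *\<^sub>R pu y) (\<lambda>x. \<rho>0 * \<phi> x)"
    using csw unfolding eq \<phi>w[symmetric] .
  have \<phi>0: "0 \<le> \<phi> y" for y using u0 U by (simp add: \<phi>_def)
  have "bfun R (\<bar>\<rho>0 / u ym\<bar> * (1 / c)) (\<lambda>x. \<rho>0 / u ym * u x)" by (rule bfun_scale[OF ub])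
  then have bs: "bfun R (\<bar>\<rho>0 / u ym\<bar> * (1 / c)) (\<lambda>x. \<rho>0 * \<phi> x)" unfolding eq .
  have \<phi>1: "\<phi> ym = 1" using U by (simp add: \<phi>_def)
  obtain k where k: "k > 0" "\<And>x. x \<in> cball 0 R \<Longrightarrow> k * (R - norm x) \<le> \<phi> x"
    by (rule csol_hopf[OF cs bs]) (use \<phi>0 \<rho>0 \<phi>1 in \<open>auto intro!: exI[of _ ym]\<close>)
  show thesis
  proof (rule that[OF \<rho>0c cs \<phi>0])
    show "\<phi> x \<le> 1" for x using um[of x] U by (simp add: \<phi>_def)
    show "\<exists>x. \<phi> x = 1" using \<phi>1 by blast
    show "0 < \<phi> x" if x: "x \<in> ball 0 R" for x
    proof -
      have "0 < k * (R - norm x)" using x k(1) by simp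
      also have "\<dots> \<le> \<phi> x" using k(2)[of x] x by simp
      finally show ?thesis .
    qed
  qed
qed

end

section \<open>Invariance of the equation under reflections\<close>

section \<open>Reflections\<close>

lemma nn_integral_lborel_translate:
  fixes f :: "'a::euclidean_space \<Rightarrow> ennreal"
  assumes "f \<in> borel_measurable borel"
  shows "(\<integral>\<^sup>+x. f (t + x) \<partial>lborel) = (\<integral>\<^sup>+x. f x \<partial>lborel)"
proof -
  have "(\<integral>\<^sup>+x. f x \<partial>lborel) = (\<integral>\<^sup>+x. f x \<partial>distr lborel borel ((+) t))" by (simp add: lborel_distr_plus)
  also have "\<dots> = (\<integral>\<^sup>+x. f (t + x) \<partial>lborel)" by (rule nn_integral_distr) (use assms in auto)
  finally show ?thesis by simp
qed

text \<open>An isometry that is also an involution is its own adjoint, so neither a transpose nor a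
  determinant appears below.\<close>

locale linear_involution =
  fixes Q :: "'a::euclidean_space \<Rightarrow> 'a"
  assumes lin: "linear Q" and nrm: "\<And>x. norm (Q x) = norm x" and inv: "\<And>x. Q (Q x) = x"
begin

lemma continuous: "continuous_on S Q" using lin by (rule linear_continuous_on_compose[OF continuous_on_id, simplified])

lemma measurable [measurable]: "Q \<in> borel_measurable borel"
  by (rule borel_measurable_continuous_onI[OF continuous])

lemma inner_Q: "Q x \<bullet> Q y = x \<bullet> y"
proof -
  have "orthogonal_transformation Q" by (simp add: orthogonal_transformation lin nrm)
  then show ?thesis by (simp add: orthogonal_transformation_def)
qed

lemma adjoint: "Q x \<bullet> y = x \<bullet> Q y"
  using inner_Q[of x "Q y"] inv by simp

text \<open>Evaluate the double integral of
  \<open>indicator A (Q x + y) * indicator (ball 0 1) y\<close> in both orders. Integrating first in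
  x gives, by translation invariance, the image measure of A times the volume of the unit ball;
  integrating first in y gives the Lebesgue measure of A times that volume, as the unit ball is
  invariant under Q.\<close>

lemma distr_lborel: "distr lborel borel Q = lborel"
proof (rule measure_eqI)
  fix A assume "A \<in> sets (distr lborel borel Q)"
  then have A[measurable]: "A \<in> sets borel" by simp
  let ?B = "ball (0::'a) 1"
  have B[measurable]: "?B \<in> sets borel" by simp
  let ?F = "\<lambda>x y. indicator A (Q x + y) * indicator ?B y :: ennreal"
  have m: "case_prod ?F \<in> borel_measurable (lborel \<Otimes>\<^sub>M lborel)"
    unfolding case_prod_beta' by measurable
  have 1: "(\<integral>\<^sup>+x. ?F x y \<partial>lborel) = emeasure (distr lborel borel Q) A * indicator ?B y" for y
  proof -
    have "(\<integral>\<^sup>+x. ?F x y \<partial>lborel) = (\<integral>\<^sup>+x. indicator A (Q (Q y + x)) \<partial>lborel) * indicator ?B y"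
      by (subst nn_integral_multc[symmetric]) (auto simp: linear_add[OF lin] inv add.commute)
    also have "(\<integral>\<^sup>+x. indicator A (Q (Q y + x)) \<partial>lborel) = (\<integral>\<^sup>+x. indicator A (Q x) \<partial>lborel)"
      by (rule nn_integral_lborel_translate) measurable
    also have "\<dots> = emeasure (distr lborel borel Q) A"
    proof -
      have "(\<integral>\<^sup>+x. indicator A x \<partial>distr lborel borel Q) = (\<integral>\<^sup>+x. indicator A (Q x) \<partial>lborel)"
        by (rule nn_integral_distr) measurable
      then show ?thesis by simp
    qed
    finally show ?thesis .
  qed
  have 2: "(\<integral>\<^sup>+y. ?F x y \<partial>lborel) = (\<integral>\<^sup>+y. indicator A y * indicator ?B (y - Q x) \<partial>lborel)" for x
    using nn_integral_lborel_translate[of "\<lambda>y. indicator A y * indicator ?B (y - Q x)" "Q x"] by simp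
  have 3: "(\<integral>\<^sup>+x. indicator A y * indicator ?B (y - Q x) \<partial>lborel) = indicator A y * emeasure lborel ?B" for y
  proof -
    have "norm (y - Q x) = norm (- Q y + x)" for x
    proof -
      have "Q (y - Q x) = - (- Q y + x)" by (simp add: linear_diff[OF lin] inv)
      then show ?thesis using nrm[of "y - Q x"] by (metis norm_minus_cancel)
    qed
    then have "indicator ?B (y - Q x) = (indicator ?B (- Q y + x) :: ennreal)" for x by (simp add: indicator_def)
    then have "(\<integral>\<^sup>+x. indicator ?B (y - Q x) \<partial>lborel) = (\<integral>\<^sup>+x. indicator ?B (- Q y + x) \<partial>(lborel :: 'a measure))" by simp
    also have "\<dots> = (\<integral>\<^sup>+x. indicator ?B x \<partial>lborel)" by (rule nn_integral_lborel_translate) measurable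
    also have "\<dots> = emeasure lborel ?B" by simp
    finally show ?thesis by (simp add: nn_integral_cmult)
  qed
  have "emeasure (distr lborel borel Q) A * emeasure lborel ?B = (\<integral>\<^sup>+y. (\<integral>\<^sup>+x. ?F x y \<partial>lborel) \<partial>lborel)"
    unfolding 1 by (simp add: nn_integral_cmult)
  also have "\<dots> = (\<integral>\<^sup>+x. (\<integral>\<^sup>+y. ?F x y \<partial>lborel) \<partial>lborel)" by (rule lborel_pair.Fubini'[OF m])
  also have "\<dots> = (\<integral>\<^sup>+y. (\<integral>\<^sup>+x. indicator A y * indicator ?B (y - Q x) \<partial>lborel) \<partial>lborel)"
    unfolding 2 by (rule lborel_pair.Fubini'[symmetric]) (unfold case_prod_beta', measurable)
  also have "\<dots> = emeasure lborel A * emeasure lborel ?B"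
    unfolding 3 by (subst nn_integral_multc) auto
  finally have "emeasure (distr lborel borel Q) A * emeasure lborel ?B = emeasure lborel A * emeasure lborel ?B" .
  moreover have "emeasure lborel ?B \<noteq> 0" "emeasure lborel ?B \<noteq> top"
    using content_ball_pos[of 1 "0::'a"] emeasure_bounded_finite[OF bounded_ball, of "0::'a" 1]
    by (auto simp: measure_def less_top)
  ultimately show "emeasure (distr lborel borel Q) A = emeasure lborel A"
    by (metis ennreal_mult_divide_eq)
qed simp

lemma integral_Q:
  fixes f :: "'a \<Rightarrow> real"
  assumes "f \<in> borel_measurable borel"
  shows "(\<integral>x. f (Q x) \<partial>lborel) = (\<integral>x. f x \<partial>lborel)"
  using assms by (subst (2) distr_lborel[symmetric]) (simp add: integral_distr)

lemma test_fun_Q: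
  assumes t: "test_fun (ball 0 R) \<psi> d\<psi>"
  shows "test_fun (ball 0 R) (\<lambda>x. \<psi> (Q x)) (\<lambda>x. Q (d\<psi> (Q x)))"
  unfolding test_fun_def
proof (intro conjI allI)
  let ?S = "closure {x. \<psi> x \<noteq> 0}"
  have S: "compact ?S" "?S \<subseteq> ball 0 R" and d: "continuous_on UNIV d\<psi>"
    and der: "\<And>x. (\<psi> has_derivative (\<lambda>h. d\<psi> x \<bullet> h)) (at x)" using t unfolding test_fun_def by auto
  show "continuous_on UNIV (\<lambda>x. Q (d\<psi> (Q x)))"
    by (intro continuous_on_compose2[OF continuous, of _ _ UNIV] continuous_on_compose2[OF d continuous]) auto
  have dQ: "(Q has_derivative Q) (at x)" for x using lin by (simp add: linear_imp_has_derivative)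
  show "((\<lambda>x. \<psi> (Q x)) has_derivative (\<lambda>h. Q (d\<psi> (Q x)) \<bullet> h)) (at x)" for x
    by (rule has_derivative_eq_rhs[OF has_derivative_compose[OF dQ der]]) (simp add: adjoint)
  have cQ: "compact (Q ` ?S)" by (rule compact_continuous_image[OF continuous S(1)])
  have "{x. \<psi> (Q x) \<noteq> 0} \<subseteq> Q ` ?S"
  proof
    fix x assume "x \<in> {x. \<psi> (Q x) \<noteq> 0}"
    then have "Q x \<in> ?S" using closure_subset[of "{x. \<psi> x \<noteq> 0}"] by auto
    then show "x \<in> Q ` ?S" using inv[of x] by (metis image_eqI)
  qed
  then have cl: "closure {x. \<psi> (Q x) \<noteq> 0} \<subseteq> Q ` ?S" by (intro closure_minimal compact_imp_closed cQ)
  then show "compact (closure {x. \<psi> (Q x) \<noteq> 0})"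
    using compact_Int_closed[OF cQ closed_closure] by (metis inf.absorb_iff2)
  show "closure {x. \<psi> (Q x) \<noteq> 0} \<subseteq> ball 0 R" using cl S(2) nrm by fastforce
qed

text \<open>Q is moved from the gradient to the test function by self-adjointness, and the
  equivariance of v does the same for the drift term.\<close>

lemma csol_Q:
  assumes s: "csol R v c u p h" and v: "v \<in> borel_measurable borel" "\<And>x. Q (v (Q x)) = v x" and h: "h \<in> borel_measurable borel"
  shows "csol R v c (\<lambda>x. u (Q x)) (\<lambda>x. Q (p (Q x))) (\<lambda>x. h (Q x))"
  unfolding csol_def
proof (intro conjI ballI allI impI)
  have QB: "Q ` cball 0 R \<subseteq> cball 0 R" using nrm by auto
  show "continuous_on (cball 0 R) (\<lambda>x. Q (p (Q x)))"
    by (intro continuous_on_compose2[OF continuous, of _ _ UNIV] continuous_on_compose2[OF csolD(1)[OF s] continuous]) (use nrm in auto)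
  fix x assume x: "x \<in> cball (0::'a) R"
  have dQ: "(Q has_derivative Q) (at x within cball 0 R)" using lin by (simp add: linear_imp_has_derivative)
  have "(u has_derivative (\<lambda>k. p (Q x) \<bullet> k)) (at (Q x) within Q ` cball 0 R)"
    by (rule has_derivative_subset[OF csolD(2)[OF s] QB]) (use x nrm in auto)
  then show "((\<lambda>x. u (Q x)) has_derivative (\<lambda>k. Q (p (Q x)) \<bullet> k)) (at x within cball 0 R)"
    by (intro has_derivative_eq_rhs[OF has_derivative_in_compose[OF dQ]]) (auto simp: adjoint)
next
  fix \<psi> d\<psi> assume t: "test_fun (ball (0::'a) R) \<psi> d\<psi>"
  note [measurable] = v(1) csol_measurable[OF s] test_fun_measurable[OF t] h
  have "wform v c (\<lambda>x. u (Q x)) (\<lambda>x. Q (p (Q x))) \<psi> d\<psi>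
      = (\<integral>x. (\<lambda>x. p x \<bullet> Q (d\<psi> (Q x)) + (v x \<bullet> p x) * \<psi> (Q x) + c * u x * \<psi> (Q x)) (Q x) \<partial>lborel)"
    unfolding wform_def using v(2) by (intro Bochner_Integration.integral_cong) (auto simp: inv adjoint, metis adjoint inv)
  also have "\<dots> = wform v c u p (\<lambda>x. \<psi> (Q x)) (\<lambda>x. Q (d\<psi> (Q x)))"
    unfolding wform_def by (rule integral_Q) measurable
  also have "\<dots> = (\<integral>x. h x * \<psi> (Q x) \<partial>lborel)" by (rule csolD(5)[OF s test_fun_Q[OF t]])
  also have "\<dots> = (\<integral>x. (\<lambda>x. h (Q x) * \<psi> x) (Q x) \<partial>lborel)" by (simp add: inv)
  also have "\<dots> = (\<integral>x. h (Q x) * \<psi> x \<partial>lborel)" by (rule integral_Q) measurable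
  finally show "wform v c (\<lambda>x. u (Q x)) (\<lambda>x. Q (p (Q x))) \<psi> d\<psi> = (\<integral>x. h (Q x) * \<psi> x \<partial>lborel)" .
next
  fix x :: 'a assume "R \<le> norm x" then show "u (Q x) = 0" using csolD(3)[OF s, of "Q x"] nrm by simp
next
  fix x :: 'a assume "R < norm x" then show "Q (p (Q x)) = 0" using csolD(4)[OF s, of "Q x"] nrm linear_0[OF lin] by simp
qed

end

text \<open>The Householder reflection in the hyperplane orthogonal to \<open>x - y\<close>.
  Involutions alone thus act transitively on spheres, so invariance under them already means radial
  symmetry.\<close>

lemma reflection_exists:
  fixes x y :: "'a::euclidean_space"
  assumes "norm x = norm y"
  obtains Q where "linear_involution Q" "Q x = y"
proof (cases "x = y")
  case True
  have "linear_involution (\<lambda>x::'a. x)" by unfold_locales auto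
  then show thesis using that True by blast
next
  case False
  define e where "e = x - y"
  have e: "e \<bullet> e \<noteq> 0" using False by (simp add: e_def)
  have xx: "x \<bullet> x = y \<bullet> y" using assms by (simp add: power2_norm_eq_inner[symmetric])
  define Q where "Q z = z - (2 * (z \<bullet> e) / (e \<bullet> e)) *\<^sub>R e" for z
  have lin: "linear Q"
    by (rule linearI) (auto simp: Q_def inner_add_left algebra_simps add_divide_distrib)
  have ne: "(Q z) \<bullet> (Q z) = z \<bullet> z" for z
    using e by (simp add: Q_def inner_diff inner_commute field_simps power2_eq_square)
  have "linear_involution Q"
  proof (rule linear_involution.intro)
    show "norm (Q z) = norm z" for z using ne[of z] by (simp add: norm_eq_sqrt_inner)
    show "Q (Q z) = z" for z using e by (simp add: Q_def inner_diff_left algebra_simps flip: scaleR_add_left)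
  qed (rule lin)
  moreover have "Q x = y"
  proof -
    have "2 * (x \<bullet> e) = e \<bullet> e" using xx by (simp add: e_def inner_diff inner_commute)
    then show ?thesis using e by (simp add: Q_def) (simp add: e_def)
  qed
  ultimately show thesis using that by blast
qed

section \<open>Radial monotone eigenfunctions and the effect of changing the drift\<close>

section \<open>Radial eigenfunctions and comparison of drifts\<close>

text \<open>The gradient of a C^1 solution is bounded, so another drift alters the right-hand side
  by a bounded function only: a solution for one drift can be read in the equation of any
  other.\<close>

lemma csol_change_drift:
  fixes v v' :: "'a::euclidean_space \<Rightarrow> 'a"
  assumes R: "R > 0" and v: "v \<in> borel_measurable borel" "\<And>x. norm (v x) \<le> \<tau>"
    and v': "v' \<in> borel_measurable borel" "\<And>x. norm (v' x) \<le> \<tau>"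
    and s: "csol R v c u p h" and b: "bfun R M h"
  defines "h' \<equiv> \<lambda>x. if x \<in> ball 0 R then h x + (v' x - v x) \<bullet> p x else 0"
  shows "csol R v' c u p h'" "\<exists>M. bfun R M h'"
proof -
  note [measurable] = v(1) v'(1) csol_measurable[OF s] bfunD(1)[OF b]
  have \<Omega>: "ball (0::'a) R \<in> sets borel" by simp
  note [measurable] = \<Omega>
  show "csol R v' c u p h'" unfolding csol_def
  proof (intro conjI ballI allI impI)
    fix \<psi> d\<psi> assume t: "test_fun (ball (0::'a) R) \<psi> d\<psi>"
    note I = weak_grad_integrable(2)[OF \<Omega> bounded_ball v csol_weak_grad[OF s] t]
      weak_grad_integrable(2)[OF \<Omega> bounded_ball v' csol_weak_grad[OF s] t]
    have ih: "integrable lborel (\<lambda>x. h x * \<psi> x)"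
    proof (rule test_fun_integrable[OF t bfunD(1)[OF b] \<Omega>])
      show "integrable lborel (\<lambda>x. indicator (ball 0 R) x * h x)"
        by (rule integrable_bounded_support[where S = "cball 0 R" and C = M])
          (use bfunD[OF b] in \<open>auto simp: indicator_def\<close>)
    qed
    have "wform v' c u p \<psi> d\<psi> = wform v c u p \<psi> d\<psi> + (\<integral>x. (v' x \<bullet> p x) * \<psi> x \<partial>lborel) - (\<integral>x. (v x \<bullet> p x) * \<psi> x \<partial>lborel)"
      unfolding wform_split[OF \<Omega> bounded_ball v csol_weak_grad[OF s] t] wform_split[OF \<Omega> bounded_ball v' csol_weak_grad[OF s] t] by simp
    also have "\<dots> = (\<integral>x. h x * \<psi> x + (v' x \<bullet> p x) * \<psi> x - (v x \<bullet> p x) * \<psi> x \<partial>lborel)"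
      using I ih by (simp add: csolD(5)[OF s t])
    also have "\<dots> = (\<integral>x. h' x * \<psi> x \<partial>lborel)"
    proof (rule Bochner_Integration.integral_cong[OF refl])
      fix x
      show "h x * \<psi> x + (v' x \<bullet> p x) * \<psi> x - (v x \<bullet> p x) * \<psi> x = h' x * \<psi> x"
        using test_fun_zero_outside(1)[OF t, of x] by (cases "x \<in> ball 0 R") (auto simp: h'_def inner_diff_left algebra_simps)
    qed
    finally show "wform v' c u p \<psi> d\<psi> = (\<integral>x. h' x * \<psi> x \<partial>lborel)" .
  qed (use csolD[OF s] in auto)
  obtain P where P: "P > 0" "\<And>x. x \<in> cball 0 R \<Longrightarrow> norm (p x) \<le> P"
    using compact_continuous_bounded[OF csolD(1)[OF s] compact_cball] by metis
  have \<tau>: "\<tau> \<ge> 0" using order_trans[OF norm_ge_zero v(2)] .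
  have "bfun R (M + 2 * \<tau> * P) h'" unfolding bfun_def
  proof (intro conjI allI impI)
    show "h' \<in> borel_measurable borel" unfolding h'_def by measurable
    show "\<bar>h' y\<bar> \<le> M + 2 * \<tau> * P" for y
    proof (cases "y \<in> ball 0 R")
      case True
      have "norm (v' y - v y) \<le> 2 * \<tau>" using norm_triangle_ineq4[of "v' y" "v y"] v(2)[of y] v'(2)[of y] by linarith
      then have "\<bar>(v' y - v y) \<bullet> p y\<bar> \<le> 2 * \<tau> * P"
        using P(2)[of y] True \<tau> by (intro order_trans[OF Cauchy_Schwarz_ineq2] mult_mono) auto
      then show ?thesis using bfunD(2)[OF b, of y] True by (simp add: h'_def)
    qed (use \<tau> P bfunD(4)[OF b] in \<open>simp add: h'_def\<close>)
    show "h' y = 0" if "y \<notin> cball 0 R" for y using that by (simp add: h'_def)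
  qed
  then show "\<exists>M. bfun R M h'" by blast
qed

text \<open>The equation contains the zero-order term \<open>c\<close>, so the principal eigenvalue is \<open>\<rho> - c\<close>.\<close>

definition eigfun :: "real \<Rightarrow> ('a::euclidean_space \<Rightarrow> 'a) \<Rightarrow> real \<Rightarrow> real \<Rightarrow> ('a \<Rightarrow> real) \<Rightarrow> ('a \<Rightarrow> 'a) \<Rightarrow> bool" where
  "eigfun R v c \<rho> \<phi> p \<longleftrightarrow> csol R v c \<phi> p (\<lambda>x. \<rho> * \<phi> x) \<and> (\<forall>x. 0 \<le> \<phi> x) \<and> (\<forall>x. \<phi> x \<le> 1) \<and> (\<exists>x. \<phi> x = 1)"

lemma eigfunD:
  assumes "eigfun R v c \<rho> \<phi> p"
  shows "csol R v c \<phi> p (\<lambda>x. \<rho> * \<phi> x)" "0 \<le> \<phi> x" "\<phi> x \<le> 1" "\<exists>x. \<phi> x = 1" "\<exists>x. \<phi> x \<noteq> 0"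
  using assms unfolding eigfun_def by (auto, metis zero_neq_one)

lemma eigfun_bfun:
  assumes "eigfun R v c \<rho> \<phi> p"
  shows "bfun R \<bar>\<rho>\<bar> (\<lambda>x. \<rho> * \<phi> x)"
  using csol_measurable(1)[OF eigfunD(1)[OF assms]] csolD(3)[OF eigfunD(1)[OF assms]] eigfunD(2,3)[OF assms]
  unfolding bfun_def by (auto simp: abs_mult abs_of_nonneg intro!: mult_left_le)

definition reflection_equivariant :: "('a::euclidean_space \<Rightarrow> 'a) \<Rightarrow> bool" where
  "reflection_equivariant v \<longleftrightarrow> (\<forall>Q x. linear_involution Q \<longrightarrow> Q (v (Q x)) = v x)"

context drift
begin

lemma eigfun_value_nonneg:
  assumes "eigfun R v c \<rho> \<phi> p"
  shows "0 \<le> \<rho>"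
proof (rule ccontr)
  assume "\<not> 0 \<le> \<rho>"
  then have "\<phi> x \<le> 0" for x
    using csol_nonpos[OF eigfunD(1)[OF assms]] eigfunD(2)[OF assms] by (simp add: mult_nonpos_nonneg)
  then show False using eigfunD(4)[OF assms] by (metis not_one_le_zero)
qed

text \<open>Whichever value is the larger one, \<open>csol_compare\<close> gives equality and
  proportionality; the common maximum 1 makes the factor 1.\<close>

lemma eigfun_unique:
  assumes 1: "eigfun R v c \<rho>1 \<phi>1 p1" and 2: "eigfun R v c \<rho>2 \<phi>2 p2"
  shows "\<rho>1 = \<rho>2" "\<phi>1 = \<phi>2"
proof -
  have *: "a = b \<and> f = g" if A: "eigfun R v c a f pf" and B: "eigfun R v c b g pg" and le: "b \<le> a" for a b f g pf pg
  proof -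
    note C = csol_compare[OF eigfunD(1)[OF A] eigfun_bfun[OF A] order_refl eigfunD(2,5)[OF A]
        eigfunD(1)[OF B] eigfun_bfun[OF B] order_refl eigfunD(2,5)[OF B] eigfun_value_nonneg[OF B] le]
    obtain t where t: "t > 0" "\<And>x. f x = t * g x" using C(2) by blast
    obtain x y where xy: "f x = 1" "g y = 1" using eigfunD(4)[OF A] eigfunD(4)[OF B] by blast
    have "t \<le> 1" using t(2)[of y] xy(2) eigfunD(3)[OF A, of y] by simp
    moreover have "1 \<le> t" using t(2)[of x] xy(1) mult_left_mono[OF eigfunD(3)[OF B, of x], of t] t(1) by simp
    ultimately show ?thesis using t(2) C(1) by auto
  qed
  show "\<rho>1 = \<rho>2" "\<phi>1 = \<phi>2"
    using *[OF 1 2] *[OF 2 1] by (metis linorder_le_cases)+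
qed

lemma eigfun_exists:
  obtains \<rho> \<phi> p where "eigfun R v c \<rho> \<phi> p" "\<rho> \<ge> c" "\<And>x. x \<in> ball 0 R \<Longrightarrow> 0 < \<phi> x"
  by (rule principal_eigenfunction) (auto simp: eigfun_def)

lemma eigfun_radial:
  assumes e: "eigfun R v c \<rho> \<phi> p" and eq: "reflection_equivariant v" and n: "norm x = norm y"
  shows "\<phi> x = \<phi> y"
proof -
  obtain Q where Q: "linear_involution Q" "Q y = x" using reflection_exists[OF n[symmetric]] by blast
  interpret linear_involution Q by (rule Q)
  have "csol R v c (\<lambda>x. \<phi> (Q x)) (\<lambda>x. Q (p (Q x))) (\<lambda>x. \<rho> * \<phi> (Q x))"
  proof (rule csol_Q[OF eigfunD(1)[OF e] v(1)])
    show "Q (v (Q x)) = v x" for x by (rule eq[unfolded reflection_equivariant_def, rule_format, OF Q(1)])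
  qed (rule bfunD(1)[OF eigfun_bfun[OF e]])
  moreover obtain x1 where "\<phi> x1 = 1" using eigfunD(4)[OF e] by blast
  then have "\<phi> (Q (Q x1)) = 1" by (simp add: inv)
  then have "\<exists>x. \<phi> (Q x) = 1" by blast
  ultimately have "eigfun R v c \<rho> (\<lambda>x. \<phi> (Q x)) (\<lambda>x. Q (p (Q x)))"
    unfolding eigfun_def using eigfunD(2,3)[OF e] by auto
  from eigfun_unique(2)[OF this e] show ?thesis using Q(2) by metis
qed

lemma eigfun_decreasing:
  assumes e: "eigfun R v c \<rho> \<phi> p" and \<rho>: "\<rho> \<ge> c" and eq: "reflection_equivariant v"
    and xy: "norm x \<le> norm y"
  shows "\<phi> y \<le> \<phi> x"
proof (cases "R \<le> norm y \<or> y = 0")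
  case True
  then show ?thesis using csolD(3)[OF eigfunD(1)[OF e], of y] eigfunD(2)[OF e, of x] xy by auto
next
  case False
  define t where "t = norm y"
  have t: "0 < t" "t < R" using False by (auto simp: t_def)
  have s: "csol R v c \<phi> p (\<lambda>x. \<rho> * \<phi> x)" by (rule eigfunD(1)[OF e])
  have sub: "cball (0::'a) t \<subseteq> cball 0 R" "ball (0::'a) t \<subseteq> ball 0 R" using t by auto
  have c\<phi>: "continuous_on (cball 0 t) \<phi>" by (rule continuous_on_subset[OF csol_continuous[OF s] sub(1)])
  have "cball (0::'a) t \<noteq> {}" using t by simp
  then obtain xm where xm: "xm \<in> cball 0 t" "\<And>x. x \<in> cball 0 t \<Longrightarrow> \<phi> xm \<le> \<phi> x"
    using continuous_attains_inf[OF compact_cball _ c\<phi>] by blast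
  let ?z = "\<lambda>x. 1 * \<phi> x + (- 1) * \<phi> xm" and ?g = "\<lambda>x. 1 *\<^sub>R p x + (- 1) *\<^sub>R 0"
  have B: "ball (0::'a) t \<in> sets borel" by simp
  have w: "weak_grad (ball 0 t) \<phi> p" by (rule weak_grad_mono[OF csol_weak_grad[OF s] sub(2)]) simp
  have wc: "weak_grad (ball (0::'a) t) (\<lambda>_. \<phi> xm) (\<lambda>_. 0)" by (rule weak_grad_const) auto
  have super: "weak_super (ball 0 t) v c ?z ?g" unfolding weak_super_def
  proof (intro conjI allI impI)
    show "weak_grad (ball 0 t) ?z ?g" by (rule weak_grad_lincomb[OF B bounded_ball v w wc])
    fix \<psi> :: "'a \<Rightarrow> real" and d\<psi> assume tf: "test_fun (ball 0 t) \<psi> d\<psi>" and pos: "\<forall>x. 0 \<le> \<psi> x"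
    have tf': "test_fun (ball 0 R) \<psi> d\<psi>" by (rule test_fun_mono[OF tf sub(2)])
    have i\<psi>: "integrable lborel (\<lambda>x. \<phi> xm * \<psi> x)" by (rule weak_grad_integrable(3)[OF B bounded_ball v wc tf])
    have "wform v c ?z ?g \<psi> d\<psi> = (\<integral>x. (\<rho> * \<phi> x) * \<psi> x \<partial>lborel) - (\<integral>x. c * (\<phi> xm * \<psi> x) \<partial>lborel)"
    proof -
      have "wform v c (\<lambda>_. \<phi> xm) (\<lambda>_. 0) \<psi> d\<psi> = (\<integral>x. c * (\<phi> xm * \<psi> x) \<partial>lborel)" by (simp add: wform_def mult.assoc)
      then show ?thesis
        unfolding wform_lincomb[OF B bounded_ball v w wc tf] csolD(5)[OF s tf'] by simp
    qed
    also have "\<dots> = (\<integral>x. (\<rho> * \<phi> x) * \<psi> x - c * (\<phi> xm * \<psi> x) \<partial>lborel)"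
      using bfun_integrable[OF eigfun_bfun[OF e] tf'] i\<psi> by simp
    also have "\<dots> \<ge> 0"
    proof (intro integral_nonneg_AE AE_I2)
      fix x
      show "0 \<le> (\<rho> * \<phi> x) * \<psi> x - c * (\<phi> xm * \<psi> x)"
      proof (cases "x \<in> ball 0 t")
        case True
        \<comment> \<open>Here \<open>\<rho> \<ge> c\<close> enters: subtracting the constant
          minimum still leaves a nonnegative right-hand side.\<close>
        have "c * \<phi> xm \<le> c * \<phi> x" using xm(2)[of x] True c0 by (intro mult_left_mono) auto
        also have "\<dots> \<le> \<rho> * \<phi> x" using \<rho> eigfunD(2)[OF e, of x] by (intro mult_right_mono)
        finally have "0 \<le> (\<rho> * \<phi> x - c * \<phi> xm) * \<psi> x" using pos by simp
        then show ?thesis by (simp add: algebra_simps)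
      qed (simp add: test_fun_zero_outside(1)[OF tf])
    qed
    finally show "0 \<le> wform v c ?z ?g \<psi> d\<psi>" .
  qed
  have rad: "\<phi> z = \<phi> y" if "norm z = t" for z by (rule eigfun_radial[OF e eq]) (use that t_def in auto)
  have xt: "x \<in> cball 0 t" using xy by (simp add: t_def)
  show ?thesis
  proof (cases "\<exists>x\<in>ball 0 t. ?z x \<noteq> 0")
    case True
    obtain k where k: "k > 0" "\<And>x. x \<in> cball 0 t \<Longrightarrow> k * (t - norm x) \<le> ?z x"
      by (rule strong_positivity[OF v c t(1) _ _ super True]) (use xm c\<phi> in \<open>auto intro!: continuous_intros\<close>)
    have "k * (t - norm xm) \<le> 0" using k(2)[OF xm(1)] by simp
    then have "norm xm = t" using k(1) xm(1) by (simp add: mult_le_0_iff)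
    then have "\<phi> y = \<phi> xm" using rad by simp
    then show ?thesis using xm(2)[OF xt] by simp
  next
    case False
    have "\<phi> z = \<phi> xm" if "z \<in> cball 0 t" for z
      by (rule continuous_constant_on_closure[of "ball 0 t" \<phi>]) (use c\<phi> t that False in auto)
    from this[OF xt] this[of y] show ?thesis by (simp add: t_def)
  qed
qed

text \<open>Along a line through x orthogonal to x, \<phi> is even about x, so its tangential
  derivatives vanish; the sign of the radial one is monotonicity. At the origin \<open>e_r\<close>
  is 0, and the conclusion says that the gradient vanishes there.\<close>

lemma eigfun_gradient_sign:
  assumes e: "eigfun R v c \<rho> \<phi> p" and \<rho>: "\<rho> \<ge> c" and eq: "reflection_equivariant v"
    and x: "x \<in> ball 0 R"
  obtains a where "a \<le> 0" "p x = a *\<^sub>R e_r x"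
proof -
  have d: "(\<phi> has_derivative (\<lambda>k. p x \<bullet> k)) (at x)" by (rule csol_derivative[OF eigfunD(1)[OF e] x])
  have line: "((\<lambda>t. \<phi> (x + t *\<^sub>R k)) has_real_derivative (p x \<bullet> k)) (at 0)" for k
  proof -
    have "((\<lambda>t. x + t *\<^sub>R k) has_derivative (\<lambda>t. t *\<^sub>R k)) (at 0)" by (auto intro!: derivative_eq_intros)
    from has_derivative_compose[OF this, of \<phi> "\<lambda>k. p x \<bullet> k"] d show ?thesis
      by (simp add: has_field_derivative_def mult_commute_abs)
  qed
  have orth: "p x \<bullet> k = 0" if k: "x \<bullet> k = 0" for k
  proof -
    have "norm (x + t *\<^sub>R k) = norm (x + (- t) *\<^sub>R k)" for t
      using k by (simp add: norm_eq_sqrt_inner inner_add inner_commute inner_diff)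
    then have "\<phi> (x + t *\<^sub>R k) = \<phi> (x + (- t) *\<^sub>R k)" for t by (rule eigfun_radial[OF e eq])
    then have "(\<lambda>t. \<phi> (x + (- t) *\<^sub>R k)) = (\<lambda>t. \<phi> (x + t *\<^sub>R k))" by auto
    moreover have "((\<lambda>t. \<phi> (x + t *\<^sub>R (- k))) has_real_derivative (p x \<bullet> (- k))) (at 0)" by (rule line)
    ultimately have "((\<lambda>t. \<phi> (x + t *\<^sub>R k)) has_real_derivative - (p x \<bullet> k)) (at 0)" by simp
    from DERIV_unique[OF this line] show ?thesis by simp
  qed
  define a where "a = p x \<bullet> e_r x"
  have px: "p x = a *\<^sub>R e_r x"
  proof (cases "x = 0")
    case True
    then have "p x \<bullet> p x = 0" by (intro orth) simp
    then show ?thesis using True by (simp add: e_r_def)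
  next
    case False
    have n: "e_r x \<bullet> e_r x = 1" using False by (simp add: e_r_def power2_norm_eq_inner[symmetric] power2_eq_square)
    define k where "k = p x - a *\<^sub>R e_r x"
    have ek: "e_r x \<bullet> k = 0" using n by (simp add: k_def a_def inner_diff_right inner_commute)
    then have "x \<bullet> k = 0" using False by (simp add: e_r_def)
    then have "p x \<bullet> k = 0" by (rule orth)
    then have "k \<bullet> k = 0" using ek by (simp add: k_def inner_diff_left)
    then show ?thesis by (simp add: k_def)
  qed
  have "a \<le> 0"
  proof (rule ccontr)
    assume a: "\<not> a \<le> 0"
    then have x0: "x \<noteq> 0" by (auto simp: a_def e_r_def)
    have "p x \<bullet> x = norm x * a" using x0 by (simp add: a_def e_r_def)
    then have "p x \<bullet> x > 0" using a x0 by simp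
    then obtain d where d: "d > 0" "\<And>h. h > 0 \<Longrightarrow> h < d \<Longrightarrow> \<phi> (x + 0 *\<^sub>R x) < \<phi> (x + (0 + h) *\<^sub>R x)"
      using has_real_derivative_pos_inc_right[OF line[of x]] by auto
    have "\<phi> x < \<phi> (x + (d / 2) *\<^sub>R x)" using d(2)[of "d / 2"] d(1) by simp
    moreover have "norm x \<le> norm (x + (d / 2) *\<^sub>R x)"
    proof -
      have "x + (d / 2) *\<^sub>R x = (1 + d / 2) *\<^sub>R x" by (simp add: scaleR_add_left)
      then show ?thesis using d(1) by (simp add: mult_le_cancel_right1)
    qed
    ultimately show False using eigfun_decreasing[OF e \<rho> eq, of x "x + (d / 2) *\<^sub>R x"] by linarith
  qed
  then show thesis using that px by blast
qed

end

lemma e_r_measurable [measurable]: "e_r \<in> borel_measurable borel"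
  unfolding e_r_def[abs_def] by measurable

lemma norm_e_r_le: "norm (e_r x) \<le> 1"
  by (cases "x = 0") (auto simp: e_r_def)

lemma radial_field_equivariant: "reflection_equivariant (\<lambda>x. \<sigma> *\<^sub>R e_r x)"
  unfolding reflection_equivariant_def
proof (intro allI impI)
  fix Q :: "'a \<Rightarrow> 'a" and x assume "linear_involution Q"
  then interpret linear_involution Q .
  show "Q (\<sigma> *\<^sub>R e_r (Q x)) = \<sigma> *\<^sub>R e_r x" by (simp add: e_r_def linear_scale[OF lin] inv nrm)
qed

lemma eigfun_compare:
  fixes v :: "'a::euclidean_space \<Rightarrow> 'a"
  assumes R: "R > 0" and \<tau>: "\<tau> \<ge> 0" and c: "c > \<tau>\<^sup>2 / 8"
    and v: "v \<in> borel_measurable borel" "\<And>x. norm (v x) \<le> \<tau>" and e: "eigfun R v c \<rho> \<phi> p"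
    and \<rho>': "\<rho>' \<ge> c"
  shows "eigfun R (\<lambda>x::'a. \<tau> *\<^sub>R e_r x) c \<rho>' \<phi>' p' \<Longrightarrow> \<rho>' \<le> \<rho>"
    and "eigfun R (\<lambda>x::'a. (- \<tau>) *\<^sub>R e_r x) c \<rho>' \<phi>' p' \<Longrightarrow> \<rho> \<le> \<rho>'"
proof -
  interpret D: drift R \<tau> c v by unfold_locales (rule R v c)+
  have rv: "(\<lambda>x::'a. \<sigma> *\<^sub>R e_r x) \<in> borel_measurable borel" "norm (\<sigma> *\<^sub>R e_r x) \<le> \<tau>" if "\<bar>\<sigma>\<bar> = \<tau>" for \<sigma> and x :: 'a
    using that mult_left_mono[OF norm_e_r_le[of x] \<tau>] by auto
  have ver: "v x \<bullet> e_r x \<le> \<tau>" "- \<tau> \<le> v x \<bullet> e_r x" for x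
  proof -
    have "\<bar>v x \<bullet> e_r x\<bar> \<le> \<tau> * 1"
      by (rule order_trans[OF Cauchy_Schwarz_ineq2]) (intro mult_mono v(2) norm_e_r_le \<tau> norm_ge_zero)
    then show "v x \<bullet> e_r x \<le> \<tau>" "- \<tau> \<le> v x \<bullet> e_r x" by auto
  qed
  have grad: "\<exists>a\<le>0. p' x = a *\<^sub>R e_r x" if s: "\<bar>\<sigma>\<bar> = \<tau>" and e': "eigfun R (\<lambda>x::'a. \<sigma> *\<^sub>R e_r x) c \<rho>' \<phi>' p'" and x: "x \<in> ball 0 R" for \<sigma> x
  proof -
    interpret D': drift R \<tau> c "\<lambda>x::'a. \<sigma> *\<^sub>R e_r x" by unfold_locales (use R c rv[OF s] in auto)
    show ?thesis using D'.eigfun_gradient_sign[OF e' \<rho>' radial_field_equivariant x] by metis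
  qed
  have ee: "e_r x \<bullet> e_r x = (if x = 0 then 0 else 1)" for x :: 'a
    by (simp add: e_r_def power2_norm_eq_inner[symmetric] power2_eq_square)
  \<comment> \<open>The second alternative is the origin, where \<open>e_r\<close> is 0 in place of
    a unit vector.\<close>
  have diff: "(v x - \<sigma> *\<^sub>R e_r x) \<bullet> (a *\<^sub>R e_r x) = a * (v x \<bullet> e_r x - \<sigma>) \<or> e_r x = 0" for x :: 'a and a \<sigma>
    using ee[of x] by (cases "x = 0") (simp_all add: inner_diff_left)
  {
    assume e': "eigfun R (\<lambda>x::'a. \<tau> *\<^sub>R e_r x) c \<rho>' \<phi>' p'"
    have t: "\<bar>\<tau>\<bar> = \<tau>" using \<tau> by simp
    define h' where "h' = (\<lambda>x. if x \<in> ball 0 R then \<rho>' * \<phi>' x + (v x - \<tau> *\<^sub>R e_r x) \<bullet> p' x else 0)"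
    note ch = csol_change_drift[OF R rv[OF t] v eigfunD(1)[OF e'] eigfun_bfun[OF e'], folded h'_def]
    obtain M where M: "bfun R M h'" using ch(2) by blast
    have h': "\<rho>' * \<phi>' x \<le> h' x" for x
    proof (cases "x \<in> ball 0 R")
      case True
      obtain a where a: "a \<le> 0" "p' x = a *\<^sub>R e_r x" using grad[OF t e' True] by blast
      have "0 \<le> a * (v x \<bullet> e_r x - \<tau>)" using a(1) ver(1)[of x] by (intro mult_nonpos_nonpos) auto
      then have "0 \<le> (v x - \<tau> *\<^sub>R e_r x) \<bullet> p' x" using diff[of x \<tau> a] a(2) by auto
      then show ?thesis using True by (simp add: h'_def)
    qed (use csolD(3)[OF eigfunD(1)[OF e'], of x] in \<open>simp add: h'_def\<close>)
    show "\<rho>' \<le> \<rho>"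
    \<comment> \<open>\<open>csol_compare\<close> takes \<open>b \<le> a\<close> as an assumption
      and returns equality, so a strict inequality in the wrong direction contradicts
      itself.\<close>
    proof (rule ccontr)
      assume "\<not> \<rho>' \<le> \<rho>"
      then have "\<rho>' = \<rho>"
        by (intro D.csol_compare(1)[OF ch(1) M h' eigfunD(2,5)[OF e'] eigfunD(1)[OF e] eigfun_bfun[OF e] order_refl eigfunD(2,5)[OF e]
              D.eigfun_value_nonneg[OF e]]) simp
      then show False using \<open>\<not> \<rho>' \<le> \<rho>\<close> by simp
    qed
  }
  {
    assume e': "eigfun R (\<lambda>x::'a. (- \<tau>) *\<^sub>R e_r x) c \<rho>' \<phi>' p'"
    have t: "\<bar>- \<tau>\<bar> = \<tau>" using \<tau> by simp
    define h' where "h' = (\<lambda>x. if x \<in> ball 0 R then \<rho>' * \<phi>' x + (v x - (- \<tau>) *\<^sub>R e_r x) \<bullet> p' x else 0)"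
    note ch = csol_change_drift[OF R rv[OF t] v eigfunD(1)[OF e'] eigfun_bfun[OF e'], folded h'_def]
    obtain M where M: "bfun R M h'" using ch(2) by blast
    have h': "h' x \<le> \<rho>' * \<phi>' x" for x
    proof (cases "x \<in> ball 0 R")
      case True
      obtain a where a: "a \<le> 0" "p' x = a *\<^sub>R e_r x" using grad[OF t e' True] by blast
      have "a * (v x \<bullet> e_r x - (- \<tau>)) \<le> 0" using a(1) ver(2)[of x] by (intro mult_nonpos_nonneg) auto
      then have "(v x - (- \<tau>) *\<^sub>R e_r x) \<bullet> p' x \<le> 0" using diff[of x "- \<tau>" a] a(2) by auto
      then show ?thesis using True by (simp add: h'_def)
    qed (use csolD(3)[OF eigfunD(1)[OF e'], of x] in \<open>simp add: h'_def\<close>)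
    show "\<rho> \<le> \<rho>'"
    proof (rule ccontr)
      assume "\<not> \<rho> \<le> \<rho>'"
      then have "\<rho> = \<rho>'"
        by (intro D.csol_compare(1)[OF eigfunD(1)[OF e] eigfun_bfun[OF e] order_refl eigfunD(2,5)[OF e] ch(1) M h' eigfunD(2,5)[OF e']])
          (use \<rho>' D.c0 in auto)
      then show False using \<open>\<not> \<rho> \<le> \<rho>'\<close> by simp
    qed
  }
qed

section \<open>Data defined almost everywhere, and the link to the definitions of eigenpair and
  eigenvalue\<close>

section \<open>Passage between Lebesgue and Borel measurable data\<close>

lemma borel_version:
  fixes g :: "'a::euclidean_space \<Rightarrow> 'b::euclidean_space"
  assumes g: "g \<in> borel_measurable lebesgue"
  obtains g' where "g' \<in> borel_measurable borel" "AE x in lborel. g x = g' x"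
proof -
  have "\<exists>h. h \<in> borel_measurable lborel \<and> (AE x in lborel. g x \<bullet> i = h x)" for i
  proof -
    have "(\<lambda>x. g x \<bullet> i) \<in> borel_measurable lebesgue" using g by measurable
    from completion_ex_borel_measurable_real[OF this] show ?thesis by blast
  qed
  then obtain h where h: "\<And>i. h i \<in> borel_measurable lborel" "\<And>i. AE x in lborel. g x \<bullet> i = h i x" by metis
  define g' where "g' = (\<lambda>x. \<Sum>i\<in>Basis. h i x *\<^sub>R i)"
  have m: "h i \<in> borel_measurable borel" for i using h(1)[of i] by simp
  have "AE x in lborel. \<forall>i\<in>Basis. g x \<bullet> i = h i x" by (rule AE_finite_allI) (auto intro: h(2))
  then have "AE x in lborel. g x = g' x"
    by (rule eventually_mono) (metis (no_types, lifting) euclidean_representation g'_def sum.cong)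
  moreover have "g' \<in> borel_measurable borel" unfolding g'_def
    by (intro borel_measurable_sum borel_measurable_scaleR m borel_measurable_const)
  ultimately show thesis using that by blast
qed

text \<open>As F' vanishes outside \<Omega>, the integral over \<Omega> for the completed measure
  becomes one over the whole space for the Borel measure, and exceptional null sets disappear on the
  way.\<close>

lemma set_lebesgue_integral_borel_version:
  fixes F F' :: "'a::euclidean_space \<Rightarrow> real"
  assumes F': "F' \<in> borel_measurable borel"
    and ae: "AE x in lborel. x \<in> \<Omega> \<longrightarrow> F x = F' x" and z: "\<And>x. x \<notin> \<Omega> \<Longrightarrow> F' x = 0"
  shows "set_integrable lebesgue \<Omega> F \<longleftrightarrow> integrable lborel F'" "(LINT x:\<Omega>|lebesgue. F x) = (\<integral>x. F' x \<partial>lborel)"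
proof -
  have ae': "AE x in lebesgue. F' x = indicator \<Omega> x *\<^sub>R F x"
    unfolding AE_completion_iff using ae by (rule eventually_mono) (use z in \<open>auto simp: indicator_def\<close>)
  have m: "F' \<in> borel_measurable lborel" using F' by simp
  have m': "F' \<in> borel_measurable lebesgue" by (rule measurable_completion[OF m])
  have mF: "(\<lambda>x. indicator \<Omega> x *\<^sub>R F x) \<in> borel_measurable lebesgue" by (rule borel_measurable_AE[OF m' ae'])
  show "set_integrable lebesgue \<Omega> F \<longleftrightarrow> integrable lborel F'"
    unfolding set_integrable_def integrable_completion[OF m, symmetric] by (rule integrable_cong_AE[OF m' mF ae', symmetric])
  show "(LINT x:\<Omega>|lebesgue. F x) = (\<integral>x. F' x \<partial>lborel)"
    unfolding set_lebesgue_integral_def integral_completion[OF m, symmetric] by (rule integral_cong_AE[OF m' mF ae', symmetric])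
qed

text \<open>The weak formulation sees neither null sets nor values outside \<Omega>, so the drift
  may be replaced by one that is Borel and bounded everywhere, as the locale \<open>drift\<close>
  asks.\<close>

lemma admissible_bounded_version:
  fixes v :: "'a::euclidean_space \<Rightarrow> 'a"
  assumes v: "v \<in> admissible \<Omega> \<tau>" and \<tau>: "\<tau> \<ge> 0"
  obtains v' where "v' \<in> borel_measurable borel" "\<And>x. norm (v' x) \<le> \<tau>" "AE x in lborel. x \<in> \<Omega> \<longrightarrow> v x = v' x"
proof -
  have vm: "v \<in> borel_measurable lebesgue" and ae: "AE x in lborel. x \<in> \<Omega> \<longrightarrow> norm (v x) \<le> \<tau>"
    using v unfolding admissible_def by (auto simp: AE_completion_iff)
  obtain w where w: "w \<in> borel_measurable borel" "AE x in lborel. v x = w x" using borel_version[OF vm] by blast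
  note [measurable] = w(1)
  define v' where "v' = (\<lambda>x. if norm (w x) \<le> \<tau> then w x else 0)"
  have "v' \<in> borel_measurable borel" unfolding v'_def by measurable
  moreover have "norm (v' x) \<le> \<tau>" for x using \<tau> by (simp add: v'_def)
  moreover have "AE x in lborel. x \<in> \<Omega> \<longrightarrow> v x = v' x" using ae w(2) by eventually_elim (auto simp: v'_def)
  ultimately show thesis using that by blast
qed

context drift
begin

text \<open>An eigenpair in the sense of the definition constrains \<phi> on the closed ball alone,
  hence the extension by 0.\<close>

lemma principal_eigenpair_imp_eigfun:
  assumes ae: "AE x in lborel. x \<in> ball 0 R \<longrightarrow> w x = v x" and pe: "principal_eigenpair (ball 0 R) w lam \<phi>"
  obtains p where "eigfun R v c (lam + c) (\<lambda>x. if x \<in> cball 0 R then \<phi> x else 0) p"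
proof -
  let ?B = "ball (0::'a) R"
  define f where "f = (\<lambda>x. if x \<in> cball 0 R then \<phi> x else 0)"
  have cl: "closure ?B = cball 0 R" "frontier ?B = sphere 0 R" using R by (auto simp: frontier_def)
  obtain g where cont: "continuous_on (cball 0 R) \<phi>" and bd: "\<And>x. norm x = R \<Longrightarrow> \<phi> x = 0"
    and pos: "\<And>x. x \<in> ?B \<Longrightarrow> \<phi> x > 0" and le1: "\<And>x. x \<in> cball 0 R \<Longrightarrow> \<phi> x \<le> 1" and one: "\<exists>x\<in>cball 0 R. \<phi> x = 1"
    and H: "H1_weak_grad ?B \<phi> g"
    and eq: "\<And>\<psi> d\<psi>. test_fun ?B \<psi> d\<psi> \<Longrightarrow>
           set_integrable lebesgue ?B (\<lambda>x. (w x \<bullet> g x) * \<psi> x) \<and>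
           (LINT x:?B|lebesgue. g x \<bullet> d\<psi> x + (w x \<bullet> g x) * \<psi> x) = lam * (LINT x:?B|lebesgue. \<phi> x * \<psi> x)"
    using pe unfolding principal_eigenpair_def cl by (auto simp: sphere_def dist_norm)
  have gm: "g \<in> borel_measurable lebesgue" using H by (simp add: H1_weak_grad_def)
  obtain g' where g': "g' \<in> borel_measurable borel" "AE x in lborel. g x = g' x" using borel_version[OF gm] by blast
  have \<Omega>: "?B \<in> sets borel" by simp
  have fm: "f \<in> borel_measurable borel" unfolding f_def
    by (rule borel_measurable_continuous_on_if) (use cont in auto)
  note [measurable] = g'(1) fm v(1) \<Omega>
  have cf: "continuous_on (cball 0 R) f" by (rule continuous_on_eq[OF cont]) (simp add: f_def)
  have f_eq: "f x = \<phi> x" if "x \<in> ?B" for x using that by (simp add: f_def)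
  have f_out: "f x = 0" if "R \<le> norm x" for x using that bd[of x] by (auto simp: f_def)
  have f01: "0 \<le> f x \<and> f x \<le> 1" for x
    using pos[of x] le1[of x] f_out[of x] f_eq[of x] by (cases "x \<in> ?B") (auto simp: less_imp_le)
  have wg: "weak_grad ?B f g'" unfolding weak_grad_def
  proof (intro conjI allI impI ballI)
    have "set_integrable lebesgue ?B (\<lambda>x. (\<phi> x)\<^sup>2)" using H by (simp add: H1_weak_grad_def)
    then show "integrable lborel (\<lambda>x. indicator ?B x * (f x)\<^sup>2)"
      by (subst (asm) set_lebesgue_integral_borel_version(1)[where F' = "\<lambda>x. indicator ?B x * (f x)\<^sup>2"]) (auto simp: f_eq)
    have "set_integrable lebesgue ?B (\<lambda>x. (norm (g x))\<^sup>2)" using H by (simp add: H1_weak_grad_def)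
    moreover have "AE x in lborel. x \<in> ?B \<longrightarrow> (norm (g x))\<^sup>2 = indicator ?B x * (norm (g' x))\<^sup>2"
      using g'(2) by eventually_elim simp
    ultimately show "integrable lborel (\<lambda>x. indicator ?B x * (norm (g' x))\<^sup>2)"
      by (subst (asm) set_lebesgue_integral_borel_version(1)[where F' = "\<lambda>x. indicator ?B x * (norm (g' x))\<^sup>2"]) auto
    fix \<psi> d\<psi> and i :: 'a assume t: "test_fun ?B \<psi> d\<psi>" and i: "i \<in> Basis"
    note [measurable] = test_fun_measurable[OF t]
    note z = test_fun_zero_outside[OF t]
    have "(LINT x:?B|lebesgue. \<phi> x * (d\<psi> x \<bullet> i)) = (\<integral>x. f x * (d\<psi> x \<bullet> i) \<partial>lborel)"
      by (rule set_lebesgue_integral_borel_version(2)) (auto simp: f_eq z)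
    moreover have "(LINT x:?B|lebesgue. (g x \<bullet> i) * \<psi> x) = (\<integral>x. (g' x \<bullet> i) * \<psi> x \<partial>lborel)"
    proof (rule set_lebesgue_integral_borel_version(2))
      show "AE x in lborel. x \<in> ?B \<longrightarrow> (g x \<bullet> i) * \<psi> x = (g' x \<bullet> i) * \<psi> x" using g'(2) by eventually_elim simp
    qed (auto simp: z)
    ultimately show "(\<integral>x. f x * (d\<psi> x \<bullet> i) \<partial>lborel) = - (\<integral>x. (g' x \<bullet> i) * \<psi> x \<partial>lborel)"
      using H t i by (simp add: H1_weak_grad_def)
  qed (fact fm g')+
  define h where "h = (\<lambda>x. (lam + c) * f x)"
  have h: "bfun R \<bar>lam + c\<bar> h" unfolding bfun_def h_def
    using f01 by (auto simp: abs_mult f_out intro!: mult_left_le)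
  have weq: "wform v c f g' \<psi> d\<psi> = (\<integral>x. h x * \<psi> x \<partial>lborel)" if t: "test_fun ?B \<psi> d\<psi>" for \<psi> d\<psi>
  proof -
    note [measurable] = test_fun_measurable[OF t]
    note z = test_fun_zero_outside[OF t]
    note I = weak_grad_integrable[OF \<Omega> bounded_ball v wg t]
    have "(LINT x:?B|lebesgue. g x \<bullet> d\<psi> x + (w x \<bullet> g x) * \<psi> x) = (\<integral>x. g' x \<bullet> d\<psi> x + (v x \<bullet> g' x) * \<psi> x \<partial>lborel)"
    proof (rule set_lebesgue_integral_borel_version(2))
      show "AE x in lborel. x \<in> ?B \<longrightarrow> g x \<bullet> d\<psi> x + (w x \<bullet> g x) * \<psi> x = g' x \<bullet> d\<psi> x + (v x \<bullet> g' x) * \<psi> x"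
        using g'(2) ae by eventually_elim simp
    qed (auto simp: z)
    moreover have "(LINT x:?B|lebesgue. \<phi> x * \<psi> x) = (\<integral>x. f x * \<psi> x \<partial>lborel)"
      by (rule set_lebesgue_integral_borel_version(2)) (auto simp: f_eq z)
    ultimately have "(\<integral>x. g' x \<bullet> d\<psi> x + (v x \<bullet> g' x) * \<psi> x \<partial>lborel) = lam * (\<integral>x. f x * \<psi> x \<partial>lborel)"
      using eq[OF t] by simp
    then show ?thesis using I(1-3) by (simp add: wform_def h_def mult.assoc distrib_right)
  qed
  \<comment> \<open>Freeze \<open>(lam + c) * f\<close> as right-hand side: by uniqueness among weak
    solutions the C^1 solution for it is f itself.\<close>
  obtain p where p: "csol R v c (Sol h) p h" using Sol_csol h by metis
  have "f x = Sol h x" for x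
  proof (cases "x \<in> cball 0 R")
    case True
    show ?thesis
      by (rule weak_solution_eq_csol[OF p wg _ _ weq True])
        (use cf f_out in auto)
  next
    case False
    then show ?thesis using csolD(3)[OF p, of x] f_out[of x] by simp
  qed
  then have "Sol h = f" by auto
  with p have "csol R v c f p (\<lambda>x. (lam + c) * f x)" by (simp add: h_def)
  moreover have "\<exists>x. f x = 1" using one by (auto simp: f_def)
  ultimately have "eigfun R v c (lam + c) f p" unfolding eigfun_def using f01 by blast
  then show thesis using that by (simp add: f_def)
qed

lemma eigfun_imp_principal_eigenpair:
  assumes ae: "AE x in lborel. x \<in> ball 0 R \<longrightarrow> w x = v x"
    and e: "eigfun R v c \<rho> \<phi> p" and pos: "\<And>x. x \<in> ball 0 R \<Longrightarrow> 0 < \<phi> x"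
  shows "principal_eigenpair (ball 0 R) w (\<rho> - c) \<phi>"
proof -
  let ?B = "ball (0::'a) R"
  have s: "csol R v c \<phi> p (\<lambda>x. \<rho> * \<phi> x)" by (rule eigfunD(1)[OF e])
  have cl: "closure ?B = cball 0 R" "frontier ?B = sphere 0 R" using R by (auto simp: frontier_def)
  have \<Omega>: "?B \<in> sets borel" by simp
  have wg: "weak_grad ?B \<phi> p" by (rule csol_weak_grad[OF s])
  note [measurable] = weak_gradD(1,2)[OF wg] v(1) \<Omega>
  obtain x1 where x1: "\<phi> x1 = 1" using eigfunD(4)[OF e] by blast
  then have "x1 \<in> cball 0 R" using csolD(3)[OF s, of x1] by force
  have H: "H1_weak_grad ?B \<phi> p" unfolding H1_weak_grad_def
  proof (intro conjI allI impI ballI)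
    show "\<phi> \<in> borel_measurable lebesgue" "p \<in> borel_measurable lebesgue" by (rule measurable_completion, measurable)+
    show "set_integrable lebesgue ?B (\<lambda>x. (\<phi> x)\<^sup>2)"
      by (subst set_lebesgue_integral_borel_version(1)[where F' = "\<lambda>x. indicator ?B x * (\<phi> x)\<^sup>2"])
        (use weak_gradD(3)[OF wg] in auto)
    show "set_integrable lebesgue ?B (\<lambda>x. (norm (p x))\<^sup>2)"
      by (subst set_lebesgue_integral_borel_version(1)[where F' = "\<lambda>x. indicator ?B x * (norm (p x))\<^sup>2"])
        (use weak_gradD(4)[OF wg] in auto)
    fix \<psi> d\<psi> and i :: 'a assume t: "test_fun ?B \<psi> d\<psi>" and i: "i \<in> Basis"
    note [measurable] = test_fun_measurable[OF t]
    note z = test_fun_zero_outside[OF t]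
    have "(LINT x:?B|lebesgue. \<phi> x * (d\<psi> x \<bullet> i)) = (\<integral>x. \<phi> x * (d\<psi> x \<bullet> i) \<partial>lborel)"
      by (rule set_lebesgue_integral_borel_version(2)) (auto simp: z)
    moreover have "(LINT x:?B|lebesgue. (p x \<bullet> i) * \<psi> x) = (\<integral>x. (p x \<bullet> i) * \<psi> x \<partial>lborel)"
      by (rule set_lebesgue_integral_borel_version(2)) (auto simp: z)
    ultimately show "(LINT x:?B|lebesgue. \<phi> x * (d\<psi> x \<bullet> i)) = - (LINT x:?B|lebesgue. (p x \<bullet> i) * \<psi> x)"
      using weak_gradD(5)[OF wg t i] by simp
  qed
  have E: "set_integrable lebesgue ?B (\<lambda>x. (w x \<bullet> p x) * \<psi> x)"
    "(LINT x:?B|lebesgue. p x \<bullet> d\<psi> x + (w x \<bullet> p x) * \<psi> x) = (\<rho> - c) * (LINT x:?B|lebesgue. \<phi> x * \<psi> x)"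
    if t: "test_fun ?B \<psi> d\<psi>" for \<psi> d\<psi>
  proof -
    note [measurable] = test_fun_measurable[OF t]
    note z = test_fun_zero_outside[OF t]
    note I = weak_grad_integrable[OF \<Omega> bounded_ball v wg t]
    show "set_integrable lebesgue ?B (\<lambda>x. (w x \<bullet> p x) * \<psi> x)"
    proof (subst set_lebesgue_integral_borel_version(1)[where F' = "\<lambda>x. (v x \<bullet> p x) * \<psi> x"])
      show "AE x in lborel. x \<in> ?B \<longrightarrow> (w x \<bullet> p x) * \<psi> x = (v x \<bullet> p x) * \<psi> x" using ae by eventually_elim simp
    qed (use I(2) z in auto)
    have "(LINT x:?B|lebesgue. p x \<bullet> d\<psi> x + (w x \<bullet> p x) * \<psi> x) = (\<integral>x. p x \<bullet> d\<psi> x + (v x \<bullet> p x) * \<psi> x \<partial>lborel)"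
    proof (rule set_lebesgue_integral_borel_version(2))
      show "AE x in lborel. x \<in> ?B \<longrightarrow> p x \<bullet> d\<psi> x + (w x \<bullet> p x) * \<psi> x = p x \<bullet> d\<psi> x + (v x \<bullet> p x) * \<psi> x"
        using ae by eventually_elim simp
    qed (auto simp: z)
    moreover have "(LINT x:?B|lebesgue. \<phi> x * \<psi> x) = (\<integral>x. \<phi> x * \<psi> x \<partial>lborel)"
      by (rule set_lebesgue_integral_borel_version(2)) (auto simp: z)
    moreover have "(\<integral>x. p x \<bullet> d\<psi> x + (v x \<bullet> p x) * \<psi> x \<partial>lborel) + c * (\<integral>x. \<phi> x * \<psi> x \<partial>lborel) = \<rho> * (\<integral>x. \<phi> x * \<psi> x \<partial>lborel)"
      using csolD(5)[OF s t] I(1-3) by (simp add: wform_def mult.assoc)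
    ultimately show "(LINT x:?B|lebesgue. p x \<bullet> d\<psi> x + (w x \<bullet> p x) * \<psi> x) = (\<rho> - c) * (LINT x:?B|lebesgue. \<phi> x * \<psi> x)"
      by (simp add: left_diff_distrib)
  qed
  show ?thesis unfolding principal_eigenpair_def cl
  proof (intro conjI)
    show "\<exists>g. H1_weak_grad ?B \<phi> g \<and> (\<forall>\<psi> d\<psi>. test_fun ?B \<psi> d\<psi> \<longrightarrow>
       set_integrable lebesgue ?B (\<lambda>x. (w x \<bullet> g x) * \<psi> x) \<and>
       (LINT x:?B|lebesgue. g x \<bullet> d\<psi> x + (w x \<bullet> g x) * \<psi> x) = (\<rho> - c) * (LINT x:?B|lebesgue. \<phi> x * \<psi> x))"
      using H E by blast
  qed (use csol_continuous[OF s] csolD(3)[OF s] pos eigfunD(3)[OF e] x1 \<open>x1 \<in> cball 0 R\<close> in \<open>auto simp: sphere_def dist_norm\<close>)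
qed

text \<open>Existence and uniqueness of the value together give the definite description in
  \<open>lambda1\<close> its meaning. The field w may differ from its bounded Borel version v on a
  null set of the ball and arbitrarily outside it.\<close>

lemma lambda1_eq:
  assumes ae: "AE x in lborel. x \<in> ball 0 R \<longrightarrow> w x = v x" and e: "eigfun R v c \<rho> \<phi> p"
  shows "lambda1 (ball 0 R) w = \<rho> - c" "\<exists>\<phi>. principal_eigenpair (ball 0 R) w (\<rho> - c) \<phi>"
proof -
  obtain \<rho>0 \<phi>0 p0 where e0: "eigfun R v c \<rho>0 \<phi>0 p0" "\<And>x. x \<in> ball 0 R \<Longrightarrow> 0 < \<phi>0 x" using eigfun_exists by metis
  have "\<rho>0 = \<rho>" by (rule eigfun_unique(1)[OF e0(1) e])
  then show ex: "\<exists>\<phi>. principal_eigenpair (ball 0 R) w (\<rho> - c) \<phi>"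
    using eigfun_imp_principal_eigenpair[OF ae e0] by blast
  show "lambda1 (ball 0 R) w = \<rho> - c" unfolding lambda1_def
  proof (rule the_equality, rule ex)
    fix lam assume "\<exists>\<phi>. principal_eigenpair (ball 0 R) w lam \<phi>"
    then obtain \<phi>' where "principal_eigenpair (ball 0 R) w lam \<phi>'" by blast
    from principal_eigenpair_imp_eigfun[OF ae this] obtain p'
      where "eigfun R v c (lam + c) (\<lambda>x. if x \<in> cball 0 R then \<phi>' x else 0) p'" by blast
    from eigfun_unique(1)[OF this e] show "lam = \<rho> - c" by simp
  qed
qed

lemma principal_eigenpair_radially_decreasing:
  assumes eq: "reflection_equivariant v" and pe: "principal_eigenpair (ball 0 R) v lam \<phi>"
  shows "radially_decreasing R \<phi>"
proof -
  define f where "f = (\<lambda>x. if x \<in> cball 0 R then \<phi> x else 0)"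
  obtain p where e: "eigfun R v c (lam + c) f p"
    using principal_eigenpair_imp_eigfun[OF _ pe] unfolding f_def by auto
  \<comment> \<open>The lower bound c is known for the constructed eigenfunction; uniqueness of the
    eigenvalue transfers it to the given one.\<close>
  obtain \<rho>0 \<phi>0 p0 where e0: "eigfun R v c \<rho>0 \<phi>0 p0" "\<rho>0 \<ge> c" using eigfun_exists by metis
  then have \<rho>: "lam + c \<ge> c" using eigfun_unique(1)[OF e e0(1)] by simp
  obtain i :: 'a where "i \<in> Basis" using nonempty_Basis by blast
  then have i: "norm i = 1" by simp
  show ?thesis unfolding radially_decreasing_def
  \<comment> \<open>The profile is read off along one fixed unit vector.\<close>
  proof (intro exI[of _ "\<lambda>s. f (s *\<^sub>R i)"] conjI ballI impI)
    show "0 \<le> f (s *\<^sub>R i)" for s by (rule eigfunD(2)[OF e])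
    show "f (t *\<^sub>R i) \<le> f (s *\<^sub>R i)" if "s \<in> {0..R}" "t \<in> {0..R}" "s \<le> t" for s t
      by (rule eigfun_decreasing[OF e \<rho> eq]) (use that i in auto)
    show "\<phi> x = f (norm x *\<^sub>R i)" if "x \<in> cball 0 R" for x
      using eigfun_radial[OF e eq, of x "norm x *\<^sub>R i"] that i by (simp add: f_def)
  qed
qed

end

section \<open>The extremal drifts on the ball\<close>

theorem theorem1p3:
  fixes R \<tau> :: real
  assumes "R > 0" and "\<tau> \<ge> 0"
  shows "lambda_under (ball (0::'a::euclidean_space) R) \<tau>
           = lambda1 (ball (0::'a) R) (\<lambda>x::'a. \<tau> *\<^sub>R e_r x)
       \<and> lambda_over (ball (0::'a) R) \<tau>
           = lambda1 (ball (0::'a) R) (\<lambda>x::'a. - (\<tau> *\<^sub>R e_r x))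
       \<and> (\<exists>\<phi>. principal_eigenpair (ball (0::'a) R) (\<lambda>x::'a. \<tau> *\<^sub>R e_r x)
                 (lambda_under (ball (0::'a) R) \<tau>) \<phi>)
       \<and> (\<exists>\<phi>. principal_eigenpair (ball (0::'a) R) (\<lambda>x::'a. - (\<tau> *\<^sub>R e_r x))
                 (lambda_over (ball (0::'a) R) \<tau>) \<phi>)
       \<and> (\<forall>\<phi>. principal_eigenpair (ball (0::'a) R) (\<lambda>x::'a. \<tau> *\<^sub>R e_r x)
                 (lambda_under (ball (0::'a) R) \<tau>) \<phi> \<longrightarrow> radially_decreasing R \<phi>)
       \<and> (\<forall>\<phi>. principal_eigenpair (ball (0::'a) R) (\<lambda>x::'a. - (\<tau> *\<^sub>R e_r x))
                 (lambda_over (ball (0::'a) R) \<tau>) \<phi> \<longrightarrow> radially_decreasing R \<phi>)"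
proof -
  \<comment> \<open>A choice above \<open>\<tau> ^ 2 / 8\<close>, made once for all drifts bounded
    by \<tau>; it cancels in the eigenvalues \<open>\<rho> - c\<close>.\<close>
  define c where "c = \<tau>\<^sup>2 + 1"
  have c: "c > \<tau>\<^sup>2 / 8" using zero_le_power2[of \<tau>] unfolding c_def by linarith
  have dr: "drift R \<tau> c (\<lambda>x::'a. \<sigma> *\<^sub>R e_r x)" if "\<bar>\<sigma>\<bar> = \<tau>" for \<sigma>
  proof
    show "norm (\<sigma> *\<^sub>R e_r x) \<le> \<tau>" for x :: 'a using that mult_left_mono[OF norm_e_r_le[of x] assms(2)] by simp
  qed (use assms c in measurable)
  have adm: "(\<lambda>x::'a. \<sigma> *\<^sub>R e_r x) \<in> admissible (ball 0 R) \<tau>" if "\<bar>\<sigma>\<bar> = \<tau>" for \<sigma>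
  proof -
    interpret drift R \<tau> c "\<lambda>x::'a. \<sigma> *\<^sub>R e_r x" by (rule dr[OF that])
    have "(\<lambda>x::'a. \<sigma> *\<^sub>R e_r x) \<in> borel_measurable lebesgue" using v(1) by (intro measurable_completion) simp
    then show ?thesis using v(2) by (simp add: admissible_def)
  qed
  interpret D1: drift R \<tau> c "\<lambda>x::'a. \<tau> *\<^sub>R e_r x" by (rule dr) (use assms in simp)
  interpret D2: drift R \<tau> c "\<lambda>x::'a. (- \<tau>) *\<^sub>R e_r x" by (rule dr) (use assms in simp)
  obtain \<rho>1 \<phi>1 p1 where e1: "eigfun R (\<lambda>x::'a. \<tau> *\<^sub>R e_r x) c \<rho>1 \<phi>1 p1" "\<rho>1 \<ge> c" using D1.eigfun_exists by metis
  obtain \<rho>2 \<phi>2 p2 where e2: "eigfun R (\<lambda>x::'a. (- \<tau>) *\<^sub>R e_r x) c \<rho>2 \<phi>2 p2" "\<rho>2 \<ge> c" using D2.eigfun_exists by metis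
  note L1 = D1.lambda1_eq[OF _ e1(1), of "\<lambda>x. \<tau> *\<^sub>R e_r x", simplified]
  note L2 = D2.lambda1_eq[OF _ e2(1), of "\<lambda>x. (- \<tau>) *\<^sub>R e_r x", simplified]
  have bounds: "\<rho>1 - c \<le> lambda1 (ball 0 R) v" "lambda1 (ball 0 R) v \<le> \<rho>2 - c"
    if v: "v \<in> admissible (ball (0::'a) R) \<tau>" for v
  proof -
    obtain v' where v': "v' \<in> borel_measurable borel" "\<And>x. norm (v' x) \<le> \<tau>"
      "AE x in lborel. x \<in> ball 0 R \<longrightarrow> v x = v' x"
      using admissible_bounded_version[OF v assms(2)] by blast
    interpret D: drift R \<tau> c v' by unfold_locales (use assms c v' in auto)
    obtain \<rho> \<phi> p where e: "eigfun R v' c \<rho> \<phi> p" using D.eigfun_exists by metis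
    have L: "lambda1 (ball 0 R) v = \<rho> - c" by (rule D.lambda1_eq(1)[OF v'(3) e])
    show "\<rho>1 - c \<le> lambda1 (ball 0 R) v"
      using eigfun_compare(1)[OF assms c v'(1,2) e e1(2) e1(1)] L by simp
    show "lambda1 (ball 0 R) v \<le> \<rho>2 - c"
      using eigfun_compare(2)[OF assms c v'(1,2) e e2(2) e2(1)] L by simp
  qed
  \<comment> \<open>The two radial fields are admissible themselves, so the infimum is a minimum and
    the supremum a maximum.\<close>
  have under: "lambda_under (ball (0::'a) R) \<tau> = \<rho>1 - c" unfolding lambda_under_def
    by (rule cInf_eq_minimum) (use adm[of \<tau>] assms L1(1) bounds(1) in \<open>auto intro!: image_eqI\<close>)
  have over: "lambda_over (ball (0::'a) R) \<tau> = \<rho>2 - c" unfolding lambda_over_def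
    by (rule cSup_eq_maximum) (use adm[of "- \<tau>"] assms L2(1) bounds(2) in \<open>auto intro!: image_eqI\<close>)
  show ?thesis
    using L1 L2 under over D1.principal_eigenpair_radially_decreasing[OF radial_field_equivariant]
      D2.principal_eigenpair_radially_decreasing[OF radial_field_equivariant] by simp
qed

end
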